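(* Fix $\kappa>0$ in the complement of the lattices $\pi\mathbb{Z}/\Lambda_i$ ($i=0,1,2,3$), $\mu\in\mathbb{R}$ and $\Phi\in\mathfrak{g}\otimes\mathbb{R}^3$. The cut-off Fermi action $S^{\lambda,\mu}_{F,\kappa,\epsilon}$ gives rise to a perturbation series in $\lambda$, $Z_{F,\kappa,\epsilon}(\lambda,\mu;\Phi)=\sum_{n\ge 0}\Xi_n(\epsilon)\lambda^{2n}$, each term of which is equal, in the limit $\epsilon\to 0$, to the corresponding term of the Bosonic formal power series $Z_\kappa(\lambda,\mu;\Phi)=\sum_{n\ge 0}\Theta_n\lambda^{2n}$. That is, for every integer $n\ge 0$, $$\lim_{\epsilon\to 0}\Xi_n(\epsilon)=\Theta_n .$$
   Context: **Setting.** $G$ is a compact simple Lie group with Lie algebra $\mathfrak{g}$ equipped with an invariant inner product; $e_\alpha$ ($\alpha=1,\dots,\dim\mathfrak{g}$) is an orthonormal basis and $f_{\alpha\beta\gamma}$ are the structure constants, $[e_\alpha,e_\beta]=\sum_\gamma f_{\alpha\beta\gamma}e_\gamma$. $\epsilon_{ijk}$ is the antisymmetric three-tensor on $\mathbb{R}^3$. Let $\Lambda_0,\dots,\Lambda_3>0$ and let $T^4=\prod_{i=0}^3[-\Lambda_i,\Lambda_i]$ with opposite faces identified (coordinates $x_0,x_1,x_2,x_3$). $\langle\cdot,\cdot\rangle$ and $\|\cdot\|$ are the $L_2$ inner product and norm on $\mathfrak{g}\otimes\mathbb{R}^3$-valued functions on $T^4$. For $\mathfrak{g}\otimes\mathbb{R}^3$-valued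 functions, $[A,B]$ is the $\mathfrak{g}\otimes\mathbb{R}^3$-valued function with components $[A,B]^k_\gamma=\sum_{i,j,\alpha,\beta}\epsilon_{ijk}f_{\alpha\beta\gamma}A^i_\alpha B^j_\beta$; $d_0A=\partial A/\partial x_0$; $\nabla\times$ is the calculus curl in $x_1,x_2,x_3$. **Bosonic fields.** $\mathcal{A}$ is the space of smooth $\mathfrak{g}$-valued one-forms $A$ on $T^4$ with $A^0=0$ (viewed as $\mathfrak{g}\otimes\mathbb{R}^3$-valued functions $(A^1,A^2,A^3)$) satisfying $A^1(0,x_1,x_2,x_3)=0$, $A^2(0,0,x_2,x_3)=0$, $A^3(0,0,0,x_3)=0$ for all $x_1,x_2,x_3$. $\mathcal{F}$ is the space of smooth $\mathfrak{g}$-valued self-dual two-forms on $T^4$, identified with smooth $\mathfrak{g}\otimes\mathbb{R}^3$-valued functions. For a function on $T^4$, a subscript $\kappa$ denotes convolution with the function $\chi_\kappa$, i.e. the projection onto Fourier modes with momenta $p\in\prod_i(\pi/\Lambda_i)\mathbb{Z}$ satisfying $|p_i|<\kappa$ for $i=0,\dots,3$. Put $\mathcal{A}^\kappa=\{A\in\mathcal{A}:A_\kappa=A\}$ and $\mathcal{F}_0^\kappa=\{F\in\mathcal{F}:F_{2\kappa}=F,\ \int_{T^4}F=0\}$. These are finite-dimensional. **Propagators.** For $\Phi\in\mathfrak{g}\otimes\mathbb{R}^3$ (regarded as a constant function) let $$S^\mu_{0,\kappa}(A,F;\Phi)=\|F\|^2-2i\langle F,d_0A\rangle-2i\langle F,\nabla\times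 A\rangle-2i\mu\langle\Phi,[A_\kappa,A_\kappa]\rangle,$$ a nondegenerate complex-valued quadratic form on $\mathcal{A}^\kappa\times\mathcal{F}_0^\kappa$. Let $Q$ be the (complex symmetric) operator on the complexification of $V=\mathcal{A}^\kappa\oplus\mathcal{F}_0^\kappa$ with $S^\mu_{0,\kappa}(v)=\langle v,Qv\rangle$ for $v\in V$. $C^{A,A}_{\mu,\kappa}(\Phi)(x,y)$, $C^{A,F}_{\mu,\kappa}(\Phi)(x,y)$, $C^{F,F}_{\mu,\kappa}(\Phi)(x,y)$ are the components of the integral kernel on $T^4\times T^4$ of $Q^{-1}$ (composed with orthogonal projection onto $V$); they are smooth functions, with matrix elements $(C(x,y))_{i,j;\alpha,\beta}$ (also written $(C(x,y))_{\alpha,\beta;i,j}$) in the standard basis of $\mathbb{R}^3$ and the basis $e_\alpha$, where $(i,\alpha)$ go with $x$ and $(j,\beta)$ with $y$. **Bosonic series.** With commuting formal variables $J^i_\alpha(x),K^i_\alpha(x)$ ($x\in T^4$, $i=1,2,3$), $$Z_\kappa(\lambda,\mu;\Phi)=\exp\Bigl(\sum_{i,j,\alpha,\beta}\int_{T^4\times T^4}dx\,dy\Bigl[(C^{A,A}_{\mu,\kappa}(\Phi)(x,y))_{i,j;\alpha,\beta}\tfrac{\delta}{\delta J^i_\alpha(x)}\tfrac{\delta}{\delta J^j_\beta(y)}+2(C^{A,F}_{\mu,\kappa}(\Phi)(x,y))_{i,j;\alpha,\beta}\tfrac{\delta}{\delta J^i_\alpha(x)}\tfrac{\delta}{\delta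 K^j_\beta(y)}+(C^{F,F}_{\mu,\kappa}(\Phi)(x,y))_{i,j;\alpha,\beta}\tfrac{\delta}{\delta K^i_\alpha(x)}\tfrac{\delta}{\delta K^j_\beta(y)}\Bigr]\Bigr)$$ $$\exp\Bigl(i\lambda\sum_{i,j,k;\alpha,\beta,\gamma}\epsilon_{ijk}f_{\alpha\beta\gamma}\int_{T^4}dx\,J^i_\alpha(x)J^j_\beta(x)K^k_\gamma(x)\Bigr)\Big|_{J=K=0},$$ as a formal power series in $\lambda$; here $\frac{\delta}{\delta J^i_\alpha(x)}J^j_\beta(y)=\delta_{ij}\delta_{\alpha\beta}\delta(x-y)$, similarly for $K$, and mixed derivatives vanish. Only even powers of $\lambda$ occur; $\Theta_n$ is the coefficient of $\lambda^{2n}$. **Fermi fields and cutoffs.** $\Psi_\alpha(x),\psi_\alpha(x)$ ($\alpha=1,\dots,\dim\mathfrak{g}$) and $H_i(x),\eta_i(x)$ ($i=1,2,3$) are complex Fermi (anticommuting) fields on $T^4$, with conjugates $\bar\Psi_\alpha,\bar\psi_\alpha,\bar H_i,\bar\eta_i$. The free action is $$S_{F,0}=\int_{T^4}dx\Bigl(\sum_i|H_i|^2+\sum_i|\eta_i|^2+\sum_\alpha|\Psi_\alpha|^2+\sum_\alpha|\psi_\alpha|^2\Bigr).$$ Let $\zeta\in C^\infty(\mathbb{R})$ be even with $\zeta\ge0$, $\int\zeta=1$, $\zeta'(x)\le0$ for $x>0$, $\zeta(x)=0$ for $x\ge1$. Let $Z\in C^\infty(\mathbb{R})$ be even with $Z\ge0$,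 $Z=1$ on $[-1,1]$, $Z'(x)\le0$ for $x>0$, $Z(x)=0$ for $|x|\ge2$. For $\epsilon>0$ let $\delta_\epsilon(x)=(2/\epsilon)^4\prod_{i=0}^3\zeta(2x_i/\epsilon)$ and $D_\epsilon(x)=\prod_{i=0}^3Z(x_i/2\epsilon)$, periodized to functions on $T^4$. The cut-off fields are $\Psi_{\alpha,\epsilon}=\Psi_\alpha\star\delta_\epsilon$, $\bar\Psi_{\alpha,\epsilon}=\bar\Psi_\alpha\star\delta_\epsilon$, $\psi_{\alpha,\epsilon}=\psi_\alpha\star\delta_\epsilon$, $\bar\psi_{\alpha,\epsilon}=\bar\psi_\alpha\star\delta_\epsilon$, $H_{i,\epsilon}=H_i\star\delta_\epsilon$, $\bar H_{i,\epsilon}=\bar H_i\star D_\epsilon$, $\eta_{i,\epsilon}=\eta_i\star\delta_\epsilon$, $\bar\eta_{i,\epsilon}=\bar\eta_i\star D_\epsilon$ ($\star$ is convolution on $T^4$). **Cut-off Fermi action.** $S^{\lambda,\mu}_{F,\kappa,\epsilon}=S_{F,0}+\mathcal{Q}_\epsilon+\lambda\mathcal{V}_\epsilon$, where $$\mathcal{Q}_\epsilon=\int_{T^4\times T^4}dx\,dy\sum_{\alpha,\beta,i,j}\Bigl[H_{i,\epsilon}(x)\Psi_{\alpha,\epsilon}(x)(C^{A,A}_{\mu,\kappa}(\Phi)(x,y))_{\alpha,\beta;i,j}H_{j,\epsilon}(y)\Psi_{\beta,\epsilon}(y)+2H_{i,\epsilon}(x)\Psi_{\alpha,\epsilon}(x)(C^{A,F}_{\mu,\kappa}(\Phi)(x,y))_{\alpha,\beta;i,j}\eta_{j,\epsilon}(y)\psi_{\beta,\epsilon}(y)+\eta_{i,\epsilon}(x)\psi_{\alpha,\epsilon}(x)(C^{F,F}_{\mu,\kappa}(\Phi)(x,y))_{\alpha,\beta;i,j}\eta_{j,\epsilon}(y)\psi_{\beta,\epsilon}(y)\Bigr],$$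 $$\mathcal{V}_\epsilon=-\frac{i}{2}\int_{T^4}dx\sum_{\alpha,\beta,\gamma;i,j,k}\epsilon_{ijk}f_{\alpha\beta\gamma}\bar H_{i,\epsilon}(x)\bar\Psi_{\alpha,\epsilon}(x)\bar H_{j,\epsilon}(x)\bar\Psi_{\beta,\epsilon}(x)\bar\eta_{k,\epsilon}(x)\bar\psi_{\gamma,\epsilon}(x).$$ **Fermionic series.** $Z_{F,\kappa,\epsilon}(\lambda,\mu;\Phi)=\int\mathcal{D}(\text{all fields})\,e^{S^{\lambda,\mu}_{F,\kappa,\epsilon}}$ is expanded in $\lambda$ with $\mu,\Phi$ held constant; it equals $\sum_{n\ge0}\Xi_n(\epsilon)\lambda^{2n}$ with $$\Xi_n(\epsilon)=\frac{1}{(2n)!(3n)!}\int\mathcal{D}\Psi\,\mathcal{D}H\,\mathcal{D}\psi\,\mathcal{D}\eta\,\mathcal{D}\bar\Psi\,\mathcal{D}\bar H\,\mathcal{D}\bar\psi\,\mathcal{D}\bar\eta\;e^{S_{F,0}}\,\mathcal{V}_\epsilon^{2n}\,\mathcal{Q}_\epsilon^{3n}.$$ The Berezin integral is normalized so that $\int e^{S_{F,0}}=1$ and is evaluated by the fermionic Wick theorem with the only nonzero two-point functions $\langle H_i(x)\bar H_j(y)\rangle=\langle\eta_i(x)\bar\eta_j(y)\rangle=\delta_{ij}\delta(x-y)$, $\langle\Psi_\alpha(x)\bar\Psi_\beta(y)\rangle=\langle\psi_\alpha(x)\bar\psi_\beta(y)\rangle=\delta_{\alpha\beta}\delta(x-y)$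 (up to a common sign convention, which does not affect $\Xi_n$). Hence the cut-off fields have two-point functions $\delta_{ij}(\delta_\epsilon\star D_\epsilon)(x-y)$ and $\delta_{\alpha\beta}(\delta_\epsilon\star\delta_\epsilon)(x-y)$ respectively. *)

theory Defs
  imports
    "HOL-Analysis.Analysis"
    "HOL-Computational_Algebra.Formal_Power_Series"
begin

section \<open>Compact simple Lie algebras\<close>

text \<open>
  The Lie algebra of a compact simple Lie group, with an invariant inner product: a real
  finite-dimensional simple Lie algebra whose ambient (positive definite) inner product is
  ad-invariant. The group itself enters only through this data.
\<close>

definition compact_simple_lie_algebra :: "('g::euclidean_space \<Rightarrow> 'g \<Rightarrow> 'g) \<Rightarrow> bool" where
  "compact_simple_lie_algebra br \<longleftrightarrow>
     bilinear br \<and>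
     (\<forall>x. br x x = 0) \<and>
     (\<forall>x y z. br x (br y z) + br y (br z x) + br z (br x y) = 0) \<and>
     (\<forall>x y z. br z x \<bullet> y + x \<bullet> br z y = 0) \<and>
     (\<exists>x y. br x y \<noteq> 0) \<and>
     (\<forall>I. subspace I \<and> (\<forall>x. \<forall>y\<in>I. br x y \<in> I) \<longrightarrow> I = {0} \<or> I = UNIV)"

definition orthonormal_basis :: "('l::finite \<Rightarrow> 'g::euclidean_space) \<Rightarrow> bool" where
  "orthonormal_basis e \<longleftrightarrow>
     (\<forall>a b. e a \<bullet> e b = (if a = b then 1 else 0)) \<and> span (range e) = UNIV"

text \<open>For orthonormal \<open>e\<close> these are the coefficients of \<open>br (e a) (e b)\<close> in the basis \<open>e\<close>.\<close>

definition structure_constants ::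
    "('g::euclidean_space \<Rightarrow> 'g \<Rightarrow> 'g) \<Rightarrow> ('l::finite \<Rightarrow> 'g) \<Rightarrow> 'l \<Rightarrow> 'l \<Rightarrow> 'l \<Rightarrow> real" where
  "structure_constants br e a b c = br (e a) (e b) \<bullet> e c"

text \<open>The index type \<open>3\<close> has the elements \<open>1, 2, 3\<close> (where \<open>3 = 0\<close>).\<close>

definition levi_civita :: "3 \<Rightarrow> 3 \<Rightarrow> 3 \<Rightarrow> real" where
  "levi_civita i j k =
     (if (i, j, k) \<in> {(1, 2, 3), (2, 3, 1), (3, 1, 2)} then 1
      else if (i, j, k) \<in> {(2, 1, 3), (1, 3, 2), (3, 2, 1)} then - 1
      else 0)"


section \<open>Functions on the torus\<close>

text \<open>
  Functions on the torus are functions on \<open>real ^ 4\<close> of period \<open>2 \<Lambda>\<^sub>i\<close> in the \<open>i\<close>-th coordinate.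
  The coordinates are \<open>x $ 0, x $ 1, x $ 2, x $ 3\<close>.
\<close>

definition periodic :: "real ^ 4 \<Rightarrow> (real ^ 4 \<Rightarrow> 'b) \<Rightarrow> bool" where
  "periodic \<Lambda> f \<longleftrightarrow> (\<forall>x i. f (x + (2 * \<Lambda> $ i) *\<^sub>R axis i 1) = f x)"

definition tint :: "real ^ 4 \<Rightarrow> (real ^ 4 \<Rightarrow> 'b) \<Rightarrow> 'b::{banach, second_countable_topology}" where
  "tint \<Lambda> f = (LINT x:cbox (- \<Lambda>) \<Lambda>|lborel. f x)"

definition conv ::
    "real ^ 4 \<Rightarrow> (real ^ 4 \<Rightarrow> real) \<Rightarrow> (real ^ 4 \<Rightarrow> 'b) \<Rightarrow> real ^ 4 \<Rightarrow> 'b::{banach, second_countable_topology}"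
  where "conv \<Lambda> f g x = tint \<Lambda> (\<lambda>y. f (x - y) *\<^sub>R g y)"

definition periodize :: "real ^ 4 \<Rightarrow> (real ^ 4 \<Rightarrow> real) \<Rightarrow> real ^ 4 \<Rightarrow> real" where
  "periodize \<Lambda> g x = (\<Sum>\<^sub>\<infinity>m\<in>(UNIV :: (int ^ 4) set). g (x + (\<chi> i. 2 * \<Lambda> $ i * real_of_int (m $ i))))"

text \<open>All iterated partial derivatives exist and are (Frechet) differentiable everywhere.\<close>

definition smooth :: "('a::euclidean_space \<Rightarrow> 'b::real_normed_vector) \<Rightarrow> bool" where
  "smooth f \<longleftrightarrow>
     (\<forall>bs. set bs \<subseteq> Basis \<longrightarrow>
        (\<forall>x. foldr (\<lambda>b g y. frechet_derivative g (at y) b) bs f differentiable (at x)))"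

definition partial_deriv :: "4 \<Rightarrow> (real ^ 4 \<Rightarrow> 'b::real_normed_vector) \<Rightarrow> real ^ 4 \<Rightarrow> 'b" where
  "partial_deriv i f x = frechet_derivative f (at x) (axis i 1)"

text \<open>
  The kernel of the projection onto the Fourier modes \<open>p\<close> with all \<open>\<bar>p $ i\<bar> < \<kappa>\<close>. The set of
  these \<open>p\<close> is symmetric, so the sum of the \<open>exp (\<i> p \<bullet> x)\<close> is the sum of the cosines.
\<close>

definition modes :: "real ^ 4 \<Rightarrow> real \<Rightarrow> (real ^ 4) set" where
  "modes \<Lambda> \<kappa> = {p. \<forall>i. (\<exists>m::int. p $ i = pi / \<Lambda> $ i * real_of_int m) \<and> \<bar>p $ i\<bar> < \<kappa>}"

definition chi_cut :: "real ^ 4 \<Rightarrow> real \<Rightarrow> real ^ 4 \<Rightarrow> real" where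
  "chi_cut \<Lambda> \<kappa> x = (\<Sum>p\<in>modes \<Lambda> \<kappa>. cos (p \<bullet> x)) / (\<Prod>i\<in>UNIV. 2 * \<Lambda> $ i)"

definition low_modes ::
    "real ^ 4 \<Rightarrow> real \<Rightarrow> (real ^ 4 \<Rightarrow> 'b) \<Rightarrow> real ^ 4 \<Rightarrow> 'b::{banach, second_countable_topology}"
  where "low_modes \<Lambda> \<kappa> A = conv \<Lambda> (chi_cut \<Lambda> \<kappa>) A"


section \<open>Bosonic fields and the quadratic form\<close>

type_synonym 'g field = "real ^ 4 \<Rightarrow> 'g ^ 3"

definition L2_inner :: "real ^ 4 \<Rightarrow> 'g::euclidean_space field \<Rightarrow> 'g field \<Rightarrow> real" where
  "L2_inner \<Lambda> A B = tint \<Lambda> (\<lambda>x. A x \<bullet> B x)"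

definition field_bracket ::
    "('g::euclidean_space \<Rightarrow> 'g \<Rightarrow> 'g) \<Rightarrow> ('l::finite \<Rightarrow> 'g) \<Rightarrow> 'g field \<Rightarrow> 'g field \<Rightarrow> 'g field" where
  "field_bracket br e A B x =
     (\<chi> k. \<Sum>c\<in>UNIV. (\<Sum>i\<in>UNIV. \<Sum>j\<in>UNIV. \<Sum>a\<in>UNIV. \<Sum>b\<in>UNIV.
        levi_civita i j k * structure_constants br e a b c * (A x $ i \<bullet> e a) * (B x $ j \<bullet> e b)) *\<^sub>R e c)"

definition field_curl :: "'g::euclidean_space field \<Rightarrow> 'g field" where
  "field_curl A x = vector
     [partial_deriv 2 A x $ 3 - partial_deriv 3 A x $ 2,
      partial_deriv 3 A x $ 1 - partial_deriv 1 A x $ 3,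
      partial_deriv 1 A x $ 2 - partial_deriv 2 A x $ 1]"

definition gauge_fields :: "real ^ 4 \<Rightarrow> 'g::euclidean_space field set" where
  "gauge_fields \<Lambda> = {A. smooth A \<and> periodic \<Lambda> A \<and>
     (\<forall>x. x $ 0 = 0 \<longrightarrow> A x $ 1 = 0) \<and>
     (\<forall>x. x $ 0 = 0 \<and> x $ 1 = 0 \<longrightarrow> A x $ 2 = 0) \<and>
     (\<forall>x. x $ 0 = 0 \<and> x $ 1 = 0 \<and> x $ 2 = 0 \<longrightarrow> A x $ 3 = 0)}"

text \<open>Smooth self-dual two-forms, as smooth functions with values in \<open>'g ^ 3\<close>.\<close>

definition sd_forms :: "real ^ 4 \<Rightarrow> 'g::euclidean_space field set" where
  "sd_forms \<Lambda> = {F. smooth F \<and> periodic \<Lambda> F}"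

definition V_space :: "real ^ 4 \<Rightarrow> real \<Rightarrow> ('g::euclidean_space field \<times> 'g field) set" where
  "V_space \<Lambda> \<kappa> =
     {A \<in> gauge_fields \<Lambda>. low_modes \<Lambda> \<kappa> A = A} \<times>
     {F \<in> sd_forms \<Lambda>. low_modes \<Lambda> (2 * \<kappa>) F = F \<and> tint \<Lambda> F = 0}"

definition S0 ::
    "('g::euclidean_space \<Rightarrow> 'g \<Rightarrow> 'g) \<Rightarrow> ('l::finite \<Rightarrow> 'g) \<Rightarrow> real ^ 4 \<Rightarrow> real \<Rightarrow> real \<Rightarrow> 'g ^ 3 \<Rightarrow>
     'g field \<times> 'g field \<Rightarrow> complex" where
  "S0 br e \<Lambda> \<kappa> \<mu> \<Phi> = (\<lambda>(A, F).
     of_real (L2_inner \<Lambda> F F)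
     - 2 * \<i> * of_real (L2_inner \<Lambda> F (partial_deriv 0 A))
     - 2 * \<i> * of_real (L2_inner \<Lambda> F (field_curl A))
     - 2 * \<i> * of_real \<mu> *
         of_real (L2_inner \<Lambda> (\<lambda>_. \<Phi>) (field_bracket br e (low_modes \<Lambda> \<kappa> A) (low_modes \<Lambda> \<kappa> A))))"


section \<open>Propagators\<close>

text \<open>
  Complexified pairs of fields are given by their components: \<open>Inl (i, a)\<close> is the component
  \<open>(i, a)\<close> of \<open>A\<close>, and \<open>Inr (i, a)\<close> the one of \<open>F\<close>.
\<close>

type_synonym 'l comp = "3 \<times> 'l + 3 \<times> 'l"

definition components ::
    "('l::finite \<Rightarrow> 'g::euclidean_space) \<Rightarrow> 'g field \<times> 'g field \<Rightarrow> 'l comp \<Rightarrow> real ^ 4 \<Rightarrow> complex" where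
  "components e v c x = (case c of
     Inl (i, a) \<Rightarrow> of_real (fst v x $ i \<bullet> e a)
   | Inr (i, a) \<Rightarrow> of_real (snd v x $ i \<bullet> e a))"

text \<open>The complex bilinear (not sesquilinear) extension of the real \<open>L\<^sub>2\<close> inner product.\<close>

definition bilin ::
    "real ^ 4 \<Rightarrow> ('l::finite comp \<Rightarrow> real ^ 4 \<Rightarrow> complex) \<Rightarrow> ('l comp \<Rightarrow> real ^ 4 \<Rightarrow> complex) \<Rightarrow> complex" where
  "bilin \<Lambda> u w = (\<Sum>c\<in>UNIV. tint \<Lambda> (\<lambda>x. u c x * w c x))"

definition V_complex ::
    "('l::finite \<Rightarrow> 'g::euclidean_space) \<Rightarrow> real ^ 4 \<Rightarrow> real \<Rightarrow> ('l comp \<Rightarrow> real ^ 4 \<Rightarrow> complex) set" where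
  "V_complex e \<Lambda> \<kappa> =
     {(\<lambda>c x. components e v c x + \<i> * components e w c x) | v w. v \<in> V_space \<Lambda> \<kappa> \<and> w \<in> V_space \<Lambda> \<kappa>}"

text \<open>
  The complex symmetric operator of the quadratic form \<open>S0\<close>; it is unique on \<open>V_complex\<close>, and
  its values elsewhere are not used.
\<close>

definition Q_op ::
    "('g::euclidean_space \<Rightarrow> 'g \<Rightarrow> 'g) \<Rightarrow> ('l::finite \<Rightarrow> 'g) \<Rightarrow> real ^ 4 \<Rightarrow> real \<Rightarrow> real \<Rightarrow> 'g ^ 3 \<Rightarrow>
     ('l comp \<Rightarrow> real ^ 4 \<Rightarrow> complex) \<Rightarrow> ('l comp \<Rightarrow> real ^ 4 \<Rightarrow> complex)" where
  "Q_op br e \<Lambda> \<kappa> \<mu> \<Phi> = (SOME Q.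
     (\<forall>u\<in>V_complex e \<Lambda> \<kappa>. Q u \<in> V_complex e \<Lambda> \<kappa>) \<and>
     (\<forall>u\<in>V_complex e \<Lambda> \<kappa>. \<forall>w\<in>V_complex e \<Lambda> \<kappa>. \<forall>s t.
        Q (\<lambda>c x. s * u c x + t * w c x) = (\<lambda>c x. s * Q u c x + t * Q w c x)) \<and>
     (\<forall>u\<in>V_complex e \<Lambda> \<kappa>. \<forall>w\<in>V_complex e \<Lambda> \<kappa>. bilin \<Lambda> u (Q w) = bilin \<Lambda> (Q u) w) \<and>
     (\<forall>v\<in>V_space \<Lambda> \<kappa>. S0 br e \<Lambda> \<kappa> \<mu> \<Phi> v = bilin \<Lambda> (components e v) (Q (components e v))))"

definition L2_space :: "real ^ 4 \<Rightarrow> ('l::finite comp \<Rightarrow> real ^ 4 \<Rightarrow> complex) set" where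
  "L2_space \<Lambda> = {g. \<forall>c. g c \<in> borel_measurable lborel \<and>
     set_integrable lborel (cbox (- \<Lambda>) \<Lambda>) (\<lambda>x. (cmod (g c x))\<^sup>2)}"

definition V_proj ::
    "('l::finite \<Rightarrow> 'g::euclidean_space) \<Rightarrow> real ^ 4 \<Rightarrow> real \<Rightarrow>
     ('l comp \<Rightarrow> real ^ 4 \<Rightarrow> complex) \<Rightarrow> ('l comp \<Rightarrow> real ^ 4 \<Rightarrow> complex)" where
  "V_proj e \<Lambda> \<kappa> g = (THE u. u \<in> V_complex e \<Lambda> \<kappa> \<and>
     (\<forall>v\<in>V_space \<Lambda> \<kappa>. bilin \<Lambda> (components e v) (\<lambda>c x. g c x - u c x) = 0))"

text \<open>
  The integral kernel of \<open>Q\<close> inverse composed with the orthogonal projection. Continuity and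
  periodicity single out one representative. The first component index goes with \<open>x\<close> and the
  second with \<open>y\<close>.
\<close>

definition propagator ::
    "('g::euclidean_space \<Rightarrow> 'g \<Rightarrow> 'g) \<Rightarrow> ('l::finite \<Rightarrow> 'g) \<Rightarrow> real ^ 4 \<Rightarrow> real \<Rightarrow> real \<Rightarrow> 'g ^ 3 \<Rightarrow>
     'l comp \<Rightarrow> 'l comp \<Rightarrow> real ^ 4 \<Rightarrow> real ^ 4 \<Rightarrow> complex" where
  "propagator br e \<Lambda> \<kappa> \<mu> \<Phi> = (SOME K.
     (\<forall>c d. continuous_on UNIV (\<lambda>(x, y). K c d x y)) \<and>
     (\<forall>c d x. periodic \<Lambda> (K c d x) \<and> periodic \<Lambda> (\<lambda>x'. K c d x' x)) \<and>
     (\<forall>g\<in>L2_space \<Lambda>. \<forall>c x.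
        inv_into (V_complex e \<Lambda> \<kappa>) (Q_op br e \<Lambda> \<kappa> \<mu> \<Phi>) (V_proj e \<Lambda> \<kappa> g) c x =
        (\<Sum>d\<in>UNIV. tint \<Lambda> (\<lambda>y. K c d x y * g d y))))"


section \<open>The bosonic series\<close>

text \<open>
  A monomial in the commuting formal variables is a list of pairs \<open>(c, x)\<close>: \<open>(Inl (i, a), x)\<close>
  is \<open>J\<^sup>i\<^sub>a(x)\<close> and \<open>(Inr (i, a), x)\<close> is \<open>K\<^sup>i\<^sub>a(x)\<close>. An operation on formal functionals, such as
  multiplication by an integral of monomials or functional differentiation, is described by its
  transpose: it sends a linear functional \<open>E\<close>, given by its values on monomials, to the functional
  \<open>M \<mapsto> E (operation applied to M)\<close>.
\<close>

definition delete_nth :: "nat \<Rightarrow> 'b list \<Rightarrow> 'b list" where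
  "delete_nth k xs = take k xs @ drop (Suc k) xs"

lemma length_delete_nth [simp]: "k < length xs \<Longrightarrow> length (delete_nth k xs) = length xs - 1"
  by (auto simp: delete_nth_def)

text \<open>
  The functional \<open>M \<mapsto> \<integral>dx E x (\<delta>M/\<delta>\<phi>\<^sub>c(x))\<close>: by the Leibniz rule every factor \<open>\<phi>\<^sub>c(z)\<close> of
  \<open>M\<close> contributes a delta function \<open>\<delta>(x - z)\<close>, which is integrated.
\<close>

definition fun_deriv ::
    "'c \<Rightarrow> ('p \<Rightarrow> ('c \<times> 'p) list \<Rightarrow> complex) \<Rightarrow> ('c \<times> 'p) list \<Rightarrow> complex" where
  "fun_deriv c E M =
     (\<Sum>k<length M. if fst (M ! k) = c then E (snd (M ! k)) (delete_nth k M) else 0)"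

definition bose_laplacian ::
    "('l::finite comp \<Rightarrow> 'l comp \<Rightarrow> real ^ 4 \<Rightarrow> real ^ 4 \<Rightarrow> complex) \<Rightarrow>
     (('l comp \<times> (real ^ 4)) list \<Rightarrow> complex) \<Rightarrow> ('l comp \<times> (real ^ 4)) list \<Rightarrow> complex" where
  "bose_laplacian C E M = (\<Sum>i\<in>UNIV. \<Sum>j\<in>UNIV. \<Sum>a\<in>UNIV. \<Sum>b\<in>UNIV.
       fun_deriv (Inl (i, a)) (\<lambda>x. fun_deriv (Inl (j, b)) (\<lambda>y N. C (Inl (i, a)) (Inl (j, b)) x y * E N)) M
     + 2 * fun_deriv (Inl (i, a)) (\<lambda>x. fun_deriv (Inr (j, b)) (\<lambda>y N. C (Inl (i, a)) (Inr (j, b)) x y * E N)) M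
     + fun_deriv (Inr (i, a)) (\<lambda>x. fun_deriv (Inr (j, b)) (\<lambda>y N. C (Inr (i, a)) (Inr (j, b)) x y * E N)) M)"

definition bose_vertex ::
    "('l::finite \<Rightarrow> 'l \<Rightarrow> 'l \<Rightarrow> real) \<Rightarrow> real ^ 4 \<Rightarrow>
     (('l comp \<times> (real ^ 4)) list \<Rightarrow> complex) \<Rightarrow> ('l comp \<times> (real ^ 4)) list \<Rightarrow> complex" where
  "bose_vertex f \<Lambda> E M = \<i> * tint \<Lambda> (\<lambda>x.
     \<Sum>i\<in>UNIV. \<Sum>j\<in>UNIV. \<Sum>k\<in>UNIV. \<Sum>a\<in>UNIV. \<Sum>b\<in>UNIV. \<Sum>c\<in>UNIV.
       of_real (levi_civita i j k * f a b c) *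
       E (M @ [(Inl (i, a), x), (Inl (j, b), x), (Inr (k, c), x)]))"

definition at_zero :: "'b list \<Rightarrow> complex" where
  "at_zero M = (if M = [] then 1 else 0)"

text \<open>The \<open>m\<close>-th coefficient of the series in \<open>\<lambda>\<close>, with both exponentials expanded.\<close>

definition Z_bose ::
    "('l::finite \<Rightarrow> 'l \<Rightarrow> 'l \<Rightarrow> real) \<Rightarrow> real ^ 4 \<Rightarrow>
     ('l comp \<Rightarrow> 'l comp \<Rightarrow> real ^ 4 \<Rightarrow> real ^ 4 \<Rightarrow> complex) \<Rightarrow> complex fps" where
  "Z_bose f \<Lambda> C = Abs_fps (\<lambda>m. \<Sum>k.
     (bose_vertex f \<Lambda> ^^ m) ((bose_laplacian C ^^ k) at_zero) [] / (fact k * fact m))"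

definition Theta ::
    "('l::finite \<Rightarrow> 'l \<Rightarrow> 'l \<Rightarrow> real) \<Rightarrow> real ^ 4 \<Rightarrow>
     ('l comp \<Rightarrow> 'l comp \<Rightarrow> real ^ 4 \<Rightarrow> real ^ 4 \<Rightarrow> complex) \<Rightarrow> nat \<Rightarrow> complex" where
  "Theta f \<Lambda> C n = fps_nth (Z_bose f \<Lambda> C) (2 * n)"


section \<open>The fermionic series\<close>

definition cutoff_zeta :: "(real \<Rightarrow> real) \<Rightarrow> bool" where
  "cutoff_zeta \<zeta> \<longleftrightarrow> smooth \<zeta> \<and> (\<forall>x. \<zeta> (- x) = \<zeta> x) \<and> (\<forall>x. 0 \<le> \<zeta> x) \<and>
     (\<zeta> has_integral 1) UNIV \<and> (\<forall>x>0. deriv \<zeta> x \<le> 0) \<and> (\<forall>x\<ge>1. \<zeta> x = 0)"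

definition cutoff_Z :: "(real \<Rightarrow> real) \<Rightarrow> bool" where
  "cutoff_Z Z \<longleftrightarrow> smooth Z \<and> (\<forall>x. Z (- x) = Z x) \<and> (\<forall>x. 0 \<le> Z x) \<and>
     (\<forall>x. \<bar>x\<bar> \<le> 1 \<longrightarrow> Z x = 1) \<and> (\<forall>x>0. deriv Z x \<le> 0) \<and> (\<forall>x. \<bar>x\<bar> \<ge> 2 \<longrightarrow> Z x = 0)"

definition delta_eps :: "real ^ 4 \<Rightarrow> (real \<Rightarrow> real) \<Rightarrow> real \<Rightarrow> real ^ 4 \<Rightarrow> real" where
  "delta_eps \<Lambda> \<zeta> \<epsilon> = periodize \<Lambda> (\<lambda>x. (2 / \<epsilon>) ^ 4 * (\<Prod>i\<in>UNIV. \<zeta> (2 * x $ i / \<epsilon>)))"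

definition D_eps :: "real ^ 4 \<Rightarrow> (real \<Rightarrow> real) \<Rightarrow> real \<Rightarrow> real ^ 4 \<Rightarrow> real" where
  "D_eps \<Lambda> Z \<epsilon> = periodize \<Lambda> (\<lambda>x. \<Prod>i\<in>UNIV. Z (x $ i / (2 * \<epsilon>)))"

text \<open>\<open>Fld h x\<close> and \<open>Bar h x\<close> are the cut-off field \<open>h\<close> and its cut-off conjugate at \<open>x\<close>.\<close>

datatype 'l species = Psi_big 'l | Psi_small 'l | H 3 | Eta 3

datatype 'l fermi = Fld "'l species" "real ^ 4" | Bar "'l species" "real ^ 4"

text \<open>
  All fields are convolved with \<open>delta_eps\<close>, except the conjugates of \<open>H\<close> and \<open>Eta\<close>, which are
  convolved with \<open>D_eps\<close>. Both functions are even, so that the uncut two-point function \<open>\<delta>(x - y)\<close>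
  turns into the following functions of \<open>x - y\<close>.
\<close>

fun two_point ::
    "real ^ 4 \<Rightarrow> (real \<Rightarrow> real) \<Rightarrow> (real \<Rightarrow> real) \<Rightarrow> real \<Rightarrow> 'l species \<Rightarrow> real ^ 4 \<Rightarrow> real" where
  "two_point \<Lambda> \<zeta> Z \<epsilon> (Psi_big a) x = conv \<Lambda> (delta_eps \<Lambda> \<zeta> \<epsilon>) (delta_eps \<Lambda> \<zeta> \<epsilon>) x"
| "two_point \<Lambda> \<zeta> Z \<epsilon> (Psi_small a) x = conv \<Lambda> (delta_eps \<Lambda> \<zeta> \<epsilon>) (delta_eps \<Lambda> \<zeta> \<epsilon>) x"
| "two_point \<Lambda> \<zeta> Z \<epsilon> (H i) x = conv \<Lambda> (delta_eps \<Lambda> \<zeta> \<epsilon>) (D_eps \<Lambda> Z \<epsilon>) x"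
| "two_point \<Lambda> \<zeta> Z \<epsilon> (Eta i) x = conv \<Lambda> (delta_eps \<Lambda> \<zeta> \<epsilon>) (D_eps \<Lambda> Z \<epsilon>) x"

fun contraction ::
    "real ^ 4 \<Rightarrow> (real \<Rightarrow> real) \<Rightarrow> (real \<Rightarrow> real) \<Rightarrow> real \<Rightarrow> 'l fermi \<Rightarrow> 'l fermi \<Rightarrow> complex" where
  "contraction \<Lambda> \<zeta> Z \<epsilon> (Fld g x) (Bar h y) =
     (if g = h then of_real (two_point \<Lambda> \<zeta> Z \<epsilon> g (x - y)) else 0)"
| "contraction \<Lambda> \<zeta> Z \<epsilon> (Bar h y) (Fld g x) =
     (if g = h then - of_real (two_point \<Lambda> \<zeta> Z \<epsilon> g (x - y)) else 0)"
| "contraction \<Lambda> \<zeta> Z \<epsilon> (Fld _ _) (Fld _ _) = 0"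
| "contraction \<Lambda> \<zeta> Z \<epsilon> (Bar _ _) (Bar _ _) = 0"

text \<open>
  The fermionic Wick theorem: the signed sum over all pairings of the factors of a product of
  anticommuting fields, expanded along the first factor. Moving the factor \<open>ws ! k\<close> next to it
  costs the sign \<open>(-1) ^ k\<close>.
\<close>

fun wick :: "('b \<Rightarrow> 'b \<Rightarrow> complex) \<Rightarrow> 'b list \<Rightarrow> complex" where
  "wick G [] = 1"
| "wick G (w # ws) = (\<Sum>k<length ws. (- 1) ^ k * G w (ws ! k) * wick G (delete_nth k ws))"

text \<open>
  Products of (anticommuting) fields are lists, and, as in the bosonic case, multiplication from
  the right by the interaction terms \<open>\<V>\<^sub>\<epsilon>\<close> and \<open>\<Q>\<^sub>\<epsilon>\<close> acts on linear functionals \<open>E\<close> of such products.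
\<close>

definition fermi_V ::
    "('l::finite \<Rightarrow> 'l \<Rightarrow> 'l \<Rightarrow> real) \<Rightarrow> real ^ 4 \<Rightarrow> ('l fermi list \<Rightarrow> complex) \<Rightarrow> 'l fermi list \<Rightarrow> complex" where
  "fermi_V f \<Lambda> E M = - (\<i> / 2) * tint \<Lambda> (\<lambda>x.
     \<Sum>a\<in>UNIV. \<Sum>b\<in>UNIV. \<Sum>c\<in>UNIV. \<Sum>i\<in>UNIV. \<Sum>j\<in>UNIV. \<Sum>k\<in>UNIV.
       of_real (levi_civita i j k * f a b c) *
       E (M @ [Bar (H i) x, Bar (Psi_big a) x, Bar (H j) x, Bar (Psi_big b) x,
               Bar (Eta k) x, Bar (Psi_small c) x]))"

definition fermi_Q ::
    "real ^ 4 \<Rightarrow> ('l::finite comp \<Rightarrow> 'l comp \<Rightarrow> real ^ 4 \<Rightarrow> real ^ 4 \<Rightarrow> complex) \<Rightarrow>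
     ('l fermi list \<Rightarrow> complex) \<Rightarrow> 'l fermi list \<Rightarrow> complex" where
  "fermi_Q \<Lambda> C E M = tint \<Lambda> (\<lambda>x. tint \<Lambda> (\<lambda>y.
     \<Sum>a\<in>UNIV. \<Sum>b\<in>UNIV. \<Sum>i\<in>UNIV. \<Sum>j\<in>UNIV.
         C (Inl (i, a)) (Inl (j, b)) x y *
           E (M @ [Fld (H i) x, Fld (Psi_big a) x, Fld (H j) y, Fld (Psi_big b) y])
       + 2 * C (Inl (i, a)) (Inr (j, b)) x y *
           E (M @ [Fld (H i) x, Fld (Psi_big a) x, Fld (Eta j) y, Fld (Psi_small b) y])
       + C (Inr (i, a)) (Inr (j, b)) x y *
           E (M @ [Fld (Eta i) x, Fld (Psi_small a) x, Fld (Eta j) y, Fld (Psi_small b) y])))"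

text \<open>The normalized Berezin integral of \<open>exp S\<^sub>F\<^sub>,\<^sub>0\<close> times \<open>\<V>\<^sub>\<epsilon> ^ m * \<Q>\<^sub>\<epsilon> ^ k\<close>.\<close>

definition fermi_moment ::
    "('l::finite \<Rightarrow> 'l \<Rightarrow> 'l \<Rightarrow> real) \<Rightarrow> real ^ 4 \<Rightarrow>
     ('l comp \<Rightarrow> 'l comp \<Rightarrow> real ^ 4 \<Rightarrow> real ^ 4 \<Rightarrow> complex) \<Rightarrow>
     (real \<Rightarrow> real) \<Rightarrow> (real \<Rightarrow> real) \<Rightarrow> real \<Rightarrow> nat \<Rightarrow> nat \<Rightarrow> complex" where
  "fermi_moment f \<Lambda> C \<zeta> Z \<epsilon> m k =
     (fermi_V f \<Lambda> ^^ m) ((fermi_Q \<Lambda> C ^^ k) (wick (contraction \<Lambda> \<zeta> Z \<epsilon>))) []"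

text \<open>The expansion of \<open>exp (S\<^sub>F\<^sub>,\<^sub>0 + \<Q>\<^sub>\<epsilon> + \<lambda> \<V>\<^sub>\<epsilon>)\<close>; all terms in the exponent are even and commute.\<close>

definition Z_fermi ::
    "('l::finite \<Rightarrow> 'l \<Rightarrow> 'l \<Rightarrow> real) \<Rightarrow> real ^ 4 \<Rightarrow>
     ('l comp \<Rightarrow> 'l comp \<Rightarrow> real ^ 4 \<Rightarrow> real ^ 4 \<Rightarrow> complex) \<Rightarrow>
     (real \<Rightarrow> real) \<Rightarrow> (real \<Rightarrow> real) \<Rightarrow> real \<Rightarrow> complex fps" where
  "Z_fermi f \<Lambda> C \<zeta> Z \<epsilon> =
     Abs_fps (\<lambda>m. \<Sum>k. fermi_moment f \<Lambda> C \<zeta> Z \<epsilon> m k / (fact m * fact k))"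

definition Xi ::
    "('l::finite \<Rightarrow> 'l \<Rightarrow> 'l \<Rightarrow> real) \<Rightarrow> real ^ 4 \<Rightarrow>
     ('l comp \<Rightarrow> 'l comp \<Rightarrow> real ^ 4 \<Rightarrow> real ^ 4 \<Rightarrow> complex) \<Rightarrow>
     (real \<Rightarrow> real) \<Rightarrow> (real \<Rightarrow> real) \<Rightarrow> nat \<Rightarrow> real \<Rightarrow> complex" where
  "Xi f \<Lambda> C \<zeta> Z n \<epsilon> =
     1 / (fact (2 * n) * fact (3 * n)) * fermi_moment f \<Lambda> C \<zeta> Z \<epsilon> (2 * n) (3 * n)"

definition even_series :: "(nat \<Rightarrow> complex) \<Rightarrow> complex fps" where
  "even_series c = Abs_fps (\<lambda>m. if even m then c (m div 2) else 0)"

end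

theory Submission
  imports Defs
begin

text \<open>
  Wick's theorem contracts every conjugate field of the vertices with a field of the quadratic
  insertions, where a product \<open>H\<^sub>i \<Psi>\<^sub>\<alpha>\<close> (or \<open>\<eta>\<^sub>i \<psi>\<^sub>\<alpha>\<close>) meets the propagator \<open>C\<close>. Since the plateau of
  \<open>D\<^sub>\<epsilon>\<close> covers the support of \<open>\<delta>\<^sub>\<epsilon> \<star> \<delta>\<^sub>\<epsilon>\<close>, such a product contributes \<open>\<delta>(x - z)\<close> in the limit if both
  factors are contracted at the same vertex \<open>z\<close>, and nothing if they are contracted at different
  vertices. So only contractions in which the fermions travel as composite bosons survive. Their signs
  cancel, and the two ways of grouping the conjugates of \<open>H\<^sub>i \<Psi>\<^sub>\<alpha> H\<^sub>j \<Psi>\<^sub>\<beta>\<close> contribute equally by the antisymmetry of \<open>f\<close>, which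
  gives the bosonic Wick expansion. Dominated convergence allows the limit to be taken under
  the integrals over the vertices.

  All that is used of \<open>C\<close> is its continuity. The propagator exists because the quadratic form is
  nondegenerate: the term with \<open>\<Phi>\<close> is purely imaginary on real fields, so a null vector satisfies
  \<open>d\<^sub>0 A + \<nabla> \<times> A = 0\<close>; then \<open>d\<^sub>0 A\<close> and \<open>\<nabla> \<times> A\<close> vanish separately, and the gauge condition forces \<open>A = 0\<close>.
\<close>

text \<open>The insertions append their factors on the right, whereas \<open>wick\<close> expands
  along the first factor. Re-expanding along the last field turns multiplication by k quadratic
  terms into the k-th power of one operator \<open>del4\<close>, which removes four conjugate fields
  at a time; the regularization enters through its kernel only. Striking out one fermion is an odd
  operation, but fields come in pairs, and pairs leave no sign. The limit kernel compares points by
  equality. The passage to bosons is therefore exact only at distinct vertex positions, and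
  convergence is claimed only in the open box, while the bounds for dominated convergence must hold
  up to the boundary. A vertex gives -i/2 times two equal groupings, that is -i against the bosonic
  i; with 2n vertices the signs cancel. On the side of the propagator, inverting Q needs an
  orthonormal basis of the field space. It is obtained from the fact that band-limited fields are
  reproduced by convolution with a bounded kernel, and the same argument applied to the range of Q
  replaces a dimension count.\<close>

lemma delete_nth_Cons [simp]:
  "delete_nth 0 (x # xs) = xs" "delete_nth (Suc k) (x # xs) = x # delete_nth k xs"
  by (auto simp: delete_nth_def)

lemma delete_nth_map: "delete_nth k (map f xs) = map f (delete_nth k xs)"
  by (simp add: delete_nth_def take_map drop_map)

lemma set_delete_nth: "set (delete_nth k xs) \<subseteq> set xs"
  by (auto simp: delete_nth_def dest: in_set_takeD in_set_dropD)

section \<open>Signed removal of list entries: the algebra of fermionic contractions\<close>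

definition del :: "('b \<Rightarrow> 'b list \<Rightarrow> complex) \<Rightarrow> 'b list \<Rightarrow> complex" where
  "del \<phi> M = (\<Sum>p<length M. (- 1) ^ p * \<phi> (M ! p) (delete_nth p M))"

lemma del_Nil [simp]: "del \<phi> [] = 0"
  by (simp add: del_def)

text \<open>The graded Leibniz rule: an odd operation changes sign when it passes the factor
  \<open>b\<close>. Later inductions on lists use this recursion instead of positions.\<close>

lemma del_Cons [simp]: "del \<phi> (b # M) = \<phi> b M - del (\<lambda>u N. \<phi> u (b # N)) M"
  unfolding del_def by (simp add: sum.lessThan_Suc_shift sum_negf del: sum.lessThan_Suc)

lemma del_cong:
  assumes "\<And>u N. u \<in> set M \<Longrightarrow> set N \<subseteq> set M \<Longrightarrow> Suc (length N) = length M \<Longrightarrow> \<phi> u N = \<psi> u N"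
  shows "del \<phi> M = del \<psi> M"
  unfolding del_def using set_delete_nth by (intro sum.cong refl arg_cong2[where f="(*)"] assms) fastforce+

lemma del_diff: "del (\<lambda>u N. \<phi> u N - \<psi> u N) M = del \<phi> M - del \<psi> M"
  by (simp add: del_def sum_subtractf algebra_simps)

lemma del_minus: "del (\<lambda>u N. - \<phi> u N) M = - del \<phi> M"
  by (simp add: del_def sum_negf)

lemma del_zero [simp]: "del (\<lambda>u N. 0) M = 0"
  by (simp add: del_def)

lemma del_mult: "del (\<lambda>u N. a * \<phi> u N) M = a * del \<phi> M"
  by (simp add: del_def sum_distrib_left algebra_simps)

lemma del_sum: "del (\<lambda>u N. \<Sum>i\<in>S. \<phi> i u N) M = (\<Sum>i\<in>S. del (\<phi> i) M)"
  unfolding del_def by (subst sum.swap) (simp add: sum_distrib_left)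

text \<open>Removing two factors in the other order differs by one transposition: the operations
  anticommute like Grassmann derivatives.\<close>

lemma del_swap: "del (\<lambda>u. del (\<phi> u)) M = - del (\<lambda>u. del (\<lambda>v. \<phi> v u)) M"
proof (induction M arbitrary: \<phi>)
  case (Cons b M)
  \<comment> \<open>The three terms: \<open>b\<close> is removed first, \<open>b\<close> is removed
    second, \<open>b\<close> stays. Exchanging the order swaps the first two, and only the third
    needs the induction hypothesis.\<close>
  have *: "del (\<lambda>u. del (\<phi> u)) (b # M) =
      del (\<phi> b) M - del (\<lambda>u. \<phi> u b) M + del (\<lambda>u. del (\<lambda>v N. \<phi> u v (b # N))) M" for \<phi>
    by (simp add: del_diff)
  show ?case
    unfolding * by (subst Cons.IH) simp
qed simp

text \<open>Moving one removal past two others costs two signs, which cancel.\<close>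

lemma del_swap3: "del (\<lambda>u. del (\<lambda>v. del (\<phi> u v))) M = del (\<lambda>w. del (\<lambda>u. del (\<lambda>v. \<phi> u v w))) M"
proof -
  have "del (\<lambda>u. del (\<lambda>v. del (\<phi> u v))) M = del (\<lambda>u N. - del (\<lambda>w. del (\<lambda>v. \<phi> u v w)) N) M"
    by (rule del_cong) (rule del_swap)
  also have "\<dots> = - del (\<lambda>u. del (\<lambda>w. del (\<lambda>v. \<phi> u v w))) M"
    by (simp add: del_minus)
  also have "\<dots> = del (\<lambda>w. del (\<lambda>u. del (\<lambda>v. \<phi> u v w))) M"
    by (subst del_swap) simp
  finally show ?thesis .
qed

text \<open>Reaching an entry of \<open>B\<close> means passing all of \<open>A\<close>; this is the
  global sign of the second term.\<close>

lemma del_append: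
  "del \<phi> (A @ B) = del (\<lambda>u N. \<phi> u (N @ B)) A + (- 1) ^ length A * del (\<lambda>u N. \<phi> u (A @ N)) B"
proof (induction A arbitrary: \<phi>)
  case (Cons a A)
  show ?case
    by (simp add: Cons.IH)
qed simp

text \<open>Signs count positions in their own list, so removals from two different lists commute
  without a sign.\<close>

lemma del_del_commute:
  "del (\<lambda>u N. del (\<lambda>v N'. \<phi> u v N N') M) F = del (\<lambda>v N'. del (\<lambda>u N. \<phi> u v N N') F) M"
  unfolding del_def sum_distrib_left by (subst sum.swap) (simp add: algebra_simps)

section \<open>The Wick expansion\<close>

lemma wick_Cons_del: "wick G (w # ws) = del (\<lambda>u N. G w u * wick G N) ws"
  by (simp add: del_def mult.assoc)

declare wick.simps(2) [simp del]

lemma del_eq_0: "(\<And>u N. u \<in> set M \<Longrightarrow> \<phi> u N = 0) \<Longrightarrow> del \<phi> M = 0"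
  by (simp add: del_def)

text \<open>The expansion along the last factor; the sign counts the entries of \<open>M\<close> and
  \<open>F\<close> that stand between \<open>u\<close> and \<open>w\<close>. The hypotheses describe
  conjugate fields \<open>M\<close> followed by fields \<open>F\<close> and \<open>w\<close>, with
  no contractions inside either group. \<open>F\<close> is kept general because expanding along the
  first entry of \<open>M\<close> removes one of its entries.\<close>

lemma wick_last:
  assumes "\<And>u v. u \<in> set M \<Longrightarrow> v \<in> set M \<Longrightarrow> G u v = 0"
    and "\<And>u v. u \<in> set F \<union> {w} \<Longrightarrow> v \<in> set F \<union> {w} \<Longrightarrow> G u v = 0"
  shows "wick G (M @ F @ [w]) =
    - ((- 1) ^ (length M + length F) * del (\<lambda>u N. G u w * wick G (N @ F)) M)"
  using assms
proof (induction M arbitrary: F)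
  case Nil
  show ?case
    using Nil(2) by (cases F) (auto simp: wick_Cons_del intro!: del_eq_0)
next
  case (Cons b M)
  have bM: "G b u = 0" if "u \<in> set M" for u using Cons.prems(1) that by auto
  \<comment> \<open>\<open>b\<close> does not contract with entries of its own group, so only
    \<open>F'\<close> contributes, after all of \<open>N\<close> has been passed.\<close>
  have exp: "wick G (b # N @ F') =
      (- 1) ^ length N * del (\<lambda>u N'. G b u * wick G (N @ N')) F'" if "set N \<subseteq> set M" for N F'
  proof -
    have "del (\<lambda>u N'. G b u * wick G (N' @ F')) N = 0"
      using that bM by (intro del_eq_0) auto
    thus ?thesis by (simp add: wick_Cons_del del_append)
  qed
  have IH: "wick G (M @ N @ [w]) =
      - ((- 1) ^ (length M + length N) * del (\<lambda>u N'. G u w * wick G (N' @ N)) M)"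
    if "set N \<subseteq> set F" for N
    by (rule Cons.IH, simp add: Cons.prems(1), rule Cons.prems(2)) (use that in blast)+
  have "wick G ((b # M) @ F @ [w]) =
     (- 1) ^ length M * (del (\<lambda>u N. G b u * wick G (M @ N @ [w])) F
       + (- 1) ^ length F * (G b w * wick G (M @ F)))"
    by (simp add: exp del_append)
  also have "del (\<lambda>u N. G b u * wick G (M @ N @ [w])) F =
     del (\<lambda>u N. (- 1) ^ (length M + length F) * del (\<lambda>v N'. G b u * (G v w * wick G (N' @ N))) M) F"
  proof (rule del_cong)
    fix u N assume N: "set N \<subseteq> set F" "Suc (length N) = length F"
    \<comment> \<open>\<open>N\<close> is one entry shorter than \<open>F\<close>; the resulting
      sign absorbs the minus of the induction hypothesis.\<close>
    have "(- 1) ^ (length M + length F) = - ((- 1) ^ (length M + length N) :: complex)"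
      by (simp flip: N(2))
    thus "G b u * wick G (M @ N @ [w]) =
       (- 1) ^ (length M + length F) * del (\<lambda>v N'. G b u * (G v w * wick G (N' @ N))) M"
      by (simp add: IH[OF N(1)] del_mult)
  qed
  also have "\<dots> = (- 1) ^ (length M + length F) *
       del (\<lambda>v N'. G v w * del (\<lambda>u N. G b u * wick G (N' @ N)) F) M"
    by (simp add: del_mult del_del_commute[where M=M] algebra_simps flip: del_mult)
  finally have 1: "wick G ((b # M) @ F @ [w]) = (- 1) ^ length M * ((- 1) ^ (length M + length F) *
       del (\<lambda>v N'. G v w * del (\<lambda>u N. G b u * wick G (N' @ N)) F) M
     + (- 1) ^ length F * (G b w * wick G (M @ F)))" .
  have "del (\<lambda>u N. G u w * wick G (b # N @ F)) M =
     del (\<lambda>u N. - ((- 1) ^ length M) * (G u w * del (\<lambda>v N'. G b v * wick G (N @ N')) F)) M"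
  proof (rule del_cong)
    fix u N assume N: "set N \<subseteq> set M" "Suc (length N) = length M"
    show "G u w * wick G (b # N @ F) =
       - ((- 1) ^ length M) * (G u w * del (\<lambda>v N'. G b v * wick G (N @ N')) F)"
      by (simp add: exp[OF N(1)] flip: N(2))
  qed
  hence 2: "del (\<lambda>u N. G u w * wick G (b # N @ F)) M =
     - ((- 1) ^ length M) * del (\<lambda>u N. G u w * del (\<lambda>v N'. G b v * wick G (N @ N')) F) M"
    by (simp only: del_mult)
  show ?case
    unfolding 1 by (simp add: 2 power_add algebra_simps)
qed

section \<open>Integrals of continuous functions over the torus\<close>

lemma set_integrable_continuous:
  fixes f :: "real ^ 4 \<Rightarrow> 'b::{banach, second_countable_topology}"
  assumes "continuous_on UNIV f"
  shows "set_integrable lborel (cbox a b) f"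
  unfolding set_integrable_def
  by (rule borel_integrable_compact) (use assms continuous_on_subset in auto)

lemma tint_eq_integral:
  fixes f :: "real ^ 4 \<Rightarrow> 'b::euclidean_space"
  assumes "continuous_on UNIV f"
  shows "tint \<Lambda> f = integral (cbox (- \<Lambda>) \<Lambda>) f"
  unfolding tint_def using set_borel_integral_eq_integral set_integrable_continuous[OF assms] by blast

lemma tint_zero [simp]: "tint \<Lambda> (\<lambda>x. 0) = 0"
  by (simp add: tint_def)

lemma tint_add:
  assumes "continuous_on UNIV f" "continuous_on UNIV g"
  shows "tint \<Lambda> (\<lambda>x. f x + g x) = tint \<Lambda> f + tint \<Lambda> g"
  unfolding tint_def by (intro set_integral_add set_integrable_continuous assms)

lemma tint_diff:
  assumes "continuous_on UNIV f" "continuous_on UNIV g"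
  shows "tint \<Lambda> (\<lambda>x. f x - g x) = tint \<Lambda> f - tint \<Lambda> g"
  unfolding tint_def by (intro set_integral_diff set_integrable_continuous assms)

lemma tint_mult:
  fixes a :: "'b::{real_normed_field, banach, second_countable_topology}"
  shows "tint \<Lambda> (\<lambda>x. a * f x) = a * tint \<Lambda> f"
  unfolding tint_def by simp

lemma tint_sum:
  assumes "\<And>i. i \<in> S \<Longrightarrow> continuous_on UNIV (f i)"
  shows "tint \<Lambda> (\<lambda>x. \<Sum>i\<in>S. f i x) = (\<Sum>i\<in>S. tint \<Lambda> (f i))"
  using assms
proof (induction S rule: infinite_finite_induct)
  case (insert i S)
  thus ?case by (simp add: tint_add continuous_on_sum)
qed auto

lemma continuous_on_tint:
  fixes F :: "'t::topological_space \<Rightarrow> real ^ 4 \<Rightarrow> 'b::euclidean_space"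
  assumes "continuous_on UNIV (\<lambda>(t, x). F t x)"
  shows "continuous_on UNIV (\<lambda>t. tint \<Lambda> (F t))"
proof -
  have "continuous_on UNIV (F t)" for t
    using continuous_on_compose2[OF assms continuous_on_Pair[OF continuous_on_const[where c=t] continuous_on_id], of UNIV]
    by simp
  hence eq: "tint \<Lambda> (F t) = integral (cbox (- \<Lambda>) \<Lambda>) (F t)" for t
    by (simp add: tint_eq_integral)
  show ?thesis
    unfolding eq by (rule integral_continuous_on_param) (use assms continuous_on_subset in auto)
qed

section \<open>Iterated integrals over pairs of points\<close>

definition dtint :: "real ^ 4 \<Rightarrow> (real ^ 4 \<Rightarrow> real ^ 4 \<Rightarrow> complex) \<Rightarrow> complex" where
  "dtint \<Lambda> \<phi> = tint \<Lambda> (\<lambda>x. tint \<Lambda> (\<phi> x))"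

definition cont2 :: "(real ^ 4 \<Rightarrow> real ^ 4 \<Rightarrow> complex) \<Rightarrow> bool" where
  "cont2 \<phi> \<longleftrightarrow> continuous_on UNIV (\<lambda>(x, y). \<phi> x y)"

lemma cont2_D:
  assumes "cont2 \<phi>"
  shows "continuous_on UNIV (\<phi> x)" "continuous_on UNIV (\<lambda>x. tint \<Lambda> (\<phi> x))"
proof -
  show "continuous_on UNIV (\<phi> x)"
    using continuous_on_compose2[OF assms[unfolded cont2_def]
        continuous_on_Pair[OF continuous_on_const[where c=x] continuous_on_id], of UNIV]
    by simp
  show "continuous_on UNIV (\<lambda>x. tint \<Lambda> (\<phi> x))"
    using assms by (intro continuous_on_tint) (simp add: cont2_def)
qed

lemma cont2_intros:
  "cont2 (\<lambda>x y. a)"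
  "cont2 \<phi> \<Longrightarrow> cont2 \<psi> \<Longrightarrow> cont2 (\<lambda>x y. \<phi> x y * \<psi> x y)"
  "(\<And>i. i \<in> S \<Longrightarrow> cont2 (\<Phi> i)) \<Longrightarrow> cont2 (\<lambda>x y. \<Sum>i\<in>S. \<Phi> i x y)"
  "(\<And>u N'. cont2 (\<lambda>x y. \<eta> x y u N')) \<Longrightarrow> cont2 (\<lambda>x y. del (\<eta> x y) N)"
  by (auto simp: cont2_def case_prod_unfold del_def intro!: continuous_intros)

lemma dtint_mult: "dtint \<Lambda> (\<lambda>x y. a * \<phi> x y) = a * dtint \<Lambda> \<phi>"
  by (simp add: dtint_def tint_mult)

lemma dtint_sum:
  assumes "\<And>i. i \<in> S \<Longrightarrow> cont2 (\<phi> i)"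
  shows "dtint \<Lambda> (\<lambda>x y. \<Sum>i\<in>S. \<phi> i x y) = (\<Sum>i\<in>S. dtint \<Lambda> (\<phi> i))"
  unfolding dtint_def using assms
  by (simp add: tint_sum cont2_D)

lemma dtint_del:
  assumes "\<And>u N'. cont2 (\<lambda>x y. \<phi> x y u N')"
  shows "dtint \<Lambda> (\<lambda>x y. del (\<phi> x y) N) = del (\<lambda>u N'. dtint \<Lambda> (\<lambda>x y. \<phi> x y u N')) N"
  unfolding del_def using assms by (simp add: dtint_sum cont2_intros dtint_mult)

section \<open>Contracting the conjugate fields with the quadratic interaction\<close>

text \<open>A component of the bosonic pair is represented by a product of two fermions:
  \<open>h_of c\<close> carries its space index, \<open>psi_of c\<close> its Lie algebra
  index.\<close>

fun h_of :: "'l comp \<Rightarrow> 'l species" where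
  "h_of (Inl (i, a)) = H i"
| "h_of (Inr (i, a)) = Eta i"

fun psi_of :: "'l comp \<Rightarrow> 'l species" where
  "psi_of (Inl (i, a)) = Psi_big a"
| "psi_of (Inr (i, a)) = Psi_small a"

definition bar :: "'l species \<times> (real ^ 4) \<Rightarrow> 'l fermi" where
  "bar u = Bar (fst u) (snd u)"

text \<open>Turns the three quadratic terms, with the factor 2 of the mixed one, into a single sum
  over ordered pairs of components. The mixed term is written in one order only, whence the value 0
  for the other order.\<close>

fun weight :: "'l comp \<Rightarrow> 'l comp \<Rightarrow> complex" where
  "weight (Inl _) (Inl _) = 1"
| "weight (Inl _) (Inr _) = 2"
| "weight (Inr _) (Inr _) = 1"
| "weight (Inr _) (Inl _) = 0"

lemma sum_UNIV_comp:
  fixes F :: "'l::finite comp \<Rightarrow> 'l comp \<Rightarrow> 'b::comm_monoid_add"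
  shows "(\<Sum>c\<in>UNIV. \<Sum>d\<in>UNIV. F c d) =
    (\<Sum>i\<in>UNIV. \<Sum>j\<in>UNIV. \<Sum>a\<in>UNIV. \<Sum>b\<in>UNIV.
       F (Inl (i, a)) (Inl (j, b)) + F (Inl (i, a)) (Inr (j, b))
     + F (Inr (i, a)) (Inl (j, b)) + F (Inr (i, a)) (Inr (j, b)))"
proof -
  have 1: "(\<Sum>c\<in>UNIV. G c) = (\<Sum>i\<in>UNIV. \<Sum>a\<in>UNIV. G (Inl (i, a)) + G (Inr (i, a)))"
    for G :: "'l comp \<Rightarrow> 'b"
    by (simp add: UNIV_Plus_UNIV[symmetric] sum.Plus sum.cartesian_product sum.distrib
        del: UNIV_Plus_UNIV)
  show ?thesis
    unfolding 1
    by (rule sum.cong[OF refl], subst sum.swap)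
       (simp add: sum.distrib add_ac sum.swap[of _ "UNIV :: 3 set" "UNIV :: 'l set"])
qed

lemma fermi_Q_eq:
  "fermi_Q \<Lambda> C E M = dtint \<Lambda> (\<lambda>x y. \<Sum>c\<in>UNIV. \<Sum>d\<in>UNIV. weight c d * C c d x y *
     E (M @ [Fld (h_of c) x, Fld (psi_of c) x, Fld (h_of d) y, Fld (psi_of d) y]))"
proof -
  have sw: "(\<Sum>i\<in>A. \<Sum>j\<in>B. \<Sum>a\<in>C. \<Sum>b\<in>D. F i j a b) = (\<Sum>a\<in>C. \<Sum>b\<in>D. \<Sum>i\<in>A. \<Sum>j\<in>B. F i j a b)"
    for A B :: "3 set" and C D :: "'a set" and F :: "_ \<Rightarrow> _ \<Rightarrow> _ \<Rightarrow> _ \<Rightarrow> complex"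
  proof -
    have "(\<Sum>i\<in>A. \<Sum>j\<in>B. \<Sum>a\<in>C. \<Sum>b\<in>D. F i j a b) =
        (\<Sum>i\<in>A. \<Sum>a\<in>C. \<Sum>b\<in>D. \<Sum>j\<in>B. F i j a b)"
      by (intro sum.cong refl) (subst sum.swap, intro sum.cong refl sum.swap)
    also have "\<dots> = (\<Sum>a\<in>C. \<Sum>b\<in>D. \<Sum>i\<in>A. \<Sum>j\<in>B. F i j a b)"
      by (subst sum.swap, intro sum.cong refl sum.swap)
    finally show ?thesis .
  qed
  show ?thesis
    unfolding fermi_Q_def dtint_def sum_UNIV_comp by (simp add: sw)
qed

lemma bose_laplacian_eq:
  "bose_laplacian C E M = (\<Sum>c\<in>UNIV. \<Sum>d\<in>UNIV. weight c d *
     fun_deriv c (\<lambda>x. fun_deriv d (\<lambda>y N. C c d x y * E N)) M)"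
  unfolding bose_laplacian_def sum_UNIV_comp by simp

definition contract :: "('l species \<Rightarrow> real ^ 4 \<Rightarrow> real) \<Rightarrow> 'l species \<Rightarrow> real ^ 4 \<Rightarrow> 'l species \<times> (real ^ 4) \<Rightarrow> complex"
  where "contract tp s x u = (if fst u = s then of_real (tp s (x - snd u)) else 0)"

definition del4 ::
  "('b \<Rightarrow> 'b \<Rightarrow> 'b \<Rightarrow> 'b \<Rightarrow> complex) \<Rightarrow> ('b list \<Rightarrow> complex) \<Rightarrow> 'b list \<Rightarrow> complex" where
  "del4 \<kappa> E = del (\<lambda>u4. del (\<lambda>u3. del (\<lambda>u2. del (\<lambda>u1 N. \<kappa> u4 u3 u2 u1 * E N))))"

text \<open>The last field is contracted first, so the removals run backwards through the fields
  \<open>h_of c\<close>, \<open>psi_of c\<close>, \<open>h_of d\<close>, \<open>psi_of d\<close> in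
  the order in which they are appended.\<close>

definition contract4 where
  "contract4 tp c d x y u4 u3 u2 u1 =
     contract tp (psi_of d) y u4 * (contract tp (h_of d) y u3 * (contract tp (psi_of c) x u2 * contract tp (h_of c) x u1))"

text \<open>The amplitude with which one regularized quadratic insertion absorbs the four conjugates
  \<open>u1\<close> to \<open>u4\<close>. Its limit is \<open>limit_kernel\<close>.\<close>

definition kernel where
  "kernel \<Lambda> C tp u4 u3 u2 u1 =
     dtint \<Lambda> (\<lambda>x y. \<Sum>c\<in>UNIV. \<Sum>d\<in>UNIV. weight c d * C c d x y * contract4 tp c d x y u4 u3 u2 u1)"

lemma wick_last_fld:
  assumes "set F \<subseteq> range (\<lambda>(s, x). Fld s x)"
  shows "wick (contraction \<Lambda> \<zeta> Z \<epsilon>) (map bar N @ F @ [Fld s x]) =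
     (- 1) ^ (length N + length F) *
       del (\<lambda>u N. contract (two_point \<Lambda> \<zeta> Z \<epsilon>) s x u * wick (contraction \<Lambda> \<zeta> Z \<epsilon>) (map bar N @ F)) N"
proof -
  have map: "del \<phi> (map bar N) = del (\<lambda>u N. \<phi> (bar u) (map bar N)) N"
    for \<phi> and N :: "('a species \<times> (real ^ 4)) list"
    by (simp add: del_def delete_nth_map)
  \<comment> \<open>A conjugate standing to the left of its field contracts with a minus sign, which
    cancels the minus in \<open>wick_last\<close>.\<close>
  have "contraction \<Lambda> \<zeta> Z \<epsilon> (bar u) (Fld s x) = - contract (two_point \<Lambda> \<zeta> Z \<epsilon>) s x u" for u
    by (simp add: bar_def contract_def)
  moreover have "contraction \<Lambda> \<zeta> Z \<epsilon> u v = 0"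
    if "u \<in> set F \<union> {Fld s x}" "v \<in> set F \<union> {Fld s x}" for u v
  proof -
    have "u \<in> range (\<lambda>(s, x). Fld s x)" "v \<in> range (\<lambda>(s, x). Fld s x)"
      using that assms by (auto intro: range_eqI[of _ _ "(s, x)"])
    thus ?thesis by force
  qed
  moreover have "contraction \<Lambda> \<zeta> Z \<epsilon> u v = 0"
    if "u \<in> set (map bar N)" "v \<in> set (map bar N)" for u v
    using that by (auto simp: bar_def)
  ultimately show ?thesis
    by (subst wick_last) (auto simp: map del_minus)
qed

text \<open>A pair of fields is even: for the second contraction one conjugate and one field fewer
  are present, so its sign equals the first one and their product is 1.\<close>

lemma wick_last2:
  assumes "set F \<subseteq> range (\<lambda>(s, x). Fld s x)"
  shows "wick (contraction \<Lambda> \<zeta> Z \<epsilon>) (map bar N @ F @ [Fld s x, Fld s' x']) =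
     del (\<lambda>u'. del (\<lambda>u N. contract (two_point \<Lambda> \<zeta> Z \<epsilon>) s' x' u' * (contract (two_point \<Lambda> \<zeta> Z \<epsilon>) s x u *
       wick (contraction \<Lambda> \<zeta> Z \<epsilon>) (map bar N @ F)))) N"
proof -
  let ?w = "wick (contraction \<Lambda> \<zeta> Z \<epsilon>)"
  let ?g = "contract (two_point \<Lambda> \<zeta> Z \<epsilon>)"
  let ?s = "(- 1) ^ Suc (length N + length F) :: complex"
  have "?w (map bar N @ F @ [Fld s x, Fld s' x']) =
     ?s * del (\<lambda>u N. ?g s' x' u * ?w (map bar N @ F @ [Fld s x])) N"
    using wick_last_fld[of "F @ [Fld s x]" \<Lambda> \<zeta> Z \<epsilon> N s' x'] assms by auto
  also have "del (\<lambda>u N. ?g s' x' u * ?w (map bar N @ F @ [Fld s x])) N =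
     del (\<lambda>u' N. ?s * (?g s' x' u' * del (\<lambda>u N. ?g s x u * ?w (map bar N @ F)) N)) N"
  proof (rule del_cong)
    fix u and N' :: "('a species \<times> (real ^ 4)) list" assume N': "Suc (length N') = length N"
    show "?g s' x' u * ?w (map bar N' @ F @ [Fld s x]) =
      ?s * (?g s' x' u * del (\<lambda>u N. ?g s x u * ?w (map bar N @ F)) N')"
      by (simp add: wick_last_fld[OF assms] flip: N')
  qed
  also have "\<dots> = ?s * del (\<lambda>u' N. ?g s' x' u' * del (\<lambda>u N. ?g s x u * ?w (map bar N @ F)) N) N"
    by (rule del_mult)
  finally show ?thesis
    by (simp only: del_mult[abs_def]) (simp flip: power_mult_distrib mult.assoc)
qed

lemma wick_last4:
  assumes "set F \<subseteq> range (\<lambda>(s, x). Fld s x)"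
  shows "wick (contraction \<Lambda> \<zeta> Z \<epsilon>)
      (map bar N @ F @ [Fld (h_of c) x, Fld (psi_of c) x, Fld (h_of d) y, Fld (psi_of d) y]) =
    del4 (contract4 (two_point \<Lambda> \<zeta> Z \<epsilon>) c d x y) (\<lambda>N. wick (contraction \<Lambda> \<zeta> Z \<epsilon>) (map bar N @ F)) N"
  using wick_last2[of "F @ [Fld (h_of c) x, Fld (psi_of c) x]" \<Lambda> \<zeta> Z \<epsilon> N "h_of d" y "psi_of d" y] assms
  by (auto simp: wick_last2 del4_def contract4_def mult.assoc simp flip: del_mult)

lemma cont2_contract4:
  assumes "\<And>s. continuous_on UNIV (tp s)"
  shows "cont2 (\<lambda>x y. contract4 tp c d x y u4 u3 u2 u1)"
proof -
  have "cont2 (\<lambda>x y. contract tp s y u)" "cont2 (\<lambda>x y. contract tp s x u)" for s u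
    unfolding cont2_def case_prod_unfold contract_def
    by (cases "fst u = s";
        auto intro!: continuous_on_of_real continuous_on_compose2[OF assms] continuous_intros)+
  thus ?thesis
    unfolding contract4_def by (intro cont2_intros)
qed

lemma cont2_del4:
  assumes "\<And>u4 u3 u2 u1. cont2 (\<lambda>x y. \<kappa> x y u4 u3 u2 u1)" "\<And>N. cont2 (\<lambda>x y. E x y N)"
  shows "cont2 (\<lambda>x y. del4 (\<kappa> x y) (E x y) N)"
  unfolding del4_def by (intro cont2_intros assms)

lemma dtint_del4:
  assumes "\<And>u4 u3 u2 u1. cont2 (\<lambda>x y. \<kappa> x y u4 u3 u2 u1)"
  shows "dtint \<Lambda> (\<lambda>x y. del4 (\<kappa> x y) E N) = del4 (\<lambda>u4 u3 u2 u1. dtint \<Lambda> (\<lambda>x y. \<kappa> x y u4 u3 u2 u1)) E N"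
  unfolding del4_def
  by (simp add: dtint_del cont2_intros assms dtint_mult mult.commute[of _ "E _"])

lemma dtint_del4_power:
  assumes "\<And>N. cont2 (\<lambda>x y. E x y N)"
  shows "cont2 (\<lambda>x y. (del4 \<kappa> ^^ k) (E x y) N)"
    and "dtint \<Lambda> (\<lambda>x y. (del4 \<kappa> ^^ k) (E x y) N) = (del4 \<kappa> ^^ k) (\<lambda>N. dtint \<Lambda> (\<lambda>x y. E x y N)) N"
proof -
  show *: "cont2 (\<lambda>x y. (del4 \<kappa> ^^ k) (E x y) N)" for N k
    by (induction k arbitrary: N) (auto intro!: cont2_del4 cont2_intros assms)
  show "dtint \<Lambda> (\<lambda>x y. (del4 \<kappa> ^^ k) (E x y) N) = (del4 \<kappa> ^^ k) (\<lambda>N. dtint \<Lambda> (\<lambda>x y. E x y N)) N"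
  proof (induction k arbitrary: N)
    case (Suc k)
    have "dtint \<Lambda> (\<lambda>x y. (del4 \<kappa> ^^ Suc k) (E x y) N) =
        del4 \<kappa> (\<lambda>N. dtint \<Lambda> (\<lambda>x y. (del4 \<kappa> ^^ k) (E x y) N)) N"
      by (simp add: del4_def dtint_del cont2_intros * dtint_mult)
    thus ?case by (simp add: Suc.IH)
  qed auto
qed

lemma del4_sum:
  "(\<Sum>c\<in>A. \<Sum>d\<in>B. a c d * del4 (\<kappa> c d) E N) = del4 (\<lambda>u4 u3 u2 u1. \<Sum>c\<in>A. \<Sum>d\<in>B. a c d * \<kappa> c d u4 u3 u2 u1) E N"
  unfolding del4_def by (simp only: sum_distrib_right del_sum[abs_def] del_mult[abs_def] mult.assoc)

lemma del4_power_sum: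
  "(del4 \<kappa> ^^ k) (\<lambda>N. \<Sum>c\<in>A. \<Sum>d\<in>B. a c d * E c d N) N = (\<Sum>c\<in>A. \<Sum>d\<in>B. a c d * (del4 \<kappa> ^^ k) (E c d) N)"
proof (induction k arbitrary: N)
  case (Suc k)
  have "del4 \<kappa> (\<lambda>N. \<Sum>c\<in>A. \<Sum>d\<in>B. a c d * E' c d N) N = (\<Sum>c\<in>A. \<Sum>d\<in>B. a c d * del4 \<kappa> (E' c d) N)" for E' N
    unfolding del4_def
    by (simp only: sum_distrib_left del_sum[abs_def] del_mult[abs_def] mult.left_commute[of _ "a _ _"])
  thus ?case by (simp add: Suc.IH[abs_def])
qed auto

text \<open>The outermost \<open>fermi_Q\<close> appends its fields first, to the left of those of
  the inner powers, so they are still uncontracted when the induction hypothesis is applied; hence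
  the list \<open>F\<close>. Once they are contracted, their points can be integrated inside the
  outer powers of \<open>del4\<close>, whose kernel does not depend on these points.\<close>

lemma fermi_Q_power_wick:
  fixes C :: "'l::finite comp \<Rightarrow> 'l comp \<Rightarrow> real ^ 4 \<Rightarrow> real ^ 4 \<Rightarrow> complex"
  assumes C: "\<And>c d. cont2 (C c d)"
    and tp: "\<And>s :: 'l species. continuous_on UNIV (two_point \<Lambda> \<zeta> Z \<epsilon> s)"
    and F: "set F \<subseteq> range (\<lambda>(s, x). Fld s x)"
  shows "(fermi_Q \<Lambda> C ^^ k) (wick (contraction \<Lambda> \<zeta> Z \<epsilon>)) (map bar N @ F) =
    (del4 (kernel \<Lambda> C (two_point \<Lambda> \<zeta> Z \<epsilon>)) ^^ k) (\<lambda>N. wick (contraction \<Lambda> \<zeta> Z \<epsilon>) (map bar N @ F)) N"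
  using F
proof (induction k arbitrary: F)
  case (Suc k)
  let ?w = "wick (contraction \<Lambda> \<zeta> Z \<epsilon>)"
  let ?g = "contract4 (two_point \<Lambda> \<zeta> Z \<epsilon>)"
  let ?K = "kernel \<Lambda> C (two_point \<Lambda> \<zeta> Z \<epsilon>)"
  let ?E = "\<lambda>N. ?w (map bar N @ F)"
  let ?A = "\<lambda>x y u4 u3 u2 u1. \<Sum>c\<in>UNIV. \<Sum>d\<in>UNIV. weight c d * C c d x y * ?g c d x y u4 u3 u2 u1"
  let ?G = "\<lambda>c d x y. [Fld (h_of c) x, Fld (psi_of c) x, Fld (h_of d) y, Fld (psi_of d) y]"
  have A: "cont2 (\<lambda>x y. ?A x y u4 u3 u2 u1)" for u4 u3 u2 u1
    by (intro cont2_intros C cont2_contract4 tp)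
  have "(fermi_Q \<Lambda> C ^^ Suc k) ?w (map bar N @ F) =
     dtint \<Lambda> (\<lambda>x y. \<Sum>c\<in>UNIV. \<Sum>d\<in>UNIV. weight c d * C c d x y *
       (del4 ?K ^^ k) (del4 (?g c d x y) ?E) N)"
  proof -
    have "(fermi_Q \<Lambda> C ^^ k) ?w (map bar N @ F @ ?G c d x y) =
       (del4 ?K ^^ k) (del4 (?g c d x y) ?E) N" for c d x y
    proof -
      have "set (F @ ?G c d x y) \<subseteq> range (\<lambda>(s, x). Fld s x)"
        using Suc.prems by auto
      from Suc.IH[OF this] show ?thesis
        by (simp add: wick_last4[OF Suc.prems])
    qed
    thus ?thesis by (simp add: fermi_Q_eq)
  qed
  also have "\<dots> = dtint \<Lambda> (\<lambda>x y. (del4 ?K ^^ k) (del4 (?A x y) ?E) N)"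
    by (simp add: del4_power_sum[symmetric] del4_sum)
  also have "\<dots> = (del4 ?K ^^ k) (\<lambda>N. dtint \<Lambda> (\<lambda>x y. del4 (?A x y) ?E N)) N"
    by (intro dtint_del4_power cont2_del4 A cont2_intros)
  also have "\<dots> = (del4 ?K ^^ Suc k) ?E N"
    by (simp add: dtint_del4 A kernel_def[abs_def] funpow_swap1)
  finally show ?case .
qed simp

section \<open>The limiting combinatorics\<close>

lemma fun_deriv_Nil [simp]: "fun_deriv c X [] = 0"
  by (simp add: fun_deriv_def)

lemma fun_deriv_Cons [simp]:
  "fun_deriv c X (n # L) = (if fst n = c then X (snd n) L else 0) + fun_deriv c (\<lambda>x L. X x (n # L)) L"
  unfolding fun_deriv_def length_Cons sum.lessThan_Suc_shift by (simp cong: if_cong)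

lemma fun_deriv_add: "fun_deriv c (\<lambda>x L. X x L + Y x L) L = fun_deriv c X L + fun_deriv c Y L"
  by (induction L arbitrary: X Y) auto

lemma fun_deriv_zero [simp]: "fun_deriv c (\<lambda>x L. 0) L = 0"
  by (induction L) auto

lemma fun_deriv_commute:
  "fun_deriv c (\<lambda>x. fun_deriv d (\<lambda>y. \<Phi> x y)) L = fun_deriv d (\<lambda>y. fun_deriv c (\<lambda>x. \<Phi> x y)) L"
proof (induction L arbitrary: \<Phi>)
  case (Cons n L)
  have *: "fun_deriv c (\<lambda>x. fun_deriv d (\<Phi> x)) (n # L) =
      (if fst n = c then fun_deriv d (\<Phi> (snd n)) L else 0)
      + (if fst n = d then fun_deriv c (\<lambda>x. \<Phi> x (snd n)) L else 0)
      + fun_deriv c (\<lambda>x. fun_deriv d (\<lambda>y N. \<Phi> x y (n # N))) L" for c d \<Phi>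
    by (simp add: fun_deriv_add)
  show ?case
    unfolding * by (subst Cons.IH) simp
qed simp

section \<open>Pairing fermions at a common point into composite bosons\<close>

definition match :: "'l comp \<Rightarrow> 'l species \<times> 'p \<Rightarrow> 'l species \<times> 'p \<Rightarrow> complex" where
  "match c v w = (if fst v = psi_of c \<and> fst w = h_of c \<and> snd v = snd w then 1 else 0)"

text \<open>Takes out a composite boson, the \<open>psi_of\<close> fermion first. Since it stands
  behind the \<open>h_of\<close> fermion in a product, this order yields the minus sign of
  \<open>pfaff_fun_deriv\<close>.\<close>

definition annihilate :: "'l comp \<Rightarrow> ('p \<Rightarrow> ('l species \<times> 'p) list \<Rightarrow> complex) \<Rightarrow> ('l species \<times> 'p) list \<Rightarrow> complex" where
  "annihilate c X = del (\<lambda>v. del (\<lambda>w N. match c v w * X (snd v) N))"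

text \<open>
  \<open>pfaff E\<close> sums \<open>E\<close> over the ways of grouping the fermions pairwise into composite bosons; fermions at
  different points do not match. It intertwines the bosonic Laplacian with the limit of the
  contraction with the quadratic interaction.
\<close>

fun pfaff :: "(('l::finite comp \<times> 'p) list \<Rightarrow> complex) \<Rightarrow> ('l species \<times> 'p) list \<Rightarrow> complex" where
  "pfaff E [] = E []"
| "pfaff E (u # N) = (\<Sum>q<length N. (- 1) ^ q * (\<Sum>c\<in>UNIV. (match c (N ! q) u - match c u (N ! q)) *
     pfaff (\<lambda>L. E ((c, snd u) # L)) (delete_nth q N)))"

lemma pfaff_Cons: "pfaff E (u # N) =
    del (\<lambda>v N. \<Sum>c\<in>UNIV. (match c v u - match c u v) * pfaff (\<lambda>L. E ((c, snd u) # L)) N) N"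
  by (simp add: del_def)

declare pfaff.simps(2) [simp del]

lemma pfaff_sum: "pfaff (\<lambda>L. \<Sum>i\<in>S. a i * E i L) N = (\<Sum>i\<in>S. a i * pfaff (E i) N)"
proof (induction N arbitrary: E rule: length_induct)
  case (1 N)
  show ?case
  proof (cases N)
    case (Cons u N')
    have "pfaff (\<lambda>L. \<Sum>i\<in>S. a i * E i L) N =
       del (\<lambda>v N. \<Sum>c\<in>UNIV. (match c v u - match c u v) *
         (\<Sum>i\<in>S. a i * pfaff (\<lambda>L. E i ((c, snd u) # L)) N)) N'"
      unfolding Cons pfaff_Cons
      by (intro del_cong sum.cong refl arg_cong2[where f="(*)"] "1"[rule_format]) (simp add: Cons)
    also have "\<dots> = (\<Sum>i\<in>S. a i * pfaff (E i) N)"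
      unfolding Cons pfaff_Cons
      by (simp only: sum_distrib_left del_sum[symmetric] del_mult[symmetric] mult.left_commute[of _ "a _"])
         (subst sum.swap, rule refl)
    finally show ?thesis .
  qed simp
qed

lemma pfaff_mult: "pfaff (\<lambda>L. a * E L) N = a * pfaff E N"
  using pfaff_sum[of "\<lambda>_. a" "\<lambda>_. E" "{()}"] by simp

lemma pfaff_zero [simp]: "pfaff (\<lambda>L. 0) N = 0"
  using pfaff_sum[of _ _ "{}"] by simp

lemma pfaff_add: "pfaff (\<lambda>L. E L + E' L) N = pfaff E N + pfaff E' N"
proof -
  have "pfaff (\<lambda>L. \<Sum>b\<in>{True, False}. 1 * (if b then E else E') L) N =
     (\<Sum>b\<in>{True, False}. 1 * pfaff (if b then E else E') N)"
    by (rule pfaff_sum)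
  thus ?thesis by simp
qed

text \<open>Split off the first entry \<open>u\<close>. Either the boson taken out contains
  \<open>u\<close>, or \<open>u\<close> forms another boson \<open>b\<close> with a partner
  \<open>r\<close>. In the second case the removal of \<open>r\<close> has to be exchanged with that
  of the pair \<open>v\<close>, \<open>w\<close>, which is an even permutation.\<close>

lemma pfaff_fun_deriv: "pfaff (fun_deriv c X) N = - annihilate c (\<lambda>x. pfaff (X x)) N"
proof (induction N arbitrary: X rule: length_induct)
  case (1 N)
  show ?case
  proof (cases N)
    case (Cons u N')
    let ?p = "\<lambda>b u v. match b v u - match b u v"
    let ?z = "snd u"
    let ?P = "\<lambda>b v w r N. ?p b u r * (match c v w * pfaff (\<lambda>L. X (snd v) ((b, ?z) # L)) N)"
    have pif: "pfaff (\<lambda>L. if b = c then X ?z L else 0) N = (if b = c then pfaff (X ?z) N else 0)" for b N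
      by simp
    have "pfaff (fun_deriv c X) N =
       del (\<lambda>r N. ?p c u r * pfaff (X ?z) N
          + (\<Sum>b\<in>UNIV. ?p b u r * pfaff (fun_deriv c (\<lambda>x L. X x ((b, ?z) # L))) N)) N'"
      by (simp add: Cons pfaff_Cons pfaff_add pif distrib_left sum.distrib if_distrib[of "(*) _"] cong: if_cong)
    also have "\<dots> = del (\<lambda>r N. ?p c u r * pfaff (X ?z) N
          - (\<Sum>b\<in>UNIV. ?p b u r * annihilate c (\<lambda>x. pfaff (\<lambda>L. X x ((b, ?z) # L))) N)) N'"
      by (rule del_cong) (use 1 in \<open>simp add: Cons sum_negf\<close>)
    also have "\<dots> = del (\<lambda>r N. ?p c u r * pfaff (X ?z) N) N'
        - (\<Sum>b\<in>UNIV. del (\<lambda>r. del (\<lambda>v. del (\<lambda>w N. ?P b v w r N))) N')"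
      unfolding annihilate_def
      by (simp only: del_diff del_sum del_mult[abs_def])
    finally have L: "pfaff (fun_deriv c X) N = \<dots>" .
    \<comment> \<open>\<open>match\<close> forces equal points, so the boson sits at the point of
      \<open>u\<close> whichever of its two fermions \<open>u\<close> is.\<close>
    have m: "match c v u * pfaff (X (snd v)) N = match c v u * pfaff (X ?z) N" for v N
      by (simp add: match_def)
    have "annihilate c (\<lambda>x. pfaff (X x)) N =
       del (\<lambda>r N. match c u r * pfaff (X ?z) N) N' - del (\<lambda>r N. match c r u * pfaff (X (snd r)) N) N'
       + del (\<lambda>v. del (\<lambda>w N. match c v w * pfaff (X (snd v)) (u # N))) N'"
      by (simp add: Cons annihilate_def del_diff)
    also have "\<dots> = - del (\<lambda>r N. ?p c u r * pfaff (X ?z) N) N'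
       + (\<Sum>b\<in>UNIV. del (\<lambda>v. del (\<lambda>w. del (\<lambda>r N. match c v w * (?p b u r * pfaff (\<lambda>L. X (snd v) ((b, ?z) # L)) N)))) N')"
      unfolding m
      by (simp only: pfaff_Cons left_diff_distrib del_diff del_sum[abs_def] del_mult[abs_def] sum_distrib_left)
         simp
    also have "(\<lambda>b. del (\<lambda>v. del (\<lambda>w. del (\<lambda>r N. match c v w * (?p b u r * pfaff (\<lambda>L. X (snd v) ((b, ?z) # L)) N)))) N')
       = (\<lambda>b. del (\<lambda>r. del (\<lambda>v. del (\<lambda>w N. ?P b v w r N))) N')"
      by (subst del_swap3) (simp add: mult.left_commute)
    finally show ?thesis
      unfolding L by simp
  qed (simp add: annihilate_def)
qed

text \<open>The \<open>kernel\<close> with each smeared boson replaced by a delta function at the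
  vertex where both of its fermions are contracted.\<close>

definition limit_kernel where
  "limit_kernel C u4 u3 u2 u1 = (\<Sum>c\<in>UNIV. \<Sum>d\<in>UNIV.
     weight c d * (match d u4 u3 * (match c u2 u1 * C c d (snd u2) (snd u4))))"

text \<open>Two derivatives produce two minus signs, which cancel. The derivatives are first
  exchanged because \<open>del4\<close> removes the fermions of the second component before those of
  the first.\<close>

lemma pfaff_bose_laplacian:
  "pfaff (bose_laplacian C E) N = del4 (limit_kernel C) (pfaff E) N"
proof -
  have "pfaff (bose_laplacian C E) N = (\<Sum>c\<in>UNIV. \<Sum>d\<in>UNIV. weight c d *
     pfaff (fun_deriv d (\<lambda>y. fun_deriv c (\<lambda>x N. C c d x y * E N))) N)"
    unfolding bose_laplacian_eq[abs_def]
    by (subst fun_deriv_commute)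
       (simp only: sum.cartesian_product case_prod_unfold pfaff_sum)
  also have "\<dots> = (\<Sum>c\<in>UNIV. \<Sum>d\<in>UNIV. weight c d * annihilate d (\<lambda>y. annihilate c (\<lambda>x N. C c d x y * pfaff E N)) N)"
    by (simp only: pfaff_fun_deriv pfaff_mult annihilate_def del_minus[abs_def] mult_minus_right minus_minus)
  also have "\<dots> = (\<Sum>c\<in>UNIV. \<Sum>d\<in>UNIV. weight c d *
      del4 (\<lambda>u4 u3 u2 u1. match d u4 u3 * (match c u2 u1 * C c d (snd u2) (snd u4))) (pfaff E) N)"
    unfolding annihilate_def del4_def by (simp only: del_mult[abs_def] mult.assoc)
  also have "\<dots> = del4 (limit_kernel C) (pfaff E) N"
    unfolding del4_sum limit_kernel_def[abs_def] ..
  finally show ?thesis .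
qed

lemma pfaff_at_zero: "pfaff at_zero = at_zero"
proof
  show "pfaff at_zero N = at_zero N" for N :: "('a species \<times> 'b) list"
    by (cases N) (simp_all add: at_zero_def pfaff_Cons)
qed

lemma pfaff_bose_laplacian_power:
  "pfaff ((bose_laplacian C ^^ k) at_zero) N = (del4 (limit_kernel C) ^^ k) at_zero N"
proof (induction k arbitrary: N)
  case (Suc k)
  thus ?case by (simp add: pfaff_bose_laplacian Suc.IH[abs_def])
qed (simp add: pfaff_at_zero)

section \<open>Vertices and the two groupings of their fermions\<close>

type_synonym 'l vertex = "3 \<times> 3 \<times> 3 \<times> 'l \<times> 'l \<times> 'l \<times> (real ^ 4)"

fun fermi_slots :: "'l vertex \<Rightarrow> ('l species \<times> (real ^ 4)) list" where
  "fermi_slots (i, j, k, a, b, c, z) =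
     [(H i, z), (Psi_big a, z), (H j, z), (Psi_big b, z), (Eta k, z), (Psi_small c, z)]"

fun bose_slots :: "'l vertex \<Rightarrow> ('l comp \<times> (real ^ 4)) list" where
  "bose_slots (i, j, k, a, b, c, z) = [(Inl (i, a), z), (Inl (j, b), z), (Inr (k, c), z)]"

text \<open>Describes the other grouping, \<open>H i\<close> with \<open>Psi_big b\<close> and
  \<open>H j\<close> with \<open>Psi_big a\<close>.\<close>

fun swap_colours :: "'l vertex \<Rightarrow> 'l vertex" where
  "swap_colours (i, j, k, a, b, c, z) = (i, j, k, b, a, c, z)"

fun point :: "'l vertex \<Rightarrow> real ^ 4" where
  "point (i, j, k, a, b, c, z) = z"

text \<open>Both groupings at every vertex; the sign is that of exchanging \<open>Psi_big a\<close>
  with \<open>Psi_big b\<close>.\<close>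

fun alt_vertices :: "'l vertex list \<Rightarrow> (('l comp \<times> (real ^ 4)) list \<Rightarrow> complex) \<Rightarrow> complex" where
  "alt_vertices [] E = E []"
| "alt_vertices (v # vs) E = alt_vertices vs (\<lambda>L. E (bose_slots v @ L)) - alt_vertices vs (\<lambda>L. E (bose_slots (swap_colours v) @ L))"

text \<open>The coefficient of one step of \<open>pfaff\<close>, isolated so that all combinations
  of species can be evaluated by rewriting.\<close>

definition match_sum :: "'l::finite species \<times> 'p \<Rightarrow> 'l species \<times> 'p \<Rightarrow> ('l comp \<Rightarrow> complex) \<Rightarrow> complex" where
  "match_sum u v f = (\<Sum>c\<in>UNIV. (match c v u - match c u v) * f c)"

lemma h_of_psi_of_eq [simp]:
  "Psi_big a = psi_of c \<longleftrightarrow> (\<exists>i. c = Inl (i, a))" "Psi_small a = psi_of c \<longleftrightarrow> (\<exists>i. c = Inr (i, a))"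
  "H i = h_of c \<longleftrightarrow> (\<exists>a. c = Inl (i, a))" "Eta i = h_of c \<longleftrightarrow> (\<exists>a. c = Inr (i, a))"
  "Psi_big a \<noteq> h_of c" "Psi_small a \<noteq> h_of c" "H i \<noteq> psi_of c" "Eta i \<noteq> psi_of c"
  by (cases c rule: h_of.cases; auto)+

lemma match_sum_simps [simp]:
  "match_sum (H i, z) (Psi_big a, z) f = f (Inl (i, a))"
  "match_sum (Psi_big a, z) (H i, z) f = - f (Inl (i, a))"
  "match_sum (Eta i, z) (Psi_small a, z) f = f (Inr (i, a))"
  "match_sum (H i, z) (H j, z) f = 0" "match_sum (H i, z) (Eta j, z) f = 0"
  "match_sum (H i, z) (Psi_small a, z) f = 0" "match_sum (Psi_big a, z) (Psi_big b, z) f = 0"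
  "match_sum (Psi_big a, z) (Psi_small b, z) f = 0" "match_sum (Psi_big a, z) (Eta i, z) f = 0"
proof -
  have 1: "match c (Psi_big a, z) (H i, z) = (if c = Inl (i, a) then 1 else 0)"
    "match c (Psi_small a, z) (Eta i, z) = (if c = Inr (i, a) then 1 else 0)" for c a i
    by (auto simp: match_def)
  have 0: "match c (H i, z) v = 0" "match c v (Psi_big a, z) = 0" "match c v (Psi_small a, z) = 0"
    "match c (Eta i, z) v = 0" "match c (Psi_big a, z) (Eta i, z) = 0"
    "match c (Psi_small a, z) (H i, z) = 0" for c i a v
    by (auto simp: match_def)
  show "match_sum (H i, z) (Psi_big a, z) f = f (Inl (i, a))"
  "match_sum (Psi_big a, z) (H i, z) f = - f (Inl (i, a))"
  "match_sum (Eta i, z) (Psi_small a, z) f = f (Inr (i, a))"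
  "match_sum (H i, z) (H j, z) f = 0" "match_sum (H i, z) (Eta j, z) f = 0"
  "match_sum (H i, z) (Psi_small a, z) f = 0" "match_sum (Psi_big a, z) (Psi_big b, z) f = 0"
  "match_sum (Psi_big a, z) (Psi_small b, z) f = 0" "match_sum (Psi_big a, z) (Eta i, z) f = 0"
    unfolding match_sum_def by (simp_all add: 0 1 if_distrib[of "\<lambda>t. t * _"] sum_negf cong: if_cong)
qed

lemma match_sum_distinct: "snd u \<noteq> snd v \<Longrightarrow> match_sum u v f = 0"
  by (auto simp: match_sum_def match_def)

text \<open>\<open>H i\<close> may join \<open>Psi_big a\<close> or \<open>Psi_big b\<close>;
  afterwards every partner is forced, and \<open>Eta k\<close> always takes
  \<open>Psi_small c\<close>. Partners in \<open>M\<close> are excluded because they sit at other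
  points.\<close>

lemma pfaff_vertex:
  assumes "\<And>u. u \<in> set M \<Longrightarrow> snd u \<noteq> point v"
  shows "pfaff E (fermi_slots v @ M) =
    pfaff (\<lambda>L. E (bose_slots v @ L)) M - pfaff (\<lambda>L. E (bose_slots (swap_colours v) @ L)) M"
proof -
  obtain i j k a b c z where v: "v = (i, j, k, a, b, c, z)" by (cases v) auto
  have ne: "z \<noteq> snd u" if "u \<in> set M" for u
    using assms[OF that] v by auto
  have kill: "del (\<lambda>u N. match_sum (s, z) u (g u N)) M = 0" for s g
    by (rule del_eq_0, rule match_sum_distinct) (simp add: ne)
  note step = pfaff_Cons[folded match_sum_def]
  let ?R = "\<lambda>ws E. pfaff E (ws @ M)"
  let ?e = "(Eta k, z)" and ?s = "(Psi_small c, z)"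
  have 1: "?R ((H i, z) # (Psi_big a, z) # (H j, z) # (Psi_big b, z) # [?e, ?s]) E =
     ?R ((H j, z) # (Psi_big b, z) # [?e, ?s]) (\<lambda>L. E ((Inl (i, a), z) # L))
     + ?R ((Psi_big a, z) # (H j, z) # [?e, ?s]) (\<lambda>L. E ((Inl (i, b), z) # L))"
    by (simp add: step[of _ "(H i, z)"] kill)
  have 2: "?R ((H j, z) # (Psi_big b, z) # [?e, ?s]) E = ?R [?e, ?s] (\<lambda>L. E ((Inl (j, b), z) # L))" for E
    by (simp add: step[of _ "(H j, z)"] kill)
  have 3: "?R ((Psi_big a, z) # (H j, z) # [?e, ?s]) E = - ?R [?e, ?s] (\<lambda>L. E ((Inl (j, a), z) # L))" for E
    by (simp add: step[of _ "(Psi_big a, z)"] kill)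
  have 4: "?R [?e, ?s] E = pfaff (\<lambda>L. E ((Inr (k, c), z) # L)) M" for E
    by (simp add: step[of _ ?e] kill)
  show ?thesis
    unfolding v fermi_slots.simps 1 2 3 4 by simp
qed

lemma pfaff_vertices:
  "distinct (map point vs) \<Longrightarrow> pfaff E (concat (map fermi_slots vs)) = alt_vertices vs E"
proof (induction vs arbitrary: E)
  case (Cons v vs)
  have pt: "snd u = point w" if "u \<in> set (fermi_slots w)" for u and w :: "'a vertex"
    using that by (cases w) auto
  have "snd u \<noteq> point v" if u: "u \<in> set (concat (map fermi_slots vs))" for u
  proof -
    obtain w where "w \<in> set vs" "u \<in> set (fermi_slots w)" using u by auto
    thus ?thesis using Cons.prems pt[of u w] by force
  qed
  hence "pfaff E (fermi_slots v @ concat (map fermi_slots vs)) =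
      pfaff (\<lambda>L. E (bose_slots v @ L)) (concat (map fermi_slots vs))
    - pfaff (\<lambda>L. E (bose_slots (swap_colours v) @ L)) (concat (map fermi_slots vs))"
    by (rule pfaff_vertex)
  with Cons.prems show ?case
    by (simp only: Cons.IH list.map concat.simps alt_vertices.simps distinct.simps simp_thms)
qed simp

text \<open>Vertex integrals append at the end of the list, whereas \<open>alt_vertices\<close>
  recurses from the front.\<close>

lemma alt_vertices_snoc: "alt_vertices (vs @ [v]) E = alt_vertices vs (\<lambda>L. E (L @ bose_slots v)) - alt_vertices vs (\<lambda>L. E (L @ bose_slots (swap_colours v)))"
  by (induction vs arbitrary: E) simp_all

lemma alt_vertices_mult: "alt_vertices vs (\<lambda>L. a * E L) = a * alt_vertices vs E"
  by (induction vs arbitrary: E) (simp_all add: algebra_simps)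

lemma alt_vertices_sum: "alt_vertices vs (\<lambda>L. \<Sum>i\<in>S. E i L) = (\<Sum>i\<in>S. alt_vertices vs (E i))"
  by (induction vs arbitrary: E) (simp_all add: sum_subtractf)

lemma alt_vertices_tint:
  assumes "\<And>L. continuous_on UNIV (\<lambda>x. E x L)"
  shows "continuous_on UNIV (\<lambda>x. alt_vertices vs (E x))" "alt_vertices vs (\<lambda>L. tint \<Lambda> (\<lambda>x. E x L)) = tint \<Lambda> (\<lambda>x. alt_vertices vs (E x))"
proof -
  have *: "continuous_on UNIV (\<lambda>x. alt_vertices vs (E x))" if "\<And>L. continuous_on UNIV (\<lambda>x. E x L)" for E vs
    using that by (induction vs arbitrary: E) (auto intro!: continuous_intros)
  show "continuous_on UNIV (\<lambda>x. alt_vertices vs (E x))"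
    using assms by (rule *)
  show "alt_vertices vs (\<lambda>L. tint \<Lambda> (\<lambda>x. E x L)) = tint \<Lambda> (\<lambda>x. alt_vertices vs (E x))"
    using assms by (induction vs arbitrary: E) (auto simp: tint_diff *)
qed

section \<open>Vanishing of the odd coefficients\<close>

lemma sum_list_delete_nth:
  fixes h :: "'b \<Rightarrow> 'c::comm_monoid_add"
  shows "p < length M \<Longrightarrow> sum_list (map h (delete_nth p M)) + h (M ! p) = sum_list (map h M)"
proof (induction M arbitrary: p)
  case (Cons b M)
  thus ?case by (cases p) (auto simp: ac_simps)
qed simp

fun charge :: "'l fermi \<Rightarrow> int" where
  "charge (Bar _ _) = 1"
| "charge (Fld _ _) = - 1"

text \<open>A nonzero contraction joins a field with a conjugate, so a complete pairing has total
  charge 0.\<close>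

lemma wick_charge:
  "sum_list (map charge L) \<noteq> 0 \<Longrightarrow> wick (contraction \<Lambda> \<zeta> Z \<epsilon>) L = 0"
proof (induction L rule: length_induct)
  case (1 L)
  show ?case
  proof (cases L)
    case (Cons w ws)
    have "contraction \<Lambda> \<zeta> Z \<epsilon> w (ws ! p) * wick (contraction \<Lambda> \<zeta> Z \<epsilon>) (delete_nth p ws) = 0"
      if p: "p < length ws" for p
    proof (cases "charge w + charge (ws ! p) = 0")
      case True
      hence "sum_list (map charge (delete_nth p ws)) \<noteq> 0"
        using 1(2) sum_list_delete_nth[OF p, of charge] by (simp add: Cons)
      thus ?thesis using 1(1) p by (simp add: Cons)
    next
      case False
      thus ?thesis by (cases w; cases "ws ! p") auto
    qed
    thus ?thesis
      unfolding Cons wick_Cons_del del_def by (intro sum.neutral) simp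
  qed (use 1 in simp)
qed

lemma fermi_Q_power_charge:
  "sum_list (map charge L) \<noteq> 4 * int k \<Longrightarrow>
     (fermi_Q \<Lambda> C ^^ k) (wick (contraction \<Lambda>' \<zeta> Z \<epsilon>)) L = 0"
proof (induction k arbitrary: L)
  case (Suc k)
  thus ?case by (simp add: fermi_Q_eq dtint_def)
qed (simp add: wick_charge)

lemma fermi_V_power_charge:
  assumes "\<And>L'. sum_list (map charge L') = sum_list (map charge L) + 6 * int m \<Longrightarrow> E L' = 0"
  shows "(fermi_V f \<Lambda> ^^ m) E L = 0"
  using assms
proof (induction m arbitrary: L)
  case (Suc m)
  have "(fermi_V f \<Lambda> ^^ m) E (L @ [Bar (H i) x, Bar (Psi_big a) x, Bar (H j) x, Bar (Psi_big b) x,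
               Bar (Eta k) x, Bar (Psi_small c) x]) = 0" for i j k a b c x
    by (rule Suc.IH) (simp add: Suc.prems)
  thus ?case by (simp add: fermi_V_def[of _ _ "(fermi_V f \<Lambda> ^^ m) E"])
qed simp

text \<open>A vertex adds charge 6 and a quadratic insertion adds -4, so balance means
  \<open>6 * m = 4 * k\<close>.\<close>

lemma fermi_moment_eq_0: "3 * m \<noteq> 2 * k \<Longrightarrow> fermi_moment f \<Lambda> C \<zeta> Z \<epsilon> m k = 0"
  unfolding fermi_moment_def by (intro fermi_V_power_charge fermi_Q_power_charge) simp

text \<open>By charge counting the series over \<open>k\<close> reduces to the term
  \<open>k = 3 * n\<close> at order \<open>m = 2 * n\<close>, and to nothing at odd orders.\<close>

lemma Z_fermi_even: "Z_fermi f \<Lambda> C \<zeta> Z \<epsilon> = even_series (\<lambda>n. Xi f \<Lambda> C \<zeta> Z n \<epsilon>)"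
proof (rule fps_ext)
  fix m
  show "fps_nth (Z_fermi f \<Lambda> C \<zeta> Z \<epsilon>) m = fps_nth (even_series (\<lambda>n. Xi f \<Lambda> C \<zeta> Z n \<epsilon>)) m"
  proof (cases "even m")
    case True
    then obtain n where m: "m = 2 * n" by auto
    have "(\<Sum>k. fermi_moment f \<Lambda> C \<zeta> Z \<epsilon> m k / (fact m * fact k)) =
        (\<Sum>k\<in>{3 * n}. fermi_moment f \<Lambda> C \<zeta> Z \<epsilon> m k / (fact m * fact k))"
      by (rule suminf_finite) (auto simp: m fermi_moment_eq_0)
    thus ?thesis by (simp add: Z_fermi_def even_series_def Xi_def m)
  next
    case False
    hence "3 * m \<noteq> 2 * k" for k by presburger
    thus ?thesis using False by (simp add: Z_fermi_def even_series_def fermi_moment_eq_0)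
  qed
qed

lemma bose_laplacian_power_length:
  "length L \<noteq> 2 * k \<Longrightarrow> (bose_laplacian C ^^ k) at_zero L = 0"
proof (induction k arbitrary: L)
  case (Suc k)
  have "fun_deriv c (\<lambda>x. fun_deriv d (\<lambda>y N. C c d x y * (bose_laplacian C ^^ k) at_zero N)) L = 0" for c d
    unfolding fun_deriv_def using Suc by (intro sum.neutral ballI) (auto intro!: sum.neutral)
  thus ?case by (simp add: bose_laplacian_eq[of _ "(bose_laplacian C ^^ k) at_zero"])
qed (simp add: at_zero_def)

lemma bose_vertex_power_length:
  assumes "\<And>L'. length L' = length L + 3 * m \<Longrightarrow> E L' = 0"
  shows "(bose_vertex f \<Lambda> ^^ m) E L = 0"
  using assms
proof (induction m arbitrary: L)
  case (Suc m)
  have "(bose_vertex f \<Lambda> ^^ m) E (L @ [u, v, w]) = 0" for u v w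
    by (rule Suc.IH) (simp add: Suc.prems)
  thus ?case by (simp add: bose_vertex_def[of _ _ "(bose_vertex f \<Lambda> ^^ m) E"])
qed simp

text \<open>The bosonic count: three variables per vertex against two derivatives per
  Laplacian.\<close>

lemma bose_moment_eq_0:
  "3 * m \<noteq> 2 * k \<Longrightarrow> (bose_vertex f \<Lambda> ^^ m) ((bose_laplacian C ^^ k) at_zero) [] = 0"
  by (intro bose_vertex_power_length bose_laplacian_power_length) simp

lemma Z_bose_even: "Z_bose f \<Lambda> C = even_series (Theta f \<Lambda> C)"
proof (rule fps_ext)
  fix m
  show "fps_nth (Z_bose f \<Lambda> C) m = fps_nth (even_series (Theta f \<Lambda> C)) m"
  proof (cases "even m")
    case False
    hence "3 * m \<noteq> 2 * k" for k by presburger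
    thus ?thesis using False by (simp add: Z_bose_def even_series_def bose_moment_eq_0)
  qed (simp add: even_series_def Theta_def)
qed

lemma Theta_eq:
  "Theta f \<Lambda> C n = (bose_vertex f \<Lambda> ^^ (2 * n)) ((bose_laplacian C ^^ (3 * n)) at_zero) [] /
     (fact (2 * n) * fact (3 * n))"
proof -
  let ?a = "\<lambda>k. (bose_vertex f \<Lambda> ^^ (2 * n)) ((bose_laplacian C ^^ k) at_zero) [] / (fact k * fact (2 * n))"
  have "(\<Sum>k. ?a k) = (\<Sum>k\<in>{3 * n}. ?a k)"
    by (rule suminf_finite) (auto simp: bose_moment_eq_0)
  thus ?thesis by (simp add: Theta_def Z_bose_def mult.commute)
qed

section \<open>Functionals that are continuous in the points\<close>

definition instantiate :: "'t \<Rightarrow> ('c \<times> ('t \<Rightarrow> 'p)) list \<Rightarrow> ('c \<times> 'p) list" where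
  "instantiate t L = map (\<lambda>u. (fst u, snd u t)) L"

definition cont_list :: "('c \<times> ('t::topological_space \<Rightarrow> 'p::topological_space)) list \<Rightarrow> bool" where
  "cont_list L \<longleftrightarrow> (\<forall>u\<in>set L. continuous_on UNIV (snd u))"

text \<open>
  The points are continuous functions of a parameter in a space that absorbs further factors
  \<open>real ^ 4\<close>, so that this class is closed under integration over a point.
\<close>

definition cont_functional :: "(('c \<times> (real ^ 4)) list \<Rightarrow> complex) \<Rightarrow> bool" where
  "cont_functional E \<longleftrightarrow>
     (\<forall>L. cont_list L \<longrightarrow> continuous_on UNIV (\<lambda>t :: nat \<Rightarrow> real ^ 4. E (instantiate t L)))"

lemma length_instantiate [simp]: "length (instantiate t L) = length L"
  by (simp add: instantiate_def)

lemma delete_nth_instantiate: "delete_nth k (instantiate t L) = instantiate t (delete_nth k L)"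
  by (simp add: instantiate_def delete_nth_map)

lemma nth_instantiate: "k < length L \<Longrightarrow> instantiate t L ! k = (fst (L ! k), snd (L ! k) t)"
  by (simp add: instantiate_def)

lemma cont_list_delete_nth: "cont_list L \<Longrightarrow> cont_list (delete_nth k L)"
  using set_delete_nth[of k L] by (auto simp: cont_list_def)

lemma cont_functional_at_zero: "cont_functional at_zero"
  by (auto simp: cont_functional_def at_zero_def instantiate_def)

lemma continuous_on_del_instantiate:
  assumes "cont_list L"
    and "\<And>u N. continuous_on UNIV (snd u) \<Longrightarrow> cont_list N \<Longrightarrow>
           continuous_on UNIV (\<lambda>t. \<phi> t (fst u, snd u t) (instantiate t N))"
  shows "continuous_on UNIV (\<lambda>t. del (\<phi> t) (instantiate t L))"
proof -
  have "continuous_on UNIV (snd (L ! k))" if "k < length L" for k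
    using assms(1) that by (auto simp: cont_list_def)
  thus ?thesis
    unfolding del_def length_instantiate
    by (intro continuous_intros) (simp add: nth_instantiate delete_nth_instantiate assms cont_list_delete_nth)
qed

lemma continuous_on_fun_deriv_instantiate:
  assumes "cont_list L"
    and "\<And>q N. continuous_on UNIV q \<Longrightarrow> cont_list N \<Longrightarrow> continuous_on UNIV (\<lambda>t. X t (q t) (instantiate t N))"
  shows "continuous_on UNIV (\<lambda>t. fun_deriv c (X t) (instantiate t L))"
proof -
  have *: "continuous_on UNIV (snd (L ! k))" if "k < length L" for k
    using assms(1) that by (auto simp: cont_list_def)
  have "continuous_on UNIV (\<lambda>t. if fst (instantiate t L ! k) = c
      then X t (snd (instantiate t L ! k)) (delete_nth k (instantiate t L)) else 0)" if "k < length L" for k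
    using that assms(2)[OF *[OF that] cont_list_delete_nth[OF assms(1), of k]]
    by (cases "fst (L ! k) = c") (simp_all add: nth_instantiate delete_nth_instantiate)
  thus ?thesis
    unfolding fun_deriv_def length_instantiate by (intro continuous_intros) auto
qed

lemma cont_functional_del4:
  assumes "\<And>s4 s3 s2 s1. continuous_on UNIV (\<lambda>(x4, x3, x2, x1). \<kappa> (s4, x4) (s3, x3) (s2, x2) (s1, x1))"
    and E: "cont_functional E"
  shows "cont_functional (del4 \<kappa> E)"
  unfolding cont_functional_def del4_def
proof (intro allI impI continuous_on_del_instantiate)
  fix u4 u3 u2 u1 :: "'a \<times> ((nat \<Rightarrow> real ^ 4) \<Rightarrow> real ^ 4)" and N :: "('a \<times> ((nat \<Rightarrow> real ^ 4) \<Rightarrow> real ^ 4)) list"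
  assume *: "continuous_on UNIV (snd u4)" "continuous_on UNIV (snd u3)"
    "continuous_on UNIV (snd u2)" "continuous_on UNIV (snd u1)"
  assume N: "cont_list N"
  have "continuous_on UNIV (\<lambda>t. (snd u4 t, snd u3 t, snd u2 t, snd u1 t))"
    by (intro continuous_intros *)
  from continuous_on_compose2[OF assms(1) this]
  have "continuous_on UNIV (\<lambda>t. \<kappa> (fst u4, snd u4 t) (fst u3, snd u3 t) (fst u2, snd u2 t) (fst u1, snd u1 t))"
    by simp
  thus "continuous_on UNIV (\<lambda>t. \<kappa> (fst u4, snd u4 t) (fst u3, snd u3 t) (fst u2, snd u2 t) (fst u1, snd u1 t) *
      E (instantiate t N))"
    using E N by (intro continuous_intros) (auto simp: cont_functional_def)
qed

lemma cont2_compose: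
  assumes "cont2 \<phi>" "continuous_on UNIV p" "continuous_on UNIV q"
  shows "continuous_on UNIV (\<lambda>t. \<phi> (p t) (q t))"
  using continuous_on_compose2[OF assms(1)[unfolded cont2_def] continuous_on_Pair[OF assms(2,3)]] by simp

lemma cont_functional_bose_laplacian:
  assumes "\<And>c d. cont2 (C c d)" "cont_functional E"
  shows "cont_functional (bose_laplacian C E)"
proof -
  have "continuous_on UNIV (\<lambda>t :: nat \<Rightarrow> real ^ 4. fun_deriv c (\<lambda>x. fun_deriv d (\<lambda>y N. C c d x y * E N)) (instantiate t L))"
    if "cont_list L" for L c d
    using that assms(2)
    by (intro continuous_on_fun_deriv_instantiate continuous_intros cont2_compose assms) (auto simp: cont_functional_def)
  thus ?thesis
    unfolding cont_functional_def bose_laplacian_eq by (intro allI impI continuous_intros)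
qed

text \<open>The map through which the parameter space absorbs another point: the new position
  becomes coordinate 0 of the sequence.\<close>

lemma continuous_on_case_nat:
  "continuous_on UNIV (\<lambda>p :: (nat \<Rightarrow> 'a::topological_space) \<times> 'a. case_nat (snd p) (fst p))"
proof (rule continuous_on_coordinatewise_then_product)
  fix i
  show "continuous_on UNIV (\<lambda>p :: (nat \<Rightarrow> 'a) \<times> 'a. case_nat (snd p) (fst p) i)"
    by (cases i) (auto intro!: continuous_intros continuous_on_product_coordinates continuous_on_compose2[OF continuous_on_product_coordinates continuous_on_fst[OF continuous_on_id]])
qed

lemma cont_functional_snoc:
  assumes E: "cont_functional E" and L: "cont_list L"
  shows "continuous_on UNIV (\<lambda>(t :: nat \<Rightarrow> real ^ 4, x). E (instantiate t L @ map (\<lambda>s. (s, x)) ws))"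
proof -
  \<comment> \<open>Old points read the coordinates from 1 on, the appended ones read coordinate
    0.\<close>
  define L' where "L' = map (\<lambda>u. (fst u, \<lambda>t. snd u (\<lambda>i. t (Suc i)))) L @ map (\<lambda>s. (s, \<lambda>t. t 0)) ws"
  have shift: "continuous_on UNIV (\<lambda>t :: nat \<Rightarrow> real ^ 4. \<lambda>i. t (Suc i))"
    by (intro continuous_on_coordinatewise_then_product continuous_on_product_coordinates)
  have "continuous_on UNIV (\<lambda>t. snd u (\<lambda>i. t (Suc i)))" if "u \<in> set L" for u
    using continuous_on_compose2[OF _ shift, of UNIV "snd u"] L that by (auto simp: cont_list_def)
  hence "cont_list L'"
    by (auto simp: cont_list_def L'_def continuous_on_product_coordinates)
  hence "continuous_on UNIV (\<lambda>t. E (instantiate t L'))"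
    using E by (auto simp: cont_functional_def)
  from continuous_on_compose2[OF this continuous_on_case_nat]
  show ?thesis by (simp add: L'_def instantiate_def case_prod_unfold o_def)
qed

lemma cont_functional_const:
  assumes "cont_functional E"
  shows "continuous_on UNIV (\<lambda>x. E (N @ map (\<lambda>s. (s, x)) ws))"
proof -
  define L where "L = map (\<lambda>u. (fst u, \<lambda>t :: nat \<Rightarrow> real ^ 4. snd u)) N"
  have *: "instantiate t L = N" for t by (simp add: L_def instantiate_def o_def)
  have "cont_list L" by (auto simp: L_def cont_list_def)
  from continuous_on_compose2[OF cont_functional_snoc[OF assms this]
      continuous_on_Pair[OF continuous_on_const[where c="\<lambda>_. 0"] continuous_on_id]]
  show ?thesis by (simp add: *)
qed

section \<open>Sums over the indices of a vertex\<close>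

definition vsum :: "('l::finite \<Rightarrow> 'l \<Rightarrow> 'l \<Rightarrow> real) \<Rightarrow> ('l vertex \<Rightarrow> complex) \<Rightarrow> real ^ 4 \<Rightarrow> complex" where
  "vsum f F x = (\<Sum>i\<in>UNIV. \<Sum>j\<in>UNIV. \<Sum>k\<in>UNIV. \<Sum>a\<in>UNIV. \<Sum>b\<in>UNIV. \<Sum>c\<in>UNIV.
     of_real (levi_civita i j k * f a b c) * F (i, j, k, a, b, c, x))"

text \<open>Renaming the summed indices \<open>a\<close> and \<open>b\<close> moves the exchange
  from \<open>F\<close> onto the antisymmetric \<open>f\<close>.\<close>

lemma vsum_swap:
  assumes "\<And>a b c. f b a c = - f a b c"
  shows "vsum f (\<lambda>v. F (swap_colours v)) x = - vsum f F x"
proof -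
  have "vsum f (\<lambda>v. F (swap_colours v)) x = (\<Sum>i\<in>UNIV. \<Sum>j\<in>UNIV. \<Sum>k\<in>UNIV. \<Sum>b\<in>UNIV. \<Sum>a\<in>UNIV. \<Sum>c\<in>UNIV.
     of_real (levi_civita i j k * f a b c) * F (i, j, k, b, a, c, x))"
    unfolding vsum_def swap_colours.simps by (intro sum.cong refl sum.swap)
  also have "\<dots> = - vsum f F x"
    unfolding vsum_def sum_negf[symmetric] by (intro sum.cong refl) (subst assms, simp)
  finally show ?thesis .
qed

lemma bose_vertex_eq: "bose_vertex f \<Lambda> E M = \<i> * tint \<Lambda> (vsum f (\<lambda>v. E (M @ bose_slots v)))"
  by (simp add: bose_vertex_def vsum_def[abs_def])

text \<open>This is \<open>fermi_V\<close> for products of conjugate fields only, with the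
  constructor \<open>Bar\<close> stripped off.\<close>

definition fvertex where
  "fvertex f \<Lambda> E M = - (\<i> / 2) * tint \<Lambda> (vsum f (\<lambda>v. E (M @ fermi_slots v)))"

lemma fermi_V_map_bar:
  "(fermi_V f \<Lambda> ^^ m) E (map bar N) = (fvertex f \<Lambda> ^^ m) (\<lambda>N. E (map bar N)) N"
proof (induction m arbitrary: N)
  case (Suc m)
  have sw: "(\<Sum>a\<in>UNIV. \<Sum>b\<in>UNIV. \<Sum>c\<in>UNIV. \<Sum>i\<in>UNIV. \<Sum>j\<in>UNIV. \<Sum>k\<in>UNIV. F i j k a b c)
     = (\<Sum>i\<in>UNIV. \<Sum>j\<in>UNIV. \<Sum>k\<in>UNIV. \<Sum>a\<in>UNIV. \<Sum>b\<in>UNIV. \<Sum>c\<in>UNIV. F i j k a b c)"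
    for F :: "3 \<Rightarrow> 3 \<Rightarrow> 3 \<Rightarrow> 'a \<Rightarrow> 'a \<Rightarrow> 'a \<Rightarrow> complex"
  proof -
    have 3: "(\<Sum>x\<in>UNIV. \<Sum>y\<in>UNIV. \<Sum>z\<in>UNIV. G x y z) = (\<Sum>p\<in>UNIV. G (fst p) (fst (snd p)) (snd (snd p)))"
      for G :: "'x::finite \<Rightarrow> 'x \<Rightarrow> 'x \<Rightarrow> complex"
      by (simp add: sum.cartesian_product case_prod_unfold)
    show ?thesis
      unfolding 3 by (rule sum.swap)
  qed
  have bar: "map bar N @ [Bar s1 x, Bar s2 x, Bar s3 x, Bar s4 x, Bar s5 x, Bar s6 x] =
     map bar (N @ [(s1, x), (s2, x), (s3, x), (s4, x), (s5, x), (s6, x)])" for s1 s2 s3 s4 s5 s6 x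
    by (simp add: bar_def)
  show ?case
    by (simp only: funpow.simps comp_apply fermi_V_def[of _ _ "(fermi_V f \<Lambda> ^^ m) E"]
        fvertex_def[of _ _ "(fvertex f \<Lambda> ^^ m) _"] vsum_def[abs_def] bar Suc.IH sw fermi_slots.simps)
qed simp

lemma slots_map:
  "fermi_slots (i, j, k, a, b, c, x) = map (\<lambda>s. (s, x)) [H i, Psi_big a, H j, Psi_big b, Eta k, Psi_small c]"
  "bose_slots (i, j, k, a, b, c, x) = map (\<lambda>s. (s, x)) [Inl (i, a), Inl (j, b), Inr (k, c)]"
  by simp_all

lemma cont_functional_vertex:
  assumes "cont_functional E"
  shows "cont_functional (fvertex f \<Lambda> E)"
proof -
  have "continuous_on UNIV (\<lambda>(t :: nat \<Rightarrow> real ^ 4, x). vsum f (\<lambda>v. E (instantiate t L @ fermi_slots v)) x)" if "cont_list L" for L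
    using cont_functional_snoc[OF assms that]
    unfolding vsum_def case_prod_unfold slots_map by (intro continuous_intros)
  thus ?thesis
    unfolding cont_functional_def fvertex_def
    by (intro allI impI continuous_intros continuous_on_tint)
qed

lemma cont_functional_bose_vertex:
  assumes "cont_functional E"
  shows "cont_functional (bose_vertex f \<Lambda> E)"
proof -
  have "continuous_on UNIV (\<lambda>(t :: nat \<Rightarrow> real ^ 4, x). vsum f (\<lambda>v. E (instantiate t L @ bose_slots v)) x)" if "cont_list L" for L
    using cont_functional_snoc[OF assms that]
    unfolding vsum_def case_prod_unfold slots_map by (intro continuous_intros)
  thus ?thesis
    unfolding cont_functional_def bose_vertex_eq
    by (intro allI impI continuous_intros continuous_on_tint)
qed

section \<open>Passing to the limit under the vertex integrals\<close>

lemma norm_tint_le: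
  fixes f :: "real ^ 4 \<Rightarrow> complex"
  assumes "continuous_on UNIV f" "\<And>x. x \<in> cbox (- \<Lambda>) \<Lambda> \<Longrightarrow> norm (f x) \<le> B" "0 \<le> B"
  shows "norm (tint \<Lambda> f) \<le> B * measure lborel (cbox (- \<Lambda>) \<Lambda>)"
  unfolding tint_eq_integral[OF assms(1)]
  by (rule integrable_bound) (use assms in \<open>auto intro!: integrable_continuous continuous_on_subset[OF assms(1)]\<close>)

lemma null_sets_boundary: "cbox a b - box a b \<in> null_sets (lborel :: (real ^ 4) measure)"
proof -
  have "negligible (cbox a b - box a b)" by (rule negligible_frontier_interval)
  hence "cbox a b - box a b \<in> null_sets (completion lborel)"
    by (simp add: negligible_iff_null_sets)
  thus ?thesis
    by (subst (asm) null_sets_completion_iff) auto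
qed

text \<open>Dominated convergence with a null set of exceptions: the boundary of the box and a
  finite set \<open>S\<close>, which will consist of the positions of the other vertices.\<close>

lemma tendsto_tint:
  fixes f :: "nat \<Rightarrow> real ^ 4 \<Rightarrow> complex"
  assumes f: "\<And>n. continuous_on UNIV (f n)" and g: "continuous_on UNIV g"
    and B: "\<And>n x. x \<in> cbox (- \<Lambda>) \<Lambda> \<Longrightarrow> norm (f n x) \<le> B"
    and S: "finite S" and lim: "\<And>x. x \<in> box (- \<Lambda>) \<Lambda> \<Longrightarrow> x \<notin> S \<Longrightarrow> (\<lambda>n. f n x) \<longlonglongrightarrow> g x"
  shows "(\<lambda>n. tint \<Lambda> (f n)) \<longlonglongrightarrow> tint \<Lambda> g"
  unfolding tint_def set_lebesgue_integral_def
proof (rule integral_dominated_convergence)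
  have m: "h \<in> borel_measurable borel" if "continuous_on UNIV h" for h :: "real ^ 4 \<Rightarrow> complex"
    using that by (rule borel_measurable_continuous_onI)
  show "(\<lambda>x. indicator (cbox (- \<Lambda>) \<Lambda>) x *\<^sub>R g x) \<in> borel_measurable lborel"
    "(\<lambda>x. indicator (cbox (- \<Lambda>) \<Lambda>) x *\<^sub>R f n x) \<in> borel_measurable lborel" for n
    using m[OF g] m[OF f[of n]] by measurable
  show "integrable lborel (\<lambda>x. indicator (cbox (- \<Lambda>) \<Lambda>) x * B)"
    using borel_integrable_compact[of "cbox (- \<Lambda>) \<Lambda>" "\<lambda>_. B"] by simp
  show "AE x in lborel. norm (indicator (cbox (- \<Lambda>) \<Lambda>) x *\<^sub>R f n x) \<le> indicator (cbox (- \<Lambda>) \<Lambda>) x * B" for n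
    using B by (intro AE_I2) (auto simp: indicator_def)
  have "(cbox (- \<Lambda>) \<Lambda> - box (- \<Lambda>) \<Lambda>) \<union> S \<in> null_sets lborel"
    using null_sets_boundary finite_imp_null_set_lborel[OF S] by (rule null_sets.Un)
  thus "AE x in lborel. (\<lambda>n. indicator (cbox (- \<Lambda>) \<Lambda>) x *\<^sub>R f n x) \<longlonglongrightarrow> indicator (cbox (- \<Lambda>) \<Lambda>) x *\<^sub>R g x"
    by (rule AE_I') (use lim in \<open>auto simp: indicator_def\<close>)
qed

definition points_in :: "(real ^ 4) set \<Rightarrow> ('c \<times> (real ^ 4)) list \<Rightarrow> bool" where
  "points_in S N \<longleftrightarrow> (\<forall>u\<in>set N. snd u \<in> S)"

text \<open>
  Pointwise convergence is only required at distinct interior points: the other vertex positions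
  form a null set.
\<close>

definition converges where
  "converges \<Lambda> E E0 \<longleftrightarrow>
     (\<forall>n :: nat. cont_functional (E n)) \<and> cont_functional E0 \<and>
     (\<forall>l. \<exists>B\<ge>0. \<forall>n N. length N = l \<longrightarrow> points_in (cbox (- \<Lambda>) \<Lambda>) N \<longrightarrow> norm (E n N) \<le> B) \<and>
     (\<forall>vs. distinct (map point vs) \<longrightarrow> set (map point vs) \<subseteq> box (- \<Lambda>) \<Lambda> \<longrightarrow>
        (\<lambda>n. E n (concat (map fermi_slots vs))) \<longlonglongrightarrow> alt_vertices vs E0)"

lemma tendsto_vsum:
  assumes "\<And>i j k a b c. (\<lambda>n. F n (i, j, k, a, b, c, x)) \<longlonglongrightarrow> G (i, j, k, a, b, c, x)"
  shows "(\<lambda>n. vsum f (F n) x) \<longlonglongrightarrow> vsum f G x"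
  unfolding vsum_def by (intro tendsto_intros assms)

text \<open>One constant for all integrands and all points, so that uniform bounds survive every
  vertex integration.\<close>

lemma norm_vsum_le:
  fixes f :: "'l::finite \<Rightarrow> 'l \<Rightarrow> 'l \<Rightarrow> real"
  shows "\<exists>K\<ge>0. \<forall>F x B. (\<forall>v. point v = x \<longrightarrow> norm (F v) \<le> B) \<longrightarrow> norm (vsum f F x) \<le> K * B"
proof -
  define K where "K = (\<Sum>i\<in>UNIV. \<Sum>j\<in>UNIV. \<Sum>k\<in>UNIV. \<Sum>a\<in>UNIV. \<Sum>b\<in>UNIV. \<Sum>c\<in>UNIV. \<bar>levi_civita i j k * f a b c\<bar>)"
  have "norm (vsum f F x) \<le> K * B" if "\<forall>v. point v = x \<longrightarrow> norm (F v) \<le> B" for F x B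
    unfolding vsum_def K_def sum_distrib_right
    by (intro sum_norm_le) (use that in \<open>auto simp: norm_mult simp flip: abs_mult intro!: mult_left_mono\<close>)
  moreover have "K \<ge> 0" unfolding K_def by (intro sum_nonneg) auto
  ultimately show ?thesis by blast
qed

lemma continuous_on_vsum:
  assumes "cont_functional E"
  shows "continuous_on UNIV (vsum f (\<lambda>v. E (N @ fermi_slots v)))"
  unfolding vsum_def slots_map by (intro continuous_intros cont_functional_const assms)

lemma continuous_on_vsum_bose:
  assumes "cont_functional E"
  shows "continuous_on UNIV (vsum f (\<lambda>v. E (N @ bose_slots v)))"
  unfolding vsum_def slots_map by (intro continuous_intros cont_functional_const assms)

lemma alt_vertices_vsum: "vsum f (\<lambda>v. alt_vertices vs (\<lambda>L. E L v)) x = alt_vertices vs (\<lambda>L. vsum f (E L) x)"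
  by (simp add: vsum_def alt_vertices_sum alt_vertices_mult)

lemma vsum_diff: "vsum f (\<lambda>v. F v - G v) x = vsum f F x - vsum f G x"
  by (simp add: vsum_def sum_subtractf algebra_simps)

text \<open>
  The two assignments of the Lie algebra indices to the slots of type \<open>A\<close> contribute equally,
  which cancels the factor \<open>1 / 2\<close> in the fermionic vertex.
\<close>

lemma converges_step:
  fixes f :: "'l::finite \<Rightarrow> 'l \<Rightarrow> 'l \<Rightarrow> real"
  assumes f: "\<And>a b c. f b a c = - f a b c" and conv: "converges \<Lambda> E E0"
  shows "converges \<Lambda> (\<lambda>n. fvertex f \<Lambda> (E n)) (\<lambda>L. - bose_vertex f \<Lambda> E0 L)"
  unfolding converges_def
proof (intro conjI allI impI)
  have E: "cont_functional (E n)" and E0: "cont_functional E0" for n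
    using conv by (auto simp: converges_def)
  show "cont_functional (fvertex f \<Lambda> (E n))" for n
    using E by (rule cont_functional_vertex)
  show "cont_functional (\<lambda>L. - bose_vertex f \<Lambda> E0 L)"
    using cont_functional_bose_vertex[OF E0, of f \<Lambda>]
    by (auto simp: cont_functional_def intro!: continuous_intros)
  have pts: "points_in S (N @ fermi_slots v)" if "points_in S N" "point v \<in> S" for S N and v :: "'l vertex"
    using that by (cases v) (auto simp: points_in_def)
  have len: "length (N @ fermi_slots v) = length N + 6" for N and v :: "'l vertex"
    by (cases v) auto
  obtain K where K: "K \<ge> 0"
    "\<And>F x B. (\<forall>v. point v = x \<longrightarrow> norm (F v) \<le> B) \<Longrightarrow> norm (vsum f F x) \<le> K * B"
    using norm_vsum_le[of f] by blast
  have bound: "\<exists>B\<ge>0. \<forall>n N x. length N = l \<longrightarrow> points_in (cbox (- \<Lambda>) \<Lambda>) N \<longrightarrow> x \<in> cbox (- \<Lambda>) \<Lambda> \<longrightarrow>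
     norm (vsum f (\<lambda>v. E n (N @ fermi_slots v)) x) \<le> B" for l
  proof -
    \<comment> \<open>A vertex appends six conjugate fields, so lists of length \<open>l\<close> are
      controlled by the bound for length \<open>l + 6\<close>.\<close>
    obtain B where B: "B \<ge> 0"
      "\<And>n N. length N = l + 6 \<Longrightarrow> points_in (cbox (- \<Lambda>) \<Lambda>) N \<Longrightarrow> norm (E n N) \<le> B"
      using conv[unfolded converges_def, THEN conjunct2, THEN conjunct2, THEN conjunct1, THEN spec[of _ "l + 6"]]
      by blast
    have "norm (vsum f (\<lambda>v. E n (N @ fermi_slots v)) x) \<le> K * B"
      if "length N = l" "points_in (cbox (- \<Lambda>) \<Lambda>) N" "x \<in> cbox (- \<Lambda>) \<Lambda>" for n N x
      using that by (intro K(2)) (auto intro!: B(2) pts simp: len simp del: length_append fermi_slots.simps)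
    thus ?thesis using K B(1) by (intro exI[of _ "K * B"]) auto
  qed
  show "\<exists>B\<ge>0. \<forall>n N. length N = l \<longrightarrow> points_in (cbox (- \<Lambda>) \<Lambda>) N \<longrightarrow> norm (fvertex f \<Lambda> (E n) N) \<le> B" for l
  proof -
    obtain B where B: "B \<ge> 0" "\<And>n N x. length N = l \<Longrightarrow> points_in (cbox (- \<Lambda>) \<Lambda>) N \<Longrightarrow> x \<in> cbox (- \<Lambda>) \<Lambda> \<Longrightarrow>
       norm (vsum f (\<lambda>v. E n (N @ fermi_slots v)) x) \<le> B"
      using bound[of l] by blast
    have "norm (fvertex f \<Lambda> (E n) N) \<le> 1 / 2 * (B * measure lborel (cbox (- \<Lambda>) \<Lambda>))"
      if N: "length N = l" "points_in (cbox (- \<Lambda>) \<Lambda>) N" for n N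
      using norm_tint_le[OF continuous_on_vsum[OF E], of \<Lambda> f n N B] B(1) B(2)[OF N]
      by (simp add: fvertex_def norm_mult norm_divide)
    thus ?thesis using B(1) by (intro exI[of _ "1 / 2 * (B * measure lborel (cbox (- \<Lambda>) \<Lambda>))"]) auto
  qed
  fix vs :: "'l vertex list"
  assume vs: "distinct (map point vs)" "set (map point vs) \<subseteq> box (- \<Lambda>) \<Lambda>"
  let ?N = "concat (map fermi_slots vs)"
  let ?V = "vsum f (\<lambda>v. alt_vertices (vs @ [v]) E0)"
  have V: "?V = (\<lambda>x. 2 * alt_vertices vs (\<lambda>L. vsum f (\<lambda>v. E0 (L @ bose_slots v)) x))"
  proof
    fix x
    have "vsum f (\<lambda>v. alt_vertices vs (\<lambda>L. E0 (L @ bose_slots (swap_colours v)))) x =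
        - vsum f (\<lambda>v. alt_vertices vs (\<lambda>L. E0 (L @ bose_slots v))) x"
      using vsum_swap[of f "\<lambda>v. alt_vertices vs (\<lambda>L. E0 (L @ bose_slots v))"] f by blast
    thus "?V x = 2 * alt_vertices vs (\<lambda>L. vsum f (\<lambda>v. E0 (L @ bose_slots v)) x)"
      by (simp add: alt_vertices_snoc vsum_diff alt_vertices_vsum)
  qed
  have contV: "continuous_on UNIV ?V"
    unfolding V by (intro continuous_intros alt_vertices_tint continuous_on_vsum_bose E0)
  have "points_in (cbox (- \<Lambda>) \<Lambda>) ?N"
  proof -
    have "snd u = point v" if "u \<in> set (fermi_slots v)" for u and v :: "'l vertex"
      using that by (cases v) auto
    hence "snd u \<in> set (map point vs)" if "u \<in> set ?N" for u
      using that unfolding set_concat set_map by blast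
    thus ?thesis using vs(2) box_subset_cbox[of "- \<Lambda>" \<Lambda>] unfolding points_in_def by blast
  qed
  then obtain B where B: "\<And>n x. x \<in> cbox (- \<Lambda>) \<Lambda> \<Longrightarrow> norm (vsum f (\<lambda>v. E n (?N @ fermi_slots v)) x) \<le> B"
    using bound[of "length ?N"] by blast
  \<comment> \<open>The new vertex may sit at any interior position different from the earlier ones;
    all other positions belong to the exceptional set of \<open>tendsto_tint\<close>.\<close>
  have "(\<lambda>n. tint \<Lambda> (vsum f (\<lambda>v. E n (?N @ fermi_slots v)))) \<longlonglongrightarrow> tint \<Lambda> ?V"
  proof (rule tendsto_tint[where S="set (map point vs)"])
    fix x assume x: "x \<in> box (- \<Lambda>) \<Lambda>" "x \<notin> set (map point vs)"
    have "(\<lambda>n. E n (concat (map fermi_slots (vs @ [v])))) \<longlonglongrightarrow> alt_vertices (vs @ [v]) E0" if "point v = x" for v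
    proof -
      have "distinct (map point (vs @ [v]))" "set (map point (vs @ [v])) \<subseteq> box (- \<Lambda>) \<Lambda>"
        using x vs that by auto
      thus ?thesis using conv unfolding converges_def by blast
    qed
    thus "(\<lambda>n. vsum f (\<lambda>v. E n (?N @ fermi_slots v)) x) \<longlonglongrightarrow> ?V x"
      by (intro tendsto_vsum) (simp del: fermi_slots.simps)
  qed (use B contV continuous_on_vsum[OF E] in auto)
  hence "(\<lambda>n. fvertex f \<Lambda> (E n) ?N) \<longlonglongrightarrow> - (\<i> / 2) * tint \<Lambda> ?V"
    unfolding fvertex_def by (intro tendsto_intros)
  also have "tint \<Lambda> ?V = 2 * alt_vertices vs (\<lambda>L. tint \<Lambda> (vsum f (\<lambda>v. E0 (L @ bose_slots v))))"
    unfolding V tint_mult by (subst alt_vertices_tint(2)) (auto intro: continuous_on_vsum_bose E0)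
  \<comment> \<open>The prefactor times the 2 of the two equal groupings is \<open>- \<i>\<close>,
    whereas the bosonic vertex carries \<open>\<i>\<close>; this explains the minus sign in the
    limit.\<close>
  also have "- (\<i> / 2) * \<dots> = alt_vertices vs (\<lambda>L. - bose_vertex f \<Lambda> E0 L)"
    using alt_vertices_mult[of vs "- \<i>" "\<lambda>L. tint \<Lambda> (vsum f (\<lambda>v. E0 (L @ bose_slots v)))"]
    by (simp add: bose_vertex_eq)
  finally show "(\<lambda>n. fvertex f \<Lambda> (E n) ?N) \<longlonglongrightarrow> alt_vertices vs (\<lambda>L. - bose_vertex f \<Lambda> E0 L)" .
qed

lemma bose_vertex_mult: "bose_vertex f \<Lambda> (\<lambda>L. a * E L) M = a * bose_vertex f \<Lambda> E M"
proof -
  have "vsum f (\<lambda>v. a * F v) = (\<lambda>x. a * vsum f F x)" for F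
    by (simp add: vsum_def[abs_def] sum_distrib_left mult.left_commute)
  thus ?thesis by (simp add: bose_vertex_eq tint_mult)
qed

text \<open>One sign accumulates per vertex; in the application \<open>m\<close> is even and they
  cancel.\<close>

lemma converges_power:
  assumes "\<And>a b c. f b a c = - f a b c" "converges \<Lambda> E E0"
  shows "(\<lambda>n. (fvertex f \<Lambda> ^^ m) (E n) []) \<longlonglongrightarrow> (- 1) ^ m * (bose_vertex f \<Lambda> ^^ m) E0 []"
proof -
  have "converges \<Lambda> (\<lambda>n. (fvertex f \<Lambda> ^^ m) (E n)) (\<lambda>L. (- 1) ^ m * (bose_vertex f \<Lambda> ^^ m) E0 L)"
  proof (induction m)
    case (Suc m)
    have "converges \<Lambda> (\<lambda>n. fvertex f \<Lambda> ((fvertex f \<Lambda> ^^ m) (E n)))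
        (\<lambda>L. - bose_vertex f \<Lambda> (\<lambda>L. (- 1) ^ m * (bose_vertex f \<Lambda> ^^ m) E0 L) L)"
      by (rule converges_step[OF assms(1) Suc.IH])
    thus ?case unfolding bose_vertex_mult by simp
  next
    case 0
    show ?case using assms(2) by simp
  qed
  hence "(\<lambda>n. (fvertex f \<Lambda> ^^ m) (E n) (concat (map fermi_slots []))) \<longlonglongrightarrow>
      alt_vertices [] (\<lambda>L. (- 1) ^ m * (bose_vertex f \<Lambda> ^^ m) E0 L)"
    unfolding converges_def by (elim conjE) (erule allE[of _ "[]"], simp only: list.map distinct.simps list.set simp_thms empty_subsetI)
  thus ?thesis by (simp only: concat.simps list.map alt_vertices.simps)
qed

section \<open>Integral inequalities on the torus\<close>

lemma tint_mono:
  fixes f g :: "real ^ 4 \<Rightarrow> real"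
  assumes "continuous_on UNIV f" "continuous_on UNIV g" "\<And>x. x \<in> cbox (- \<Lambda>) \<Lambda> \<Longrightarrow> f x \<le> g x"
  shows "tint \<Lambda> f \<le> tint \<Lambda> g"
  unfolding assms(1,2)[THEN tint_eq_integral]
  by (rule integral_le) (use assms in \<open>auto intro!: integrable_continuous intro: continuous_on_subset\<close>)

lemma norm_tint_le_tint:
  fixes f :: "real ^ 4 \<Rightarrow> 'b::euclidean_space"
  assumes "continuous_on UNIV f" "continuous_on UNIV g" "\<And>x. x \<in> cbox (- \<Lambda>) \<Lambda> \<Longrightarrow> norm (f x) \<le> g x"
  shows "norm (tint \<Lambda> f) \<le> tint \<Lambda> g"
  unfolding assms(1,2)[THEN tint_eq_integral]
  by (rule Henstock_Kurzweil_Integration.integral_norm_bound_integral)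
     (use assms in \<open>auto intro!: integrable_continuous intro: continuous_on_subset\<close>)

lemma tint_cong:
  assumes "\<And>x. x \<in> cbox (- \<Lambda>) \<Lambda> \<Longrightarrow> f x = g x"
  shows "tint \<Lambda> f = tint \<Lambda> g"
  unfolding tint_def by (rule set_lebesgue_integral_cong) (use assms in auto)

lemma tint_nonneg:
  fixes f :: "real ^ 4 \<Rightarrow> real"
  assumes "\<And>x. x \<in> cbox (- \<Lambda>) \<Lambda> \<Longrightarrow> 0 \<le> f x"
  shows "0 \<le> tint \<Lambda> f"
  unfolding tint_def set_lebesgue_integral_def
  by (rule Bochner_Integration.integral_nonneg) (use assms in \<open>auto simp: indicator_def\<close>)

lemma continuous_on_slices:
  assumes "continuous_on UNIV (\<lambda>(x, y). f x y)"
  shows "continuous_on UNIV (f x)" "continuous_on UNIV (\<lambda>x. f x y)"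
  using continuous_on_compose2[OF assms continuous_on_Pair[OF continuous_on_const[where c=x] continuous_on_id], of UNIV]
    continuous_on_compose2[OF assms continuous_on_Pair[OF continuous_on_id continuous_on_const[where c=y]], of UNIV]
  by simp_all

lemma tint_swap:
  fixes f :: "real ^ 4 \<Rightarrow> real ^ 4 \<Rightarrow> 'b::euclidean_space"
  assumes f: "continuous_on UNIV (\<lambda>(x, y). f x y)"
  shows "tint \<Lambda> (\<lambda>x. tint \<Lambda> (f x)) = tint \<Lambda> (\<lambda>y. tint \<Lambda> (\<lambda>x. f x y))"
proof -
  have f': "continuous_on UNIV (\<lambda>(y, x). f x y)"
    using continuous_on_compose2[OF f continuous_on_swap, of UNIV] by (simp add: case_prod_unfold)
  have "tint \<Lambda> (\<lambda>x. tint \<Lambda> (f x)) = integral (cbox (- \<Lambda>) \<Lambda>) (\<lambda>x. integral (cbox (- \<Lambda>) \<Lambda>) (f x))"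
    by (simp only: tint_eq_integral[OF continuous_on_tint[OF f]]) (simp only: tint_eq_integral[OF continuous_on_slices(1)[OF f]])
  also have "\<dots> = integral (cbox (- \<Lambda>) \<Lambda>) (\<lambda>y. integral (cbox (- \<Lambda>) \<Lambda>) (\<lambda>x. f x y))"
    by (rule integral_swap_continuous) (rule continuous_on_subset[OF f], simp)
  also have "\<dots> = tint \<Lambda> (\<lambda>y. tint \<Lambda> (\<lambda>x. f x y))"
    by (simp only: tint_eq_integral[OF continuous_on_tint[OF f']]) (simp only: tint_eq_integral[OF continuous_on_slices(1)[OF f']])
  finally show ?thesis .
qed

lemma mem_torus: "x \<in> cbox (- \<Lambda>) \<Lambda> \<longleftrightarrow> (\<forall>i. \<bar>x $ i\<bar> \<le> \<Lambda> $ i)" for x :: "real ^ 4"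
  by (auto simp: mem_box_cart abs_le_iff minus_le_iff)

lemma mem_box_torus: "x \<in> box (- \<Lambda>) \<Lambda> \<longleftrightarrow> (\<forall>i. \<bar>x $ i\<bar> < \<Lambda> $ i)" for x :: "real ^ 4"
  by (auto simp: mem_box_cart abs_less_iff minus_less_iff)

section \<open>Periodization\<close>

definition shift :: "real ^ 4 \<Rightarrow> int ^ 4 \<Rightarrow> real ^ 4" where
  "shift \<Lambda> m = (\<chi> i. 2 * \<Lambda> $ i * real_of_int (m $ i))"

definition int_cube :: "int \<Rightarrow> (int ^ 4) set" where
  "int_cube R = {m. \<forall>i. \<bar>m $ i\<bar> \<le> R}"

lemma finite_int_cube: "finite (int_cube R)"
proof -
  have "int_cube R \<subseteq> vec_lambda ` (PiE UNIV (\<lambda>_. {- R..R}))"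
  proof
    fix m assume "m \<in> int_cube R"
    hence "vec_nth m \<in> PiE UNIV (\<lambda>_. {- R..R})" by (auto simp: int_cube_def abs_le_iff minus_le_iff)
    thus "m \<in> vec_lambda ` (PiE UNIV (\<lambda>_. {- R..R}))"
      by (metis image_eqI vec_nth_inverse)
  qed
  thus ?thesis by (rule finite_subset) (intro finite_imageI finite_PiE, auto)
qed

text \<open>If some \<open>\<bar>m $ i\<bar>\<close> exceeds \<open>R\<close>, the translate of
  \<open>w\<close> is at distance at least
  \<open>2 * \<Lambda> $ i * (R + 1) - R * \<Lambda> $ i\<close> from 0 in that coordinate, which is
  outside the support. The infinite sum becomes a finite one with the same range for a whole box of
  \<open>w\<close>.\<close>

lemma periodize_eq_sum:
  assumes \<Lambda>: "\<And>i. \<Lambda> $ i > 0" and g: "\<And>x i. g x \<noteq> 0 \<Longrightarrow> \<bar>x $ i\<bar> \<le> \<Lambda> $ i"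
    and w: "\<And>i. \<bar>w $ i\<bar> \<le> real_of_int R * \<Lambda> $ i" and R: "R \<ge> 1"
  shows "periodize \<Lambda> g w = (\<Sum>m\<in>int_cube R. g (w + shift \<Lambda> m))"
proof -
  have "g (w + shift \<Lambda> m) = 0" if "m \<notin> int_cube R" for m
  proof (rule ccontr)
    assume "g (w + shift \<Lambda> m) \<noteq> 0"
    from g[OF this] have gm: "\<bar>w $ i + 2 * \<Lambda> $ i * real_of_int (m $ i)\<bar> \<le> \<Lambda> $ i" for i
      by (simp add: shift_def)
    from that obtain i where "R < \<bar>m $ i\<bar>" by (auto simp: int_cube_def not_le)
    hence "\<bar>real_of_int (m $ i)\<bar> \<ge> real_of_int R + 1" by linarith
    hence "2 * \<Lambda> $ i * (real_of_int R + 1) \<le> \<bar>2 * \<Lambda> $ i * real_of_int (m $ i)\<bar>"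
      using \<Lambda>[of i] by (simp add: abs_mult)
    also have "\<dots> \<le> \<bar>w $ i + 2 * \<Lambda> $ i * real_of_int (m $ i)\<bar> + \<bar>w $ i\<bar>" by linarith
    also have "\<dots> \<le> \<Lambda> $ i + real_of_int R * \<Lambda> $ i" using gm[of i] w[of i] by linarith
    finally have "\<Lambda> $ i * (real_of_int R + 1) \<le> 0" by (simp add: algebra_simps)
    thus False using \<Lambda>[of i] R by (simp add: mult_le_0_iff)
  qed
  hence "periodize \<Lambda> g w = (\<Sum>\<^sub>\<infinity>m\<in>int_cube R. g (w + shift \<Lambda> m))"
    unfolding periodize_def shift_def by (intro infsum_cong_neutral) auto
  thus ?thesis by (simp add: finite_int_cube)
qed

text \<open>A nonzero translation moves some coordinate by at least a full period, hence out of the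
  support.\<close>

lemma periodize_eq:
  assumes \<Lambda>: "\<And>i. \<Lambda> $ i > 0" and g: "\<And>x i. g x \<noteq> 0 \<Longrightarrow> \<bar>x $ i\<bar> \<le> r"
    and w: "\<And>i. \<bar>w $ i\<bar> + r < 2 * \<Lambda> $ i"
  shows "periodize \<Lambda> g w = g w"
proof -
  have "g (w + shift \<Lambda> m) = 0" if "m \<noteq> 0" for m
  proof (rule ccontr)
    assume "g (w + shift \<Lambda> m) \<noteq> 0"
    from g[OF this] have gm: "\<bar>w $ i + 2 * \<Lambda> $ i * real_of_int (m $ i)\<bar> \<le> r" for i
      by (simp add: shift_def)
    from that obtain i where "m $ i \<noteq> 0" by (auto simp: vec_eq_iff)
    hence "1 \<le> \<bar>real_of_int (m $ i)\<bar>" by linarith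
    hence "2 * \<Lambda> $ i * 1 \<le> \<bar>2 * \<Lambda> $ i * real_of_int (m $ i)\<bar>"
      using \<Lambda>[of i] unfolding abs_mult by (intro mult_mono) auto
    thus False using gm[of i] w[of i] by linarith
  qed
  hence "periodize \<Lambda> g w = (\<Sum>\<^sub>\<infinity>m\<in>{0}. g (w + shift \<Lambda> m))"
    unfolding periodize_def shift_def by (intro infsum_cong_neutral) auto
  thus ?thesis by (simp add: shift_def zero_vec_def[symmetric])
qed

lemma continuous_on_periodize:
  assumes \<Lambda>: "\<And>i. \<Lambda> $ i > 0" and g: "\<And>x i. g x \<noteq> 0 \<Longrightarrow> \<bar>x $ i\<bar> \<le> \<Lambda> $ i"
    and cont: "continuous_on UNIV g"
  shows "continuous_on UNIV (periodize \<Lambda> g)"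
proof (intro continuous_at_imp_continuous_on ballI)
  fix x :: "real ^ 4"
  \<comment> \<open>The added 1 puts \<open>x\<close> strictly inside the box, so that one finite
    sum represents the periodization near \<open>x\<close>.\<close>
  define R :: int where "R = (MAX i. \<lceil>\<bar>x $ i\<bar> / \<Lambda> $ i\<rceil> + 1)"
  have RM: "\<lceil>\<bar>x $ i\<bar> / \<Lambda> $ i\<rceil> + 1 \<le> R" for i
    unfolding R_def by (rule Max_ge) auto
  have "0 \<le> \<lceil>\<bar>x $ 0\<bar> / \<Lambda> $ 0\<rceil>" using \<Lambda>[of 0] by (simp add: le_ceiling_iff) (smt (verit) divide_nonneg_pos)
  with RM[of 0] have R: "R \<ge> 1" by linarith
  let ?U = "box (- (real_of_int R *\<^sub>R \<Lambda>)) (real_of_int R *\<^sub>R \<Lambda>)"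
  have "\<bar>x $ i\<bar> < real_of_int R * \<Lambda> $ i" for i
  proof -
    have "\<bar>x $ i\<bar> / \<Lambda> $ i < real_of_int R" using RM[of i] by linarith
    thus ?thesis using \<Lambda>[of i] by (simp add: field_simps)
  qed
  hence x: "x \<in> ?U" by (simp add: mem_box_torus)
  have "continuous_on ?U (\<lambda>w. \<Sum>m\<in>int_cube R. g (w + shift \<Lambda> m))"
    by (intro continuous_intros continuous_on_compose2[OF cont]) auto
  moreover have "periodize \<Lambda> g w = (\<Sum>m\<in>int_cube R. g (w + shift \<Lambda> m))" if "w \<in> ?U" for w
  proof (rule periodize_eq_sum[OF \<Lambda> g _ R])
    show "\<bar>w $ i\<bar> \<le> real_of_int R * \<Lambda> $ i" for i
      using that unfolding mem_box_torus by (metis less_eq_real_def scaleR_conv_of_real of_real_eq_id id_apply real_scaleR_def vector_scaleR_component)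
  qed
  ultimately have "continuous_on ?U (periodize \<Lambda> g)" by (simp cong: continuous_on_cong)
  thus "isCont (periodize \<Lambda> g) x"
    using x continuous_on_eq_continuous_at[OF open_box] by blast
qed

lemma periodize_nonneg: "(\<And>x. 0 \<le> g x) \<Longrightarrow> 0 \<le> periodize \<Lambda> g w"
  unfolding periodize_def by (rule infsum_nonneg) auto

section \<open>The two-point functions\<close>

lemma smooth_imp_continuous: "smooth f \<Longrightarrow> continuous_on UNIV f"
  unfolding smooth_def
  by (drule spec[of _ "[]"])
     (auto intro!: continuous_at_imp_continuous_on differentiable_imp_continuous_within)

locale cutoffs =
  fixes \<Lambda> :: "real ^ 4" and \<zeta> Z :: "real \<Rightarrow> real"
  assumes pos: "\<Lambda> $ i > 0"
    and zeta: "cutoff_zeta \<zeta>"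
    and Z: "cutoff_Z Z"
begin

definition bump :: "real \<Rightarrow> real ^ 4 \<Rightarrow> real" where
  "bump \<epsilon> x = (2 / \<epsilon>) ^ 4 * (\<Prod>i\<in>UNIV. \<zeta> (2 * x $ i / \<epsilon>))"

definition plateau :: "real \<Rightarrow> real ^ 4 \<Rightarrow> real" where
  "plateau \<epsilon> x = (\<Prod>i\<in>UNIV. Z (x $ i / (2 * \<epsilon>)))"

text \<open>The margin 10 leaves room for all supports that occur: radius
  \<open>\<epsilon> / 2\<close> for \<open>bump\<close>, \<open>4 * \<epsilon>\<close> for
  \<open>plateau\<close>, at most \<open>5 * \<epsilon>\<close> for the two-point functions. None of
  them then wraps around the torus.\<close>

definition small :: "real \<Rightarrow> bool" where
  "small \<epsilon> \<longleftrightarrow> 0 < \<epsilon> \<and> (\<forall>i. 10 * \<epsilon> \<le> \<Lambda> $ i)"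

lemma eventually_small: "eventually small (at_right 0)"
proof -
  have "eventually (\<lambda>\<epsilon>. 10 * \<epsilon> \<le> \<Lambda> $ i) (at_right 0)" for i
    using eventually_at_right_less[of 0] eventually_at_right_real[of 0 "\<Lambda> $ i / 10"] pos[of i]
    by (auto elim!: eventually_mono)
  hence "eventually (\<lambda>\<epsilon>. \<forall>i. 10 * \<epsilon> \<le> \<Lambda> $ i) (at_right 0)"
    by (simp add: eventually_all_finite)
  thus ?thesis
    unfolding small_def by (intro eventually_conj eventually_at_right_less)
qed

lemma delta_eps_eq: "delta_eps \<Lambda> \<zeta> \<epsilon> = periodize \<Lambda> (bump \<epsilon>)"
  by (simp add: delta_eps_def bump_def[abs_def])

lemma D_eps_eq: "D_eps \<Lambda> Z \<epsilon> = periodize \<Lambda> (plateau \<epsilon>)"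
  by (simp add: D_eps_def plateau_def[abs_def])

lemma continuous_zeta: "continuous_on UNIV \<zeta>" and continuous_Z: "continuous_on UNIV Z"
  using zeta Z by (auto simp: cutoff_zeta_def cutoff_Z_def intro: smooth_imp_continuous)

lemma zeta_nonneg: "0 \<le> \<zeta> t" and zeta_even: "\<zeta> (- t) = \<zeta> t"
  using zeta by (auto simp: cutoff_zeta_def)

lemma zeta_support: "\<zeta> t \<noteq> 0 \<Longrightarrow> \<bar>t\<bar> \<le> 1"
  using zeta unfolding cutoff_zeta_def by (metis abs_of_neg abs_of_nonneg linorder_le_cases not_less)

lemma Z_support: "Z t \<noteq> 0 \<Longrightarrow> \<bar>t\<bar> \<le> 2" and Z_one: "\<bar>t\<bar> \<le> 1 \<Longrightarrow> Z t = 1"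
  using Z unfolding cutoff_Z_def by (metis linorder_le_cases, metis)

lemma bump_nonneg: "0 \<le> bump \<epsilon> x"
  unfolding bump_def by (intro mult_nonneg_nonneg prod_nonneg ballI zeta_nonneg) simp

lemma bump_even: "bump \<epsilon> (- x) = bump \<epsilon> x"
  by (simp add: bump_def zeta_even)

lemma bump_support: "0 < \<epsilon> \<Longrightarrow> bump \<epsilon> x \<noteq> 0 \<Longrightarrow> \<bar>x $ i\<bar> \<le> \<epsilon> / 2"
  using zeta_support[of "2 * x $ i / \<epsilon>"] by (auto simp: bump_def abs_mult field_simps)

lemma plateau_support: "0 < \<epsilon> \<Longrightarrow> plateau \<epsilon> x \<noteq> 0 \<Longrightarrow> \<bar>x $ i\<bar> \<le> 4 * \<epsilon>"
  using Z_support[of "x $ i / (2 * \<epsilon>)"] by (auto simp: plateau_def abs_mult field_simps)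

lemma plateau_one: "0 < \<epsilon> \<Longrightarrow> (\<And>i. \<bar>x $ i\<bar> \<le> 2 * \<epsilon>) \<Longrightarrow> plateau \<epsilon> x = 1"
  unfolding plateau_def by (intro prod.neutral ballI Z_one) (auto simp: abs_mult field_simps)

lemma continuous_bump: "continuous_on UNIV (bump \<epsilon>)"
  unfolding bump_def divide_inverse
  by (intro continuous_intros continuous_on_compose2[OF continuous_zeta]) auto

lemma continuous_plateau: "continuous_on UNIV (plateau \<epsilon>)"
  unfolding plateau_def divide_inverse
  by (intro continuous_intros continuous_on_compose2[OF continuous_Z]) auto

text \<open>\<open>\<epsilon>\<close> only rescales the argument, so one bound serves all
  cut-offs.\<close>

lemma plateau_bounded: "\<exists>B\<ge>0. \<forall>\<epsilon> x. \<bar>plateau \<epsilon> x\<bar> \<le> B"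
proof -
  have "compact (Z ` {- 2..2})"
    by (intro compact_continuous_image continuous_on_subset[OF continuous_Z]) auto
  then obtain b where b: "\<And>t. \<bar>t\<bar> \<le> 2 \<Longrightarrow> \<bar>Z t\<bar> \<le> b"
    using compact_imp_bounded[THEN bounded_iff[THEN iffD1]] by fastforce
  have b0: "0 \<le> b" using b[of 0] by auto
  have b': "\<bar>Z t\<bar> \<le> b" for t
    using b[of t] b0 Z_support[of t] by (cases "Z t = 0") auto
  have "\<bar>plateau \<epsilon> x\<bar> \<le> (\<Prod>i\<in>(UNIV :: 4 set). b)" for \<epsilon> x
    unfolding plateau_def abs_prod by (intro prod_mono) (auto simp: b')
  thus ?thesis using b0 by (intro exI[of _ "\<Prod>i\<in>(UNIV :: 4 set). b"]) (auto intro: prod_nonneg)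
qed

text \<open>The integral factorizes over the four coordinates, and each factor is 1 by
  scaling.\<close>

lemma nn_integral_bump:
  assumes "0 < \<epsilon>"
  shows "(\<integral>\<^sup>+x. ennreal (bump \<epsilon> x) \<partial>lborel) = 1"
proof -
  have m[measurable]: "\<zeta> \<in> borel_measurable borel"
    by (rule borel_measurable_continuous_onI[OF continuous_zeta])
  have "(\<integral>\<^sup>+t. ennreal (\<zeta> t) \<partial>lborel) = ennreal 1"
    by (rule nn_integral_has_integral_lborel) (use zeta zeta_nonneg m in \<open>auto simp: cutoff_zeta_def\<close>)
  moreover have "ennreal (2 / \<epsilon> * \<zeta> (2 * t / \<epsilon>)) = ennreal (2 / \<epsilon>) * ennreal (\<zeta> (2 * t / \<epsilon>))" for t
    using assms by (intro ennreal_mult zeta_nonneg) simp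
  ultimately have 1: "(\<integral>\<^sup>+t. ennreal (2 / \<epsilon> * \<zeta> (2 * t / \<epsilon>)) \<partial>lborel) = 1"
    using assms nn_integral_real_affine[of "\<lambda>t. ennreal (\<zeta> t)" "2 / \<epsilon>" 0]
    by (simp only:) (simp add: nn_integral_cmult)
  have Basis: "Basis = range (\<lambda>i :: 4. axis i (1 :: real))"
    by (auto simp: Basis_vec_def)
  have inj: "inj (\<lambda>i :: 4. axis i (1 :: real))"
    by (auto simp: inj_def axis_eq_axis)
  have "bump \<epsilon> x = (\<Prod>b\<in>Basis. 2 / \<epsilon> * \<zeta> (2 * (x \<bullet> b) / \<epsilon>))" for x
    unfolding Basis prod.reindex[OF inj] o_def prod.distrib by (simp add: bump_def cart_eq_inner_axis)
  hence "(\<integral>\<^sup>+x. ennreal (bump \<epsilon> x) \<partial>lborel) =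
      (\<integral>\<^sup>+x. (\<Prod>b\<in>Basis. ennreal (2 / \<epsilon> * \<zeta> (2 * (x \<bullet> b) / \<epsilon>))) \<partial>(lborel :: (real ^ 4) measure))"
    using assms by (simp add: prod_ennreal zeta_nonneg)
  also have "\<dots> = (\<Prod>b\<in>(Basis :: (real ^ 4) set). \<integral>\<^sup>+t. ennreal (2 / \<epsilon> * \<zeta> (2 * t / \<epsilon>)) \<partial>lborel)"
    by (rule nn_integral_lborel_prod) auto
  finally show ?thesis by (simp only: 1 prod.neutral_const)
qed

lemma integral_bump_shift:
  assumes "0 < \<epsilon>"
  shows "integrable lborel (\<lambda>x. bump \<epsilon> (x - c))" "(\<integral>x. bump \<epsilon> (x - c) \<partial>lborel) = 1"
proof -
  have m: "bump \<epsilon> \<in> borel_measurable borel"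
    by (rule borel_measurable_continuous_onI[OF continuous_bump])
  have "(\<integral>\<^sup>+x. ennreal (bump \<epsilon> (x - c)) \<partial>lborel) =
      (\<integral>\<^sup>+x. ennreal (bump \<epsilon> (x - c)) \<partial>distr lborel borel ((+) c))"
    by (subst lborel_distr_plus) simp
  also have "\<dots> = (\<integral>\<^sup>+x. ennreal (bump \<epsilon> x) \<partial>lborel)"
    using m by (subst nn_integral_distr) auto
  also have "\<dots> = 1" using assms by (rule nn_integral_bump)
  finally have "has_bochner_integral lborel (\<lambda>x. bump \<epsilon> (x - c)) 1"
    using m by (intro has_bochner_integral_nn_integral) (auto simp: bump_nonneg)
  thus "integrable lborel (\<lambda>x. bump \<epsilon> (x - c))" "(\<integral>x. bump \<epsilon> (x - c) \<partial>lborel) = 1"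
    by (auto simp: has_bochner_integral_iff)
qed

lemma continuous_bump_shift: "continuous_on UNIV (\<lambda>x. bump \<epsilon> (x - c))"
  by (intro continuous_on_compose2[OF continuous_bump] continuous_intros) auto

text \<open>For a centre near the boundary part of the mass may lie outside the box, so only an
  inequality holds.\<close>

lemma tint_bump_le: "0 < \<epsilon> \<Longrightarrow> tint \<Lambda> (\<lambda>x. bump \<epsilon> (x - c)) \<le> 1"
  unfolding tint_def set_lebesgue_integral_def integral_bump_shift(2)[of \<epsilon> c, symmetric]
  by (rule integral_mono)
     (use set_integrable_continuous[OF continuous_bump_shift, unfolded set_integrable_def] integral_bump_shift(1)
      in \<open>auto simp: indicator_def bump_nonneg\<close>)

lemma tint_bump:
  assumes "0 < \<epsilon>" "\<And>i. \<bar>c $ i\<bar> + \<epsilon> / 2 \<le> \<Lambda> $ i"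
  shows "tint \<Lambda> (\<lambda>x. bump \<epsilon> (x - c)) = 1"
proof -
  have "indicator (cbox (- \<Lambda>) \<Lambda>) x *\<^sub>R bump \<epsilon> (x - c) = bump \<epsilon> (x - c)" for x
  proof (cases "bump \<epsilon> (x - c) = 0")
    case False
    have "\<bar>x $ i\<bar> \<le> \<Lambda> $ i" for i
      using bump_support[OF assms(1) False, of i] assms(2)[of i] unfolding vector_minus_component by linarith
    thus ?thesis by (simp add: indicator_def mem_torus)
  qed simp
  thus ?thesis
    unfolding tint_def set_lebesgue_integral_def by (simp only: integral_bump_shift(2)[OF assms(1)])
qed

definition two_psi :: "real \<Rightarrow> real ^ 4 \<Rightarrow> real" where
  "two_psi \<epsilon> w = conv \<Lambda> (delta_eps \<Lambda> \<zeta> \<epsilon>) (delta_eps \<Lambda> \<zeta> \<epsilon>) w"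

definition two_h :: "real \<Rightarrow> real ^ 4 \<Rightarrow> real" where
  "two_h \<epsilon> w = conv \<Lambda> (delta_eps \<Lambda> \<zeta> \<epsilon>) (D_eps \<Lambda> Z \<epsilon>) w"

lemma two_point_psi_of: "two_point \<Lambda> \<zeta> Z \<epsilon> (psi_of c) = two_psi \<epsilon>"
  and two_point_h_of: "two_point \<Lambda> \<zeta> Z \<epsilon> (h_of c) = two_h \<epsilon>"
  by (cases c rule: psi_of.cases; simp add: two_psi_def two_h_def fun_eq_iff)+

context
  fixes \<epsilon> :: real
  assumes eps: "small \<epsilon>"
begin

lemma eps_pos: "0 < \<epsilon>" and eps_le: "10 * \<epsilon> \<le> \<Lambda> $ i"
  using eps by (auto simp: small_def)

lemma bump_supp: "bump \<epsilon> x \<noteq> 0 \<Longrightarrow> \<bar>x $ i\<bar> \<le> \<epsilon> / 2"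
  by (rule bump_support[OF eps_pos])

lemma plateau_supp: "plateau \<epsilon> x \<noteq> 0 \<Longrightarrow> \<bar>x $ i\<bar> \<le> 4 * \<epsilon>"
  by (rule plateau_support[OF eps_pos])

lemma bump_supp': "bump \<epsilon> x \<noteq> 0 \<Longrightarrow> \<bar>x $ i\<bar> \<le> \<Lambda> $ i"
  using bump_supp[of x i] eps_le[of i] eps_pos by linarith

lemma plateau_supp': "plateau \<epsilon> x \<noteq> 0 \<Longrightarrow> \<bar>x $ i\<bar> \<le> \<Lambda> $ i"
  using plateau_supp[of x i] eps_le[of i] eps_pos by linarith

abbreviation \<delta> where "\<delta> \<equiv> delta_eps \<Lambda> \<zeta> \<epsilon>"
abbreviation D where "D \<equiv> D_eps \<Lambda> Z \<epsilon>"

lemma continuous_delta: "continuous_on UNIV \<delta>"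
  unfolding delta_eps_eq by (intro continuous_on_periodize pos bump_supp' continuous_bump)

lemma continuous_D: "continuous_on UNIV D"
  unfolding D_eps_eq by (intro continuous_on_periodize pos plateau_supp' continuous_plateau)

lemma delta_nonneg: "0 \<le> \<delta> x"
  unfolding delta_eps_eq by (intro periodize_nonneg bump_nonneg)

lemma delta_near: "(\<And>i. \<bar>w $ i\<bar> + \<epsilon> / 2 < 2 * \<Lambda> $ i) \<Longrightarrow> \<delta> w = bump \<epsilon> w"
  unfolding delta_eps_eq by (rule periodize_eq[OF pos bump_supp])

lemma delta_torus: "y \<in> cbox (- \<Lambda>) \<Lambda> \<Longrightarrow> \<delta> y = bump \<epsilon> y"
proof (rule delta_near)
  fix i assume "y \<in> cbox (- \<Lambda>) \<Lambda>"
  hence "\<bar>y $ i\<bar> \<le> \<Lambda> $ i" by (simp add: mem_torus)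
  thus "\<bar>y $ i\<bar> + \<epsilon> / 2 < 2 * \<Lambda> $ i" using eps_le[of i] eps_pos by linarith
qed

lemma D_torus: "y \<in> cbox (- \<Lambda>) \<Lambda> \<Longrightarrow> D y = plateau \<epsilon> y"
  unfolding D_eps_eq
proof (rule periodize_eq[OF pos plateau_supp])
  fix i assume "y \<in> cbox (- \<Lambda>) \<Lambda>"
  hence "\<bar>y $ i\<bar> \<le> \<Lambda> $ i" by (simp add: mem_torus)
  thus "\<bar>y $ i\<bar> + 4 * \<epsilon> < 2 * \<Lambda> $ i" using eps_le[of i] eps_pos by linarith
qed

lemma continuous_pairs:
  "continuous_on UNIV (\<lambda>(x, y). \<delta> (x - y) *\<^sub>R \<delta> y)" "continuous_on UNIV (\<lambda>(x, y). \<delta> (x - y) *\<^sub>R D y)"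
  "continuous_on UNIV (\<lambda>x. \<delta> (x - w))" "continuous_on UNIV (\<lambda>x. \<delta> (w - x))"
  unfolding case_prod_unfold
  by (auto intro!: continuous_intros continuous_on_compose2[OF continuous_delta] continuous_on_compose2[OF continuous_D])

lemma continuous_two_psi: "continuous_on UNIV (two_psi \<epsilon>)"
  unfolding two_psi_def[abs_def] conv_def using continuous_pairs(1) by (rule continuous_on_tint)

lemma continuous_two_h: "continuous_on UNIV (two_h \<epsilon>)"
  unfolding two_h_def[abs_def] conv_def using continuous_pairs(2) by (rule continuous_on_tint)

lemma two_psi_nonneg: "0 \<le> two_psi \<epsilon> w"
  unfolding two_psi_def conv_def by (intro tint_nonneg) (auto simp: delta_nonneg)

lemma tint_delta: "tint \<Lambda> \<delta> = 1"
proof -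
  have "tint \<Lambda> \<delta> = tint \<Lambda> (\<lambda>x. bump \<epsilon> (x - 0))"
    by (rule tint_cong) (simp add: delta_torus)
  also have "\<dots> = 1"
  proof (rule tint_bump[OF eps_pos])
    show "\<bar>0 $ i\<bar> + \<epsilon> / 2 \<le> \<Lambda> $ i" for i
      using eps_le[of i] eps_pos by simp
  qed
  finally show ?thesis .
qed

text \<open>A crude count of the translates that can meet the torus: for \<open>x\<close> in the
  box, \<open>x - w\<close> has coordinates of size at most \<open>3 * \<Lambda> $ i\<close>, hence
  \<open>int_cube 3\<close>, and each translate has mass at most 1. The bound extends to centres at
  the boundary, as domination requires.\<close>

lemma tint_delta_shift_le:
  assumes "\<And>i. \<bar>w $ i\<bar> \<le> 2 * \<Lambda> $ i"
  shows "tint \<Lambda> (\<lambda>x. \<delta> (x - w)) \<le> card (int_cube 3)"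
    and "tint \<Lambda> (\<lambda>x. \<delta> (w - x)) \<le> card (int_cube 3)"
proof -
  have b: "\<bar>x $ i - w $ i\<bar> \<le> 3 * \<Lambda> $ i" if "x \<in> cbox (- \<Lambda>) \<Lambda>" for x i
    using that[unfolded mem_torus, rule_format, of i] assms[of i] by linarith
  have "tint \<Lambda> (\<lambda>x. \<delta> (x - w)) = tint \<Lambda> (\<lambda>x. \<Sum>m\<in>int_cube 3. bump \<epsilon> (x - (w - shift \<Lambda> m)))"
  proof (rule tint_cong)
    fix x assume x: "x \<in> cbox (- \<Lambda>) \<Lambda>"
    have "\<delta> (x - w) = (\<Sum>m\<in>int_cube 3. bump \<epsilon> (x - w + shift \<Lambda> m))"
      unfolding delta_eps_eq by (rule periodize_eq_sum[OF pos bump_supp']) (use b[OF x] in auto)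
    thus "\<delta> (x - w) = (\<Sum>m\<in>int_cube 3. bump \<epsilon> (x - (w - shift \<Lambda> m)))"
      by (simp add: algebra_simps)
  qed
  also have "\<dots> = (\<Sum>m\<in>int_cube 3. tint \<Lambda> (\<lambda>x. bump \<epsilon> (x - (w - shift \<Lambda> m))))"
    by (rule tint_sum) (rule continuous_bump_shift)
  also have "\<dots> \<le> (\<Sum>m\<in>int_cube 3. 1)"
    by (intro sum_mono tint_bump_le eps_pos)
  finally show "tint \<Lambda> (\<lambda>x. \<delta> (x - w)) \<le> card (int_cube 3)" by simp
  have "tint \<Lambda> (\<lambda>x. \<delta> (w - x)) = tint \<Lambda> (\<lambda>x. \<Sum>m\<in>int_cube 3. bump \<epsilon> (x - (w + shift \<Lambda> m)))"
  proof (rule tint_cong)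
    fix x assume x: "x \<in> cbox (- \<Lambda>) \<Lambda>"
    have "\<delta> (w - x) = (\<Sum>m\<in>int_cube 3. bump \<epsilon> (w - x + shift \<Lambda> m))"
      unfolding delta_eps_eq
      by (rule periodize_eq_sum[OF pos bump_supp']) (use b[OF x] in \<open>auto simp: abs_minus_commute\<close>)
    also have "\<dots> = (\<Sum>m\<in>int_cube 3. bump \<epsilon> (x - (w + shift \<Lambda> m)))"
      by (intro sum.cong refl) (subst bump_even[symmetric], simp add: algebra_simps)
    finally show "\<delta> (w - x) = (\<Sum>m\<in>int_cube 3. bump \<epsilon> (x - (w + shift \<Lambda> m)))" .
  qed
  also have "\<dots> = (\<Sum>m\<in>int_cube 3. tint \<Lambda> (\<lambda>x. bump \<epsilon> (x - (w + shift \<Lambda> m))))"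
    by (rule tint_sum) (rule continuous_bump_shift)
  also have "\<dots> \<le> (\<Sum>m\<in>int_cube 3. 1)"
    by (intro sum_mono tint_bump_le eps_pos)
  finally show "tint \<Lambda> (\<lambda>x. \<delta> (w - x)) \<le> card (int_cube 3)" by simp
qed

lemma two_h_bound:
  assumes "\<And>x. \<bar>plateau \<epsilon> x\<bar> \<le> B" "\<And>i. \<bar>w $ i\<bar> \<le> 2 * \<Lambda> $ i"
  shows "\<bar>two_h \<epsilon> w\<bar> \<le> B * card (int_cube 3)"
proof -
  have B: "0 \<le> B" using assms(1)[of 0] by linarith
  have "norm (two_h \<epsilon> w) \<le> tint \<Lambda> (\<lambda>y. B * \<delta> (w - y))"
    unfolding two_h_def conv_def
  proof (rule norm_tint_le_tint)
    show "continuous_on UNIV (\<lambda>y. \<delta> (w - y) *\<^sub>R D y)"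
      using continuous_on_slices(1)[OF continuous_pairs(2), of w] by simp
    show "continuous_on UNIV (\<lambda>y. B * \<delta> (w - y))"
      by (intro continuous_intros continuous_pairs(4))
    fix y assume "y \<in> cbox (- \<Lambda>) \<Lambda>"
    thus "norm (\<delta> (w - y) *\<^sub>R D y) \<le> B * \<delta> (w - y)"
      using mult_right_mono[OF assms(1)[of y] delta_nonneg[of "w - y"]]
      by (simp add: abs_mult D_torus delta_nonneg mult.commute)
  qed
  also have "\<dots> \<le> B * card (int_cube 3)"
    unfolding tint_mult by (intro mult_left_mono tint_delta_shift_le assms B)
  finally show ?thesis by simp
qed

text \<open>Exchanging the integrals reduces the mass of the convolution square to that of a single
  approximate delta function around \<open>z + y\<close>.\<close>

lemma tint_two_psi:
  "tint \<Lambda> (\<lambda>x. two_psi \<epsilon> (x - z)) = tint \<Lambda> (\<lambda>y. \<delta> y * tint \<Lambda> (\<lambda>x. \<delta> (x - (z + y))))"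
proof -
  have "continuous_on UNIV (\<lambda>(x, y). \<delta> (x - z - y) * \<delta> y)"
    unfolding case_prod_unfold
    by (auto intro!: continuous_intros continuous_on_compose2[OF continuous_delta])
  from tint_swap[OF this, of \<Lambda>]
  have "tint \<Lambda> (\<lambda>x. two_psi \<epsilon> (x - z)) = tint \<Lambda> (\<lambda>y. tint \<Lambda> (\<lambda>x. \<delta> (x - z - y) * \<delta> y))"
    by (simp add: two_psi_def conv_def)
  moreover have "tint \<Lambda> (\<lambda>x. \<delta> (x - z - y) * \<delta> y) = \<delta> y * tint \<Lambda> (\<lambda>x. \<delta> (x - (z + y)))" for y
    unfolding tint_mult[symmetric] by (simp only: diff_diff_eq mult.commute[of "\<delta> y"])
  ultimately show ?thesis by simp
qed

lemma continuous_inner: "continuous_on UNIV (\<lambda>y. tint \<Lambda> (\<lambda>x. \<delta> (x - (z + y))))"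
  by (rule continuous_on_tint)
     (auto simp: case_prod_unfold intro!: continuous_intros continuous_on_compose2[OF continuous_delta])

lemma tint_two_psi_le:
  assumes z: "z \<in> cbox (- \<Lambda>) \<Lambda>"
  shows "tint \<Lambda> (\<lambda>x. two_psi \<epsilon> (x - z)) \<le> card (int_cube 3)"
proof -
  have "tint \<Lambda> (\<lambda>y. \<delta> y * tint \<Lambda> (\<lambda>x. \<delta> (x - (z + y)))) \<le> tint \<Lambda> (\<lambda>y. card (int_cube 3) * \<delta> y)"
  proof (rule tint_mono)
    fix y assume y: "y \<in> cbox (- \<Lambda>) \<Lambda>"
    have "\<bar>(z + y) $ i\<bar> \<le> 2 * \<Lambda> $ i" for i
      using y[unfolded mem_torus, rule_format, of i] z[unfolded mem_torus, rule_format, of i]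
      unfolding vector_add_component by linarith
    thus "\<delta> y * tint \<Lambda> (\<lambda>x. \<delta> (x - (z + y))) \<le> card (int_cube 3) * \<delta> y"
      by (subst mult.commute) (intro mult_right_mono tint_delta_shift_le delta_nonneg)
  qed (intro continuous_intros continuous_delta continuous_inner)+
  thus ?thesis unfolding tint_two_psi tint_mult tint_delta by simp
qed

context
  fixes z :: "real ^ 4"
  assumes z: "\<And>i. \<bar>z $ i\<bar> + 10 * \<epsilon> \<le> \<Lambda> $ i"
begin

text \<open>At distance \<open>10 * \<epsilon>\<close> from the boundary no mass leaves the box, so
  the normalization is exact.\<close>

lemma tint_two_psi_interior: "tint \<Lambda> (\<lambda>x. two_psi \<epsilon> (x - z)) = 1"
proof -
  have "tint \<Lambda> (\<lambda>y. \<delta> y * tint \<Lambda> (\<lambda>x. \<delta> (x - (z + y)))) = tint \<Lambda> \<delta>"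
  proof (rule tint_cong)
    fix y assume y: "y \<in> cbox (- \<Lambda>) \<Lambda>"
    show "\<delta> y * tint \<Lambda> (\<lambda>x. \<delta> (x - (z + y))) = \<delta> y"
    proof (cases "\<delta> y = 0")
      case False
      hence y': "\<bar>y $ i\<bar> \<le> \<epsilon> / 2" for i
        using bump_supp y by (simp add: delta_torus)
      have zy: "\<bar>(z + y) $ i\<bar> + 9 * \<epsilon> \<le> \<Lambda> $ i" for i
        using y'[of i] z[of i] eps_pos unfolding vector_add_component by linarith
      have "tint \<Lambda> (\<lambda>x. \<delta> (x - (z + y))) = tint \<Lambda> (\<lambda>x. bump \<epsilon> (x - (z + y)))"
      proof (intro tint_cong delta_near)
        fix x i assume "x \<in> cbox (- \<Lambda>) \<Lambda>"
        hence "\<bar>x $ i\<bar> \<le> \<Lambda> $ i" by (simp add: mem_torus)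
        thus "\<bar>(x - (z + y)) $ i\<bar> + \<epsilon> / 2 < 2 * \<Lambda> $ i"
          using zy[of i] eps_pos unfolding vector_minus_component by linarith
      qed
      also have "\<dots> = 1"
      proof (rule tint_bump[OF eps_pos])
        show "\<bar>(z + y) $ i\<bar> + \<epsilon> / 2 \<le> \<Lambda> $ i" for i
          using zy[of i] eps_pos by linarith
      qed
      finally show ?thesis by simp
    qed simp
  qed
  thus ?thesis by (simp add: tint_two_psi tint_delta)
qed

text \<open>The coordinates of \<open>x - z - y\<close> are at most
  \<open>2 * \<Lambda> $ i - 6 * \<epsilon>\<close> in size, still short of the neighbouring
  period.\<close>

lemma delta_diff:
  assumes x: "x \<in> cbox (- \<Lambda>) \<Lambda>" and y: "\<And>i. \<bar>y $ i\<bar> \<le> 4 * \<epsilon>"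
  shows "\<delta> (x - z - y) = bump \<epsilon> (x - z - y)"
proof (rule delta_near)
  fix i
  show "\<bar>(x - z - y) $ i\<bar> + \<epsilon> / 2 < 2 * \<Lambda> $ i"
    using x[unfolded mem_torus, rule_format, of i] y[of i] z[of i] eps_pos
    unfolding vector_minus_component by linarith
qed

text \<open>A nonzero convolution needs a point \<open>y\<close> at which both factors are nonzero;
  the two radii \<open>\<epsilon> / 2\<close> add up.\<close>

lemma two_psi_support:
  assumes x: "x \<in> cbox (- \<Lambda>) \<Lambda>" and "two_psi \<epsilon> (x - z) \<noteq> 0"
  shows "\<bar>x $ i - z $ i\<bar> \<le> \<epsilon>"
proof -
  have "\<exists>y\<in>cbox (- \<Lambda>) \<Lambda>. \<delta> (x - z - y) * \<delta> y \<noteq> 0"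
  proof (rule ccontr)
    assume "\<not> ?thesis"
    hence "tint \<Lambda> (\<lambda>y. \<delta> (x - z - y) *\<^sub>R \<delta> y) = tint \<Lambda> (\<lambda>_. 0)"
      by (intro tint_cong) auto
    with assms(2) show False by (simp add: two_psi_def conv_def)
  qed
  then obtain y where y: "y \<in> cbox (- \<Lambda>) \<Lambda>" "\<delta> (x - z - y) * \<delta> y \<noteq> 0" by blast
  have y': "\<bar>y $ i\<bar> \<le> \<epsilon> / 2" for i
    using bump_supp y by (simp add: delta_torus)
  have "\<bar>y $ i\<bar> \<le> 4 * \<epsilon>" for i using y'[of i] eps_pos by linarith
  hence "\<bar>(x - z - y) $ i\<bar> \<le> \<epsilon> / 2"
    using y(2) delta_diff[OF x] by (intro bump_supp) auto
  thus ?thesis using y'[of i] unfolding vector_minus_component by linarith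
qed

text \<open>As for \<open>two_psi\<close>, with the radii \<open>4 * \<epsilon>\<close> and
  \<open>\<epsilon> / 2\<close>, rounded up.\<close>

lemma two_h_support:
  assumes x: "x \<in> cbox (- \<Lambda>) \<Lambda>" and "two_h \<epsilon> (x - z) \<noteq> 0"
  shows "\<bar>x $ i - z $ i\<bar> \<le> 5 * \<epsilon>"
proof -
  have "\<exists>y\<in>cbox (- \<Lambda>) \<Lambda>. \<delta> (x - z - y) * D y \<noteq> 0"
  proof (rule ccontr)
    assume "\<not> ?thesis"
    hence "tint \<Lambda> (\<lambda>y. \<delta> (x - z - y) *\<^sub>R D y) = tint \<Lambda> (\<lambda>_. 0)"
      by (intro tint_cong) auto
    with assms(2) show False by (simp add: two_h_def conv_def)
  qed
  then obtain y where y: "y \<in> cbox (- \<Lambda>) \<Lambda>" "\<delta> (x - z - y) * D y \<noteq> 0" by blast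
  have y': "\<bar>y $ i\<bar> \<le> 4 * \<epsilon>" for i
    using plateau_supp y by (simp add: D_torus)
  hence "\<bar>(x - z - y) $ i\<bar> \<le> \<epsilon> / 2"
    using y(2) delta_diff[OF x] by (intro bump_supp) auto
  thus ?thesis using y'[of i] eps_pos unfolding vector_minus_component by linarith
qed

text \<open>The mass of the smearing function around \<open>w\<close> lies within
  \<open>3 / 2 * \<epsilon>\<close> of 0 in each coordinate, where the plateau function equals
  1.\<close>

lemma two_h_eq_1:
  assumes w: "\<And>i. \<bar>w $ i\<bar> \<le> \<epsilon>"
  shows "two_h \<epsilon> w = 1"
proof -
  have "two_h \<epsilon> w = tint \<Lambda> (\<lambda>y. bump \<epsilon> (y - w))"
    unfolding two_h_def conv_def
  proof (rule tint_cong)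
    fix y assume y: "y \<in> cbox (- \<Lambda>) \<Lambda>"
    have "\<bar>(w - y) $ i\<bar> + \<epsilon> / 2 < 2 * \<Lambda> $ i" for i
      using w[of i] y[unfolded mem_torus, rule_format, of i] eps_le[of i] eps_pos
      unfolding vector_minus_component by linarith
    hence d: "\<delta> (w - y) = bump \<epsilon> (y - w)"
      using delta_near[of "w - y"] bump_even[of \<epsilon> "y - w"] by simp
    show "\<delta> (w - y) *\<^sub>R D y = bump \<epsilon> (y - w)"
    proof (cases "bump \<epsilon> (y - w) = 0")
      case False
      have "\<bar>y $ i\<bar> \<le> 2 * \<epsilon>" for i
        using bump_supp[OF False, of i] w[of i] eps_pos unfolding vector_minus_component by linarith
      thus ?thesis using y by (simp add: d D_torus plateau_one eps_pos)
    qed (simp add: d)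
  qed
  also have "\<dots> = 1"
  proof (rule tint_bump[OF eps_pos])
    show "\<bar>w $ i\<bar> + \<epsilon> / 2 \<le> \<Lambda> $ i" for i
      using w[of i] eps_le[of i] eps_pos by linarith
  qed
  finally show ?thesis .
qed

text \<open>The reason for two different cut-offs: one contraction of the pair is identically 1
  where the other is nonzero, so a composite boson contributes one approximate delta function.
  Smearing all fields alike would give the square of one.\<close>

lemma two_psi_two_h:
  assumes x: "x \<in> cbox (- \<Lambda>) \<Lambda>"
  shows "two_psi \<epsilon> (x - z) * two_h \<epsilon> (x - z) = two_psi \<epsilon> (x - z)"
proof (cases "two_psi \<epsilon> (x - z) = 0")
  case False
  have "two_h \<epsilon> (x - z) = 1"
    by (rule two_h_eq_1) (use two_psi_support[OF x False] in simp)
  thus ?thesis by simp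
qed simp

end

end

end

section \<open>The limit of the contractions\<close>

lemma dtint_cong:
  assumes "\<And>x y. x \<in> cbox (- \<Lambda>) \<Lambda> \<Longrightarrow> y \<in> cbox (- \<Lambda>) \<Lambda> \<Longrightarrow> \<phi> x y = \<psi> x y"
  shows "dtint \<Lambda> \<phi> = dtint \<Lambda> \<psi>"
  unfolding dtint_def using assms by (intro tint_cong)

lemma dtint_product:
  fixes p q :: "real ^ 4 \<Rightarrow> real"
  shows "dtint \<Lambda> (\<lambda>x y. a * of_real (q y * p x)) = a * of_real (tint \<Lambda> p * tint \<Lambda> q)"
proof -
  have r: "tint \<Lambda> (\<lambda>x. complex_of_real (f x)) = of_real (tint \<Lambda> f)" for f
    unfolding tint_def by (rule set_integral_complex_of_real)
  have "tint \<Lambda> (\<lambda>y. a * of_real (q y * p x)) = a * of_real (tint \<Lambda> q) * of_real (p x)" for x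
    using tint_mult[of \<Lambda> "a * of_real (p x)" "\<lambda>y. of_real (q y)"] by (simp add: r mult_ac)
  hence "dtint \<Lambda> (\<lambda>x y. a * of_real (q y * p x)) = tint \<Lambda> (\<lambda>x. a * of_real (tint \<Lambda> q) * of_real (p x))"
    by (simp add: dtint_def)
  also have "\<dots> = a * of_real (tint \<Lambda> q) * tint \<Lambda> (\<lambda>x. of_real (p x))"
    by (rule tint_mult)
  finally show ?thesis by (simp add: r mult_ac)
qed

lemma dtint_diff:
  assumes "cont2 \<phi>" "cont2 \<psi>"
  shows "dtint \<Lambda> (\<lambda>x y. \<phi> x y - \<psi> x y) = dtint \<Lambda> \<phi> - dtint \<Lambda> \<psi>"
  using assms by (simp add: dtint_def tint_diff cont2_D)

text \<open>Only the masses of \<open>p\<close> and \<open>q\<close> enter, not their heights: the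
  approximate delta functions are unbounded as \<open>\<epsilon>\<close> tends to 0.\<close>

lemma norm_dtint_le:
  assumes \<phi>: "cont2 \<phi>" and p: "continuous_on UNIV p" "\<And>x. 0 \<le> p x" "tint \<Lambda> p \<le> P"
    and q: "continuous_on UNIV q" "\<And>x. 0 \<le> q x" "tint \<Lambda> q \<le> Q"
    and K: "0 \<le> K" "\<And>x y. x \<in> cbox (- \<Lambda>) \<Lambda> \<Longrightarrow> y \<in> cbox (- \<Lambda>) \<Lambda> \<Longrightarrow> norm (\<phi> x y) \<le> K * (q y * p x)"
  shows "norm (dtint \<Lambda> \<phi>) \<le> K * (P * Q)"
proof -
  have "norm (dtint \<Lambda> \<phi>) \<le> tint \<Lambda> (\<lambda>x. K * Q * p x)"
    unfolding dtint_def
  proof (rule norm_tint_le_tint)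
    fix x assume x: "x \<in> cbox (- \<Lambda>) \<Lambda>"
    have "norm (tint \<Lambda> (\<phi> x)) \<le> tint \<Lambda> (\<lambda>y. K * p x * q y)"
      by (rule norm_tint_le_tint) (use K(2)[OF x] in \<open>auto intro!: continuous_intros cont2_D \<phi> q simp: mult_ac\<close>)
    also have "\<dots> \<le> K * p x * Q"
      unfolding tint_mult by (intro mult_left_mono q mult_nonneg_nonneg K p)
    finally show "norm (tint \<Lambda> (\<phi> x)) \<le> K * Q * p x" by (simp add: mult_ac)
  qed (intro continuous_intros cont2_D \<phi> p)+
  also have "\<dots> \<le> K * Q * P"
  proof -
    have "0 \<le> tint \<Lambda> q" by (intro tint_nonneg q)
    hence "0 \<le> Q" using q(3) by linarith
    thus ?thesis unfolding tint_mult by (intro mult_left_mono p mult_nonneg_nonneg K)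
  qed
  finally show ?thesis by (simp add: mult_ac)
qed

lemma continuous_on_dtint:
  assumes "continuous_on UNIV (\<lambda>(t, x, y). \<phi> t x y)"
  shows "continuous_on UNIV (\<lambda>t. dtint \<Lambda> (\<phi> t))"
proof -
  have "continuous_on UNIV (\<lambda>(s, y). case_prod \<phi> s y)"
    using continuous_on_compose2[OF assms, of UNIV "\<lambda>p. (fst (fst p), snd (fst p), snd p)"]
    by (force intro!: continuous_intros simp: case_prod_unfold)
  hence "continuous_on UNIV (\<lambda>(t, x). tint \<Lambda> (\<phi> t x))"
    using continuous_on_tint[of "case_prod \<phi>" \<Lambda>] by (simp add: case_prod_unfold)
  thus ?thesis unfolding dtint_def by (rule continuous_on_tint)
qed

lemma tendsto_del:
  assumes "\<And>u N'. u \<in> set N \<Longrightarrow> set N' \<subseteq> set N \<Longrightarrow> ((\<lambda>n. \<phi> n u N') \<longlongrightarrow> \<psi> u N') F"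
  shows "((\<lambda>n. del (\<phi> n) N) \<longlongrightarrow> del \<psi> N) F"
  unfolding del_def by (intro tendsto_intros assms) (auto intro!: set_delete_nth)

text \<open>Removals never introduce new points, so convergence of the kernel at points of
  \<open>S\<close> is enough for lists over \<open>S\<close>.\<close>

lemma tendsto_del4_power:
  assumes "\<And>u4 u3 u2 u1. {snd u4, snd u3, snd u2, snd u1} \<subseteq> S \<Longrightarrow>
      ((\<lambda>n. \<kappa> n u4 u3 u2 u1) \<longlongrightarrow> \<kappa>0 u4 u3 u2 u1) F"
    and "points_in S N"
  shows "((\<lambda>n. (del4 (\<kappa> n) ^^ k) at_zero N) \<longlongrightarrow> (del4 \<kappa>0 ^^ k) at_zero N) F"
  using assms(2)
proof (induction k arbitrary: N)
  case (Suc k)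
  show ?case
    unfolding funpow.simps comp_apply del4_def[of _ "(del4 _ ^^ k) at_zero"]
  proof (intro tendsto_del tendsto_mult assms(1) Suc.IH)
    fix u4 N4 u3 N3 u2 N2 u1 N1
    assume *: "u4 \<in> set N" "set N4 \<subseteq> set N" "u3 \<in> set N4" "set N3 \<subseteq> set N4" "u2 \<in> set N3"
      "set N2 \<subseteq> set N3" "u1 \<in> set N2" "set N1 \<subseteq> set N2"
    have P: "\<And>u. u \<in> set N \<Longrightarrow> snd u \<in> S" using Suc.prems by (auto simp: points_in_def)
    have "u3 \<in> set N" "u2 \<in> set N" "u1 \<in> set N" "set N1 \<subseteq> set N" using * by blast+
    thus "{snd u4, snd u3, snd u2, snd u1} \<subseteq> S" "points_in S N1"
      using P *(1) by (auto simp: points_in_def)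
  qed
qed auto

lemma norm_del_le:
  assumes "\<And>u N'. u \<in> set N \<Longrightarrow> set N' \<subseteq> set N \<Longrightarrow> Suc (length N') = length N \<Longrightarrow> norm (\<phi> u N') \<le> b"
  shows "norm (del \<phi> N) \<le> real (length N) * b"
proof -
  have "norm (del \<phi> N) \<le> (\<Sum>p<length N. b)"
    unfolding del_def by (intro sum_norm_le) (auto simp: norm_mult norm_power intro!: assms set_delete_nth)
  thus ?thesis by simp
qed

lemma norm_del4_le:
  assumes \<kappa>: "\<And>u4 u3 u2 u1. {u4, u3, u2, u1} \<subseteq> set N \<Longrightarrow> norm (\<kappa> u4 u3 u2 u1) \<le> K" "0 \<le> K"
    and E: "\<And>N'. set N' \<subseteq> set N \<Longrightarrow> length N' = length N - 4 \<Longrightarrow> norm (E N') \<le> b" "0 \<le> b"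
  shows "norm (del4 \<kappa> E N) \<le> real (length N) ^ 4 * (K * b)"
proof -
  let ?l = "real (length N)"
  have le: "real m * t \<le> ?l * t" if "m \<le> length N" "0 \<le> t" for m t
    using that by (intro mult_right_mono) auto
  have nn: "0 \<le> K * b" "0 \<le> ?l * (K * b)" "0 \<le> ?l * (?l * (K * b))" using \<kappa>(2) E(2) by auto
  have "norm (del4 \<kappa> E N) \<le> ?l * (?l * (?l * (?l * (K * b))))"
    unfolding del4_def
  proof (rule norm_del_le)
    fix u4 N4 assume 4: "u4 \<in> set N" "set N4 \<subseteq> set N" "Suc (length N4) = length N"
    show "norm (del (\<lambda>u3. del (\<lambda>u2. del (\<lambda>u1 N. \<kappa> u4 u3 u2 u1 * E N))) N4) \<le> ?l * (?l * (?l * (K * b)))"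
    proof (rule order.trans[OF norm_del_le le])
      fix u3 N3 assume 3: "u3 \<in> set N4" "set N3 \<subseteq> set N4" "Suc (length N3) = length N4"
      show "norm (del (\<lambda>u2. del (\<lambda>u1 N. \<kappa> u4 u3 u2 u1 * E N)) N3) \<le> ?l * (?l * (K * b))"
      proof (rule order.trans[OF norm_del_le le])
        fix u2 N2 assume 2: "u2 \<in> set N3" "set N2 \<subseteq> set N3" "Suc (length N2) = length N3"
        show "norm (del (\<lambda>u1 N. \<kappa> u4 u3 u2 u1 * E N) N2) \<le> ?l * (K * b)"
        proof (rule order.trans[OF norm_del_le le])
          fix u1 N1 assume 1: "u1 \<in> set N2" "set N1 \<subseteq> set N2" "Suc (length N1) = length N2"
          have "{u4, u3, u2, u1} \<subseteq> set N" "set N1 \<subseteq> set N" "length N1 = length N - 4"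
            using 1 2 3 4 by auto
          thus "norm (\<kappa> u4 u3 u2 u1 * E N1) \<le> K * b"
            unfolding norm_mult by (intro mult_mono \<kappa> E) auto
        qed (use 2 3 4 nn in auto)
      qed (use 3 4 nn in auto)
    qed (use 4 nn in auto)
  qed
  thus ?thesis by (simp add: power4_eq_xxxx mult.assoc)
qed

text \<open>Four removals from a list of length \<open>l\<close> have at most \<open>l ^ 4\<close>
  terms, each with a list shorter by four. If \<open>l < 4\<close> there are no terms, so the
  truncated \<open>l - 4\<close> is harmless.\<close>

lemma bounded_del4_power:
  assumes "\<And>n u4 u3 u2 u1. {snd u4, snd u3, snd u2, snd u1} \<subseteq> S \<Longrightarrow> norm (\<kappa> n u4 u3 u2 u1) \<le> K" "0 \<le> K"
  shows "\<exists>B\<ge>0. \<forall>n N. length N = l \<longrightarrow> points_in S N \<longrightarrow> norm ((del4 (\<kappa> n) ^^ k) at_zero N) \<le> B"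
proof (induction k arbitrary: l)
  case 0
  show ?case by (intro exI[of _ 1]) (auto simp: at_zero_def)
next
  case (Suc k)
  obtain B where B: "B \<ge> 0"
    "\<And>n N. length N = l - 4 \<Longrightarrow> points_in S N \<Longrightarrow> norm ((del4 (\<kappa> n) ^^ k) at_zero N) \<le> B"
    using Suc by blast
  have "norm ((del4 (\<kappa> n) ^^ Suc k) at_zero N) \<le> real l ^ 4 * (K * B)" if N: "length N = l" "points_in S N" for n N
  proof -
    have "norm (del4 (\<kappa> n) ((del4 (\<kappa> n) ^^ k) at_zero) N) \<le> real (length N) ^ 4 * (K * B)"
    proof (rule norm_del4_le)
      fix u4 u3 u2 u1 assume "{u4, u3, u2, u1} \<subseteq> set N"
      thus "norm (\<kappa> n u4 u3 u2 u1) \<le> K"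
        using N(2) by (intro assms(1)) (auto simp: points_in_def)
    next
      fix N' assume "set N' \<subseteq> set N" "length N' = length N - 4"
      thus "norm ((del4 (\<kappa> n) ^^ k) at_zero N') \<le> B"
        using N by (intro B(2)) (auto simp: points_in_def)
    qed (use B(1) assms(2) in auto)
    thus ?thesis by (simp add: N(1))
  qed
  thus ?case using B(1) assms(2) by (intro exI[of _ "real l ^ 4 * (K * B)"]) auto
qed

context cutoffs
begin

text \<open>The contractions of one composite boson at \<open>x\<close>, its \<open>psi_of\<close>
  field going to the vertex \<open>z\<close> and its \<open>h_of\<close> field to
  \<open>z'\<close>.\<close>

definition pair_weight :: "real \<Rightarrow> real ^ 4 \<Rightarrow> real ^ 4 \<Rightarrow> real ^ 4 \<Rightarrow> real" where
  "pair_weight \<epsilon> z z' x = two_psi \<epsilon> (x - z) * two_h \<epsilon> (x - z')"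

definition pair_integral where
  "pair_integral \<epsilon> \<phi> z4 z3 z2 z1 = dtint \<Lambda> (\<lambda>x y. \<phi> x y * of_real (pair_weight \<epsilon> z4 z3 y * pair_weight \<epsilon> z2 z1 x))"

lemma continuous_pair_weight:
  assumes "small \<epsilon>" "continuous_on UNIV a" "continuous_on UNIV b" "continuous_on UNIV c"
  shows "continuous_on UNIV (\<lambda>t. pair_weight \<epsilon> (a t) (b t) (c t))"
  unfolding pair_weight_def
  by (intro continuous_intros assms continuous_on_compose2[OF continuous_two_psi[OF assms(1)]]
      continuous_on_compose2[OF continuous_two_h[OF assms(1)]]) auto

lemma cont2_pair_integral:
  assumes "small \<epsilon>" "cont2 \<phi>"
  shows "cont2 (\<lambda>x y. \<phi> x y * of_real (pair_weight \<epsilon> z4 z3 y * pair_weight \<epsilon> z2 z1 x))"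
  by (rule cont2_intros(2)[OF assms(2)])
     (auto simp: cont2_def case_prod_unfold intro!: continuous_intros continuous_pair_weight assms)

lemma kernel_eq:
  assumes "small \<epsilon>" "\<And>c d. cont2 (C c d)"
  shows "kernel \<Lambda> C (two_point \<Lambda> \<zeta> Z \<epsilon>) u4 u3 u2 u1 = (\<Sum>c\<in>UNIV. \<Sum>d\<in>UNIV. weight c d *
     (if fst u4 = psi_of d \<and> fst u3 = h_of d \<and> fst u2 = psi_of c \<and> fst u1 = h_of c
      then pair_integral \<epsilon> (C c d) (snd u4) (snd u3) (snd u2) (snd u1) else 0))"
proof -
  let ?s = "\<lambda>c d. if fst u4 = psi_of d \<and> fst u3 = h_of d \<and> fst u2 = psi_of c \<and> fst u1 = h_of c then 1 else 0 :: complex"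
  let ?f = "\<lambda>c d x y. C c d x y * of_real (pair_weight \<epsilon> (snd u4) (snd u3) y * pair_weight \<epsilon> (snd u2) (snd u1) x)"
  have g: "weight c d * C c d x y * contract4 (two_point \<Lambda> \<zeta> Z \<epsilon>) c d x y u4 u3 u2 u1 = weight c d * ?s c d * ?f c d x y" for c d x y
    by (simp add: contract4_def contract_def two_point_psi_of two_point_h_of pair_weight_def)
  have "kernel \<Lambda> C (two_point \<Lambda> \<zeta> Z \<epsilon>) u4 u3 u2 u1 = (\<Sum>c\<in>UNIV. \<Sum>d\<in>UNIV. weight c d * ?s c d * dtint \<Lambda> (?f c d))"
    unfolding kernel_def g using cont2_pair_integral[OF assms]
    by (simp add: dtint_sum dtint_mult cont2_intros)
  thus ?thesis by (simp add: pair_integral_def mult.assoc if_distrib[of "\<lambda>t. t * _"] cong: if_cong)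
qed

lemma continuous_kernel:
  assumes "small \<epsilon>" "\<And>c d. cont2 (C c d)"
  shows "continuous_on UNIV (\<lambda>(x4, x3, x2, x1). kernel \<Lambda> C (two_point \<Lambda> \<zeta> Z \<epsilon>) (s4, x4) (s3, x3) (s2, x2) (s1, x1))"
proof -
  have "continuous_on UNIV (\<lambda>p. pair_integral \<epsilon> (C c d) (fst p) (fst (snd p)) (fst (snd (snd p))) (snd (snd (snd p))))" for c d
    unfolding pair_integral_def
    by (rule continuous_on_dtint)
       (unfold case_prod_unfold, intro continuous_intros continuous_pair_weight cont2_compose assms)
  hence "continuous_on UNIV (\<lambda>p. if b then pair_integral \<epsilon> (C c d) (fst p) (fst (snd p)) (fst (snd (snd p))) (snd (snd (snd p))) else 0)" for c d b
    by (cases b) auto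
  thus ?thesis
    unfolding kernel_eq[OF assms] case_prod_unfold fst_conv snd_conv
    by (intro continuous_intros)
qed

lemma cont2_bounded:
  assumes "cont2 \<phi>"
  shows "\<exists>M\<ge>0. \<forall>x\<in>cbox (- \<Lambda>) \<Lambda>. \<forall>y\<in>cbox (- \<Lambda>) \<Lambda>. norm (\<phi> x y) \<le> M"
proof -
  have "compact ((\<lambda>(x, y). \<phi> x y) ` (cbox (- \<Lambda>) \<Lambda> \<times> cbox (- \<Lambda>) \<Lambda>))"
    by (intro compact_continuous_image compact_Times compact_cbox continuous_on_subset[OF assms[unfolded cont2_def]]) auto
  then obtain M where M: "\<And>x y. x \<in> cbox (- \<Lambda>) \<Lambda> \<Longrightarrow> y \<in> cbox (- \<Lambda>) \<Lambda> \<Longrightarrow> norm (\<phi> x y) \<le> M"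
    using compact_imp_bounded[THEN bounded_iff[THEN iffD1]] by fastforce
  show ?thesis
    by (intro exI[of _ "\<bar>M\<bar>"]) (auto intro: order.trans[OF M])
qed

text \<open>\<open>two_h\<close> is bounded and \<open>two_psi\<close> has bounded mass, uniformly
  in \<open>\<epsilon>\<close> and up to the boundary; this is the source of the dominating
  constants.\<close>

lemma pair_integral_bounded:
  assumes \<phi>: "cont2 \<phi>"
  shows "\<exists>K\<ge>0. \<forall>\<epsilon> z4 z3 z2 z1. small \<epsilon> \<longrightarrow> {z4, z3, z2, z1} \<subseteq> cbox (- \<Lambda>) \<Lambda> \<longrightarrow>
     norm (pair_integral \<epsilon> \<phi> z4 z3 z2 z1) \<le> K"
proof -
  obtain B where B: "B \<ge> 0" "\<And>\<epsilon> x. \<bar>plateau \<epsilon> x\<bar> \<le> B"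
    using plateau_bounded by blast
  obtain M where M: "M \<ge> 0" "\<And>x y. x \<in> cbox (- \<Lambda>) \<Lambda> \<Longrightarrow> y \<in> cbox (- \<Lambda>) \<Lambda> \<Longrightarrow> norm (\<phi> x y) \<le> M"
    using cont2_bounded[OF \<phi>] by blast
  define N where "N = real (card (int_cube 3))"
  have N: "0 \<le> N" by (simp add: N_def)
  have "norm (pair_integral \<epsilon> \<phi> z4 z3 z2 z1) \<le> M * ((B * N) * (B * N)) * (N * N)"
    if \<epsilon>: "small \<epsilon>" and z: "{z4, z3, z2, z1} \<subseteq> cbox (- \<Lambda>) \<Lambda>" for \<epsilon> z4 z3 z2 z1
    unfolding pair_integral_def
  proof (rule norm_dtint_le[OF cont2_pair_integral[OF \<epsilon> \<phi>], where p="\<lambda>x. two_psi \<epsilon> (x - z2)" and q="\<lambda>x. two_psi \<epsilon> (x - z4)"])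
    have w: "\<bar>pair_weight \<epsilon> z z' x\<bar> \<le> B * N * two_psi \<epsilon> (x - z)"
      if "z' \<in> cbox (- \<Lambda>) \<Lambda>" "x \<in> cbox (- \<Lambda>) \<Lambda>" for z z' x
    proof -
      have "\<bar>(x - z') $ i\<bar> \<le> 2 * \<Lambda> $ i" for i
        using that[unfolded mem_torus, THEN spec, of i] unfolding vector_minus_component by linarith
      from two_h_bound[OF \<epsilon> B(2) this] have "\<bar>two_h \<epsilon> (x - z')\<bar> \<le> B * N" by (simp add: N_def)
      from mult_right_mono[OF this two_psi_nonneg[OF \<epsilon>]] show ?thesis
        by (simp add: pair_weight_def abs_mult two_psi_nonneg[OF \<epsilon>] mult.commute)
    qed
    fix x y assume x: "x \<in> cbox (- \<Lambda>) \<Lambda>" and y: "y \<in> cbox (- \<Lambda>) \<Lambda>"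
    have "norm (\<phi> x y * of_real (pair_weight \<epsilon> z4 z3 y * pair_weight \<epsilon> z2 z1 x)) = norm (\<phi> x y) * (\<bar>pair_weight \<epsilon> z4 z3 y\<bar> * \<bar>pair_weight \<epsilon> z2 z1 x\<bar>)"
      by (simp add: norm_mult abs_mult)
    also have "\<dots> \<le> M * ((B * N * two_psi \<epsilon> (y - z4)) * (B * N * two_psi \<epsilon> (x - z2)))"
      using z x y B(1) N by (intro mult_mono M w mult_nonneg_nonneg two_psi_nonneg[OF \<epsilon>]) auto
    finally show "norm (\<phi> x y * of_real (pair_weight \<epsilon> z4 z3 y * pair_weight \<epsilon> z2 z1 x))
      \<le> M * ((B * N) * (B * N)) * (two_psi \<epsilon> (y - z4) * two_psi \<epsilon> (x - z2))"
      by (simp add: mult_ac)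
  next
    show "continuous_on UNIV (\<lambda>x. two_psi \<epsilon> (x - z))" for z
      by (intro continuous_on_compose2[OF continuous_two_psi[OF \<epsilon>]] continuous_intros) auto
    thus "continuous_on UNIV (\<lambda>x. two_psi \<epsilon> (x - z))" for z .
    show "tint \<Lambda> (\<lambda>x. two_psi \<epsilon> (x - z2)) \<le> N" "tint \<Lambda> (\<lambda>x. two_psi \<epsilon> (x - z4)) \<le> N"
      unfolding N_def using z by (intro tint_two_psi_le[OF \<epsilon>]; simp)+
  qed (use two_psi_nonneg[OF \<epsilon>] M(1) B(1) N in auto)
  thus ?thesis using M(1) B(1) N
    by (intro exI[of _ "M * ((B * N) * (B * N)) * (N * N)"]) auto
qed

lemma kernel_bounded:
  fixes C :: "'l::finite comp \<Rightarrow> 'l comp \<Rightarrow> real ^ 4 \<Rightarrow> real ^ 4 \<Rightarrow> complex"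
  assumes C: "\<And>c d. cont2 (C c d)"
  shows "\<exists>K\<ge>0. \<forall>\<epsilon> u4 u3 u2 u1. small \<epsilon> \<longrightarrow> {snd u4, snd u3, snd u2, snd u1} \<subseteq> cbox (- \<Lambda>) \<Lambda> \<longrightarrow>
     norm (kernel \<Lambda> C (two_point \<Lambda> \<zeta> Z \<epsilon>) u4 u3 u2 u1) \<le> K"
proof -
  obtain K where K: "\<And>c d. K c d \<ge> 0"
    "\<And>c d \<epsilon> z4 z3 z2 z1. small \<epsilon> \<Longrightarrow> {z4, z3, z2, z1} \<subseteq> cbox (- \<Lambda>) \<Lambda> \<Longrightarrow> norm (pair_integral \<epsilon> (C c d) z4 z3 z2 z1) \<le> K c d"
    using pair_integral_bounded[OF C] by metis
  let ?K = "\<Sum>c\<in>UNIV. \<Sum>d\<in>UNIV. norm (weight c d) * K c d"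
  have "norm (kernel \<Lambda> C (two_point \<Lambda> \<zeta> Z \<epsilon>) u4 u3 u2 u1) \<le> ?K"
    if "small \<epsilon>" "{snd u4, snd u3, snd u2, snd u1} \<subseteq> cbox (- \<Lambda>) \<Lambda>" for \<epsilon> u4 u3 u2 u1
    unfolding kernel_eq[OF that(1) C]
    by (intro sum_norm_le) (auto simp: norm_mult K(1) intro!: mult_left_mono K(2) that)
  moreover have "?K \<ge> 0" by (intro sum_nonneg mult_nonneg_nonneg K) auto
  ultimately show ?thesis by blast
qed

lemma eventually_interior:
  assumes "z \<in> box (- \<Lambda>) \<Lambda>"
  shows "eventually (\<lambda>\<epsilon>. \<forall>i. \<bar>z $ i\<bar> + 10 * \<epsilon> \<le> \<Lambda> $ i) (at_right 0)"
proof -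
  have "eventually (\<lambda>\<epsilon>. \<bar>z $ i\<bar> + 10 * \<epsilon> \<le> \<Lambda> $ i) (at_right 0)" for i
    using assms[unfolded mem_box_torus, rule_format, of i]
      eventually_at_right_real[of 0 "(\<Lambda> $ i - \<bar>z $ i\<bar>) / 10"]
    by (auto elim!: eventually_mono simp: field_simps)
  thus ?thesis by (simp add: eventually_all_finite)
qed

text \<open>The two supports have radii \<open>\<epsilon>\<close> and \<open>5 * \<epsilon>\<close>
  and are disjoint once \<open>6 * \<epsilon>\<close> is below the distance of the vertices in some
  coordinate.\<close>

lemma pair_weight_far:
  assumes z: "z \<in> box (- \<Lambda>) \<Lambda>" "z' \<in> box (- \<Lambda>) \<Lambda>" "z \<noteq> z'"
  shows "eventually (\<lambda>\<epsilon>. \<forall>x\<in>cbox (- \<Lambda>) \<Lambda>. pair_weight \<epsilon> z z' x = 0) (at_right 0)"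
proof -
  obtain i where i: "z $ i \<noteq> z' $ i" using z(3) by (auto simp: vec_eq_iff)
  have "eventually (\<lambda>\<epsilon>. \<epsilon> \<in> {0<..<\<bar>z $ i - z' $ i\<bar> / 6}) (at_right 0)"
    using i by (intro eventually_at_right_real) simp
  with eventually_small eventually_interior[OF z(1)] eventually_interior[OF z(2)]
  show ?thesis
  proof eventually_elim
    case (elim \<epsilon>)
    show ?case
    proof (rule ballI, rule ccontr)
      fix x assume x: "x \<in> cbox (- \<Lambda>) \<Lambda>" "pair_weight \<epsilon> z z' x \<noteq> 0"
      have "\<bar>x $ i - z $ i\<bar> \<le> \<epsilon>" "\<bar>x $ i - z' $ i\<bar> \<le> 5 * \<epsilon>"
        using x elim by (auto simp: pair_weight_def intro!: two_psi_support two_h_support)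
      moreover have "6 * \<epsilon> < \<bar>z $ i - z' $ i\<bar>" using elim by auto
      ultimately show False by linarith
    qed
  qed
qed

text \<open>For small \<open>\<epsilon>\<close> the integrand vanishes identically on the torus, so
  no estimate is involved.\<close>

lemma tendsto_pair_integral_far:
  assumes "z4 \<in> box (- \<Lambda>) \<Lambda>" "z3 \<in> box (- \<Lambda>) \<Lambda>" "z2 \<in> box (- \<Lambda>) \<Lambda>" "z1 \<in> box (- \<Lambda>) \<Lambda>"
    and "z4 \<noteq> z3 \<or> z2 \<noteq> z1"
  shows "((\<lambda>\<epsilon>. pair_integral \<epsilon> \<phi> z4 z3 z2 z1) \<longlongrightarrow> 0) (at_right 0)"
proof (rule tendsto_eventually)
  have z: "pair_integral \<epsilon> \<phi> z4 z3 z2 z1 = 0"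
    if "(\<forall>x\<in>cbox (- \<Lambda>) \<Lambda>. pair_weight \<epsilon> z4 z3 x = 0) \<or> (\<forall>x\<in>cbox (- \<Lambda>) \<Lambda>. pair_weight \<epsilon> z2 z1 x = 0)" for \<epsilon>
  proof -
    have "pair_integral \<epsilon> \<phi> z4 z3 z2 z1 = dtint \<Lambda> (\<lambda>x y. 0)"
      unfolding pair_integral_def by (rule dtint_cong) (use that in auto)
    thus ?thesis by (simp add: dtint_def)
  qed
  from assms(5) show "eventually (\<lambda>\<epsilon>. pair_integral \<epsilon> \<phi> z4 z3 z2 z1 = 0) (at_right 0)"
  proof
    assume "z4 \<noteq> z3"
    from pair_weight_far[OF assms(1,2) this] show ?thesis by (rule eventually_mono) (blast intro: z)
  next
    assume "z2 \<noteq> z1"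
    from pair_weight_far[OF assms(3,4) this] show ?thesis by (rule eventually_mono) (blast intro: z)
  qed
qed

text \<open>By \<open>two_psi_two_h\<close> the weights collapse to \<open>two_psi\<close>, which is
  nonnegative of mass 1 and concentrates at the vertex; the rest is continuity of
  \<open>\<phi>\<close>.\<close>

lemma tendsto_pair_integral_near:
  assumes \<phi>: "cont2 \<phi>" and z: "z \<in> box (- \<Lambda>) \<Lambda>" "z' \<in> box (- \<Lambda>) \<Lambda>"
  shows "((\<lambda>\<epsilon>. pair_integral \<epsilon> \<phi> z' z' z z) \<longlongrightarrow> \<phi> z z') (at_right 0)"
proof (rule tendstoI)
  fix \<eta> :: real assume \<eta>: "\<eta> > 0"
  have "isCont (\<lambda>(x, y). \<phi> x y) (z, z')"
    using \<phi> by (auto simp: cont2_def continuous_on_eq_continuous_at)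
  then obtain d where d: "d > 0" "\<And>x y. dist (x, y) (z, z') < d \<Longrightarrow> norm (\<phi> x y - \<phi> z z') < \<eta> / 2"
    using \<eta> unfolding continuous_at_eps_delta dist_norm[symmetric]
    by (metis (no_types, lifting) case_prod_conv half_gt_zero_iff)
  \<comment> \<open>Four coordinates within \<open>\<epsilon>\<close> give distance at most
    \<open>4 * \<epsilon>\<close> for each of \<open>x\<close> and \<open>y\<close>, hence
    \<open>8 * \<epsilon>\<close> for the pair.\<close>
  have "eventually (\<lambda>\<epsilon>. \<epsilon> \<in> {0<..<d / 8}) (at_right 0)"
    using d(1) by (intro eventually_at_right_real) simp
  with eventually_small eventually_interior[OF z(1)] eventually_interior[OF z(2)]
  show "eventually (\<lambda>\<epsilon>. dist (pair_integral \<epsilon> \<phi> z' z' z z) (\<phi> z z') < \<eta>) (at_right 0)"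
  proof eventually_elim
    case (elim \<epsilon>)
    note \<epsilon> = elim(1) and iz = elim(2)[rule_format] and iz' = elim(3)[rule_format]
    let ?p = "\<lambda>x. two_psi \<epsilon> (x - z)" and ?q = "\<lambda>x. two_psi \<epsilon> (x - z')"
    have cp: "continuous_on UNIV ?p" "continuous_on UNIV ?q"
      by (intro continuous_on_compose2[OF continuous_two_psi[OF \<epsilon>]] continuous_intros; simp)+
    have tp: "tint \<Lambda> ?p = 1" "tint \<Lambda> ?q = 1"
      by (intro tint_two_psi_interior[OF \<epsilon>] iz iz')+
    have c: "cont2 (\<lambda>x y. \<psi> x y * of_real (?q y * ?p x))" if "cont2 \<psi>" for \<psi>
      by (rule cont2_intros(2)[OF that])
         (auto simp: cont2_def case_prod_unfold intro!: continuous_intros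
            continuous_on_compose2[OF continuous_two_psi[OF \<epsilon>]])
    have "pair_integral \<epsilon> \<phi> z' z' z z = dtint \<Lambda> (\<lambda>x y. \<phi> x y * of_real (?q y * ?p x))"
      unfolding pair_integral_def pair_weight_def
      by (rule dtint_cong) (simp add: two_psi_two_h[OF \<epsilon>] iz iz')
    moreover have "\<phi> z z' = dtint \<Lambda> (\<lambda>x y. \<phi> z z' * of_real (?q y * ?p x))"
      unfolding dtint_product tp by simp
    ultimately have "pair_integral \<epsilon> \<phi> z' z' z z - \<phi> z z' =
       dtint \<Lambda> (\<lambda>x y. \<phi> x y * of_real (?q y * ?p x)) - dtint \<Lambda> (\<lambda>x y. \<phi> z z' * of_real (?q y * ?p x))"
      by simp
    also have "\<dots> = dtint \<Lambda> (\<lambda>x y. \<phi> x y * of_real (?q y * ?p x) - \<phi> z z' * of_real (?q y * ?p x))"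
      by (rule dtint_diff[symmetric]) (intro c \<phi> cont2_intros)+
    finally have eq: "pair_integral \<epsilon> \<phi> z' z' z z - \<phi> z z' =
        dtint \<Lambda> (\<lambda>x y. (\<phi> x y - \<phi> z z') * of_real (?q y * ?p x))"
      by (simp only: left_diff_distrib)
    have "norm (dtint \<Lambda> (\<lambda>x y. (\<phi> x y - \<phi> z z') * of_real (?q y * ?p x))) \<le> \<eta> / 2 * (1 * 1)"
    proof (rule norm_dtint_le[where p="?p" and q="?q"])
      have "cont2 (\<lambda>x y. \<phi> x y - \<phi> z z')"
        using \<phi> by (auto simp: cont2_def case_prod_unfold intro!: continuous_intros)
      thus "cont2 (\<lambda>x y. (\<phi> x y - \<phi> z z') * of_real (?q y * ?p x))" by (rule c)
      fix x y assume xy: "x \<in> cbox (- \<Lambda>) \<Lambda>" "y \<in> cbox (- \<Lambda>) \<Lambda>"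
      show "norm ((\<phi> x y - \<phi> z z') * of_real (?q y * ?p x)) \<le> \<eta> / 2 * (?q y * ?p x)"
      proof (cases "?q y * ?p x = 0")
        case False
        have dl: "dist v w \<le> 4 * \<epsilon>" if "\<And>i. \<bar>v $ i - w $ i\<bar> \<le> \<epsilon>" for v w :: "real ^ 4"
        proof -
          have "dist v w \<le> (\<Sum>i\<in>UNIV. \<bar>(v - w) $ i\<bar>)" unfolding dist_norm by (rule norm_le_l1_cart)
          also have "\<dots> \<le> (\<Sum>i\<in>(UNIV :: 4 set). \<epsilon>)" by (intro sum_mono) (use that in simp)
          finally show ?thesis by simp
        qed
        have "dist x z \<le> 4 * \<epsilon>" "dist y z' \<le> 4 * \<epsilon>"
          using False xy by (auto intro!: dl two_psi_support[OF \<epsilon>] iz iz')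
        moreover have "dist (x, y) (z, z') \<le> dist x z + dist y z'"
          unfolding dist_prod_def by (simp add: sqrt_sum_squares_le_sum)
        ultimately have "dist (x, y) (z, z') < d" using elim(4) by auto
        from d(2)[OF this] have "norm (\<phi> x y - \<phi> z z') * (?q y * ?p x) \<le> \<eta> / 2 * (?q y * ?p x)"
          by (intro mult_right_mono mult_nonneg_nonneg two_psi_nonneg[OF \<epsilon>]) simp
        thus ?thesis by (simp add: norm_mult abs_mult two_psi_nonneg[OF \<epsilon>])
      qed auto
    qed (use cp tp two_psi_nonneg[OF \<epsilon>] \<eta> in auto)
    thus ?case using \<eta> by (simp add: dist_norm eq)
  qed
qed

lemma tendsto_kernel:
  assumes C: "\<And>c d. cont2 (C c d)" and "{snd u4, snd u3, snd u2, snd u1} \<subseteq> box (- \<Lambda>) \<Lambda>"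
  shows "((\<lambda>\<epsilon>. kernel \<Lambda> C (two_point \<Lambda> \<zeta> Z \<epsilon>) u4 u3 u2 u1) \<longlongrightarrow> limit_kernel C u4 u3 u2 u1) (at_right 0)"
proof -
  have z: "snd u4 \<in> box (- \<Lambda>) \<Lambda>" "snd u3 \<in> box (- \<Lambda>) \<Lambda>" "snd u2 \<in> box (- \<Lambda>) \<Lambda>" "snd u1 \<in> box (- \<Lambda>) \<Lambda>"
    using assms(2) by auto
  have *: "((\<lambda>\<epsilon>. if fst u4 = psi_of d \<and> fst u3 = h_of d \<and> fst u2 = psi_of c \<and> fst u1 = h_of c
      then pair_integral \<epsilon> (C c d) (snd u4) (snd u3) (snd u2) (snd u1) else 0) \<longlongrightarrow>
      match d u4 u3 * (match c u2 u1 * C c d (snd u2) (snd u4))) (at_right 0)" for c d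
  proof (cases "snd u4 = snd u3 \<and> snd u2 = snd u1")
    case True
    thus ?thesis
      using tendsto_pair_integral_near[OF C[of c d] z(3,1)] by (auto simp: match_def)
  next
    case False
    hence zero: "match d u4 u3 * (match c u2 u1 * C c d (snd u2) (snd u4)) = 0"
      by (auto simp: match_def)
    show ?thesis
      unfolding zero
    proof (cases "fst u4 = psi_of d \<and> fst u3 = h_of d \<and> fst u2 = psi_of c \<and> fst u1 = h_of c")
      case True
      from False have "snd u4 \<noteq> snd u3 \<or> snd u2 \<noteq> snd u1" by blast
      from tendsto_pair_integral_far[OF z this] show "((\<lambda>\<epsilon>. if fst u4 = psi_of d \<and> fst u3 = h_of d \<and> fst u2 = psi_of c \<and> fst u1 = h_of c
          then pair_integral \<epsilon> (C c d) (snd u4) (snd u3) (snd u2) (snd u1) else 0) \<longlongrightarrow> 0) (at_right 0)"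
        by (simp only: if_P[OF True])
    next
      case F: False
      show "((\<lambda>\<epsilon>. if fst u4 = psi_of d \<and> fst u3 = h_of d \<and> fst u2 = psi_of c \<and> fst u1 = h_of c
          then pair_integral \<epsilon> (C c d) (snd u4) (snd u3) (snd u2) (snd u1) else 0) \<longlongrightarrow> 0) (at_right 0)"
        by (simp only: if_not_P[OF F] tendsto_const)
    qed
  qed
  have "((\<lambda>\<epsilon>. \<Sum>c\<in>UNIV. \<Sum>d\<in>UNIV. weight c d *
     (if fst u4 = psi_of d \<and> fst u3 = h_of d \<and> fst u2 = psi_of c \<and> fst u1 = h_of c
      then pair_integral \<epsilon> (C c d) (snd u4) (snd u3) (snd u2) (snd u1) else 0)) \<longlongrightarrow> limit_kernel C u4 u3 u2 u1) (at_right 0)"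
    unfolding limit_kernel_def by (intro tendsto_intros *)
  moreover have "eventually (\<lambda>\<epsilon>. (\<Sum>c\<in>UNIV. \<Sum>d\<in>UNIV. weight c d *
     (if fst u4 = psi_of d \<and> fst u3 = h_of d \<and> fst u2 = psi_of c \<and> fst u1 = h_of c
      then pair_integral \<epsilon> (C c d) (snd u4) (snd u3) (snd u2) (snd u1) else 0)) =
      kernel \<Lambda> C (two_point \<Lambda> \<zeta> Z \<epsilon>) u4 u3 u2 u1) (at_right 0)"
    using eventually_small by (rule eventually_mono) (simp only: kernel_eq[OF _ C])
  ultimately show ?thesis by (rule Lim_transform_eventually)
qed

lemma wick_bars: "wick (contraction \<Lambda> \<zeta> Z \<epsilon>) (map bar N) = at_zero N"
proof (cases N)
  case (Cons u N')
  have "sum_list (map charge (map bar N)) = int (length N)" for N :: "('a species \<times> (real ^ 4)) list"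
    by (induction N) (auto simp: bar_def)
  moreover have "int (length N) \<noteq> 0" by (simp add: Cons)
  ultimately have "sum_list (map charge (map bar N)) \<noteq> 0" by metis
  from wick_charge[OF this] show ?thesis by (simp add: at_zero_def Cons)
qed (simp add: at_zero_def)

text \<open>After all insertions are contracted only conjugates remain, on which \<open>wick\<close>
  is \<open>at_zero\<close>. The regularized moment thus has the shape of its limit and differs from
  it in the kernel alone.\<close>

lemma fermi_moment_eq:
  fixes C :: "'l::finite comp \<Rightarrow> 'l comp \<Rightarrow> real ^ 4 \<Rightarrow> real ^ 4 \<Rightarrow> complex"
  assumes "small \<epsilon>" "\<And>c d. cont2 (C c d)"
  shows "fermi_moment f \<Lambda> C \<zeta> Z \<epsilon> m k =
     (fvertex f \<Lambda> ^^ m) ((del4 (kernel \<Lambda> C (two_point \<Lambda> \<zeta> Z \<epsilon>)) ^^ k) at_zero) []"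
proof -
  have "continuous_on UNIV (two_point \<Lambda> \<zeta> Z \<epsilon> s)" for s :: "'l species"
  proof -
    obtain c where "s = psi_of c \<or> s = h_of c"
    proof (cases s)
      case (Psi_big a)
      thus thesis using that[of "Inl (1, a)"] by simp
    next
      case (Psi_small a)
      thus thesis using that[of "Inr (1, a)"] by simp
    next
      case (H i)
      thus thesis using that[of "Inl (i, undefined)"] by simp
    next
      case (Eta i)
      thus thesis using that[of "Inr (i, undefined)"] by simp
    qed
    thus ?thesis
      using continuous_two_psi[OF assms(1)] continuous_two_h[OF assms(1)]
      by (auto simp: two_point_psi_of two_point_h_of)
  qed
  from fermi_Q_power_wick[OF assms(2) this, where F="[]"]
  have "(fermi_Q \<Lambda> C ^^ k) (wick (contraction \<Lambda> \<zeta> Z \<epsilon>)) (map bar N) =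
    (del4 (kernel \<Lambda> C (two_point \<Lambda> \<zeta> Z \<epsilon>)) ^^ k) at_zero N" for N
    by (simp add: wick_bars)
  thus ?thesis
    unfolding fermi_moment_def using fermi_V_map_bar[of m f \<Lambda> _ "[]"] by simp
qed

lemma tendsto_Xi:
  fixes C :: "'l::finite comp \<Rightarrow> 'l comp \<Rightarrow> real ^ 4 \<Rightarrow> real ^ 4 \<Rightarrow> complex"
  assumes C: "\<And>c d. cont2 (C c d)" and f: "\<And>a b c. f b a c = - f a b c"
  shows "(Xi f \<Lambda> C \<zeta> Z n \<longlongrightarrow> Theta f \<Lambda> C n) (at_right 0)"
proof -
  \<comment> \<open>Dominated convergence works along sequences. Staying below \<open>b\<close>
    makes every member of the sequence \<open>small\<close>, with the factor 10 of that
    definition.\<close>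
  define b where "b = Min (range (($) \<Lambda>)) / 10"
  have b: "b > 0" "\<And>i. 10 * b \<le> \<Lambda> $ i" using pos by (auto simp: b_def)
  let ?k = "3 * n"
  show ?thesis
  proof (rule tendsto_at_right_sequentially[OF b(1)])
    fix S :: "nat \<Rightarrow> real"
    assume S: "\<And>n. 0 < S n" "\<And>n. S n < b" "S \<longlonglongrightarrow> 0"
    have sm: "small (S j)" for j
      unfolding small_def
    proof (intro conjI allI S)
      show "10 * S j \<le> \<Lambda> $ i" for i using S(2)[of j] b(2)[of i] by linarith
    qed
    have S0: "filterlim S (at_right 0) sequentially"
      by (rule tendsto_imp_filterlim_at_right[OF S(3)]) (simp add: S(1))
    let ?K = "\<lambda>j. kernel \<Lambda> C (two_point \<Lambda> \<zeta> Z (S j))"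
    let ?E = "\<lambda>j. (del4 (?K j) ^^ ?k) at_zero"
    have "converges \<Lambda> ?E ((bose_laplacian C ^^ ?k) at_zero)"
      unfolding converges_def
    proof (intro conjI allI impI)
      have "cont_functional ((del4 (?K j) ^^ k) at_zero)" for j k
      proof (induction k)
        case (Suc k)
        show ?case
          unfolding funpow.simps comp_apply by (rule cont_functional_del4, rule continuous_kernel[OF sm C], rule Suc.IH)
      qed (simp add: cont_functional_at_zero)
      thus "cont_functional (?E j)" for j .
      have "cont_functional ((bose_laplacian C ^^ k) at_zero)" for k
      proof (induction k)
        case (Suc k)
        show ?case
          unfolding funpow.simps comp_apply by (rule cont_functional_bose_laplacian[OF C Suc.IH])
      qed (simp add: cont_functional_at_zero)
      thus "cont_functional ((bose_laplacian C ^^ ?k) at_zero)" .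
      obtain K where "K \<ge> 0" "\<And>j u4 u3 u2 u1. {snd u4, snd u3, snd u2, snd u1} \<subseteq> cbox (- \<Lambda>) \<Lambda> \<Longrightarrow>
          norm (?K j u4 u3 u2 u1) \<le> K"
        using kernel_bounded[of C, OF C] sm by metis
      thus "\<exists>B\<ge>0. \<forall>j N. length N = l \<longrightarrow> points_in (cbox (- \<Lambda>) \<Lambda>) N \<longrightarrow> norm (?E j N) \<le> B" for l
        by (intro bounded_del4_power[where K=K])
    next
      fix vs :: "'l vertex list"
      assume vs: "distinct (map point vs)" "set (map point vs) \<subseteq> box (- \<Lambda>) \<Lambda>"
      let ?N = "concat (map fermi_slots vs)"
      have "snd u = point v" if "u \<in> set (fermi_slots v)" for u and v :: "'l vertex"
        using that by (cases v) auto
      hence "snd u \<in> set (map point vs)" if "u \<in> set ?N" for u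
        using that unfolding set_concat set_map by blast
      hence "points_in (box (- \<Lambda>) \<Lambda>) ?N" using vs(2) unfolding points_in_def by blast
      hence "(\<lambda>j. ?E j ?N) \<longlonglongrightarrow> (del4 (limit_kernel C) ^^ ?k) at_zero ?N"
      proof (rule tendsto_del4_power[where S="box (- \<Lambda>) \<Lambda>" and \<kappa>="?K", rotated])
        fix u4 u3 u2 u1 :: "'l species \<times> (real ^ 4)"
        assume "{snd u4, snd u3, snd u2, snd u1} \<subseteq> box (- \<Lambda>) \<Lambda>"
        from filterlim_compose[OF tendsto_kernel[OF C this] S0]
        show "(\<lambda>j. ?K j u4 u3 u2 u1) \<longlonglongrightarrow> limit_kernel C u4 u3 u2 u1" .
      qed
      \<comment> \<open>Here the fermionic limit becomes bosonic; distinctness of the points enters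
        through \<open>pfaff_vertices\<close>.\<close>
      also have "(del4 (limit_kernel C) ^^ ?k) at_zero ?N = alt_vertices vs ((bose_laplacian C ^^ ?k) at_zero)"
        by (simp only: pfaff_bose_laplacian_power[symmetric] pfaff_vertices[OF vs(1)])
      finally show "(\<lambda>j. ?E j ?N) \<longlonglongrightarrow> alt_vertices vs ((bose_laplacian C ^^ ?k) at_zero)" .
    qed
    from converges_power[OF f this, of "2 * n"]
    have "(\<lambda>j. fermi_moment f \<Lambda> C \<zeta> Z (S j) (2 * n) ?k) \<longlonglongrightarrow>
       (bose_vertex f \<Lambda> ^^ (2 * n)) ((bose_laplacian C ^^ ?k) at_zero) []"
      by (simp add: fermi_moment_eq[OF sm C])
    hence "(\<lambda>j. 1 / (fact (2 * n) * fact (3 * n)) * fermi_moment f \<Lambda> C \<zeta> Z (S j) (2 * n) ?k) \<longlonglongrightarrow>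
       1 / (fact (2 * n) * fact (3 * n)) * (bose_vertex f \<Lambda> ^^ (2 * n)) ((bose_laplacian C ^^ ?k) at_zero) []"
      by (rule tendsto_mult_left)
    thus "(\<lambda>j. Xi f \<Lambda> C \<zeta> Z n (S j)) \<longlonglongrightarrow> Theta f \<Lambda> C n"
      by (simp add: Xi_def Theta_eq)
  qed
qed

end

section \<open>Trigonometric polynomials on the torus\<close>

lemma integral_translate:
  fixes g :: "real ^ 4 \<Rightarrow> 'b::{banach, second_countable_topology}"
  assumes "g \<in> borel_measurable borel"
  shows "(\<integral>x. g (x + c) \<partial>lborel) = (\<integral>x. g x \<partial>lborel)"
proof -
  have "(\<integral>x. g x \<partial>lborel) = (\<integral>x. g x \<partial>distr lborel borel ((+) c))"
    by (simp add: lborel_distr_plus)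
  also have "\<dots> = (\<integral>x. g (c + x) \<partial>lborel)"
    using assms by (intro integral_distr) auto
  finally show ?thesis by (simp add: add.commute)
qed

lemma integral_indicator_translate:
  fixes f :: "real ^ 4 \<Rightarrow> 'b::{banach, second_countable_topology}"
  assumes "continuous_on UNIV f" "S \<in> sets borel"
  shows "(\<integral>x. indicator S (x + c) *\<^sub>R f (x + c) \<partial>lborel) = (\<integral>x. indicator S x *\<^sub>R f x \<partial>lborel)"
  by (rule integral_translate[where g="\<lambda>x. indicator S x *\<^sub>R f x"])
     (use assms(2) borel_measurable_continuous_onI[OF assms(1)] in measurable)

text \<open>The shifted box is cut at \<open>\<Lambda> $ i\<close> and the overhanging slab is moved
  back by one period. Half-open boxes make the cut exact; passing to them from the closed box
  changes a null set only.\<close>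

lemma tint_shift:
  fixes f :: "real ^ 4 \<Rightarrow> 'b::{banach, second_countable_topology}"
  assumes per: "periodic \<Lambda> f" and cont: "continuous_on UNIV f" and t: "0 \<le> t" "t \<le> 2 * \<Lambda> $ i"
  shows "tint \<Lambda> (\<lambda>x. f (x + t *\<^sub>R axis i 1)) = tint \<Lambda> f"
proof -
  define up :: "real \<Rightarrow> real \<Rightarrow> 4 \<Rightarrow> real" where "up a b j = (if j = i then a else b)" for a b j
  have up: "up a b i = a" "j \<noteq> i \<Longrightarrow> up a b j = b" for a b j by (auto simp: up_def)
  \<comment> \<open>The torus box with its side in direction \<open>i\<close> replaced by the
    half-open interval from \<open>a\<close> to \<open>b\<close>.\<close>
  define I :: "real \<Rightarrow> real \<Rightarrow> (real ^ 4) set" where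
    "I a b = (\<Inter>j. {x. up a (- \<Lambda> $ j) j \<le> x $ j} \<inter> {x. x $ j < up b (\<Lambda> $ j) j})" for a b
  have I_iff: "x \<in> I a b \<longleftrightarrow> (\<forall>j. up a (- \<Lambda> $ j) j \<le> x $ j \<and> x $ j < up b (\<Lambda> $ j) j)" for x a b
    by (simp add: I_def)
  have I[measurable]: "I a b \<in> sets borel" for a b
    unfolding I_def
  proof (rule sets.finite_INT)
    fix j
    show "{x :: real ^ 4. up a (- \<Lambda> $ j) j \<le> x $ j} \<inter> {x. x $ j < up b (\<Lambda> $ j) j} \<in> sets borel"
      by (rule sets.Int[OF borel_closed[OF closed_halfspace_component_ge_cart]
          borel_open[OF open_halfspace_component_lt_cart]])
  qed simp_all
  have int: "integrable lborel (\<lambda>x. indicator (I a b) x *\<^sub>R f x)" for a b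
  proof -
    have "I a b \<subseteq> cbox (\<chi> j. up a (- \<Lambda> $ j) j) (\<chi> j. up b (\<Lambda> $ j) j)"
    proof (intro subsetI)
      fix x assume "x \<in> I a b"
      hence "up a (- \<Lambda> $ j) j \<le> x $ j" "x $ j \<le> up b (\<Lambda> $ j) j" for j
        unfolding I_iff by (simp_all add: less_imp_le)
      thus "x \<in> cbox (\<chi> j. up a (- \<Lambda> $ j) j) (\<chi> j. up b (\<Lambda> $ j) j)"
        by (simp add: mem_box_cart)
    qed
    from set_integrable_subset[OF set_integrable_continuous[OF cont] _ this]
    show ?thesis unfolding set_integrable_def by simp
  qed
  have split: "(\<integral>x. indicator (I a c) x *\<^sub>R f x \<partial>lborel) =
      (\<integral>x. indicator (I a b) x *\<^sub>R f x \<partial>lborel) + (\<integral>x. indicator (I b c) x *\<^sub>R f x \<partial>lborel)"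
    if "a \<le> b" "b \<le> c" for a b c
  proof -
    have I': "x \<in> I a b \<longleftrightarrow> a \<le> x $ i \<and> x $ i < b \<and> (\<forall>j. j \<noteq> i \<longrightarrow> - \<Lambda> $ j \<le> x $ j \<and> x $ j < \<Lambda> $ j)" for x a b
    proof -
      have "x \<in> I a b \<longleftrightarrow> (\<forall>j. if j = i then a \<le> x $ i \<and> x $ i < b else - \<Lambda> $ j \<le> x $ j \<and> x $ j < \<Lambda> $ j)"
        unfolding I_iff by (intro all_cong1) (simp add: up_def)
      thus ?thesis by (metis (full_types))
    qed
    have *: "(a \<le> t \<and> t < c \<and> P) = (a \<le> t \<and> t < b \<and> P \<or> b \<le> t \<and> t < c \<and> P)"
      "\<not> ((a \<le> t \<and> t < b \<and> P) \<and> b \<le> t \<and> t < c \<and> P)" for t P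
      using that by (cases P; auto)+
    have "x \<in> I a c \<longleftrightarrow> x \<in> I a b \<or> x \<in> I b c" "\<not> (x \<in> I a b \<and> x \<in> I b c)" for x
      unfolding I' by (rule *)+
    hence "indicator (I a c) x = (indicator (I a b) x + indicator (I b c) x :: real)" for x
      by (auto simp: indicator_def)
    hence "(\<lambda>x. indicator (I a c) x *\<^sub>R f x) = (\<lambda>x. indicator (I a b) x *\<^sub>R f x + indicator (I b c) x *\<^sub>R f x)"
      by (simp only: scaleR_add_left)
    thus ?thesis by (simp add: int)
  qed
  let ?B = "I (- \<Lambda> $ i) (\<Lambda> $ i)"
  have B: "?B = {x. \<forall>j. - \<Lambda> $ j \<le> x $ j \<and> x $ j < \<Lambda> $ j}"
  proof -
    have "up (- \<Lambda> $ i) (- \<Lambda> $ j) j = - \<Lambda> $ j" "up (\<Lambda> $ i) (\<Lambda> $ j) j = \<Lambda> $ j" for j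
      by (simp_all add: up_def)
    thus ?thesis by (auto simp: I_iff)
  qed
  have tint_B: "tint \<Lambda> g = (\<integral>x. indicator ?B x *\<^sub>R g x \<partial>lborel)" if g: "continuous_on UNIV g" for g :: "real ^ 4 \<Rightarrow> 'b"
    unfolding tint_def set_lebesgue_integral_def
  proof (rule integral_cong_AE)
    show "AE x in lborel. indicator (cbox (- \<Lambda>) \<Lambda>) x *\<^sub>R g x = indicator ?B x *\<^sub>R g x"
    proof (rule AE_I'[OF null_sets_boundary[of "- \<Lambda>" \<Lambda>]])
      have sub: "box (- \<Lambda>) \<Lambda> \<subseteq> ?B" "?B \<subseteq> cbox (- \<Lambda>) \<Lambda>"
        unfolding B by (auto simp: mem_box_cart less_imp_le)
      show "{x \<in> space lborel. indicator (cbox (- \<Lambda>) \<Lambda>) x *\<^sub>R g x \<noteq> indicator ?B x *\<^sub>R g x}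
          \<subseteq> cbox (- \<Lambda>) \<Lambda> - box (- \<Lambda>) \<Lambda>"
      proof (intro subsetI)
        fix x assume "x \<in> {x \<in> space lborel. indicator (cbox (- \<Lambda>) \<Lambda>) x *\<^sub>R g x \<noteq> indicator ?B x *\<^sub>R g x}"
        hence "(x \<in> cbox (- \<Lambda>) \<Lambda>) \<noteq> (x \<in> ?B)" unfolding indicator_def by (cases "x \<in> cbox (- \<Lambda>) \<Lambda>"; cases "x \<in> ?B"; simp)
        thus "x \<in> cbox (- \<Lambda>) \<Lambda> - box (- \<Lambda>) \<Lambda>" using sub by blast
      qed
    qed
  qed (use borel_measurable_continuous_onI[OF g] in measurable)
  let ?e = "axis i (1 :: real) :: real ^ 4"
  have tr: "x + s *\<^sub>R ?e \<in> I a b \<longleftrightarrow> x \<in> I (a - s) (b - s)" for x s a b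
    unfolding I_iff
  proof (intro all_cong1)
    fix j
    show "(up a (- \<Lambda> $ j) j \<le> (x + s *\<^sub>R ?e) $ j \<and> (x + s *\<^sub>R ?e) $ j < up b (\<Lambda> $ j) j) =
        (up (a - s) (- \<Lambda> $ j) j \<le> x $ j \<and> x $ j < up (b - s) (\<Lambda> $ j) j)"
      by (cases "j = i") (auto simp: up axis_def)
  qed
  have sh: "(\<integral>x. indicator (I a b) x *\<^sub>R f (x + s *\<^sub>R ?e) \<partial>lborel) = (\<integral>x. indicator (I (a + s) (b + s)) x *\<^sub>R f x \<partial>lborel)"
    for a b s
    by (subst integral_indicator_translate[OF cont I, of "a + s" "b + s" "s *\<^sub>R ?e", symmetric])
       (simp add: indicator_def tr)
  have "tint \<Lambda> (\<lambda>x. f (x + t *\<^sub>R ?e)) = (\<integral>x. indicator (I (- \<Lambda> $ i + t) (\<Lambda> $ i + t)) x *\<^sub>R f x \<partial>lborel)"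
    by (subst tint_B) (auto simp: sh intro!: continuous_on_compose2[OF cont] continuous_intros)
  also have "\<dots> = (\<integral>x. indicator (I (- \<Lambda> $ i + t) (\<Lambda> $ i)) x *\<^sub>R f x \<partial>lborel)
      + (\<integral>x. indicator (I (\<Lambda> $ i) (\<Lambda> $ i + t)) x *\<^sub>R f x \<partial>lborel)"
    using t by (intro split) auto
  also have "(\<integral>x. indicator (I (\<Lambda> $ i) (\<Lambda> $ i + t)) x *\<^sub>R f x \<partial>lborel) =
      (\<integral>x. indicator (I (- \<Lambda> $ i) (- \<Lambda> $ i + t)) x *\<^sub>R f (x + (2 * \<Lambda> $ i) *\<^sub>R ?e) \<partial>lborel)"
    by (subst sh) simp
  also have "\<dots> = (\<integral>x. indicator (I (- \<Lambda> $ i) (- \<Lambda> $ i + t)) x *\<^sub>R f x \<partial>lborel)"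
    using per by (simp add: periodic_def)
  also have "(\<integral>x. indicator (I (- \<Lambda> $ i + t) (\<Lambda> $ i)) x *\<^sub>R f x \<partial>lborel) + \<dots> = tint \<Lambda> f"
    using t split[of "- \<Lambda> $ i" "- \<Lambda> $ i + t" "\<Lambda> $ i"] by (simp add: tint_B[OF cont] add.commute)
  finally show ?thesis .
qed

section \<open>Momenta and the kernel of the projection\<close>

definition lattice :: "real ^ 4 \<Rightarrow> (real ^ 4) set" where
  "lattice \<Lambda> = {p. \<forall>i. \<exists>m::int. p $ i = pi / \<Lambda> $ i * real_of_int m}"

definition torus_volume :: "real ^ 4 \<Rightarrow> real" where
  "torus_volume \<Lambda> = (\<Prod>i\<in>UNIV. 2 * \<Lambda> $ i)"

lemma modes_subset_lattice: "modes \<Lambda> \<kappa> \<subseteq> lattice \<Lambda>"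
  by (auto simp: modes_def lattice_def)

lemma modes_mono: "\<kappa> \<le> \<kappa>' \<Longrightarrow> modes \<Lambda> \<kappa> \<subseteq> modes \<Lambda> \<kappa>'"
  by (auto simp: modes_def) (meson less_le_trans)

lemma lattice_minus: "p \<in> lattice \<Lambda> \<Longrightarrow> - p \<in> lattice \<Lambda>"
proof -
  assume p: "p \<in> lattice \<Lambda>"
  have "\<exists>m::int. (- p) $ i = pi / \<Lambda> $ i * real_of_int m" for i
  proof -
    obtain m :: int where "p $ i = pi / \<Lambda> $ i * real_of_int m" using p by (auto simp: lattice_def)
    thus ?thesis by (intro exI[of _ "- m"]) simp
  qed
  thus ?thesis by (simp add: lattice_def)
qed

lemma lattice_add: "p \<in> lattice \<Lambda> \<Longrightarrow> q \<in> lattice \<Lambda> \<Longrightarrow> p + q \<in> lattice \<Lambda>"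
proof -
  assume p: "p \<in> lattice \<Lambda>" and q: "q \<in> lattice \<Lambda>"
  have "\<exists>m::int. (p + q) $ i = pi / \<Lambda> $ i * real_of_int m" for i
  proof -
    obtain m m' :: int where "p $ i = pi / \<Lambda> $ i * real_of_int m" "q $ i = pi / \<Lambda> $ i * real_of_int m'"
      using p q unfolding lattice_def mem_Collect_eq by blast
    thus ?thesis by (intro exI[of _ "m + m'"]) (simp only: vector_add_component of_int_add distrib_left)
  qed
  thus ?thesis by (simp add: lattice_def)
qed

lemma modes_minus: "p \<in> modes \<Lambda> \<kappa> \<Longrightarrow> - p \<in> modes \<Lambda> \<kappa>"
  using lattice_minus[of p \<Lambda>] by (auto simp: modes_def lattice_def)

lemma finite_modes:
  assumes pos: "\<And>i. \<Lambda> $ i > 0"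
  shows "finite (modes \<Lambda> \<kappa>)"
proof -
  define R :: int where "R = (MAX i. \<lceil>\<kappa> * \<Lambda> $ i / pi\<rceil>)"
  have "modes \<Lambda> \<kappa> \<subseteq> (\<lambda>m. \<chi> i. pi / \<Lambda> $ i * real_of_int (m $ i)) ` int_cube R"
  proof
    fix p assume p: "p \<in> modes \<Lambda> \<kappa>"
    then obtain m :: "4 \<Rightarrow> int" where m: "\<And>i. p $ i = pi / \<Lambda> $ i * real_of_int (m i)"
      unfolding modes_def mem_Collect_eq by metis
    have "\<bar>m i\<bar> \<le> R" for i
    proof -
      have "\<bar>p $ i\<bar> < \<kappa>" using p by (simp add: modes_def)
      hence "real_of_int \<bar>m i\<bar> < \<kappa> * \<Lambda> $ i / pi"
        using pos[of i] by (simp add: m abs_mult field_simps)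
      hence "\<bar>m i\<bar> \<le> \<lceil>\<kappa> * \<Lambda> $ i / pi\<rceil>" by linarith
      also have "\<dots> \<le> R" unfolding R_def by (rule Max_ge) auto
      finally show ?thesis .
    qed
    hence "vec_lambda m \<in> int_cube R" by (simp add: int_cube_def)
    moreover have "p = (\<chi> i. pi / \<Lambda> $ i * real_of_int (vec_lambda m $ i))" by (simp add: vec_eq_iff m)
    ultimately show "p \<in> (\<lambda>m. \<chi> i. pi / \<Lambda> $ i * real_of_int (m $ i)) ` int_cube R" by blast
  qed
  thus ?thesis by (rule finite_subset) (intro finite_imageI finite_int_cube)
qed

lemma tint_const:
  assumes pos: "\<And>i. \<Lambda> $ i > 0"
  shows "tint \<Lambda> (\<lambda>x. c) = torus_volume \<Lambda> *\<^sub>R c"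
proof -
  have "cbox (- \<Lambda>) \<Lambda> \<noteq> {}" using pos by (auto simp: interval_ne_empty_cart less_imp_le intro: order.trans[of _ 0])
  hence "measure lborel (cbox (- \<Lambda>) \<Lambda>) = torus_volume \<Lambda>"
    by (simp add: content_cbox_cart torus_volume_def)
  moreover have "has_bochner_integral lborel (\<lambda>x. indicator (cbox (- \<Lambda>) \<Lambda>) x *\<^sub>R c)
      (measure lborel (cbox (- \<Lambda>) \<Lambda>) *\<^sub>R c)"
    by (rule has_bochner_integral_indicator, simp, rule emeasure_lborel_cbox_finite)
  ultimately show ?thesis
    unfolding tint_def set_lebesgue_integral_def by (simp only: has_bochner_integral_integral_eq)
qed

lemma cos_periodic:
  assumes pos: "\<And>i. \<Lambda> $ i > 0" and p: "p \<in> lattice \<Lambda>"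
  shows "periodic \<Lambda> (\<lambda>x. cos (p \<bullet> x + \<theta>))"
  unfolding periodic_def
proof (intro allI)
  fix x i
  obtain m :: int where m: "p $ i = pi / \<Lambda> $ i * real_of_int m" using p by (auto simp: lattice_def)
  have "p \<bullet> (x + (2 * \<Lambda> $ i) *\<^sub>R axis i 1) + \<theta> = (p \<bullet> x + \<theta>) + 2 * pi * real_of_int m"
    using pos[of i] by (simp add: inner_add_right inner_axis m field_simps)
  thus "cos (p \<bullet> (x + (2 * \<Lambda> $ i) *\<^sub>R axis i 1) + \<theta>) = cos (p \<bullet> x + \<theta>)"
    by (simp only: cos_add[of "p \<bullet> x + \<theta>" "2 * pi * real_of_int m"] cos_int_2pin sin_int_2pin
        mult_1_right mult_zero_right diff_zero)
qed

text \<open>A translation by half a wavelength reverses the sign of the cosine and preserves the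
  integral.\<close>

lemma tint_cos:
  assumes pos: "\<And>i. \<Lambda> $ i > 0" and p: "p \<in> lattice \<Lambda>"
  shows "tint \<Lambda> (\<lambda>x. cos (p \<bullet> x + \<theta>)) = (if p = 0 then torus_volume \<Lambda> * cos \<theta> else 0)"
proof (cases "p = 0")
  case True
  thus ?thesis by (simp add: tint_const[OF pos])
next
  case False
  then obtain i where i: "p $ i \<noteq> 0" by (auto simp: vec_eq_iff)
  obtain m :: int where m: "p $ i = pi / \<Lambda> $ i * real_of_int m" using p by (auto simp: lattice_def)
  have m0: "m \<noteq> 0" using i m by auto
  \<comment> \<open>Half a wavelength: \<open>p $ i * ?t\<close> is \<open>pi\<close> up to sign. It
    stays below one period because \<open>m\<close> is a nonzero integer.\<close>
  let ?t = "\<Lambda> $ i / \<bar>real_of_int m\<bar>"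
  have c: "continuous_on UNIV (\<lambda>x. cos (p \<bullet> x + \<theta>))" by (intro continuous_intros)
  have "1 \<le> \<bar>real_of_int m\<bar>" using m0 by linarith
  hence "?t \<le> \<Lambda> $ i" using pos[of i] by (simp add: divide_le_eq)
  hence t: "0 \<le> ?t" "?t \<le> 2 * \<Lambda> $ i" using pos[of i] by auto
  have "cos (p \<bullet> (x + ?t *\<^sub>R axis i 1) + \<theta>) = - cos (p \<bullet> x + \<theta>)" for x
  proof -
    have "p \<bullet> (x + ?t *\<^sub>R axis i 1) + \<theta> = (p \<bullet> x + \<theta>) + sgn (real_of_int m) * pi"
      using pos[of i] m0 by (simp add: inner_add_right inner_axis m sgn_if abs_if)
    thus ?thesis using m0 by (simp only:) (simp add: sgn_if cos_add cos_diff)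
  qed
  hence "- tint \<Lambda> (\<lambda>x. cos (p \<bullet> x + \<theta>)) = tint \<Lambda> (\<lambda>x. cos (p \<bullet> x + \<theta>))"
    using tint_shift[OF cos_periodic[OF pos p, of \<theta>] c t] tint_mult[of \<Lambda> "- 1" "\<lambda>x. cos (p \<bullet> x + \<theta>)"]
    by simp
  thus ?thesis using False by simp
qed

text \<open>After the addition formula only \<open>p = q\<close> and \<open>p = - q\<close> survive,
  each with half the amplitude; both belong to \<open>modes\<close> by symmetry. For
  \<open>q = 0\<close> they coincide and the two halves still add up.\<close>

lemma tint_chi_cut_cos:
  assumes pos: "\<And>i. \<Lambda> $ i > 0" and q: "q \<in> modes \<Lambda> \<kappa>"
  shows "tint \<Lambda> (\<lambda>y. chi_cut \<Lambda> \<kappa> (x - y) * cos (q \<bullet> y + \<theta>)) = cos (q \<bullet> x + \<theta>)"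
proof -
  have vol: "torus_volume \<Lambda> > 0" unfolding torus_volume_def using pos by (intro prod_pos) auto
  have q': "- q \<in> modes \<Lambda> \<kappa>" by (rule modes_minus[OF q])
  have ql: "q \<in> lattice \<Lambda>" using q modes_subset_lattice by auto
  have "chi_cut \<Lambda> \<kappa> (x - y) * cos (q \<bullet> y + \<theta>) = 1 / (2 * torus_volume \<Lambda>) *
     (\<Sum>p\<in>modes \<Lambda> \<kappa>. cos ((q - p) \<bullet> y + (p \<bullet> x + \<theta>)) + cos ((- q - p) \<bullet> y + (p \<bullet> x - \<theta>)))" for y
  proof -
    have c: "cos (p \<bullet> (x - y)) * cos (q \<bullet> y + \<theta>) =
      1 / 2 * (cos ((q - p) \<bullet> y + (p \<bullet> x + \<theta>)) + cos ((- q - p) \<bullet> y + (p \<bullet> x - \<theta>)))" for p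
      by (subst cos_times_cos) (simp add: inner_diff_left inner_diff_right algebra_simps)
    have "chi_cut \<Lambda> \<kappa> (x - y) * cos (q \<bullet> y + \<theta>) =
        (\<Sum>p\<in>modes \<Lambda> \<kappa>. cos (p \<bullet> (x - y)) * cos (q \<bullet> y + \<theta>)) / torus_volume \<Lambda>"
      unfolding chi_cut_def torus_volume_def by (simp only: times_divide_eq_left sum_distrib_right)
    thus ?thesis
      by (simp only: c sum_distrib_left[symmetric]) simp
  qed
  hence "tint \<Lambda> (\<lambda>y. chi_cut \<Lambda> \<kappa> (x - y) * cos (q \<bullet> y + \<theta>)) = 1 / (2 * torus_volume \<Lambda>) *
     tint \<Lambda> (\<lambda>y. \<Sum>p\<in>modes \<Lambda> \<kappa>. cos ((q - p) \<bullet> y + (p \<bullet> x + \<theta>)) + cos ((- q - p) \<bullet> y + (p \<bullet> x - \<theta>)))"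
    by (simp only: tint_mult)
  also have "\<dots> = 1 / (2 * torus_volume \<Lambda>) * (\<Sum>p\<in>modes \<Lambda> \<kappa>.
     (if p = q then torus_volume \<Lambda> * cos (p \<bullet> x + \<theta>) else 0) + (if p = - q then torus_volume \<Lambda> * cos (p \<bullet> x - \<theta>) else 0))"
  proof (intro arg_cong2[where f="(*)"] refl)
    have L: "q - p \<in> lattice \<Lambda>" "- q - p \<in> lattice \<Lambda>" if "p \<in> modes \<Lambda> \<kappa>" for p
    proof -
      have "- p \<in> lattice \<Lambda>" using that modes_subset_lattice lattice_minus by blast
      from lattice_add[OF ql this] lattice_add[OF lattice_minus[OF ql] this]
      show "q - p \<in> lattice \<Lambda>" "- q - p \<in> lattice \<Lambda>" by simp_all
    qed
    have "tint \<Lambda> (\<lambda>y. \<Sum>p\<in>modes \<Lambda> \<kappa>. cos ((q - p) \<bullet> y + (p \<bullet> x + \<theta>)) + cos ((- q - p) \<bullet> y + (p \<bullet> x - \<theta>))) =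
      (\<Sum>p\<in>modes \<Lambda> \<kappa>. tint \<Lambda> (\<lambda>y. cos ((q - p) \<bullet> y + (p \<bullet> x + \<theta>))) + tint \<Lambda> (\<lambda>y. cos ((- q - p) \<bullet> y + (p \<bullet> x - \<theta>))))"
      by (subst tint_sum) (auto intro!: continuous_intros sum.cong tint_add)
    also have "\<dots> = (\<Sum>p\<in>modes \<Lambda> \<kappa>.
      (if p = q then torus_volume \<Lambda> * cos (p \<bullet> x + \<theta>) else 0) + (if p = - q then torus_volume \<Lambda> * cos (p \<bullet> x - \<theta>) else 0))"
    proof (intro sum.cong refl)
      fix p assume p: "p \<in> modes \<Lambda> \<kappa>"
      have "q - p = 0 \<longleftrightarrow> p = q" "- q - p = 0 \<longleftrightarrow> p = - q" by auto
      thus "tint \<Lambda> (\<lambda>y. cos ((q - p) \<bullet> y + (p \<bullet> x + \<theta>))) + tint \<Lambda> (\<lambda>y. cos ((- q - p) \<bullet> y + (p \<bullet> x - \<theta>))) =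
        (if p = q then torus_volume \<Lambda> * cos (p \<bullet> x + \<theta>) else 0) + (if p = - q then torus_volume \<Lambda> * cos (p \<bullet> x - \<theta>) else 0)"
        by (simp only: tint_cos[OF pos L(1)[OF p]] tint_cos[OF pos L(2)[OF p]])
    qed
    finally show "tint \<Lambda> (\<lambda>y. \<Sum>p\<in>modes \<Lambda> \<kappa>. cos ((q - p) \<bullet> y + (p \<bullet> x + \<theta>)) + cos ((- q - p) \<bullet> y + (p \<bullet> x - \<theta>))) = \<dots>" .
  qed
  also have "\<dots> = cos (q \<bullet> x + \<theta>)"
  proof -
    have "cos (- q \<bullet> x - \<theta>) = cos (q \<bullet> x + \<theta>)"
    proof -
      have "- q \<bullet> x - \<theta> = - (q \<bullet> x + \<theta>)" by simp
      thus ?thesis by (simp only: cos_minus)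
    qed
    moreover have "(\<Sum>p\<in>modes \<Lambda> \<kappa>. (if p = q then torus_volume \<Lambda> * cos (p \<bullet> x + \<theta>) else 0)
        + (if p = - q then torus_volume \<Lambda> * cos (p \<bullet> x - \<theta>) else 0)) =
        torus_volume \<Lambda> * cos (q \<bullet> x + \<theta>) + torus_volume \<Lambda> * cos (- q \<bullet> x - \<theta>)"
      by (simp only: sum.distrib sum.delta[OF finite_modes[OF pos]] q q' if_True)
    ultimately show ?thesis using vol by (simp only:) simp
  qed
  finally show ?thesis .
qed

text \<open>
  A trigonometric polynomial is given by the list of its terms. Phases instead of sines keep the
  class closed under differentiation term by term.
\<close>

definition trig :: "((real ^ 4) \<times> real \<times> 'b::real_vector) list \<Rightarrow> real ^ 4 \<Rightarrow> 'b" where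
  "trig xs x = (\<Sum>(p, \<theta>, v)\<leftarrow>xs. cos (p \<bullet> x + \<theta>) *\<^sub>R v)"

definition trig_on :: "(real ^ 4) set \<Rightarrow> (real ^ 4 \<Rightarrow> 'b::real_vector) \<Rightarrow> bool" where
  "trig_on P f \<longleftrightarrow> (\<exists>xs. fst ` set xs \<subseteq> P \<and> f = trig xs)"

lemma trig_simps [simp]:
  "trig [] x = 0" "trig ((p, \<theta>, v) # xs) x = cos (p \<bullet> x + \<theta>) *\<^sub>R v + trig xs x"
  by (simp_all add: trig_def)

lemma trig_append: "trig (xs @ ys) x = trig xs x + trig ys x"
  by (simp add: trig_def)

lemma trig_on_mono: "trig_on P f \<Longrightarrow> P \<subseteq> P' \<Longrightarrow> trig_on P' f"
  unfolding trig_on_def by blast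

lemma trig_on_zero: "trig_on P (\<lambda>x. 0)"
  unfolding trig_on_def by (intro exI[of _ "[]"]) auto

lemma trig_on_term: "p \<in> P \<Longrightarrow> trig_on P (\<lambda>x. cos (p \<bullet> x + \<theta>) *\<^sub>R v)"
  unfolding trig_on_def by (intro exI[of _ "[(p, \<theta>, v)]"]) auto

lemma trig_on_add: "trig_on P f \<Longrightarrow> trig_on P g \<Longrightarrow> trig_on P (\<lambda>x. f x + g x)"
  unfolding trig_on_def
proof (elim exE conjE)
  fix xs ys assume "fst ` set xs \<subseteq> P" "f = trig xs" "fst ` set ys \<subseteq> P" "g = trig ys"
  thus "\<exists>zs. fst ` set zs \<subseteq> P \<and> (\<lambda>x. f x + g x) = trig zs"
    by (intro exI[of _ "xs @ ys"]) (auto simp: trig_append)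
qed

lemma trig_on_linear:
  assumes "trig_on P f" "linear L"
  shows "trig_on P (\<lambda>x. L (f x))"
proof -
  obtain xs where xs: "fst ` set xs \<subseteq> P" "f = trig xs" using assms(1) by (auto simp: trig_on_def)
  have "L (trig xs x) = trig (map (\<lambda>(p, \<theta>, v). (p, \<theta>, L v)) xs) x" for x
    by (induction xs) (auto simp: linear_0 linear_add linear_scale assms(2))
  hence "(\<lambda>x. L (f x)) = trig (map (\<lambda>(p, \<theta>, v). (p, \<theta>, L v)) xs)" by (simp add: xs)
  moreover have "fst ` set (map (\<lambda>(p, \<theta>, v). (p, \<theta>, L v)) xs) = fst ` set xs"
    by (induction xs) auto
  ultimately show ?thesis unfolding trig_on_def using xs(1) by metis
qed

lemma trig_on_sum:
  assumes "\<And>i. i \<in> S \<Longrightarrow> trig_on P (f i)"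
  shows "trig_on P (\<lambda>x. \<Sum>i\<in>S. f i x)"
  using assms by (induction S rule: infinite_finite_induct) (auto intro: trig_on_zero trig_on_add)

text \<open>Differentiation turns the phase by \<open>pi / 2\<close> and puts the momentum factor
  into the coefficient, so the set of momenta is preserved.\<close>

definition dtrig :: "real ^ 4 \<Rightarrow> ((real ^ 4) \<times> real \<times> 'b::real_vector) list \<Rightarrow> ((real ^ 4) \<times> real \<times> 'b) list" where
  "dtrig h xs = map (\<lambda>(p, \<theta>, v). (p, \<theta> + pi / 2, (p \<bullet> h) *\<^sub>R v)) xs"

lemma has_derivative_trig:
  fixes xs :: "((real ^ 4) \<times> real \<times> 'b::real_normed_vector) list"
  shows "(trig xs has_derivative (\<lambda>h. trig (dtrig h xs) x)) (at x)"
proof (induction xs)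
  case Nil
  show ?case by (simp add: trig_def[abs_def] dtrig_def)
next
  case (Cons t xs)
  obtain p \<theta> v where t: "t = (p, \<theta>, v)" by (cases t) auto
  have "((\<lambda>x. cos (p \<bullet> x + \<theta>)) has_derivative (\<lambda>h. - sin (p \<bullet> x + \<theta>) * (p \<bullet> h))) (at x)"
    by (auto intro!: derivative_eq_intros)
  from has_derivative_add[OF has_derivative_scaleR_left[OF this, of v] Cons.IH]
  have "((\<lambda>x. cos (p \<bullet> x + \<theta>) *\<^sub>R v + trig xs x) has_derivative
     (\<lambda>h. (- sin (p \<bullet> x + \<theta>) * (p \<bullet> h)) *\<^sub>R v + trig (dtrig h xs) x)) (at x)" .
  moreover have "trig (t # xs) = (\<lambda>x. cos (p \<bullet> x + \<theta>) *\<^sub>R v + trig xs x)"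
    by (simp add: t fun_eq_iff)
  moreover have "cos (p \<bullet> x + (\<theta> + pi / 2)) = - sin (p \<bullet> x + \<theta>)"
    by (simp add: cos_add sin_add)
  ultimately show ?case by (simp add: t dtrig_def)
qed

lemma frechet_derivative_trig: "frechet_derivative (trig xs) (at x) h = trig (dtrig h xs) x"
  by (rule fun_cong[OF frechet_derivative_at[OF has_derivative_trig], symmetric])

lemma partial_deriv_trig: "partial_deriv i (trig xs) = trig (dtrig (axis i 1) xs)"
  by (simp add: fun_eq_iff partial_deriv_def frechet_derivative_trig)

lemma fst_dtrig: "fst ` set (dtrig h xs) = fst ` set xs"
  unfolding dtrig_def by (induction xs) auto

lemma trig_on_partial_deriv: "trig_on P f \<Longrightarrow> trig_on P (partial_deriv i f)"
  unfolding trig_on_def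
proof (elim exE conjE)
  fix xs assume "fst ` set xs \<subseteq> P" "f = trig xs"
  thus "\<exists>ys. fst ` set ys \<subseteq> P \<and> partial_deriv i f = trig ys"
    by (intro exI[of _ "dtrig (axis i 1) xs"]) (simp add: fst_dtrig partial_deriv_trig)
qed

lemma smooth_trig: "smooth (trig xs)"
  unfolding smooth_def
proof (intro allI impI)
  fix bs :: "(real ^ 4) list" and x
  have "\<exists>ys. foldr (\<lambda>b g y. frechet_derivative g (at y) b) bs (trig xs) = trig ys"
  proof (induction bs)
    case (Cons b bs)
    then obtain ys where ys: "foldr (\<lambda>b g y. frechet_derivative g (at y) b) bs (trig xs) = trig ys" by blast
    have "foldr (\<lambda>b g y. frechet_derivative g (at y) b) (b # bs) (trig xs) = trig (dtrig b ys)"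
      unfolding foldr.simps comp_apply ys by (rule ext) (rule frechet_derivative_trig)
    thus ?case by blast
  qed auto
  then obtain ys where ys: "foldr (\<lambda>b g y. frechet_derivative g (at y) b) bs (trig xs) = trig ys" by blast
  show "foldr (\<lambda>b g y. frechet_derivative g (at y) b) bs (trig xs) differentiable (at x)"
    unfolding ys by (rule differentiableI[OF has_derivative_trig])
qed

lemma trig_on_smooth: "trig_on P f \<Longrightarrow> smooth f"
  by (auto simp: trig_on_def smooth_trig)

lemma trig_on_continuous: "trig_on P f \<Longrightarrow> continuous_on UNIV f"
  for f :: "real ^ 4 \<Rightarrow> 'b::real_normed_vector"
  by (rule smooth_imp_continuous[OF trig_on_smooth])

lemma trig_on_has_derivative:
  "trig_on P f \<Longrightarrow> (f has_derivative frechet_derivative f (at x)) (at x)"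
  unfolding trig_on_def
  using frechet_derivative_works[THEN iffD1, OF differentiableI[OF has_derivative_trig]] by blast

lemma trig_on_periodic:
  assumes pos: "\<And>i. \<Lambda> $ i > 0" and f: "trig_on (lattice \<Lambda>) f"
  shows "periodic \<Lambda> f"
proof -
  obtain xs where xs: "fst ` set xs \<subseteq> lattice \<Lambda>" "f = trig xs" using f by (auto simp: trig_on_def)
  have "trig xs (x + (2 * \<Lambda> $ i) *\<^sub>R axis i 1) = trig xs x" for x i
    using xs(1)
  proof (induction xs)
    case (Cons t xs)
    obtain p \<theta> v where t: "t = (p, \<theta>, v)" by (cases t) auto
    have "p \<in> lattice \<Lambda>" using Cons.prems t by simp
    from cos_periodic[OF pos this, of \<theta>, unfolded periodic_def, rule_format, of x i] show ?case
      using Cons unfolding t trig_simps by simp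
  qed simp
  thus ?thesis by (simp add: xs periodic_def)
qed

lemma tint_scaleR_const: "continuous_on UNIV f \<Longrightarrow> tint \<Lambda> (\<lambda>x. f x *\<^sub>R v) = tint \<Lambda> f *\<^sub>R (v :: 'b::euclidean_space)"
  using integral_scaleR_left[of v lborel "\<lambda>x. indicator (cbox (- \<Lambda>) \<Lambda>) x *\<^sub>R f x"]
    set_integrable_continuous[of f "- \<Lambda>" \<Lambda>]
  by (simp add: tint_def set_lebesgue_integral_def set_integrable_def)

text \<open>A term of momentum 0 gets coefficient 0, and every other term has mean zero.\<close>

lemma tint_partial_deriv_trig:
  fixes f :: "real ^ 4 \<Rightarrow> 'b::euclidean_space"
  assumes pos: "\<And>i. \<Lambda> $ i > 0" and f: "trig_on (lattice \<Lambda>) f"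
  shows "tint \<Lambda> (partial_deriv i f) = 0"
proof -
  obtain xs where xs: "fst ` set xs \<subseteq> lattice \<Lambda>" "f = trig xs" using f by (auto simp: trig_on_def)
  have "tint \<Lambda> (trig (dtrig (axis i 1) xs)) = 0"
    using xs(1)
  proof (induction xs)
    case Nil
    show ?case by (simp add: dtrig_def trig_def[abs_def])
  next
    case (Cons t xs)
    obtain p \<theta> v where t: "t = (p, \<theta>, v)" by (cases t) auto
    have eq: "trig (dtrig (axis i 1) (t # xs)) =
       (\<lambda>x. cos (p \<bullet> x + (\<theta> + pi / 2)) *\<^sub>R (p $ i *\<^sub>R v) + trig (dtrig (axis i 1) xs) x)"
      by (simp add: t dtrig_def fun_eq_iff inner_axis)
    have "tint \<Lambda> (trig (dtrig (axis i 1) (t # xs))) =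
        tint \<Lambda> (\<lambda>x. cos (p \<bullet> x + (\<theta> + pi / 2)) *\<^sub>R (p $ i *\<^sub>R v)) + tint \<Lambda> (trig (dtrig (axis i 1) xs))"
      unfolding eq by (intro tint_add continuous_intros smooth_imp_continuous smooth_trig)
    also have "\<dots> = 0"
      using Cons tint_cos[OF pos, of p "\<theta> + pi / 2"]
      by (subst tint_scaleR_const) (auto simp: t intro!: continuous_intros)
    finally show ?case .
  qed
  thus ?thesis by (simp add: xs partial_deriv_trig)
qed

lemma low_modes_trig:
  fixes f :: "real ^ 4 \<Rightarrow> 'b::euclidean_space"
  assumes pos: "\<And>i. \<Lambda> $ i > 0" and f: "trig_on (modes \<Lambda> \<kappa>) f"
  shows "low_modes \<Lambda> \<kappa> f = f"
proof -
  obtain xs where xs: "fst ` set xs \<subseteq> modes \<Lambda> \<kappa>" "f = trig xs" using f by (auto simp: trig_on_def)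
  have chi: "continuous_on UNIV (\<lambda>y. chi_cut \<Lambda> \<kappa> (x - y))" for x
    unfolding chi_cut_def divide_inverse by (intro continuous_intros)
  have "tint \<Lambda> (\<lambda>y. chi_cut \<Lambda> \<kappa> (x - y) *\<^sub>R trig xs y) = trig xs x" for x
    using xs(1)
  proof (induction xs)
    case (Cons t xs)
    obtain p \<theta> v where t: "t = (p, \<theta>, v)" by (cases t) auto
    have "tint \<Lambda> (\<lambda>y. chi_cut \<Lambda> \<kappa> (x - y) *\<^sub>R trig (t # xs) y) =
      tint \<Lambda> (\<lambda>y. (chi_cut \<Lambda> \<kappa> (x - y) * cos (p \<bullet> y + \<theta>)) *\<^sub>R v + chi_cut \<Lambda> \<kappa> (x - y) *\<^sub>R trig xs y)"
      by (simp add: t scaleR_add_right)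
    also have "\<dots> = tint \<Lambda> (\<lambda>y. (chi_cut \<Lambda> \<kappa> (x - y) * cos (p \<bullet> y + \<theta>)) *\<^sub>R v) + tint \<Lambda> (\<lambda>y. chi_cut \<Lambda> \<kappa> (x - y) *\<^sub>R trig xs y)"
      by (intro tint_add continuous_intros smooth_imp_continuous smooth_trig chi)
    also have "\<dots> = trig (t # xs) x"
      using Cons tint_chi_cut_cos[OF pos, of p \<kappa> x \<theta>]
      by (subst tint_scaleR_const) (auto simp: t intro!: continuous_intros chi)
    finally show ?case .
  qed simp
  thus ?thesis by (simp add: xs low_modes_def conv_def fun_eq_iff)
qed

text \<open>Converse to \<open>low_modes_trig\<close>: band-limited fields become explicit
  trigonometric polynomials. Sines are cosines with phase \<open>- (pi / 2)\<close>, and the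
  coefficients are the Fourier integrals of \<open>f\<close>.\<close>

lemma trig_on_low_modes:
  fixes f :: "real ^ 4 \<Rightarrow> 'b::euclidean_space"
  assumes f: "continuous_on UNIV f" and low: "low_modes \<Lambda> \<kappa> f = f"
  shows "trig_on (modes \<Lambda> \<kappa>) f"
proof -
  let ?a = "\<lambda>p. tint \<Lambda> (\<lambda>y. (cos (p \<bullet> y) / torus_volume \<Lambda>) *\<^sub>R f y)"
  let ?b = "\<lambda>p. tint \<Lambda> (\<lambda>y. (sin (p \<bullet> y) / torus_volume \<Lambda>) *\<^sub>R f y)"
  have c: "continuous_on UNIV (\<lambda>y. (cos (p \<bullet> y) / torus_volume \<Lambda>) *\<^sub>R f y)"
    "continuous_on UNIV (\<lambda>y. (sin (p \<bullet> y) / torus_volume \<Lambda>) *\<^sub>R f y)" for p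
    unfolding divide_inverse by (intro continuous_intros f)+
  have sc: "tint \<Lambda> (\<lambda>y. a *\<^sub>R g y) = a *\<^sub>R tint \<Lambda> g" for a and g :: "real ^ 4 \<Rightarrow> 'b"
    by (simp add: tint_def)
  have "f x = (\<Sum>p\<in>modes \<Lambda> \<kappa>. cos (p \<bullet> x + 0) *\<^sub>R ?a p + cos (p \<bullet> x + - (pi / 2)) *\<^sub>R ?b p)" for x
  proof -
    have "f x = tint \<Lambda> (\<lambda>y. chi_cut \<Lambda> \<kappa> (x - y) *\<^sub>R f y)"
      using fun_cong[OF low, of x] by (simp add: low_modes_def conv_def)
    also have "(\<lambda>y. chi_cut \<Lambda> \<kappa> (x - y) *\<^sub>R f y) = (\<lambda>y. \<Sum>p\<in>modes \<Lambda> \<kappa>.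
       cos (p \<bullet> x) *\<^sub>R ((cos (p \<bullet> y) / torus_volume \<Lambda>) *\<^sub>R f y) + sin (p \<bullet> x) *\<^sub>R ((sin (p \<bullet> y) / torus_volume \<Lambda>) *\<^sub>R f y))"
      unfolding chi_cut_def torus_volume_def[symmetric] sum_divide_distrib scaleR_sum_left
      by (intro ext sum.cong refl) (simp add: inner_diff_right cos_diff scaleR_add_left[symmetric] add_divide_distrib)
    also have "tint \<Lambda> \<dots> = (\<Sum>p\<in>modes \<Lambda> \<kappa>. tint \<Lambda> (\<lambda>y.
       cos (p \<bullet> x) *\<^sub>R ((cos (p \<bullet> y) / torus_volume \<Lambda>) *\<^sub>R f y) + sin (p \<bullet> x) *\<^sub>R ((sin (p \<bullet> y) / torus_volume \<Lambda>) *\<^sub>R f y)))"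
      by (intro tint_sum continuous_on_add continuous_on_scaleR continuous_on_const c)
    also have "\<dots> = (\<Sum>p\<in>modes \<Lambda> \<kappa>. cos (p \<bullet> x) *\<^sub>R ?a p + sin (p \<bullet> x) *\<^sub>R ?b p)"
      unfolding sc[symmetric] by (intro sum.cong refl tint_add continuous_on_scaleR continuous_on_const c)
    finally show ?thesis by (simp add: cos_diff)
  qed
  hence eq: "f = (\<lambda>x. \<Sum>p\<in>modes \<Lambda> \<kappa>. cos (p \<bullet> x + 0) *\<^sub>R ?a p + cos (p \<bullet> x + - (pi / 2)) *\<^sub>R ?b p)" by blast
  show ?thesis
    by (subst eq) (intro trig_on_sum trig_on_add trig_on_term)
qed

text \<open>Momenta add under multiplication, so products are taken over the whole lattice and not
  over a fixed set of modes.\<close>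

lemma trig_on_product:
  fixes f g :: "real ^ 4 \<Rightarrow> complex"
  assumes "trig_on (lattice \<Lambda>) f" "trig_on (lattice \<Lambda>) g"
  shows "trig_on (lattice \<Lambda>) (\<lambda>x. f x * g x)"
proof -
  obtain xs ys where xs: "fst ` set xs \<subseteq> lattice \<Lambda>" "f = trig xs" and ys: "fst ` set ys \<subseteq> lattice \<Lambda>" "g = trig ys"
    using assms by (auto simp: trig_on_def)
  have 1: "trig_on (lattice \<Lambda>) (\<lambda>x. cos (p \<bullet> x + \<theta>) *\<^sub>R v * trig ys x)" if p: "p \<in> lattice \<Lambda>" for p \<theta> and v :: complex
    using ys(1)
  proof (induction ys)
    case (Cons t ys)
    obtain q \<eta> w where t: "t = (q, \<eta>, w)" by (cases t) auto
    have q: "q \<in> lattice \<Lambda>" using Cons.prems t by auto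
    have "(\<lambda>x. cos (p \<bullet> x + \<theta>) *\<^sub>R v * trig (t # ys) x) = (\<lambda>x.
       (cos ((p + - q) \<bullet> x + (\<theta> - \<eta>)) *\<^sub>R ((1 / 2) *\<^sub>R (v * w)) + cos ((p + q) \<bullet> x + (\<theta> + \<eta>)) *\<^sub>R ((1 / 2) *\<^sub>R (v * w)))
       + cos (p \<bullet> x + \<theta>) *\<^sub>R v * trig ys x)"
    proof
      fix x
      have "cos (p \<bullet> x + \<theta>) * cos (q \<bullet> x + \<eta>) =
          (cos ((p + - q) \<bullet> x + (\<theta> - \<eta>)) + cos ((p + q) \<bullet> x + (\<theta> + \<eta>))) / 2"
        by (subst cos_times_cos) (simp add: inner_add_left inner_diff_left algebra_simps)
      hence "(cos (p \<bullet> x + \<theta>) *\<^sub>R v) * (cos (q \<bullet> x + \<eta>) *\<^sub>R w) =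
          ((cos ((p + - q) \<bullet> x + (\<theta> - \<eta>)) + cos ((p + q) \<bullet> x + (\<theta> + \<eta>))) / 2) *\<^sub>R (v * w)"
        by (simp add: mult.commute)
      thus "cos (p \<bullet> x + \<theta>) *\<^sub>R v * trig (t # ys) x =
       (cos ((p + - q) \<bullet> x + (\<theta> - \<eta>)) *\<^sub>R ((1 / 2) *\<^sub>R (v * w)) + cos ((p + q) \<bullet> x + (\<theta> + \<eta>)) *\<^sub>R ((1 / 2) *\<^sub>R (v * w)))
       + cos (p \<bullet> x + \<theta>) *\<^sub>R v * trig ys x"
        unfolding t trig_simps distrib_left by (simp add: scaleR_add_left add_divide_distrib)
    qed
    moreover have "trig_on (lattice \<Lambda>) \<dots>"
      using Cons.prems
      by (intro trig_on_add trig_on_term Cons.IH lattice_add lattice_minus p q) simp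
    ultimately show ?case by (simp only:)
  qed (simp add: trig_on_zero)
  have "trig_on (lattice \<Lambda>) (\<lambda>x. trig xs x * trig ys x)"
    using xs(1)
  proof (induction xs)
    case (Cons t xs)
    obtain p \<theta> v where t: "t = (p, \<theta>, v)" by (cases t) auto
    show ?case
      using Cons unfolding t trig_simps distrib_right by (intro trig_on_add 1) auto
  qed (simp add: trig_on_zero)
  thus ?thesis by (simp add: xs ys)
qed

lemma integration_by_parts:
  fixes f g :: "real ^ 4 \<Rightarrow> complex"
  assumes pos: "\<And>i. \<Lambda> $ i > 0" and f: "trig_on (lattice \<Lambda>) f" and g: "trig_on (lattice \<Lambda>) g"
  shows "tint \<Lambda> (\<lambda>x. partial_deriv i f x * g x) = - tint \<Lambda> (\<lambda>x. f x * partial_deriv i g x)"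
proof -
  have eq: "partial_deriv i (\<lambda>x. f x * g x) = (\<lambda>x. partial_deriv i f x * g x + f x * partial_deriv i g x)"
  proof
    fix x
    have "((\<lambda>x. f x * g x) has_derivative
      (\<lambda>h. f x * frechet_derivative g (at x) h + frechet_derivative f (at x) h * g x)) (at x)"
      by (intro has_derivative_mult trig_on_has_derivative[OF f] trig_on_has_derivative[OF g])
    from fun_cong[OF frechet_derivative_at[OF this], of "axis i 1", symmetric]
    show "partial_deriv i (\<lambda>x. f x * g x) x = partial_deriv i f x * g x + f x * partial_deriv i g x"
      unfolding partial_deriv_def by (simp only: add.commute)
  qed
  have "tint \<Lambda> (\<lambda>x. partial_deriv i f x * g x + f x * partial_deriv i g x) = 0"
    using tint_partial_deriv_trig[OF pos trig_on_product[OF f g], of i] unfolding eq .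
  moreover have "tint \<Lambda> (\<lambda>x. partial_deriv i f x * g x + f x * partial_deriv i g x) =
     tint \<Lambda> (\<lambda>x. partial_deriv i f x * g x) + tint \<Lambda> (\<lambda>x. f x * partial_deriv i g x)"
    by (intro tint_add continuous_intros trig_on_continuous[OF f] trig_on_continuous[OF g]
        trig_on_continuous[OF trig_on_partial_deriv[OF f]] trig_on_continuous[OF trig_on_partial_deriv[OF g]])
  ultimately show ?thesis by (simp add: eq_neg_iff_add_eq_0)
qed

lemma partial_deriv_commute: "trig_on P f \<Longrightarrow> partial_deriv i (partial_deriv j f) = partial_deriv j (partial_deriv i f)"
proof -
  assume "trig_on P f"
  then obtain xs where "f = trig xs" by (auto simp: trig_on_def)
  moreover have "dtrig h (dtrig k xs) = dtrig k (dtrig h xs)" for h k and xs :: "((real ^ 4) \<times> real \<times> 'a) list"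
    by (auto simp: dtrig_def mult.commute)
  ultimately show ?thesis by (simp add: partial_deriv_trig)
qed

text \<open>The reproducing formula integrates over the box only, so vanishing there spreads to all
  points.\<close>

lemma trig_on_eq_0:
  fixes f :: "real ^ 4 \<Rightarrow> 'b::euclidean_space"
  assumes pos: "\<And>i. \<Lambda> $ i > 0" and f: "trig_on (modes \<Lambda> \<kappa>) f" and "\<And>x. x \<in> cbox (- \<Lambda>) \<Lambda> \<Longrightarrow> f x = 0"
  shows "f x = 0"
proof -
  have "f x = tint \<Lambda> (\<lambda>y. chi_cut \<Lambda> \<kappa> (x - y) *\<^sub>R f y)"
    using fun_cong[OF low_modes_trig[OF pos f], of x] by (simp add: low_modes_def conv_def)
  also have "\<dots> = tint \<Lambda> (\<lambda>y. 0)" by (rule tint_cong) (simp add: assms(3))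
  finally show ?thesis by simp
qed

section \<open>Orthonormal bases of spaces with a reproducing kernel\<close>

type_synonym 'c cfun = "'c \<Rightarrow> real ^ 4 \<Rightarrow> complex"

definition ip :: "real ^ 4 \<Rightarrow> 'c::finite cfun \<Rightarrow> 'c cfun \<Rightarrow> complex" where
  "ip \<Lambda> u w = (\<Sum>c\<in>UNIV. tint \<Lambda> (\<lambda>x. cnj (u c x) * w c x))"

definition continuous_cfun :: "'c cfun \<Rightarrow> bool" where
  "continuous_cfun u \<longleftrightarrow> (\<forall>c. continuous_on UNIV (u c))"

text \<open>Covers continuous functions as well as \<open>L2_space\<close>, so that pairings with
  continuous fields are additive in both cases.\<close>

definition locally_integrable :: "real ^ 4 \<Rightarrow> 'c cfun \<Rightarrow> bool" where
  "locally_integrable \<Lambda> g \<longleftrightarrow> (\<forall>c h. continuous_on UNIV h \<longrightarrow>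
     set_integrable lborel (cbox (- \<Lambda>) \<Lambda>) (\<lambda>x. h x * g c x))"

definition comb :: "nat \<Rightarrow> (nat \<Rightarrow> 'c cfun) \<Rightarrow> (nat \<Rightarrow> complex) \<Rightarrow> 'c cfun" where
  "comb N b \<gamma> = (\<lambda>c x. \<Sum>n<N. \<gamma> n * b n c x)"

definition lin_closed :: "'c cfun set \<Rightarrow> bool" where
  "lin_closed W \<longleftrightarrow> (\<lambda>c x. 0) \<in> W \<and> (\<forall>u\<in>W. \<forall>w\<in>W. \<forall>s t. (\<lambda>c x. s * u c x + t * w c x) \<in> W)"

definition orthonormal :: "real ^ 4 \<Rightarrow> nat \<Rightarrow> (nat \<Rightarrow> 'c::finite cfun) \<Rightarrow> bool" where
  "orthonormal \<Lambda> N b \<longleftrightarrow> (\<forall>m<N. \<forall>n<N. ip \<Lambda> (b m) (b n) = (if m = n then 1 else 0))"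

lemma tint_add_integrable:
  assumes "set_integrable lborel (cbox (- \<Lambda>) \<Lambda>) f" "set_integrable lborel (cbox (- \<Lambda>) \<Lambda>) g"
  shows "tint \<Lambda> (\<lambda>x. f x + g x) = tint \<Lambda> f + tint \<Lambda> g"
  unfolding tint_def using assms by (rule set_integral_add)

lemma tint_sum_integrable:
  assumes "finite S" "\<And>i. i \<in> S \<Longrightarrow> set_integrable lborel (cbox (- \<Lambda>) \<Lambda>) (f i)"
  shows "tint \<Lambda> (\<lambda>x. \<Sum>i\<in>S. f i x) = (\<Sum>i\<in>S. tint \<Lambda> (f i))"
  using assms
proof (induction S rule: finite_induct)
  case (insert i S)
  have "set_integrable lborel (cbox (- \<Lambda>) \<Lambda>) (\<lambda>x. \<Sum>i\<in>S. f i x)"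
    using insert.prems unfolding set_integrable_def scaleR_sum_right
    by (intro Bochner_Integration.integrable_sum) auto
  thus ?case using insert by (simp add: tint_add_integrable)
qed simp

lemma tint_cnj: "tint \<Lambda> (\<lambda>x. cnj (f x)) = cnj (tint \<Lambda> f)"
  unfolding tint_def set_lebesgue_integral_def complex_cnj_scaleR[symmetric]
  by (rule integral_bounded_linear'[OF bounded_linear_cnj bounded_linear_cnj]) simp

lemma continuous_cfun_locally_integrable: "continuous_cfun g \<Longrightarrow> locally_integrable \<Lambda> g"
  unfolding continuous_cfun_def locally_integrable_def
  by (intro allI impI set_integrable_continuous continuous_intros) auto

lemma locally_integrable_D:
  assumes "locally_integrable \<Lambda> g" "continuous_cfun u"
  shows "set_integrable lborel (cbox (- \<Lambda>) \<Lambda>) (\<lambda>x. cnj (u c x) * g c x)"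
  using assms(1)[unfolded locally_integrable_def, rule_format, of "\<lambda>x. cnj (u c x)"] assms(2)
  by (auto simp: continuous_cfun_def intro: continuous_on_cnj)

lemma continuous_cfun_comb: "(\<And>n. n < N \<Longrightarrow> continuous_cfun (b n)) \<Longrightarrow> continuous_cfun (comb N b \<gamma>)"
  unfolding continuous_cfun_def comb_def by (intro allI continuous_intros) auto

lemma continuous_cfun_lin:
  "continuous_cfun u \<Longrightarrow> continuous_cfun w \<Longrightarrow> continuous_cfun (\<lambda>c x. s * u c x + t * w c x)"
  unfolding continuous_cfun_def by (intro allI continuous_intros) auto

lemma lin_closed_comb:
  assumes "lin_closed W"
  shows "(\<And>n. n < N \<Longrightarrow> b n \<in> W) \<Longrightarrow> comb N b \<gamma> \<in> W"
proof (induction N)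
  case (Suc N)
  hence "comb N b \<gamma> \<in> W" "b N \<in> W" by auto
  hence "(\<lambda>c x. 1 * comb N b \<gamma> c x + \<gamma> N * b N c x) \<in> W"
    using assms unfolding lin_closed_def by blast
  thus ?case by (simp add: comb_def)
qed (use assms in \<open>simp add: comb_def lin_closed_def\<close>)

lemma ip_cnj: "ip \<Lambda> w u = cnj (ip \<Lambda> u w)"
  unfolding ip_def cnj_sum tint_cnj[symmetric] by (simp add: mult.commute)

lemma ip_lin_right:
  assumes "continuous_cfun u" "locally_integrable \<Lambda> g" "locally_integrable \<Lambda> w"
  shows "ip \<Lambda> u (\<lambda>c x. s * g c x + t * w c x) = s * ip \<Lambda> u g + t * ip \<Lambda> u w"
proof -
  have "tint \<Lambda> (\<lambda>x. cnj (u c x) * (s * g c x + t * w c x)) =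
     s * tint \<Lambda> (\<lambda>x. cnj (u c x) * g c x) + t * tint \<Lambda> (\<lambda>x. cnj (u c x) * w c x)" for c
  proof -
    have "(\<lambda>x. cnj (u c x) * (s * g c x + t * w c x)) =
        (\<lambda>x. s * (cnj (u c x) * g c x) + t * (cnj (u c x) * w c x))"
      by (simp add: algebra_simps)
    thus ?thesis
      using locally_integrable_D[OF assms(2,1), of c] locally_integrable_D[OF assms(3,1), of c]
      by (simp only:) (subst tint_add_integrable, auto simp: tint_mult intro: set_integrable_mult_right)
  qed
  thus ?thesis by (simp add: ip_def sum.distrib sum_distrib_left)
qed

lemma ip_diff_right:
  assumes "continuous_cfun u" "locally_integrable \<Lambda> g" "locally_integrable \<Lambda> w"
  shows "ip \<Lambda> u (\<lambda>c x. g c x - w c x) = ip \<Lambda> u g - ip \<Lambda> u w"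
  using ip_lin_right[OF assms, of 1 "- 1"] by simp

lemma ip_comb_right:
  assumes "continuous_cfun u"
  shows "(\<And>n. n < N \<Longrightarrow> continuous_cfun (b n)) \<Longrightarrow> ip \<Lambda> u (comb N b \<gamma>) = (\<Sum>n<N. \<gamma> n * ip \<Lambda> u (b n))"
proof (induction N)
  case (Suc N)
  have "continuous_cfun (comb N b \<gamma>)" "continuous_cfun (b N)"
    using Suc.prems by (auto intro: continuous_cfun_comb)
  hence "ip \<Lambda> u (\<lambda>c x. 1 * comb N b \<gamma> c x + \<gamma> N * b N c x) = 1 * ip \<Lambda> u (comb N b \<gamma>) + \<gamma> N * ip \<Lambda> u (b N)"
    by (intro ip_lin_right assms continuous_cfun_locally_integrable)
  thus ?case using Suc by (simp add: comb_def)
qed (simp add: comb_def ip_def)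

lemma ip_comb_left:
  assumes "locally_integrable \<Lambda> g" "\<And>n. n < N \<Longrightarrow> continuous_cfun (b n)"
  shows "ip \<Lambda> (comb N b \<gamma>) g = (\<Sum>n<N. cnj (\<gamma> n) * ip \<Lambda> (b n) g)"
proof -
  have "tint \<Lambda> (\<lambda>x. cnj (comb N b \<gamma> c x) * g c x) = (\<Sum>n<N. cnj (\<gamma> n) * tint \<Lambda> (\<lambda>x. cnj (b n c x) * g c x))" for c
  proof -
    have "(\<lambda>x. cnj (comb N b \<gamma> c x) * g c x) = (\<lambda>x. \<Sum>n<N. cnj (\<gamma> n) * (cnj (b n c x) * g c x))"
      by (simp add: comb_def sum_distrib_right mult.assoc)
    thus ?thesis
      using locally_integrable_D[OF assms(1) assms(2), of _ c]
      by (simp only:) (subst tint_sum_integrable, auto simp: tint_mult intro: set_integrable_mult_right)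
  qed
  thus ?thesis by (simp add: ip_def sum_distrib_left) (rule sum.swap)
qed

lemma ip_self: "ip \<Lambda> u u = of_real (\<Sum>c\<in>UNIV. tint \<Lambda> (\<lambda>x. (cmod (u c x))\<^sup>2))"
proof -
  have "tint \<Lambda> (\<lambda>x. cnj (u c x) * u c x) = of_real (tint \<Lambda> (\<lambda>x. (cmod (u c x))\<^sup>2))" for c
  proof -
    have "cnj (u c x) * u c x = of_real ((cmod (u c x))\<^sup>2)" for x
      by (simp only: complex_norm_square mult.commute)
    thus ?thesis unfolding tint_def by (simp only: set_integral_complex_of_real)
  qed
  thus ?thesis by (simp add: ip_def)
qed

lemma ip_self_nonneg: "0 \<le> Re (ip \<Lambda> u u)" "Im (ip \<Lambda> u u) = 0"
  unfolding ip_self by (simp_all add: sum_nonneg tint_nonneg)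

lemma tint_eq_0:
  fixes f :: "real ^ 4 \<Rightarrow> real"
  assumes pos: "\<And>i. \<Lambda> $ i > 0" and f: "continuous_on UNIV f" "\<And>x. 0 \<le> f x" "tint \<Lambda> f = 0"
    and x: "x \<in> cbox (- \<Lambda>) \<Lambda>"
  shows "f x = 0"
proof (rule has_integral_0_cbox_imp_0[OF _ _ _ _ x])
  show "continuous_on (cbox (- \<Lambda>) \<Lambda>) f" using f(1) by (rule continuous_on_subset) simp
  hence "f integrable_on (cbox (- \<Lambda>) \<Lambda>)" by (rule integrable_continuous)
  thus "(f has_integral 0) (cbox (- \<Lambda>) \<Lambda>)"
    using f(3) unfolding tint_eq_integral[OF f(1)] by (metis integrable_integral)
  have "0 \<in> box (- \<Lambda>) \<Lambda>" using pos by (simp add: mem_box_torus)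
  thus "box (- \<Lambda>) \<Lambda> \<noteq> {}" by blast
qed (rule f)

lemma ip_self_eq_0:
  fixes u :: "'c::finite cfun"
  assumes pos: "\<And>i. \<Lambda> $ i > 0" and u: "continuous_cfun u" and 0: "ip \<Lambda> u u = 0"
    and x: "x \<in> cbox (- \<Lambda>) \<Lambda>"
  shows "u c x = 0"
proof -
  have "(\<Sum>c\<in>UNIV. tint \<Lambda> (\<lambda>x. (cmod (u c x))\<^sup>2)) = 0"
    using 0 unfolding ip_self by (simp only: of_real_eq_0_iff)
  hence "tint \<Lambda> (\<lambda>x. (cmod (u c x))\<^sup>2) = 0"
    by (subst (asm) sum_nonneg_eq_0_iff) (auto intro: tint_nonneg)
  hence "(cmod (u c x))\<^sup>2 = 0"
    by (rule tint_eq_0[OF pos _ _ _ x, rotated 2])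
       (use u in \<open>auto simp: continuous_cfun_def intro!: continuous_intros\<close>)
  thus ?thesis by simp
qed

lemma bessel:
  assumes on: "orthonormal \<Lambda> N b" and b: "\<And>n. n < N \<Longrightarrow> continuous_cfun (b n)" and G: "continuous_cfun G"
  shows "(\<Sum>n<N. (cmod (ip \<Lambda> (b n) G))\<^sup>2) \<le> Re (ip \<Lambda> G G)"
proof -
  define \<gamma> where "\<gamma> n = ip \<Lambda> (b n) G" for n
  define h where "h = (\<lambda>c x. G c x - comb N b \<gamma> c x)"
  note li = continuous_cfun_locally_integrable
  have cb: "continuous_cfun (comb N b \<gamma>)" by (rule continuous_cfun_comb[OF b])
  have h: "continuous_cfun h"
    using continuous_cfun_lin[OF G cb, of 1 "- 1"] by (simp add: h_def)
  have "ip \<Lambda> (b n) h = 0" if n: "n < N" for n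
  proof -
    have "ip \<Lambda> (b n) (comb N b \<gamma>) = (\<Sum>m<N. \<gamma> m * (if n = m then 1 else 0))"
      using on n by (subst ip_comb_right[OF b[OF n] b]) (auto simp: orthonormal_def)
    also have "\<dots> = \<gamma> n" using n by (simp add: if_distrib[of "(*) _"] cong: if_cong)
    finally show ?thesis
      unfolding h_def by (subst ip_diff_right[OF b[OF n] li[OF G] li[OF cb]]) (simp add: \<gamma>_def)
  qed
  hence "ip \<Lambda> (comb N b \<gamma>) h = 0" by (subst ip_comb_left[OF li[OF h] b]) auto
  hence "ip \<Lambda> h (comb N b \<gamma>) = 0" by (subst ip_cnj) simp
  moreover have "ip \<Lambda> h h = ip \<Lambda> h G - ip \<Lambda> h (comb N b \<gamma>)"
    using ip_diff_right[OF h li[OF G] li[OF cb]] by (simp add: h_def)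
  ultimately have "ip \<Lambda> h h = cnj (ip \<Lambda> G h)" by (subst (asm) (3) ip_cnj) simp
  also have "ip \<Lambda> G h = ip \<Lambda> G G - (\<Sum>n<N. \<gamma> n * cnj (\<gamma> n))"
  proof -
    have "ip \<Lambda> G (b n) = cnj (\<gamma> n)" for n unfolding \<gamma>_def by (rule ip_cnj)
    thus ?thesis
      unfolding h_def by (subst ip_diff_right[OF G li[OF G] li[OF cb]]) (simp add: ip_comb_right[OF G b])
  qed
  finally have "Re (ip \<Lambda> h h) = Re (ip \<Lambda> G G) - (\<Sum>n<N. (cmod (\<gamma> n))\<^sup>2)"
  proof -
    assume *: "ip \<Lambda> h h = cnj (ip \<Lambda> G G - (\<Sum>n<N. \<gamma> n * cnj (\<gamma> n)))"
    have "(\<Sum>n<N. \<gamma> n * cnj (\<gamma> n)) = of_real (\<Sum>n<N. (cmod (\<gamma> n))\<^sup>2)"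
      by (simp only: complex_norm_square of_real_sum)
    thus ?thesis unfolding * by (simp only: complex_cnj_diff minus_complex.sel complex_cnj_complex_of_real complex_cnj cnj.sel Re_complex_of_real)
  qed
  thus ?thesis using ip_self_nonneg(1)[of \<Lambda> h] by (simp add: \<gamma>_def)
qed

text \<open>
  Bessel's inequality for the kernel functions bounds the number of elements of an orthonormal
  family, so that a largest one exists.
\<close>

lemma orthonormal_basis_exists:
  fixes W :: "'c::finite cfun set" and k :: "'c \<Rightarrow> real ^ 4 \<Rightarrow> real"
  assumes pos: "\<And>i. \<Lambda> $ i > 0" and lin: "lin_closed W" and cont: "\<And>u. u \<in> W \<Longrightarrow> continuous_cfun u"
    and k: "\<And>c. continuous_on UNIV (k c)" "\<And>c x. \<bar>k c x\<bar> \<le> K"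
    and rep: "\<And>u c x. u \<in> W \<Longrightarrow> u c x = tint \<Lambda> (\<lambda>y. of_real (k c (x - y)) * u c y)"
  shows "\<exists>N b. orthonormal \<Lambda> N b \<and> (\<forall>n<N. b n \<in> W) \<and> (\<forall>w\<in>W. w = comb N b (\<lambda>n. ip \<Lambda> (b n) w))"
proof -
  note li = continuous_cfun_locally_integrable
  define M where "M = (\<Sum>c\<in>(UNIV :: 'c set). torus_volume \<Lambda> * (torus_volume \<Lambda> * K\<^sup>2))"
  have K: "0 \<le> K" using k(2) by (meson abs_ge_zero order.trans)
  have bound: "real N \<le> M" if on: "orthonormal \<Lambda> N b" and b: "\<And>n. n < N \<Longrightarrow> b n \<in> W" for N b
  proof -
    have pt: "(\<Sum>n<N. (cmod (b n c x))\<^sup>2) \<le> torus_volume \<Lambda> * K\<^sup>2" for c x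
    proof -
      \<comment> \<open>The function that represents evaluation of component \<open>c\<close> at
        \<open>x\<close>; being real, it is its own conjugate.\<close>
      define G :: "'c cfun" where "G c' y = (if c' = c then of_real (k c (x - y)) else 0)" for c' y
      have ck: "continuous_on UNIV (\<lambda>y. k c (x - y))"
        by (intro continuous_on_compose2[OF k(1)] continuous_intros) auto
      have G: "continuous_cfun G"
        unfolding continuous_cfun_def
      proof
        fix c' show "continuous_on UNIV (G c')"
          by (cases "c' = c") (auto simp: G_def[abs_def] intro!: continuous_intros ck)
      qed
      have "ip \<Lambda> G (b n) = b n c x" if "n < N" for n
      proof -
        have "(\<lambda>y. cnj (G c' y) * b n c' y) = (if c' = c then (\<lambda>y. of_real (k c (x - y)) * b n c y) else (\<lambda>y. 0))" for c'
          by (auto simp: G_def)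
        thus ?thesis
          using rep[OF b[OF that], of c x] by (simp add: ip_def if_distrib[of "tint \<Lambda>"] cong: if_cong)
      qed
      hence 1: "cmod (ip \<Lambda> (b n) G) = cmod (b n c x)" if "n < N" for n
        using that by (subst ip_cnj) simp
      have "(\<Sum>n<N. (cmod (b n c x))\<^sup>2) \<le> Re (ip \<Lambda> G G)"
        using bessel[OF on cont[OF b] G] 1 by simp
      also have "\<dots> = tint \<Lambda> (\<lambda>y. (k c (x - y))\<^sup>2)"
      proof -
        have "(\<lambda>y. (cmod (G c' y))\<^sup>2) = (if c' = c then (\<lambda>y. (k c (x - y))\<^sup>2) else (\<lambda>y. 0))" for c'
          by (auto simp: G_def)
        thus ?thesis by (simp add: ip_self if_distrib[of "tint \<Lambda>"] cong: if_cong)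
      qed
      also have "\<dots> \<le> tint \<Lambda> (\<lambda>y. K\<^sup>2)"
        by (intro tint_mono continuous_intros ck) (use k(2) K in \<open>auto simp: abs_le_square_iff[symmetric]\<close>)
      finally show ?thesis by (simp add: tint_const[OF pos])
    qed
    have cc: "continuous_on UNIV (\<lambda>x. (cmod (b n c x))\<^sup>2)" if "n < N" for n c
      using cont[OF b[OF that]] by (auto simp: continuous_cfun_def intro!: continuous_intros)
    have "real N = (\<Sum>n<N. Re (ip \<Lambda> (b n) (b n)))"
      using on by (simp add: orthonormal_def)
    also have "\<dots> = (\<Sum>c\<in>UNIV. tint \<Lambda> (\<lambda>x. \<Sum>n<N. (cmod (b n c x))\<^sup>2))"
      unfolding ip_self Re_complex_of_real
      by (subst sum.swap) (subst tint_sum, auto intro: cc)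
    also have "\<dots> \<le> (\<Sum>c\<in>(UNIV :: 'c set). tint \<Lambda> (\<lambda>x. torus_volume \<Lambda> * K\<^sup>2))"
      by (intro sum_mono tint_mono pt continuous_on_sum continuous_on_const cc) auto
    finally show ?thesis by (simp add: tint_const[OF pos] M_def)
  qed
  define S where "S = {N. \<exists>b. orthonormal \<Lambda> N b \<and> (\<forall>n<N. b n \<in> W)}"
  have fin: "finite S"
  proof (rule finite_subset)
    show "S \<subseteq> {..nat \<lfloor>M\<rfloor>}" using bound unfolding S_def by (auto simp: le_nat_floor)
  qed simp
  have "0 \<in> S" by (simp add: S_def orthonormal_def)
  hence "Max S \<in> S" using fin by (intro Max_in) auto
  then obtain N b where N: "N = Max S" and on: "orthonormal \<Lambda> N b" and b: "\<And>n. n < N \<Longrightarrow> b n \<in> W"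
    by (auto simp: S_def)
  have "w = comb N b (\<lambda>n. ip \<Lambda> (b n) w)" if w: "w \<in> W" for w
  proof -
    let ?\<gamma> = "\<lambda>n. ip \<Lambda> (b n) w"
    define r where "r = (\<lambda>c x. 1 * w c x + (- 1) * comb N b ?\<gamma> c x)"
    have cW: "comb N b ?\<gamma> \<in> W" by (rule lin_closed_comb[OF lin b])
    have r: "r \<in> W" unfolding r_def using lin w cW unfolding lin_closed_def by blast
    have br: "ip \<Lambda> (b n) r = 0" if n: "n < N" for n
    proof -
      have "ip \<Lambda> (b n) (comb N b ?\<gamma>) = (\<Sum>m<N. ?\<gamma> m * (if n = m then 1 else 0))"
        using on n by (subst ip_comb_right[OF cont[OF b[OF n]] cont[OF b]]) (auto simp: orthonormal_def)
      also have "\<dots> = ?\<gamma> n" using n by (simp add: if_distrib[of "(*) _"] cong: if_cong)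
      finally show ?thesis
        unfolding r_def by (subst ip_lin_right[OF cont[OF b[OF n]] li[OF cont[OF w]] li[OF cont[OF cW]]]) simp
    qed
    \<comment> \<open>A nonzero remainder could be normalized and adjoined to the family, against
      the maximality of \<open>N\<close>.\<close>
    have "ip \<Lambda> r r = 0"
    proof (rule ccontr)
      assume nz: "ip \<Lambda> r r \<noteq> 0"
      define s where "s = Re (ip \<Lambda> r r)"
      have s: "ip \<Lambda> r r = of_real s" "s > 0"
        using nz ip_self_nonneg[of \<Lambda> r] by (auto simp: s_def complex_eq_iff less_le)
      define q :: complex where "q = of_real (1 / sqrt s)"
      define r' where "r' = (\<lambda>c x. q * r c x + 0 * r c x)"
      have r': "r' \<in> W" unfolding r'_def using lin r unfolding lin_closed_def by blast
      have lr: "ip \<Lambda> u r' = q * ip \<Lambda> u r" if "continuous_cfun u" for u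
        unfolding r'_def using ip_lin_right[OF that li[OF cont[OF r]] li[OF cont[OF r]], where s=q and t=0] by simp
      have "ip \<Lambda> r' r' = q * cnj (ip \<Lambda> r r')"
        using lr[OF cont[OF r']] ip_cnj[of \<Lambda> r' r] by simp
      also have "\<dots> = q * cnj (q * ip \<Lambda> r r)" using lr[OF cont[OF r]] by simp
      also have "\<dots> = of_real (1 / sqrt s * (1 / sqrt s * s))" by (simp only: q_def s(1) complex_cnj_mult complex_cnj_complex_of_real of_real_mult)
      also have "1 / sqrt s * (1 / sqrt s * s) = 1" using s(2) by (simp add: field_simps)
      finally have rr: "ip \<Lambda> r' r' = 1" by simp
      have br': "ip \<Lambda> (b n) r' = 0" "ip \<Lambda> r' (b n) = 0" if "n < N" for n
        using lr[OF cont[OF b[OF that]]] br[OF that] ip_cnj[of \<Lambda> r' "b n"] by simp_all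
      let ?b = "b(N := r')"
      have "orthonormal \<Lambda> (Suc N) ?b"
        unfolding orthonormal_def
      proof (intro allI impI)
        fix m n assume "m < Suc N" "n < Suc N"
        thus "ip \<Lambda> (?b m) (?b n) = (if m = n then 1 else 0)"
          using on rr br' by (cases "m = N"; cases "n = N") (auto simp: orthonormal_def)
      qed
      moreover have "\<forall>n<Suc N. ?b n \<in> W" using b r' by (auto simp: less_Suc_eq)
      ultimately have "Suc N \<in> S" unfolding S_def by blast
      hence "Suc N \<le> Max S" using fin by (rule Max_ge[rotated])
      thus False using N by simp
    qed
    hence z: "r c y = 0" if "y \<in> cbox (- \<Lambda>) \<Lambda>" for c y
      using ip_self_eq_0[OF pos cont[OF r] _ that] by blast
    have "r c x = 0" for c x
    proof -
      have "r c x = tint \<Lambda> (\<lambda>y. 0)"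
        by (subst rep[OF r]) (rule tint_cong, simp add: z)
      thus ?thesis by simp
    qed
    thus ?thesis by (auto simp: r_def fun_eq_iff)
  qed
  thus ?thesis using on b by blast
qed

section \<open>The complexified field space\<close>

lemma orthonormal_basis_expand:
  assumes "orthonormal_basis e"
  shows "x = (\<Sum>a\<in>UNIV. (x \<bullet> e a) *\<^sub>R e a)"
proof -
  define y where "y = x - (\<Sum>a\<in>UNIV. (x \<bullet> e a) *\<^sub>R e a)"
  have "y \<bullet> e b = 0" for b
    using assms by (simp add: y_def orthonormal_basis_def inner_diff_left inner_sum_left if_distrib[of "(*) _"] cong: if_cong)
  hence *: "orthogonal y z" if "z \<in> range e" for z using that by (auto simp: orthogonal_def)
  have "y \<in> span (range e)" using assms by (simp add: orthonormal_basis_def)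
  hence "orthogonal y y" by (rule orthogonal_to_span) (rule *)
  thus ?thesis by (simp add: y_def orthogonal_def)
qed

lemma orthonormal_basis_inner:
  assumes "orthonormal_basis e"
  shows "x \<bullet> y = (\<Sum>a\<in>UNIV. (x \<bullet> e a) * (y \<bullet> e a))"
  by (subst orthonormal_basis_expand[OF assms, of y]) (simp add: inner_sum_right mult.commute)

lemma tint_linear:
  fixes f :: "real ^ 4 \<Rightarrow> 'a::euclidean_space" and L :: "'a \<Rightarrow> 'b::euclidean_space"
  assumes "linear L" "continuous_on UNIV f"
  shows "tint \<Lambda> (\<lambda>x. L (f x)) = L (tint \<Lambda> f)"
proof -
  have L: "bounded_linear L" using assms(1) by (simp add: linear_conv_bounded_linear)
  have "tint \<Lambda> (\<lambda>x. L (f x)) = (\<integral>x. L (indicator (cbox (- \<Lambda>) \<Lambda>) x *\<^sub>R f x) \<partial>lborel)"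
    by (simp add: tint_def set_lebesgue_integral_def linear_scale[OF assms(1)])
  also have "\<dots> = L (tint \<Lambda> f)"
    unfolding tint_def set_lebesgue_integral_def
    by (rule integral_bounded_linear[OF L])
       (use set_integrable_continuous[OF assms(2)] in \<open>simp add: set_integrable_def\<close>)
  finally show ?thesis .
qed

lemma partial_deriv_linear:
  fixes f :: "real ^ 4 \<Rightarrow> 'a::euclidean_space" and L :: "'a \<Rightarrow> 'b::euclidean_space"
  assumes "linear L" "trig_on P f"
  shows "partial_deriv i (\<lambda>x. L (f x)) = (\<lambda>x. L (partial_deriv i f x))"
proof
  fix x
  have L: "bounded_linear L" using assms(1) by (simp add: linear_conv_bounded_linear)
  have "((\<lambda>x. L (f x)) has_derivative (\<lambda>h. L (frechet_derivative f (at x) h))) (at x)"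
    by (rule bounded_linear.has_derivative[OF L trig_on_has_derivative[OF assms(2)]])
  from fun_cong[OF frechet_derivative_at[OF this], of "axis i 1", symmetric]
  show "partial_deriv i (\<lambda>x. L (f x)) x = L (partial_deriv i f x)" by (simp add: partial_deriv_def)
qed

lemma partial_deriv_add:
  fixes f g :: "real ^ 4 \<Rightarrow> 'a::euclidean_space"
  assumes "trig_on P f" "trig_on P g"
  shows "partial_deriv i (\<lambda>x. f x + g x) = (\<lambda>x. partial_deriv i f x + partial_deriv i g x)"
proof
  fix x
  from fun_cong[OF frechet_derivative_at[OF has_derivative_add[OF
    trig_on_has_derivative[OF assms(1), of x] trig_on_has_derivative[OF assms(2), of x]]], of "axis i 1", symmetric]
  show "partial_deriv i (\<lambda>x. f x + g x) x = partial_deriv i f x + partial_deriv i g x"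
    by (simp add: partial_deriv_def)
qed

lemma linear_mult: "linear (\<lambda>z. s * z)" for s :: complex
  by (rule bounded_linear.linear) (rule bounded_linear_mult_right)

lemma linear_cnj: "linear cnj"
  by (rule bounded_linear.linear) (rule bounded_linear_cnj)

lemma trig_on_lin:
  fixes f g :: "real ^ 4 \<Rightarrow> complex"
  assumes "trig_on P f" "trig_on P g"
  shows "trig_on P (\<lambda>x. s * f x + t * g x)"
  by (intro trig_on_add trig_on_linear[OF _ linear_mult] assms)

lemma partial_deriv_lin:
  fixes f g :: "real ^ 4 \<Rightarrow> complex"
  assumes "trig_on P f" "trig_on P g"
  shows "partial_deriv i (\<lambda>x. s * f x + t * g x) = (\<lambda>x. s * partial_deriv i f x + t * partial_deriv i g x)"
  by (subst partial_deriv_add[OF trig_on_linear[OF assms(1) linear_mult] trig_on_linear[OF assms(2) linear_mult]])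
     (simp only: partial_deriv_linear[OF linear_mult assms(1)] partial_deriv_linear[OF linear_mult assms(2)])

section \<open>The first-order operator of the action and its injectivity in the gauge\<close>

definition curlc :: "(3 \<Rightarrow> real ^ 4 \<Rightarrow> complex) \<Rightarrow> 3 \<Rightarrow> real ^ 4 \<Rightarrow> complex" where
  "curlc g i x = (if i = 1 then partial_deriv 2 (g 3) x - partial_deriv 3 (g 2) x
     else if i = 2 then partial_deriv 3 (g 1) x - partial_deriv 1 (g 3) x
     else partial_deriv 1 (g 2) x - partial_deriv 2 (g 1) x)"

definition Dop :: "(3 \<Rightarrow> real ^ 4 \<Rightarrow> complex) \<Rightarrow> 3 \<Rightarrow> real ^ 4 \<Rightarrow> complex" where
  "Dop g i x = partial_deriv 0 (g i) x + curlc g i x"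

text \<open>The three gauge conditions in one formula: component \<open>i\<close> vanishes where all
  coordinates of index below \<open>i\<close> vanish.\<close>

definition gauge_fixed :: "3 \<Rightarrow> (real ^ 4 \<Rightarrow> complex) \<Rightarrow> bool" where
  "gauge_fixed i g \<longleftrightarrow> (\<forall>x. x $ 0 = 0 \<and> (i \<noteq> 1 \<longrightarrow> x $ 1 = 0) \<and> (i = 3 \<longrightarrow> x $ 2 = 0) \<longrightarrow> g x = 0)"

lemma trig_on_diff:
  fixes f g :: "real ^ 4 \<Rightarrow> complex"
  assumes "trig_on P f" "trig_on P g"
  shows "trig_on P (\<lambda>x. f x - g x)"
  using trig_on_lin[OF assms, of 1 "- 1"] by simp

lemma trig_on_curlc: "(\<And>i. trig_on P (g i)) \<Longrightarrow> trig_on P (curlc g i)"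
proof -
  assume g: "\<And>i. trig_on P (g i)"
  note t = trig_on_diff[OF trig_on_partial_deriv[OF g] trig_on_partial_deriv[OF g]]
  show "trig_on P (curlc g i)"
    unfolding curlc_def[abs_def] by (cases "i = 1"; cases "i = 2") (simp_all add: t)
qed

lemma trig_on_Dop: "(\<And>i. trig_on P (g i)) \<Longrightarrow> trig_on P (Dop g i)"
  unfolding Dop_def[abs_def] by (intro trig_on_add trig_on_partial_deriv trig_on_curlc)

lemma Dop_lin:
  assumes "\<And>i. trig_on P (g i)" "\<And>i. trig_on P (h i)"
  shows "Dop (\<lambda>i x. s * g i x + t * h i x) i x = s * Dop g i x + t * Dop h i x"
  unfolding Dop_def curlc_def using partial_deriv_lin[OF assms(1,2), of _ s _ t]
  by (simp add: algebra_simps)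

lemma Dop_cnj:
  assumes "\<And>i. trig_on P (g i)"
  shows "Dop (\<lambda>i x. cnj (g i x)) i x = cnj (Dop g i x)"
  unfolding Dop_def curlc_def by (simp add: partial_deriv_linear[OF linear_cnj assms])

lemma partial_deriv_zero: "partial_deriv i (\<lambda>x. 0 :: complex) x = 0"
  using fun_cong[OF partial_deriv_linear[OF linear_mult[of 0] trig_on_zero], of i x] by simp

lemma Dop_zero: "Dop (\<lambda>i x. 0) i x = 0"
  by (simp add: Dop_def curlc_def partial_deriv_zero)

text \<open>Derivatives have mean zero. This makes \<open>Dop\<close> of a gauge field usable as a
  test field of the second kind in \<open>form_nondegenerate\<close>.\<close>

lemma tint_Dop:
  assumes pos: "\<And>i. \<Lambda> $ i > 0" and g: "\<And>i. trig_on (modes \<Lambda> \<kappa>) (g i)"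
  shows "tint \<Lambda> (Dop g i) = 0"
proof -
  have gl: "trig_on (lattice \<Lambda>) (g i)" for i
    by (rule trig_on_mono[OF g modes_subset_lattice])
  have c: "continuous_on UNIV (partial_deriv j (g i))" for i j
    by (rule trig_on_continuous[OF trig_on_partial_deriv[OF g]])
  note z = tint_partial_deriv_trig[OF pos gl]
  have d: "tint \<Lambda> (\<lambda>x. partial_deriv j (g i) x - partial_deriv k (g l) x) = 0" for i j k l
    by (subst tint_diff[OF c c]) (simp add: z)
  have "tint \<Lambda> (curlc g i) = 0"
    unfolding curlc_def[abs_def] by (cases "i = 1"; cases "i = 2") (simp_all add: d)
  moreover have "tint \<Lambda> (Dop g i) = tint \<Lambda> (partial_deriv 0 (g i)) + tint \<Lambda> (curlc g i)"
    unfolding Dop_def[abs_def] by (rule tint_add[OF c trig_on_continuous[OF trig_on_curlc[OF g]]])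
  ultimately show ?thesis by (simp add: z)
qed

text \<open>A coordinate on which \<open>f\<close> does not depend may be set to 0, which carries
  \<open>x\<close> into the subspace where a gauge condition applies.\<close>

lemma zero_derivative_line:
  fixes f :: "real ^ 4 \<Rightarrow> complex"
  assumes f: "trig_on P f" and 0: "\<And>x. partial_deriv i f x = 0"
  shows "f x = f (x - (x $ i) *\<^sub>R axis i 1)"
proof -
  have "((\<lambda>t. f (x - t *\<^sub>R axis i 1)) has_derivative (\<lambda>h. 0)) (at t)" for t :: real
  proof -
    have "((\<lambda>t. x - t *\<^sub>R axis i 1) has_derivative (\<lambda>h. - (h *\<^sub>R axis i 1))) (at t)"
      by (auto intro!: derivative_eq_intros)
    from has_derivative_compose[OF this trig_on_has_derivative[OF f]]
    have d: "((\<lambda>t. f (x - t *\<^sub>R axis i 1)) has_derivative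
       (\<lambda>h. frechet_derivative f (at (x - t *\<^sub>R axis i 1)) (- (h *\<^sub>R axis i 1)))) (at t)" .
    have "frechet_derivative f (at y) (- (h *\<^sub>R axis i 1)) = 0" for y h
    proof -
      have "linear (frechet_derivative f (at y))"
        using has_derivative_bounded_linear[OF trig_on_has_derivative[OF f, of y]] by (rule bounded_linear.linear)
      from linear_scale[OF this, of "- h" "axis i 1"] show ?thesis
        using 0[of y] by (simp add: partial_deriv_def)
    qed
    thus ?thesis using d by simp
  qed
  then obtain c where "\<And>t. f (x - t *\<^sub>R axis i 1) = c"
    using has_derivative_zero_constant[of "UNIV :: real set" "\<lambda>t. f (x - t *\<^sub>R axis i 1)"] by auto
  from this[of 0] this[of "x $ i"] show ?thesis by simp
qed

lemma UNIV_3: "(UNIV :: 3 set) = {1, 2, 3}"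
  using exhaust_3 by auto

text \<open>
  On the torus \<open>d\<^sub>0 A\<close> and the curl of \<open>A\<close> are orthogonal in \<open>L\<^sub>2\<close>, so both vanish if their sum does.
\<close>

lemma Dop_injective:
  assumes pos: "\<And>i. \<Lambda> $ i > 0" and g: "\<And>i. trig_on (modes \<Lambda> \<kappa>) (g i)"
    and gauge_fixed: "\<And>i. gauge_fixed i (g i)" and 0: "\<And>i x. Dop g i x = 0"
  shows "g i x = 0"
proof -
  have gl: "trig_on (lattice \<Lambda>) (g i)" for i
    by (rule trig_on_mono[OF g modes_subset_lattice])
  have gcl: "trig_on (lattice \<Lambda>) (\<lambda>x. cnj (g i x))" for i
    by (rule trig_on_linear[OF gl linear_cnj])
  let ?d = "\<lambda>j i. partial_deriv j (g i)"
  have cd: "partial_deriv j (\<lambda>x. cnj (g i x)) x = cnj (?d j i x)" for i j x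
    by (simp add: partial_deriv_linear[OF linear_cnj gl])
  \<comment> \<open>The inner product of d_0 g_i with d_j g_k. Two integrations by parts exchange
    the derivatives, so it is the conjugate of \<open>s k j i\<close>; the antisymmetry of the curl
    then cancels all real parts.\<close>
  define s where "s i j k = tint \<Lambda> (\<lambda>x. cnj (?d 0 i x) * ?d j k x)" for i j k
  have cont: "continuous_on UNIV (?d j k)" for j k
    by (rule trig_on_continuous[OF trig_on_partial_deriv[OF g]])
  have s: "s i j k = cnj (s k j i)" for i j k
  proof -
    have "s i j k = - tint \<Lambda> (\<lambda>x. cnj (g i x) * partial_deriv 0 (?d j k) x)"
      unfolding s_def using integration_by_parts[OF pos gcl[of i] trig_on_partial_deriv[OF gl[of k], of j], of 0]
      by (simp add: cd)
    also have "partial_deriv 0 (?d j k) = partial_deriv j (?d 0 k)"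
      by (rule partial_deriv_commute[OF gl])
    also have "- tint \<Lambda> (\<lambda>x. cnj (g i x) * partial_deriv j (?d 0 k) x) = tint \<Lambda> (\<lambda>x. cnj (?d j i x) * ?d 0 k x)"
      using integration_by_parts[OF pos gcl[of i] trig_on_partial_deriv[OF gl[of k], of 0], of j]
      by (simp add: cd)
    also have "\<dots> = cnj (s k j i)"
      unfolding s_def tint_cnj[symmetric] by (simp add: mult.commute)
    finally show ?thesis .
  qed
  have Re_s: "Re (s i j k) = Re (s k j i)" for i j k by (subst s) simp
  have P: "?d 0 i x = - curlc g i x" for i x
    using 0[of i x] by (simp add: Dop_def eq_neg_iff_add_eq_0)
  have "(\<Sum>i\<in>UNIV. tint \<Lambda> (\<lambda>x. cnj (?d 0 i x) * curlc g i x)) =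
      (s 1 2 3 - s 1 3 2) + (s 2 3 1 - s 2 1 3) + (s 3 1 2 - s 3 2 1)"
  proof -
    have d: "tint \<Lambda> (\<lambda>x. cnj (?d 0 i x) * (?d j k x - ?d l m x)) = s i j k - s i l m" for i j k l m
      unfolding s_def right_diff_distrib
      by (rule tint_diff; intro continuous_intros cont)
    show ?thesis
      unfolding UNIV_3 by (simp add: curlc_def d)
  qed
  hence "Re (\<Sum>i\<in>UNIV. tint \<Lambda> (\<lambda>x. cnj (?d 0 i x) * curlc g i x)) = 0"
    using Re_s[of 1 2 3] Re_s[of 1 3 2] Re_s[of 2 1 3] by simp
  moreover have "(\<Sum>i\<in>UNIV. tint \<Lambda> (\<lambda>x. cnj (?d 0 i x) * curlc g i x)) = - ip \<Lambda> (?d 0) (?d 0)"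
  proof -
    have "tint \<Lambda> (\<lambda>x. cnj (?d 0 i x) * curlc g i x) = - tint \<Lambda> (\<lambda>x. cnj (?d 0 i x) * ?d 0 i x)" for i
    proof -
      have "curlc g i x = - ?d 0 i x" for x using P[of i x] by simp
      thus ?thesis using tint_mult[of \<Lambda> "- 1" "\<lambda>x. cnj (?d 0 i x) * ?d 0 i x"] by simp
    qed
    thus ?thesis by (simp add: ip_def sum_negf)
  qed
  ultimately have ip0: "ip \<Lambda> (?d 0) (?d 0) = 0"
    using ip_self_nonneg(2)[of \<Lambda> "?d 0"] by (simp add: complex_eq_iff)
  have d0: "?d 0 i x = 0" for i x
  proof (rule trig_on_eq_0[OF pos trig_on_partial_deriv[OF g]])
    fix x assume "x \<in> cbox (- \<Lambda>) \<Lambda>"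
    with ip0 show "?d 0 i x = 0"
      by (intro ip_self_eq_0[where u="?d 0", OF pos]) (auto simp: continuous_cfun_def cont)
  qed
  have c0: "curlc g i x = 0" for i x using P[of i x] d0[of i x] by simp
  note z = partial_deriv_zero
  \<comment> \<open>Each component found to be zero reduces the curl equations to the vanishing of
    exactly those derivatives that the next gauge condition requires.\<close>
  have g1: "g 1 = (\<lambda>x. 0)"
  proof
    fix x :: "real ^ 4"
    have "g 1 x = g 1 (x - (x $ 0) *\<^sub>R axis 0 1)" by (rule zero_derivative_line[OF g d0])
    also have "\<dots> = 0"
      using gauge_fixed[of 1] unfolding gauge_fixed_def by (auto simp: axis_def)
    finally show "g 1 x = 0" .
  qed
  have "?d 1 2 x = 0" for x using c0[of 3 x] by (simp add: curlc_def g1 z)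
  note d12 = this
  have g2: "g 2 = (\<lambda>x. 0)"
  proof
    fix x :: "real ^ 4"
    let ?y = "x - (x $ 0) *\<^sub>R axis 0 1"
    have "g 2 x = g 2 ?y" by (rule zero_derivative_line[OF g d0])
    also have "\<dots> = g 2 (?y - (?y $ 1) *\<^sub>R axis 1 1)" by (rule zero_derivative_line[OF g d12])
    also have "\<dots> = 0"
      using gauge_fixed[of 2] unfolding gauge_fixed_def by (auto simp: axis_def)
    finally show "g 2 x = 0" .
  qed
  have d13: "?d 1 3 x = 0" and d23: "?d 2 3 x = 0" for x
    using c0[of 2 x] c0[of 1 x] by (simp_all add: curlc_def g1 g2 z)
  have g3: "g 3 = (\<lambda>x. 0)"
  proof
    fix x :: "real ^ 4"
    let ?y = "x - (x $ 0) *\<^sub>R axis 0 1"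
    let ?w = "?y - (?y $ 1) *\<^sub>R axis 1 1"
    have "g 3 x = g 3 ?y" by (rule zero_derivative_line[OF g d0])
    also have "\<dots> = g 3 ?w" by (rule zero_derivative_line[OF g d13])
    also have "\<dots> = g 3 (?w - (?w $ 2) *\<^sub>R axis 2 1)" by (rule zero_derivative_line[OF g d23])
    also have "\<dots> = 0"
      using gauge_fixed[of 3] unfolding gauge_fixed_def by (auto simp: axis_def)
    finally show "g 3 x = 0" .
  qed
  show ?thesis using exhaust_3[of i] g1 g2 g3 by auto
qed

section \<open>The complexified field space in components\<close>

definition V_trig :: "real ^ 4 \<Rightarrow> real \<Rightarrow> 'l::finite comp cfun set" where
  "V_trig \<Lambda> \<kappa> = {u. (\<forall>i a. trig_on (modes \<Lambda> \<kappa>) (u (Inl (i, a))) \<and> gauge_fixed i (u (Inl (i, a)))) \<and>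
     (\<forall>i a. trig_on (modes \<Lambda> (2 * \<kappa>)) (u (Inr (i, a))) \<and> tint \<Lambda> (u (Inr (i, a))) = 0)}"

lemma gauge_fields_iff:
  "(\<forall>x. x $ 0 = 0 \<longrightarrow> A x $ 1 = 0) \<and> (\<forall>x. x $ 0 = 0 \<and> x $ 1 = 0 \<longrightarrow> A x $ 2 = 0) \<and>
     (\<forall>x. x $ 0 = 0 \<and> x $ 1 = 0 \<and> x $ 2 = 0 \<longrightarrow> A x $ 3 = 0) \<longleftrightarrow>
   (\<forall>i x. x $ 0 = 0 \<and> (i \<noteq> 1 \<longrightarrow> x $ 1 = 0) \<and> (i = 3 \<longrightarrow> x $ 2 = 0) \<longrightarrow> A x $ i = 0)"
  for A :: "real ^ 4 \<Rightarrow> 'g::zero ^ 3"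
  unfolding forall_3 by auto

lemma linear_component: "linear (\<lambda>z :: 'g::euclidean_space ^ 3. complex_of_real (z $ i \<bullet> v))"
  by (rule linearI) (simp_all add: inner_add_left scaleR_conv_of_real)

lemma components_V_trig:
  fixes v :: "'g::euclidean_space field \<times> 'g field" and e :: "'l::finite \<Rightarrow> 'g"
  assumes v: "v \<in> V_space \<Lambda> \<kappa>"
  shows "components e v \<in> V_trig \<Lambda> \<kappa>" "trig_on (modes \<Lambda> \<kappa>) (fst v)" "trig_on (modes \<Lambda> (2 * \<kappa>)) (snd v)"
proof -
  obtain A F where AF: "v = (A, F)" by (cases v)
  have A: "smooth A" "low_modes \<Lambda> \<kappa> A = A"
    "\<forall>i x. x $ 0 = 0 \<and> (i \<noteq> 1 \<longrightarrow> x $ 1 = 0) \<and> (i = 3 \<longrightarrow> x $ 2 = 0) \<longrightarrow> A x $ i = 0"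
    using v unfolding AF gauge_fields_iff[symmetric] by (auto simp: V_space_def gauge_fields_def)
  have F: "smooth F" "low_modes \<Lambda> (2 * \<kappa>) F = F" "tint \<Lambda> F = 0"
    using v unfolding AF by (auto simp: V_space_def sd_forms_def)
  have tA: "trig_on (modes \<Lambda> \<kappa>) A" and tF: "trig_on (modes \<Lambda> (2 * \<kappa>)) F"
    using A F by (auto intro: trig_on_low_modes smooth_imp_continuous)
  show "trig_on (modes \<Lambda> \<kappa>) (fst v)" "trig_on (modes \<Lambda> (2 * \<kappa>)) (snd v)"
    using tA tF by (simp_all add: AF)
  have "components e v (Inl (i, a)) = (\<lambda>x. complex_of_real (A x $ i \<bullet> e a))"
    "components e v (Inr (i, a)) = (\<lambda>x. complex_of_real (F x $ i \<bullet> e a))" for i a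
    by (simp_all add: components_def AF fun_eq_iff)
  moreover have "tint \<Lambda> (\<lambda>x. complex_of_real (F x $ i \<bullet> e a)) = 0" for i a
    using tint_linear[OF linear_component[of i "e a"] trig_on_continuous[OF tF], of \<Lambda>] F(3) by simp
  moreover have "gauge_fixed i (\<lambda>x. complex_of_real (A x $ i \<bullet> e a))" for i a
    using A(3) by (auto simp: gauge_fixed_def)
  ultimately show "components e v \<in> V_trig \<Lambda> \<kappa>"
    using trig_on_linear[OF tA linear_component] trig_on_linear[OF tF linear_component]
    by (simp add: V_trig_def)
qed

lemma lin_closed_V_trig: "lin_closed (V_trig \<Lambda> \<kappa>)"
proof -
  have z: "tint \<Lambda> (\<lambda>x. s * f x + t * g x) = 0"
    if "trig_on P f" "trig_on P g" "tint \<Lambda> f = 0" "tint \<Lambda> g = 0" for s t P and f g :: "real ^ 4 \<Rightarrow> complex"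
    using that trig_on_continuous[OF that(1)] trig_on_continuous[OF that(2)]
    by (subst tint_add) (auto simp: tint_mult intro!: continuous_intros)
  show ?thesis
    unfolding lin_closed_def V_trig_def
    by (auto simp: gauge_fixed_def trig_on_zero intro!: trig_on_lin z[where P="modes \<Lambda> (2 * \<kappa>)"])
qed

lemma cnj_V_trig: "u \<in> V_trig \<Lambda> \<kappa> \<Longrightarrow> (\<lambda>c x. cnj (u c x)) \<in> V_trig \<Lambda> \<kappa>"
  unfolding V_trig_def by (auto simp: gauge_fixed_def tint_cnj intro!: trig_on_linear[OF _ linear_cnj])

lemma continuous_V_trig: "u \<in> V_trig \<Lambda> \<kappa> \<Longrightarrow> continuous_cfun u"
  unfolding continuous_cfun_def
proof
  fix c assume "u \<in> V_trig \<Lambda> \<kappa>"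
  thus "continuous_on UNIV (u c)"
    using trig_on_continuous[of "modes \<Lambda> \<kappa>" "u c"] trig_on_continuous[of "modes \<Lambda> (2 * \<kappa>)" "u c"]
    by (cases c) (auto simp: V_trig_def)
qed

text \<open>The fields are reassembled from their components in the basis \<open>e\<close> by real
  linear maps, which preserve trigonometric polynomials and their momenta.\<close>

lemma Re_V_trig:
  fixes e :: "'l::finite \<Rightarrow> 'g::euclidean_space"
  assumes pos: "\<And>i. \<Lambda> $ i > 0" and e: "orthonormal_basis e" and u: "u \<in> V_trig \<Lambda> \<kappa>"
  shows "\<exists>v\<in>V_space \<Lambda> \<kappa>. components e v = (\<lambda>c x. of_real (Re (u c x)))"
proof -
  define L where "L i a z = (axis i (Re z *\<^sub>R e a) :: 'g ^ 3)" for i a z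
  have L: "linear (L i a)" for i a
    by (rule linearI) (simp_all add: L_def vec_eq_iff axis_def scaleR_add_left)
  define X where "X w x = (\<Sum>p\<in>UNIV. L (fst p) (snd p) (w p x))" for w :: "3 \<times> 'l \<Rightarrow> real ^ 4 \<Rightarrow> complex" and x
  have X_nth: "X w x $ i = (\<Sum>a\<in>UNIV. Re (w (i, a) x) *\<^sub>R e a)" for w x i
  proof -
    have "X w x = (\<Sum>j\<in>UNIV. \<Sum>a\<in>UNIV. L j a (w (j, a) x))"
      by (simp add: X_def sum.cartesian_product case_prod_unfold)
    hence "X w x $ i = (\<Sum>j\<in>UNIV. \<Sum>a\<in>UNIV. if i = j then Re (w (j, a) x) *\<^sub>R e a else 0)"
      by (simp add: L_def axis_def)
    also have "\<dots> = (\<Sum>a\<in>UNIV. \<Sum>j\<in>UNIV. if i = j then Re (w (j, a) x) *\<^sub>R e a else 0)"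
      by (rule sum.swap)
    finally show ?thesis by simp
  qed
  have X_e: "X w x $ i \<bullet> e a = Re (w (i, a) x)" for w x i a
    using e by (simp add: X_nth inner_sum_left orthonormal_basis_def if_distrib[of "(*) _"] cong: if_cong)
  have X_trig: "trig_on P (X w)" if "\<And>p. trig_on P (w p)" for P w
    unfolding X_def[abs_def] by (intro trig_on_sum trig_on_linear[OF _ L] that)
  define A where "A = X (\<lambda>p. u (Inl p))"
  define F where "F = X (\<lambda>p. u (Inr p))"
  have tA: "trig_on (modes \<Lambda> \<kappa>) A" and tF: "trig_on (modes \<Lambda> (2 * \<kappa>)) F"
    unfolding A_def F_def using u by (auto intro!: X_trig simp: V_trig_def)
  have per: "periodic \<Lambda> A" "periodic \<Lambda> F"
    using trig_on_mono[OF tA modes_subset_lattice] trig_on_mono[OF tF modes_subset_lattice]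
    by (auto intro: trig_on_periodic[OF pos])
  have "A x $ i = 0" if "x $ 0 = 0 \<and> (i \<noteq> 1 \<longrightarrow> x $ 1 = 0) \<and> (i = 3 \<longrightarrow> x $ 2 = 0)" for i x
  proof -
    have "u (Inl (i, a)) x = 0" for a using u that by (auto simp: V_trig_def gauge_fixed_def)
    thus ?thesis by (simp add: A_def X_nth)
  qed
  hence "A \<in> gauge_fields \<Lambda>"
    unfolding gauge_fields_def mem_Collect_eq gauge_fields_iff using trig_on_smooth[OF tA] per by blast
  moreover have "tint \<Lambda> F = 0"
  proof -
    have c: "continuous_on UNIV (u (Inr p))" "tint \<Lambda> (u (Inr p)) = 0" for p
      using u continuous_V_trig[OF u] by (cases p; auto simp: V_trig_def continuous_cfun_def)+
    have "tint \<Lambda> F = (\<Sum>p\<in>UNIV. tint \<Lambda> (\<lambda>x. L (fst p) (snd p) (u (Inr p) x)))"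
      unfolding F_def X_def[abs_def]
      by (rule tint_sum) (rule linear_continuous_on_compose[OF c(1) L])
    thus ?thesis by (simp add: tint_linear[OF L c(1)] c(2) linear_0[OF L])
  qed
  ultimately have "(A, F) \<in> V_space \<Lambda> \<kappa>"
    using trig_on_smooth[OF tF] per low_modes_trig[OF pos tA] low_modes_trig[OF pos tF]
    by (simp add: V_space_def sd_forms_def)
  moreover have "components e (A, F) = (\<lambda>c x. of_real (Re (u c x)))"
    by (auto simp: components_def fun_eq_iff A_def F_def X_e split: sum.splits)
  ultimately show ?thesis by blast
qed

text \<open>The conditions of \<open>V_trig\<close> are complex linear and invariant under
  conjugation, so real and imaginary parts of its members come from genuine fields.\<close>

lemma V_complex_eq:
  fixes e :: "'l::finite \<Rightarrow> 'g::euclidean_space"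
  assumes pos: "\<And>i. \<Lambda> $ i > 0" and e: "orthonormal_basis e"
  shows "V_complex e \<Lambda> \<kappa> = V_trig \<Lambda> \<kappa>"
proof (intro equalityI subsetI)
  fix u assume "u \<in> V_complex e \<Lambda> \<kappa>"
  then obtain v w where vw: "v \<in> V_space \<Lambda> \<kappa>" "w \<in> V_space \<Lambda> \<kappa>"
    "u = (\<lambda>c x. components e v c x + \<i> * components e w c x)"
    by (auto simp: V_complex_def)
  have "(\<lambda>c x. 1 * components e v c x + \<i> * components e w c x) \<in> V_trig \<Lambda> \<kappa>"
    using lin_closed_V_trig[of \<Lambda> \<kappa>] components_V_trig(1)[OF vw(1), of e] components_V_trig(1)[OF vw(2), of e]
    unfolding lin_closed_def by blast
  thus "u \<in> V_trig \<Lambda> \<kappa>" by (simp add: vw(3))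
next
  fix u :: "'l comp cfun" assume u: "u \<in> V_trig \<Lambda> \<kappa>"
  \<comment> \<open>The imaginary part of \<open>u\<close> is the real part of
    \<open>- \<i> * u\<close>.\<close>
  have "(\<lambda>c x. (- \<i>) * u c x + 0 * u c x) \<in> V_trig \<Lambda> \<kappa>"
    using lin_closed_V_trig[of \<Lambda> \<kappa>] u unfolding lin_closed_def by blast
  from Re_V_trig[OF pos e this] obtain w where
    w: "w \<in> V_space \<Lambda> \<kappa>" "components e w = (\<lambda>c x. of_real (Im (u c x)))" by auto
  obtain v where v: "v \<in> V_space \<Lambda> \<kappa>" "components e v = (\<lambda>c x. of_real (Re (u c x)))"
    using Re_V_trig[OF pos e u] by auto
  have "u = (\<lambda>c x. components e v c x + \<i> * components e w c x)"
    unfolding v w by (simp add: complex_eq[symmetric])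
  thus "u \<in> V_complex e \<Lambda> \<kappa>" unfolding V_complex_def using v(1) w(1) by blast
qed

section \<open>The quadratic form and the propagator\<close>

definition bil :: "real ^ 4 \<Rightarrow> (real ^ 4 \<Rightarrow> complex) \<Rightarrow> (real ^ 4 \<Rightarrow> complex) \<Rightarrow> complex" where
  "bil \<Lambda> f g = tint \<Lambda> (\<lambda>x. f x * g x)"

lemma bil_commute: "bil \<Lambda> f g = bil \<Lambda> g f"
  by (simp add: bil_def mult.commute)

lemma bil_lin_left:
  assumes "continuous_on UNIV f" "continuous_on UNIV g" "continuous_on UNIV h"
  shows "bil \<Lambda> (\<lambda>x. s * f x + t * g x) h = s * bil \<Lambda> f h + t * bil \<Lambda> g h"
proof -
  have "bil \<Lambda> (\<lambda>x. s * f x + t * g x) h = tint \<Lambda> (\<lambda>x. s * (f x * h x) + t * (g x * h x))"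
    by (simp add: bil_def algebra_simps)
  also have "\<dots> = tint \<Lambda> (\<lambda>x. s * (f x * h x)) + tint \<Lambda> (\<lambda>x. t * (g x * h x))"
    by (intro tint_add continuous_intros assms)
  finally show ?thesis by (simp add: bil_def tint_mult)
qed

lemma bil_lin_right:
  assumes "continuous_on UNIV f" "continuous_on UNIV g" "continuous_on UNIV h"
  shows "bil \<Lambda> h (\<lambda>x. s * f x + t * g x) = s * bil \<Lambda> h f + t * bil \<Lambda> h g"
  using bil_lin_left[OF assms] by (simp add: bil_commute[of \<Lambda> h])

lemma bil_cnj: "bil \<Lambda> (\<lambda>x. cnj (f x)) (\<lambda>x. cnj (g x)) = cnj (bil \<Lambda> f g)"
  by (simp add: bil_def tint_cnj[symmetric])

lemma bil_zero [simp]: "bil \<Lambda> (\<lambda>x. 0) g = 0" "bil \<Lambda> f (\<lambda>x. 0) = 0"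
  by (simp_all add: bil_def)

lemma bilin_eq_ip: "bilin \<Lambda> u w = ip \<Lambda> (\<lambda>c x. cnj (u c x)) w"
  by (simp add: bilin_def ip_def)

lemma sum_prod_UNIV: "(\<Sum>p\<in>UNIV. F (fst p) (snd p)) = (\<Sum>i\<in>UNIV. \<Sum>a\<in>UNIV. F i a)"
  for F :: "'i::finite \<Rightarrow> 'a::finite \<Rightarrow> 'b::comm_monoid_add"
  by (simp add: sum.cartesian_product case_prod_unfold)

locale quadratic_model =
  fixes br :: "'g::euclidean_space \<Rightarrow> 'g \<Rightarrow> 'g" and e :: "'l::finite \<Rightarrow> 'g"
    and \<Lambda> :: "real ^ 4" and \<kappa> \<mu> :: real and \<Phi> :: "'g ^ 3"
  assumes pos: "\<Lambda> $ i > 0" and \<kappa>: "\<kappa> > 0" and e: "orthonormal_basis e"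
begin

abbreviation W :: "'l comp cfun set" where "W \<equiv> V_trig \<Lambda> \<kappa>"

definition coeff :: "3 \<Rightarrow> 3 \<Rightarrow> 3 \<Rightarrow> 'l \<Rightarrow> 'l \<Rightarrow> 'l \<Rightarrow> complex" where
  "coeff i j k a b c = of_real ((\<Phi> $ k \<bullet> e c) * (levi_civita i j k * structure_constants br e a b c))"

text \<open>The term with \<open>\<Phi>\<close>: cubic when \<open>\<Phi>\<close> is counted,
  bilinear in the two gauge fields.\<close>

definition cubic :: "'l comp cfun \<Rightarrow> 'l comp cfun \<Rightarrow> complex" where
  "cubic u w = (\<Sum>k\<in>UNIV. \<Sum>c\<in>UNIV. \<Sum>i\<in>UNIV. \<Sum>j\<in>UNIV. \<Sum>a\<in>UNIV. \<Sum>b\<in>UNIV.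
     coeff i j k a b c * bil \<Lambda> (u (Inl (i, a))) (w (Inl (j, b))))"

definition du :: "'l comp cfun \<Rightarrow> 3 \<times> 'l \<Rightarrow> real ^ 4 \<Rightarrow> complex" where
  "du u p = Dop (\<lambda>i. u (Inl (i, snd p))) (fst p)"

text \<open>The polarization of \<open>S0\<close>, extended complex bilinearly. Each mixed term
  appears in both orders, which produces the factors 2 of \<open>S0\<close> on the diagonal.\<close>

definition form :: "'l comp cfun \<Rightarrow> 'l comp cfun \<Rightarrow> complex" where
  "form u w = (\<Sum>p\<in>UNIV. bil \<Lambda> (u (Inr p)) (w (Inr p)) - \<i> * bil \<Lambda> (u (Inr p)) (du w p)
      - \<i> * bil \<Lambda> (w (Inr p)) (du u p)) - \<i> * of_real \<mu> * (cubic u w + cubic w u)"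

lemma W_trig:
  assumes "u \<in> W"
  shows "trig_on (modes \<Lambda> \<kappa>) (u (Inl (i, a)))" "trig_on (modes \<Lambda> (2 * \<kappa>)) (u (Inr p))"
    "tint \<Lambda> (u (Inr p)) = 0" "gauge_fixed i (u (Inl (i, a)))"
  using assms by (cases p; auto simp: V_trig_def)+

lemma W_cont: "u \<in> W \<Longrightarrow> continuous_on UNIV (u c)"
  using continuous_V_trig[of u] by (auto simp: continuous_cfun_def)

lemma W_lin: "u \<in> W \<Longrightarrow> w \<in> W \<Longrightarrow> (\<lambda>c x. s * u c x + t * w c x) \<in> W"
  using lin_closed_V_trig[of \<Lambda> \<kappa>] unfolding lin_closed_def by blast

lemma trig_on_du: "u \<in> W \<Longrightarrow> trig_on (modes \<Lambda> \<kappa>) (du u p)"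
  unfolding du_def by (rule trig_on_Dop[OF W_trig(1)])

lemma du_cont: "u \<in> W \<Longrightarrow> continuous_on UNIV (du u p)"
  by (rule trig_on_continuous[OF trig_on_du])

lemma du_lin:
  assumes "u \<in> W" "w \<in> W"
  shows "du (\<lambda>c x. s * u c x + t * w c x) p = (\<lambda>x. s * du u p x + t * du w p x)"
  unfolding du_def by (rule ext) (rule Dop_lin[OF W_trig(1)[OF assms(1)] W_trig(1)[OF assms(2)]])

lemma form_commute: "form u w = form w u"
proof -
  have "(\<Sum>p\<in>UNIV. bil \<Lambda> (u (Inr p)) (w (Inr p)) - \<i> * bil \<Lambda> (u (Inr p)) (du w p) - \<i> * bil \<Lambda> (w (Inr p)) (du u p)) =
      (\<Sum>p\<in>UNIV. bil \<Lambda> (w (Inr p)) (u (Inr p)) - \<i> * bil \<Lambda> (w (Inr p)) (du u p) - \<i> * bil \<Lambda> (u (Inr p)) (du w p))"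
    by (intro sum.cong refl) (subst bil_commute, simp add: algebra_simps)
  thus ?thesis unfolding form_def by (simp only: add.commute[of "cubic u w"])
qed

lemma cubic_lin_left:
  assumes "u \<in> W" "u' \<in> W" "w \<in> W"
  shows "cubic (\<lambda>c x. s * u c x + t * u' c x) w = s * cubic u w + t * cubic u' w"
  unfolding cubic_def bil_lin_left[OF W_cont[OF assms(1)] W_cont[OF assms(2)] W_cont[OF assms(3)]]
  by (simp add: distrib_left sum.distrib sum_distrib_left mult.left_commute)

lemma cubic_lin_right:
  assumes "u \<in> W" "u' \<in> W" "w \<in> W"
  shows "cubic w (\<lambda>c x. s * u c x + t * u' c x) = s * cubic w u + t * cubic w u'"
  unfolding cubic_def bil_lin_right[OF W_cont[OF assms(1)] W_cont[OF assms(2)] W_cont[OF assms(3)]]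
  by (simp add: distrib_left sum.distrib sum_distrib_left mult.left_commute)

lemma form_lin_left:
  assumes "u \<in> W" "u' \<in> W" "w \<in> W"
  shows "form (\<lambda>c x. s * u c x + t * u' c x) w = s * form u w + t * form u' w"
proof -
  note c = W_cont[OF assms(1)] W_cont[OF assms(2)] W_cont[OF assms(3)]
  have "(\<Sum>p\<in>UNIV. bil \<Lambda> (\<lambda>x. s * u (Inr p) x + t * u' (Inr p) x) (w (Inr p))
        - \<i> * bil \<Lambda> (\<lambda>x. s * u (Inr p) x + t * u' (Inr p) x) (du w p)
        - \<i> * bil \<Lambda> (w (Inr p)) (\<lambda>x. s * du u p x + t * du u' p x)) =
    s * (\<Sum>p\<in>UNIV. bil \<Lambda> (u (Inr p)) (w (Inr p)) - \<i> * bil \<Lambda> (u (Inr p)) (du w p) - \<i> * bil \<Lambda> (w (Inr p)) (du u p))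
    + t * (\<Sum>p\<in>UNIV. bil \<Lambda> (u' (Inr p)) (w (Inr p)) - \<i> * bil \<Lambda> (u' (Inr p)) (du w p) - \<i> * bil \<Lambda> (w (Inr p)) (du u' p))"
    unfolding sum_distrib_left sum.distrib[symmetric]
  proof (rule sum.cong[OF refl])
    fix p
    show "bil \<Lambda> (\<lambda>x. s * u (Inr p) x + t * u' (Inr p) x) (w (Inr p))
        - \<i> * bil \<Lambda> (\<lambda>x. s * u (Inr p) x + t * u' (Inr p) x) (du w p)
        - \<i> * bil \<Lambda> (w (Inr p)) (\<lambda>x. s * du u p x + t * du u' p x) =
      s * (bil \<Lambda> (u (Inr p)) (w (Inr p)) - \<i> * bil \<Lambda> (u (Inr p)) (du w p) - \<i> * bil \<Lambda> (w (Inr p)) (du u p))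
      + t * (bil \<Lambda> (u' (Inr p)) (w (Inr p)) - \<i> * bil \<Lambda> (u' (Inr p)) (du w p) - \<i> * bil \<Lambda> (w (Inr p)) (du u' p))"
      unfolding bil_lin_left[OF c] bil_lin_left[OF c(1,2) du_cont[OF assms(3)]]
        bil_lin_right[OF du_cont[OF assms(1)] du_cont[OF assms(2)] c(3)]
      by (simp add: algebra_simps)
  qed
  thus ?thesis
    unfolding form_def du_lin[OF assms(1,2)] cubic_lin_left[OF assms] cubic_lin_right[OF assms]
    by (simp only:) (simp add: algebra_simps)
qed

lemma form_lin_right:
  assumes "u \<in> W" "u' \<in> W" "w \<in> W"
  shows "form w (\<lambda>c x. s * u c x + t * u' c x) = s * form w u + t * form w u'"
  using form_lin_left[OF assms] by (simp add: form_commute[of w])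

lemma of_real_L2_inner:
  assumes "continuous_on UNIV X" "continuous_on UNIV Y"
  shows "complex_of_real (L2_inner \<Lambda> X Y) =
     (\<Sum>p\<in>UNIV. bil \<Lambda> (\<lambda>x. of_real (X x $ fst p \<bullet> e (snd p))) (\<lambda>x. of_real (Y x $ fst p \<bullet> e (snd p))))"
proof -
  have c: "continuous_on UNIV (\<lambda>x. Z x $ i)" if "continuous_on UNIV Z" for Z :: "'g field" and i
    using that by (intro continuous_intros)
  have "L2_inner \<Lambda> X Y = tint \<Lambda> (\<lambda>x. \<Sum>p\<in>UNIV. (X x $ fst p \<bullet> e (snd p)) * (Y x $ fst p \<bullet> e (snd p)))"
  proof -
    have "X x \<bullet> Y x = (\<Sum>i\<in>UNIV. \<Sum>a\<in>UNIV. (X x $ i \<bullet> e a) * (Y x $ i \<bullet> e a))" for x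
      unfolding inner_vec_def by (rule sum.cong[OF refl]) (rule orthonormal_basis_inner[OF e])
    thus ?thesis
      unfolding L2_inner_def by (simp only: sum_prod_UNIV[where F="\<lambda>i a. (X _ $ i \<bullet> e a) * (Y _ $ i \<bullet> e a)"])
  qed
  also have "\<dots> = (\<Sum>p\<in>UNIV. tint \<Lambda> (\<lambda>x. (X x $ fst p \<bullet> e (snd p)) * (Y x $ fst p \<bullet> e (snd p))))"
    by (rule tint_sum) (intro continuous_intros c assms)
  finally have "L2_inner \<Lambda> X Y = (\<Sum>p\<in>UNIV. tint \<Lambda> (\<lambda>x. (X x $ fst p \<bullet> e (snd p)) * (Y x $ fst p \<bullet> e (snd p))))" .
  moreover have "tint \<Lambda> (\<lambda>x. complex_of_real (h x)) = of_real (tint \<Lambda> h)" for h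
    unfolding tint_def by (rule set_integral_complex_of_real)
  ultimately show ?thesis by (simp only: bil_def of_real_mult[symmetric] of_real_sum)
qed

lemma Inner_partial:
  fixes A :: "'g field"
  assumes "trig_on P A"
  shows "partial_deriv j (\<lambda>x. complex_of_real (A x $ i \<bullet> e a)) x = of_real (partial_deriv j A x $ i \<bullet> e a)"
  using fun_cong[OF partial_deriv_linear[OF linear_component assms]] by simp

lemma field_curl_nth:
  "field_curl A x $ i = (if i = 1 then partial_deriv 2 A x $ 3 - partial_deriv 3 A x $ 2
     else if i = 2 then partial_deriv 3 A x $ 1 - partial_deriv 1 A x $ 3
     else partial_deriv 1 A x $ 2 - partial_deriv 2 A x $ 1)"
  using exhaust_3[of i] by (auto simp: field_curl_def)

lemma du_components:
  assumes v: "v \<in> V_space \<Lambda> \<kappa>"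
  shows "du (components e v) p x =
    of_real (partial_deriv 0 (fst v) x $ fst p \<bullet> e (snd p)) + of_real (field_curl (fst v) x $ fst p \<bullet> e (snd p))"
proof -
  note P = Inner_partial[OF components_V_trig(2)[OF v]]
  have "components e v (Inl (i, a)) = (\<lambda>x. complex_of_real (fst v x $ i \<bullet> e a))" for i a
    by (simp add: components_def fun_eq_iff)
  thus ?thesis
    by (simp add: du_def Dop_def curlc_def P field_curl_nth inner_diff_left)
qed

text \<open>Inner products are expanded in the basis \<open>e\<close>, and the projection in the
  \<open>\<Phi>\<close> term acts as the identity on the band-limited \<open>A\<close>.\<close>

lemma S0_form:
  assumes v: "v \<in> V_space \<Lambda> \<kappa>"
  shows "S0 br e \<Lambda> \<kappa> \<mu> \<Phi> v = form (components e v) (components e v)"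
proof -
  obtain A F where AF: "v = (A, F)" by (cases v)
  let ?u = "components e v"
  have tA: "trig_on (modes \<Lambda> \<kappa>) A" and tF: "trig_on (modes \<Lambda> (2 * \<kappa>)) F"
    using components_V_trig(2,3)[OF v] by (simp_all add: AF)
  have cA: "continuous_on UNIV A" and cF: "continuous_on UNIV F"
    by (rule trig_on_continuous[OF tA], rule trig_on_continuous[OF tF])
  have cd: "continuous_on UNIV (partial_deriv j A)" for j
    by (rule trig_on_continuous[OF trig_on_partial_deriv[OF tA]])
  have ccurl: "continuous_on UNIV (field_curl A)"
  proof -
    have "continuous_on UNIV (\<lambda>x. field_curl A x $ i)" for i
      unfolding field_curl_nth by (cases "i = 1"; cases "i = 2"; simp; intro continuous_intros cd)
    hence "continuous_on UNIV (\<lambda>x. \<chi> i. field_curl A x $ i)" by (intro continuous_on_vec_lambda)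
    thus ?thesis by simp
  qed
  have low: "low_modes \<Lambda> \<kappa> A = A" using v by (simp add: V_space_def AF)
  have uA: "?u (Inl (i, a)) = (\<lambda>x. complex_of_real (A x $ i \<bullet> e a))" for i a
    by (simp add: components_def AF fun_eq_iff)
  have uF: "?u (Inr p) = (\<lambda>x. complex_of_real (F x $ fst p \<bullet> e (snd p)))" for p
    by (cases p) (simp add: components_def AF fun_eq_iff)
  have caA: "continuous_on UNIV (\<lambda>x. complex_of_real (A x $ i \<bullet> e a))" for i a
    by (intro continuous_intros cA)
  have FF: "complex_of_real (L2_inner \<Lambda> F F) = (\<Sum>p\<in>UNIV. bil \<Lambda> (?u (Inr p)) (?u (Inr p)))"
    unfolding of_real_L2_inner[OF cF cF] uF ..
  have "complex_of_real (L2_inner \<Lambda> F (partial_deriv 0 A)) + complex_of_real (L2_inner \<Lambda> F (field_curl A)) =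
      (\<Sum>p\<in>UNIV. bil \<Lambda> (?u (Inr p)) (du ?u p))"
    unfolding of_real_L2_inner[OF cF cd] of_real_L2_inner[OF cF ccurl] uF sum.distrib[symmetric]
  proof (rule sum.cong[OF refl])
    fix p
    have "du ?u p = (\<lambda>x. 1 * of_real (partial_deriv 0 A x $ fst p \<bullet> e (snd p)) + 1 * of_real (field_curl A x $ fst p \<bullet> e (snd p)))"
      by (rule ext) (subst du_components[OF v], simp add: AF)
    thus "bil \<Lambda> (\<lambda>x. complex_of_real (F x $ fst p \<bullet> e (snd p))) (\<lambda>x. of_real (partial_deriv 0 A x $ fst p \<bullet> e (snd p)))
      + bil \<Lambda> (\<lambda>x. complex_of_real (F x $ fst p \<bullet> e (snd p))) (\<lambda>x. of_real (field_curl A x $ fst p \<bullet> e (snd p)))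
      = bil \<Lambda> (\<lambda>x. complex_of_real (F x $ fst p \<bullet> e (snd p))) (du ?u p)"
      by (simp only:) (subst bil_lin_right; (intro continuous_intros cd ccurl cF)?; simp)
  qed
  note FD = this
  let ?B = "\<lambda>x k c. \<Sum>i\<in>UNIV. \<Sum>j\<in>UNIV. \<Sum>a\<in>UNIV. \<Sum>b\<in>UNIV.
        levi_civita i j k * structure_constants br e a b c * (A x $ i \<bullet> e a) * (A x $ j \<bullet> e b)"
  have fb: "field_bracket br e A A x $ k \<bullet> e c = ?B x k c" for x k c
    using e by (simp add: field_bracket_def inner_sum_left orthonormal_basis_def if_distrib[of "(*) _"] cong: if_cong)
  have cfb: "continuous_on UNIV (field_bracket br e A A)"
    unfolding field_bracket_def[abs_def] by (intro continuous_on_vec_lambda continuous_intros cA)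
  have "complex_of_real (L2_inner \<Lambda> (\<lambda>_. \<Phi>) (field_bracket br e A A)) =
     (\<Sum>k\<in>UNIV. \<Sum>c\<in>UNIV. bil \<Lambda> (\<lambda>x. of_real (\<Phi> $ k \<bullet> e c)) (\<lambda>x. of_real (?B x k c)))"
    unfolding of_real_L2_inner[OF continuous_on_const cfb] fb
    by (rule sum_prod_UNIV[where F="\<lambda>k c. bil \<Lambda> (\<lambda>x. of_real (\<Phi> $ k \<bullet> e c)) (\<lambda>x. of_real (?B x k c))"])
  also have "\<dots> = cubic ?u ?u"
    unfolding cubic_def
  proof (intro sum.cong refl)
    fix k c
    have "bil \<Lambda> (\<lambda>x. of_real (\<Phi> $ k \<bullet> e c)) (\<lambda>x. of_real (?B x k c)) = tint \<Lambda> (\<lambda>x.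
      \<Sum>i\<in>UNIV. \<Sum>j\<in>UNIV. \<Sum>a\<in>UNIV. \<Sum>b\<in>UNIV. coeff i j k a b c *
         (complex_of_real (A x $ i \<bullet> e a) * complex_of_real (A x $ j \<bullet> e b)))"
      unfolding bil_def coeff_def by (simp add: sum_distrib_left mult.assoc)
    also have "\<dots> = (\<Sum>i\<in>UNIV. \<Sum>j\<in>UNIV. \<Sum>a\<in>UNIV. \<Sum>b\<in>UNIV. coeff i j k a b c *
         bil \<Lambda> (\<lambda>x. of_real (A x $ i \<bullet> e a)) (\<lambda>x. of_real (A x $ j \<bullet> e b)))"
      unfolding bil_def tint_mult[symmetric]
      by (subst tint_sum, intro continuous_intros cA, rule sum.cong[OF refl])+ (rule refl)
    finally show "bil \<Lambda> (\<lambda>x. of_real (\<Phi> $ k \<bullet> e c)) (\<lambda>x. of_real (?B x k c)) =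
      (\<Sum>i\<in>UNIV. \<Sum>j\<in>UNIV. \<Sum>a\<in>UNIV. \<Sum>b\<in>UNIV. coeff i j k a b c * bil \<Lambda> (?u (Inl (i, a))) (?u (Inl (j, b))))"
      unfolding uA .
  qed
  finally have N: "complex_of_real (L2_inner \<Lambda> (\<lambda>_. \<Phi>) (field_bracket br e A A)) = cubic ?u ?u" .
  have "S0 br e \<Lambda> \<kappa> \<mu> \<Phi> v = complex_of_real (L2_inner \<Lambda> F F)
     - 2 * \<i> * (complex_of_real (L2_inner \<Lambda> F (partial_deriv 0 A)) + complex_of_real (L2_inner \<Lambda> F (field_curl A)))
     - 2 * \<i> * of_real \<mu> * complex_of_real (L2_inner \<Lambda> (\<lambda>_. \<Phi>) (field_bracket br e A A))"
    unfolding AF S0_def by (simp add: low algebra_simps)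
  also have "\<dots> = form ?u ?u"
    unfolding FF FD N form_def by (simp add: sum_subtractf sum_distrib_left[symmetric] algebra_simps)
  finally show ?thesis .
qed

text \<open>Conjugation passes through because the coefficients \<open>coeff\<close> are
  real.\<close>

lemma cubic_cnj: "cubic (\<lambda>c x. cnj (u c x)) w = cnj (cubic u (\<lambda>c x. cnj (w c x)))"
proof -
  have "bil \<Lambda> (\<lambda>x. cnj (f x)) g = cnj (bil \<Lambda> f (\<lambda>x. cnj (g x)))" for f g
    using bil_cnj[of \<Lambda> f "\<lambda>x. cnj (g x)"] by simp
  thus ?thesis by (simp add: cubic_def coeff_def)
qed

text \<open>
  Testing with the conjugate of \<open>F - i D A\<close> and then with the conjugate of \<open>A\<close> gives
  \<open>F = i D A\<close> and \<open>D A = 0\<close>: the term with \<open>\<Phi>\<close> contributes only to the imaginary part.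
\<close>

lemma form_nondegenerate:
  assumes u: "u \<in> W" and 0: "\<And>v. v \<in> W \<Longrightarrow> form v u = 0"
  shows "u = (\<lambda>c x. 0)"
proof -
  \<comment> \<open>The conjugate of \<open>q\<close> is an admissible \<open>F\<close>: the momenta
    of \<open>du u p\<close> are below \<open>\<kappa>\<close>, hence below
    \<open>2 * \<kappa>\<close>, and its mean is zero.\<close>
  define q where "q p x = u (Inr p) x - \<i> * du u p x" for p x
  have tq: "trig_on (modes \<Lambda> (2 * \<kappa>)) (q p)" for p
  proof -
    have "trig_on (modes \<Lambda> (2 * \<kappa>)) (du u p)"
      by (rule trig_on_mono[OF trig_on_du[OF u] modes_mono]) (use \<kappa> in simp)
    from trig_on_lin[OF W_trig(2)[OF u, of p] this, of 1 "- \<i>"] show ?thesis by (simp add: q_def[abs_def])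
  qed
  have cq: "continuous_on UNIV (q p)" for p by (rule trig_on_continuous[OF tq])
  have iq: "tint \<Lambda> (q p) = 0" for p
  proof -
    have "tint \<Lambda> (q p) = tint \<Lambda> (u (Inr p)) - \<i> * tint \<Lambda> (du u p)"
      unfolding q_def[abs_def] tint_mult[symmetric]
      by (rule tint_diff) (intro continuous_intros W_cont[OF u] du_cont[OF u])+
    moreover have "tint \<Lambda> (du u p) = 0"
      unfolding du_def by (rule tint_Dop[OF pos W_trig(1)[OF u]])
    ultimately show ?thesis by (simp add: W_trig(3)[OF u])
  qed
  define v :: "'l comp cfun" where "v c = (case c of Inl p \<Rightarrow> (\<lambda>x. 0) | Inr p \<Rightarrow> (\<lambda>x. cnj (q p x)))" for c
  have v: "v \<in> W"
    unfolding V_trig_def v_def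
    by (auto simp: gauge_fixed_def trig_on_zero tint_cnj iq intro!: trig_on_linear[OF tq linear_cnj])
  have dv: "du v p = (\<lambda>x. 0)" for p
    by (rule ext) (simp add: du_def v_def Dop_zero)
  have "cubic v u = 0" "cubic u v = 0" by (simp_all add: cubic_def v_def)
  hence "form v u = (\<Sum>p\<in>UNIV. bil \<Lambda> (v (Inr p)) (u (Inr p)) - \<i> * bil \<Lambda> (v (Inr p)) (du u p))"
    by (simp add: form_def dv)
  also have "\<dots> = ip \<Lambda> q q"
    unfolding ip_def
  proof (rule sum.cong[OF refl])
    fix p
    have "bil \<Lambda> (v (Inr p)) (\<lambda>x. 1 * u (Inr p) x + (- \<i>) * du u p x) =
        1 * bil \<Lambda> (v (Inr p)) (u (Inr p)) + (- \<i>) * bil \<Lambda> (v (Inr p)) (du u p)"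
      by (rule bil_lin_right[OF W_cont[OF u] du_cont[OF u] W_cont[OF v]])
    thus "bil \<Lambda> (v (Inr p)) (u (Inr p)) - \<i> * bil \<Lambda> (v (Inr p)) (du u p) = tint \<Lambda> (\<lambda>x. cnj (q p x) * q p x)"
      by (simp add: bil_def v_def q_def)
  qed
  finally have ipq: "ip \<Lambda> q q = 0" using 0[OF v] by simp
  have "continuous_cfun q" by (simp add: continuous_cfun_def cq)
  note qz = ip_self_eq_0[OF pos this ipq]
  have "q p x = 0" for p x by (rule trig_on_eq_0[OF pos tq]) (rule qz)
  hence uF: "u (Inr p) x = \<i> * du u p x" for p x by (simp add: q_def)
  define w :: "'l comp cfun" where "w c = (case c of Inl p \<Rightarrow> (\<lambda>x. cnj (u (Inl p) x)) | Inr p \<Rightarrow> (\<lambda>x. 0))" for c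
  have w: "w \<in> W"
    using u unfolding V_trig_def w_def
    by (auto simp: gauge_fixed_def trig_on_zero intro!: trig_on_linear[OF _ linear_cnj])
  have dw: "du w p x = cnj (du u p x)" for p x
  proof -
    have "Dop (\<lambda>i x. cnj (u (Inl (i, snd p)) x)) (fst p) x = cnj (Dop (\<lambda>i. u (Inl (i, snd p))) (fst p) x)"
      by (rule Dop_cnj) (rule W_trig(1)[OF u])
    thus ?thesis by (simp add: du_def w_def)
  qed
  have "cubic w u = cnj (cubic u w)"
  proof -
    have "cubic w u = cubic (\<lambda>c x. cnj (u c x)) u" "cubic u w = cubic u (\<lambda>c x. cnj (u c x))"
      by (simp_all add: cubic_def w_def)
    thus ?thesis by (simp add: cubic_cnj)
  qed
  \<comment> \<open>A number plus its conjugate is real, so its product with \<open>\<i>\<close> and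
    the real \<open>\<mu>\<close> has no real part.\<close>
  hence "Re (\<i> * of_real \<mu> * (cubic w u + cubic u w)) = 0" by simp
  moreover have "form w u = ip \<Lambda> (du u) (du u) - \<i> * of_real \<mu> * (cubic w u + cubic u w)"
  proof -
    \<comment> \<open>Inserting \<open>\<i> * du u p\<close> for \<open>u (Inr p)\<close> gives the
      factor \<open>- \<i> * \<i>\<close>, which is 1: the mixed term turns into a squared
      norm.\<close>
    have "- \<i> * bil \<Lambda> (u (Inr p)) (du w p) = tint \<Lambda> (\<lambda>x. cnj (du u p x) * du u p x)" for p
    proof -
      have "bil \<Lambda> (u (Inr p)) (du w p) = tint \<Lambda> (\<lambda>x. \<i> * (cnj (du u p x) * du u p x))"
        by (simp add: bil_def uF dw mult_ac)
      thus ?thesis by (simp add: tint_mult)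
    qed
    moreover have "w (Inr p) = (\<lambda>x. 0)" for p by (simp add: w_def)
    ultimately show ?thesis by (simp add: form_def ip_def)
  qed
  ultimately have "Re (ip \<Lambda> (du u) (du u)) = 0" using 0[OF w] by simp
  hence ipd: "ip \<Lambda> (du u) (du u) = 0" using ip_self_nonneg(2)[of \<Lambda> "du u"] by (simp add: complex_eq_iff)
  have "continuous_cfun (du u)" by (simp add: continuous_cfun_def du_cont[OF u])
  note dz = ip_self_eq_0[OF pos this ipd]
  have d0: "du u p x = 0" for p x by (rule trig_on_eq_0[OF pos trig_on_du[OF u]]) (rule dz)
  have "u (Inl (i, a)) x = 0" for i a x
    by (rule Dop_injective[OF pos, of \<kappa> "\<lambda>i. u (Inl (i, a))"])
       (use W_trig[OF u] d0[of "(_, a)"] in \<open>simp_all add: du_def\<close>)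
  moreover have "u (Inr p) x = 0" for p x by (simp add: uF d0)
  ultimately have "u c x = 0" for c x
    by (cases c) auto
  thus ?thesis by blast
qed

end

text \<open>\<open>h\<close> is bounded on the box, and
  \<open>cmod z \<le> 1 + (cmod z)\<^sup>2\<close> does the work of the Cauchy-Schwarz inequality,
  the box having finite volume.\<close>

lemma L2_space_locally_integrable:
  assumes g: "g \<in> L2_space \<Lambda>"
  shows "locally_integrable \<Lambda> g"
  unfolding locally_integrable_def
proof (intro allI impI)
  fix c and h :: "real ^ 4 \<Rightarrow> complex" assume h: "continuous_on UNIV h"
  have gm: "g c \<in> borel_measurable lborel" and g2: "set_integrable lborel (cbox (- \<Lambda>) \<Lambda>) (\<lambda>x. (cmod (g c x))\<^sup>2)"
    using g by (auto simp: L2_space_def)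
  have hm: "h \<in> borel_measurable lborel" using borel_measurable_continuous_onI[OF h] by simp
  have "compact (h ` cbox (- \<Lambda>) \<Lambda>)"
    by (intro compact_continuous_image continuous_on_subset[OF h] compact_cbox) auto
  from compact_imp_bounded[OF this] obtain M where M: "\<And>x. x \<in> cbox (- \<Lambda>) \<Lambda> \<Longrightarrow> norm (h x) \<le> M"
    unfolding bounded_iff by blast
  have "set_integrable lborel (cbox (- \<Lambda>) \<Lambda>) (\<lambda>x. M * (1 + (cmod (g c x))\<^sup>2))"
    by (intro set_integrable_mult_right set_integral_add g2 set_integrable_continuous continuous_on_const)
  thus "set_integrable lborel (cbox (- \<Lambda>) \<Lambda>) (\<lambda>x. h x * g c x)"
    unfolding set_integrable_def
  proof (rule Bochner_Integration.integrable_bound)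
    show "(\<lambda>x. indicator (cbox (- \<Lambda>) \<Lambda>) x *\<^sub>R (h x * g c x)) \<in> borel_measurable lborel"
      using gm hm by measurable
    show "AE x in lborel. norm (indicator (cbox (- \<Lambda>) \<Lambda>) x *\<^sub>R (h x * g c x)) \<le>
        norm (indicator (cbox (- \<Lambda>) \<Lambda>) x *\<^sub>R (M * (1 + (cmod (g c x))\<^sup>2)))"
    proof (rule AE_I2)
      fix x
      show "norm (indicator (cbox (- \<Lambda>) \<Lambda>) x *\<^sub>R (h x * g c x)) \<le>
        norm (indicator (cbox (- \<Lambda>) \<Lambda>) x *\<^sub>R (M * (1 + (cmod (g c x))\<^sup>2)))"
      proof (cases "x \<in> cbox (- \<Lambda>) \<Lambda>")
        case True
        have M0: "0 \<le> M" using M[OF True] norm_ge_zero order.trans by blast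
        have "0 \<le> (cmod (g c x) - 1)\<^sup>2" by simp
        hence "2 * cmod (g c x) \<le> 1 + (cmod (g c x))\<^sup>2" unfolding power2_diff by simp
        hence "cmod (g c x) \<le> 1 + (cmod (g c x))\<^sup>2" using norm_ge_zero[of "g c x"] by linarith
        hence "norm (h x) * cmod (g c x) \<le> M * (1 + (cmod (g c x))\<^sup>2)"
          using M[OF True] M0 by (intro mult_mono) auto
        also have "\<dots> \<le> \<bar>M * (1 + (cmod (g c x))\<^sup>2)\<bar>" by (rule abs_ge_self)
        finally show ?thesis using True by (simp add: norm_mult)
      qed simp
    qed
  qed
qed

lemma bilin_commute: "bilin \<Lambda> u w = bilin \<Lambda> w u"
  by (simp add: bilin_def mult.commute)

section \<open>The operator of the quadratic form, its inverse and the integral kernel\<close>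

context quadratic_model
begin

definition Q where "Q = Q_op br e \<Lambda> \<kappa> \<mu> \<Phi>"

lemma W_eq: "V_complex e \<Lambda> \<kappa> = W"
  by (rule V_complex_eq[OF pos e])

lemma W_cnj: "u \<in> W \<Longrightarrow> (\<lambda>c x. cnj (u c x)) \<in> W"
  by (rule cnj_V_trig)

lemma W_li: "u \<in> W \<Longrightarrow> locally_integrable \<Lambda> u"
  by (rule continuous_cfun_locally_integrable[OF continuous_V_trig])

text \<open>The reproducing kernels are the two functions \<open>chi_cut\<close>. They serve every
  subspace \<open>W'\<close>, in particular the range of \<open>Q\<close> in
  \<open>Q_surj\<close>.\<close>

lemma W_basis:
  assumes sub: "W' \<subseteq> W" and lin: "lin_closed W'"
  shows "\<exists>N b. orthonormal \<Lambda> N b \<and> (\<forall>n<N. b n \<in> W') \<and> (\<forall>w\<in>W'. w = comb N b (\<lambda>n. ip \<Lambda> (b n) w))"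
proof -
  define k :: "'l comp \<Rightarrow> real ^ 4 \<Rightarrow> real"
    where "k c = (case c of Inl _ \<Rightarrow> chi_cut \<Lambda> \<kappa> | Inr _ \<Rightarrow> chi_cut \<Lambda> (2 * \<kappa>))" for c
  define K where "K = (real (card (modes \<Lambda> \<kappa>)) + real (card (modes \<Lambda> (2 * \<kappa>)))) / torus_volume \<Lambda>"
  have vol: "torus_volume \<Lambda> > 0" unfolding torus_volume_def using pos by (intro prod_pos) auto
  have chi: "\<bar>chi_cut \<Lambda> \<kappa>' x\<bar> \<le> real (card (modes \<Lambda> \<kappa>')) / torus_volume \<Lambda>" for \<kappa>' x
  proof -
    have "\<bar>\<Sum>p\<in>modes \<Lambda> \<kappa>'. cos (p \<bullet> x)\<bar> \<le> (\<Sum>p\<in>modes \<Lambda> \<kappa>'. 1)"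
      by (rule order.trans[OF sum_abs]) (intro sum_mono abs_cos_le_one)
    thus ?thesis
      using vol by (simp add: chi_cut_def torus_volume_def[symmetric] divide_right_mono)
  qed
  show ?thesis
  proof (rule orthonormal_basis_exists[where k=k and K=K, OF pos lin])
    show "continuous_cfun u" if "u \<in> W'" for u using that sub continuous_V_trig by blast
    have "continuous_on UNIV (chi_cut \<Lambda> \<kappa>')" for \<kappa>'
      unfolding chi_cut_def[abs_def] divide_inverse by (intro continuous_intros)
    thus "continuous_on UNIV (k c)" for c by (cases c) (simp_all add: k_def)
    show "\<bar>k c x\<bar> \<le> K" for c x
    proof -
      have "\<bar>k c x\<bar> \<le> real (card (modes \<Lambda> \<kappa>)) / torus_volume \<Lambda> \<or> \<bar>k c x\<bar> \<le> real (card (modes \<Lambda> (2 * \<kappa>))) / torus_volume \<Lambda>"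
        using chi by (cases c) (simp_all add: k_def)
      moreover have "0 \<le> real (card (modes \<Lambda> \<kappa>)) / torus_volume \<Lambda>" "0 \<le> real (card (modes \<Lambda> (2 * \<kappa>))) / torus_volume \<Lambda>"
        using vol by simp_all
      ultimately show ?thesis unfolding K_def add_divide_distrib by linarith
    qed
    show "u c x = tint \<Lambda> (\<lambda>y. of_real (k c (x - y)) * u c y)" if "u \<in> W'" for u c x
    proof -
      have u: "u \<in> W" using that sub by blast
      have r: "f x = tint \<Lambda> (\<lambda>y. of_real (chi_cut \<Lambda> \<kappa>' (x - y)) * f y)" if "trig_on (modes \<Lambda> \<kappa>') f"
        for f :: "real ^ 4 \<Rightarrow> complex" and \<kappa>'
        using fun_cong[OF low_modes_trig[OF pos that], of x] by (simp add: low_modes_def conv_def scaleR_conv_of_real)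
      show ?thesis
      proof (cases c)
        case (Inl p)
        obtain i a where "p = (i, a)" by (cases p)
        thus ?thesis using r[OF W_trig(1)[OF u, of i a]] by (simp add: k_def Inl)
      next
        case (Inr p)
        show ?thesis using r[OF W_trig(2)[OF u, of p]] by (simp add: k_def Inr)
      qed
    qed
  qed
qed

lemma bilin_lin_right:
  assumes "v \<in> W" "u \<in> W" "w \<in> W"
  shows "bilin \<Lambda> v (\<lambda>c x. s * u c x + t * w c x) = s * bilin \<Lambda> v u + t * bilin \<Lambda> v w"
  unfolding bilin_eq_ip by (rule ip_lin_right[OF continuous_V_trig[OF W_cnj[OF assms(1)]] W_li[OF assms(2)] W_li[OF assms(3)]])

lemma bilin_lin_left:
  assumes "v \<in> W" "u \<in> W" "w \<in> W"
  shows "bilin \<Lambda> (\<lambda>c x. s * u c x + t * w c x) v = s * bilin \<Lambda> u v + t * bilin \<Lambda> w v"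
  using bilin_lin_right[OF assms, of s t]
  unfolding bilin_commute[of \<Lambda> v] .

lemma form_comb_left:
  assumes "u \<in> W"
  shows "(\<And>n. n < N \<Longrightarrow> b n \<in> W) \<Longrightarrow> form (comb N b \<gamma>) u = (\<Sum>n<N. \<gamma> n * form (b n) u)"
proof (induction N)
  case 0
  have "form (\<lambda>c x. 0 * u c x + 0 * u c x) u = 0 * form u u + 0 * form u u"
    by (rule form_lin_left[OF assms assms assms])
  thus ?case by (simp add: comb_def)
next
  case (Suc N)
  hence "comb N b \<gamma> \<in> W" "b N \<in> W" by (auto intro: lin_closed_comb[OF lin_closed_V_trig])
  from form_lin_left[OF this assms, of 1 "\<gamma> N"] show ?case
    using Suc by (simp add: comb_def)
qed

text \<open>Riesz representation in an orthonormal basis. The coefficient of \<open>b n\<close> is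
  \<open>form\<close> against the conjugate of \<open>b n\<close>, because \<open>bilin\<close>
  becomes an inner product only after conjugating one argument.\<close>

lemma Q_op_exists:
  "\<exists>Q. (\<forall>u\<in>W. Q u \<in> W) \<and>
     (\<forall>u\<in>W. \<forall>w\<in>W. \<forall>s t. Q (\<lambda>c x. s * u c x + t * w c x) = (\<lambda>c x. s * Q u c x + t * Q w c x)) \<and>
     (\<forall>u\<in>W. \<forall>w\<in>W. bilin \<Lambda> u (Q w) = bilin \<Lambda> (Q u) w) \<and>
     (\<forall>v\<in>V_space \<Lambda> \<kappa>. S0 br e \<Lambda> \<kappa> \<mu> \<Phi> v = bilin \<Lambda> (components e v) (Q (components e v)))"
proof -
  obtain N b where b: "\<And>n. n < N \<Longrightarrow> b n \<in> W" and ex: "\<And>w. w \<in> W \<Longrightarrow> w = comb N b (\<lambda>n. ip \<Lambda> (b n) w)"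
    using W_basis[OF subset_refl lin_closed_V_trig] by blast
  define cb where "cb n = (\<lambda>c x. cnj (b n c x))" for n
  have cb: "cb n \<in> W" if "n < N" for n unfolding cb_def by (rule W_cnj[OF b[OF that]])
  define Q1 where "Q1 u = comb N b (\<lambda>n. form (cb n) u)" for u
  have Q1: "Q1 u \<in> W" for u unfolding Q1_def by (rule lin_closed_comb[OF lin_closed_V_trig b])
  have bQ: "bilin \<Lambda> v (Q1 u) = form v u" if v: "v \<in> W" and u: "u \<in> W" for v u
  proof -
    let ?v = "\<lambda>c x. cnj (v c x)"
    let ?\<gamma> = "\<lambda>n. ip \<Lambda> (b n) ?v"
    define \<gamma> where "\<gamma> = ?\<gamma>"
    have "?v = comb N b \<gamma>" unfolding \<gamma>_def by (rule ex[OF W_cnj[OF v]])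
    hence "cnj (v c x) = comb N b \<gamma> c x" for c x by (simp only: fun_eq_iff)
    hence "v c x = cnj (comb N b \<gamma> c x)" for c x by (metis complex_cnj_cnj)
    hence "v = comb N cb (\<lambda>n. cnj (\<gamma> n))" by (simp add: comb_def cb_def fun_eq_iff)
    hence "form v u = form (comb N cb (\<lambda>n. cnj (\<gamma> n))) u" by (rule arg_cong[where f="\<lambda>v. form v u"])
    also have "\<dots> = (\<Sum>n<N. cnj (\<gamma> n) * form (cb n) u)" by (rule form_comb_left[OF u cb])
    finally have "form v u = (\<Sum>n<N. cnj (?\<gamma> n) * form (cb n) u)" unfolding \<gamma>_def .
    moreover have "bilin \<Lambda> v (Q1 u) = (\<Sum>n<N. form (cb n) u * ip \<Lambda> ?v (b n))"
      unfolding bilin_eq_ip Q1_def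
      by (rule ip_comb_right[OF continuous_V_trig[OF W_cnj[OF v]] continuous_V_trig[OF b]])
    moreover have "ip \<Lambda> ?v (b n) = cnj (?\<gamma> n)" for n by (rule ip_cnj)
    ultimately show ?thesis by (simp add: mult.commute)
  qed
  have lin: "Q1 (\<lambda>c x. s * u c x + t * w c x) = (\<lambda>c x. s * Q1 u c x + t * Q1 w c x)"
    if "u \<in> W" "w \<in> W" for u w s t
  proof -
    have "form (cb n) (\<lambda>c x. s * u c x + t * w c x) = s * form (cb n) u + t * form (cb n) w" if n: "n < N" for n
      by (rule form_lin_right[OF \<open>u \<in> W\<close> \<open>w \<in> W\<close> cb[OF n]])
    thus ?thesis
      unfolding Q1_def comb_def by (simp add: distrib_right sum.distrib sum_distrib_left mult.assoc)
  qed
  show ?thesis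
  proof (intro exI[of _ Q1] conjI ballI allI)
    fix u w assume "u \<in> W" "w \<in> W"
    thus "bilin \<Lambda> u (Q1 w) = bilin \<Lambda> (Q1 u) w"
      by (simp add: bQ bilin_commute[of \<Lambda> "Q1 u"] form_commute[of u])
  next
    fix v :: "'g field \<times> 'g field" assume v: "v \<in> V_space \<Lambda> \<kappa>"
    note c = components_V_trig(1)[OF v, of e]
    show "S0 br e \<Lambda> \<kappa> \<mu> \<Phi> v = bilin \<Lambda> (components e v) (Q1 (components e v))"
      unfolding bQ[OF c c] by (rule S0_form[OF v])
  qed (rule Q1, rule lin)
qed

lemma Q_props:
  shows Q_W: "u \<in> W \<Longrightarrow> Q u \<in> W"
    and Q_lin: "u \<in> W \<Longrightarrow> w \<in> W \<Longrightarrow> Q (\<lambda>c x. s * u c x + t * w c x) = (\<lambda>c x. s * Q u c x + t * Q w c x)"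
    and Q_sym: "u \<in> W \<Longrightarrow> w \<in> W \<Longrightarrow> bilin \<Lambda> u (Q w) = bilin \<Lambda> (Q u) w"
    and Q_S0: "v \<in> V_space \<Lambda> \<kappa> \<Longrightarrow> S0 br e \<Lambda> \<kappa> \<mu> \<Phi> v = bilin \<Lambda> (components e v) (Q (components e v))"
proof -
  have "(\<forall>u\<in>W. Q u \<in> W) \<and>
     (\<forall>u\<in>W. \<forall>w\<in>W. \<forall>s t. Q (\<lambda>c x. s * u c x + t * w c x) = (\<lambda>c x. s * Q u c x + t * Q w c x)) \<and>
     (\<forall>u\<in>W. \<forall>w\<in>W. bilin \<Lambda> u (Q w) = bilin \<Lambda> (Q u) w) \<and>
     (\<forall>v\<in>V_space \<Lambda> \<kappa>. S0 br e \<Lambda> \<kappa> \<mu> \<Phi> v = bilin \<Lambda> (components e v) (Q (components e v)))"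
    unfolding Q_def Q_op_def W_eq by (rule someI_ex[OF Q_op_exists])
  thus "u \<in> W \<Longrightarrow> Q u \<in> W"
    "u \<in> W \<Longrightarrow> w \<in> W \<Longrightarrow> Q (\<lambda>c x. s * u c x + t * w c x) = (\<lambda>c x. s * Q u c x + t * Q w c x)"
    "u \<in> W \<Longrightarrow> w \<in> W \<Longrightarrow> bilin \<Lambda> u (Q w) = bilin \<Lambda> (Q u) w"
    "v \<in> V_space \<Lambda> \<kappa> \<Longrightarrow> S0 br e \<Lambda> \<kappa> \<mu> \<Phi> v = bilin \<Lambda> (components e v) (Q (components e v))"
    by blast+
qed

definition real_valued :: "'l comp cfun \<Rightarrow> bool" where
  "real_valued u \<longleftrightarrow> (\<forall>c x. cnj (u c x) = u c x)"

lemma real_valued_components: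
  assumes "u \<in> W" "real_valued u"
  shows "\<exists>v\<in>V_space \<Lambda> \<kappa>. components e v = u"
proof -
  have "of_real (Re (u c x)) = u c x" for c x
    using assms(2) by (simp add: real_valued_def complex_eq_iff)
  thus ?thesis using Re_V_trig[OF pos e assms(1)] by simp
qed

lemma real_decompose:
  assumes "u \<in> W"
  shows "\<exists>v w. v \<in> W \<and> w \<in> W \<and> real_valued v \<and> real_valued w \<and> u = (\<lambda>c x. 1 * v c x + \<i> * w c x)"
proof (intro exI conjI)
  let ?v = "\<lambda>c x. (1 / 2) * u c x + (1 / 2) * cnj (u c x)"
  let ?w = "\<lambda>c x. (- \<i> / 2) * u c x + (\<i> / 2) * cnj (u c x)"
  show "?v \<in> W" "?w \<in> W" by (rule W_lin[OF assms W_cnj[OF assms]])+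
  show "real_valued ?v" "real_valued ?w" by (simp_all add: real_valued_def)
  show "u = (\<lambda>c x. 1 * ?v c x + \<i> * ?w c x)" by (simp add: fun_eq_iff algebra_simps)
qed

text \<open>\<open>Q\<close> is an arbitrary choice, specified by linearity, symmetry and
  \<open>S0\<close> on real fields. Polarization determines it on pairs of real fields, and complex
  bilinearity then on all of \<open>W\<close>.\<close>

lemma bilin_Q:
  assumes v: "v \<in> W" and u: "u \<in> W"
  shows "bilin \<Lambda> v (Q u) = form v u"
proof -
  have diag: "bilin \<Lambda> a (Q a) = form a a" if a: "a \<in> W" "real_valued a" for a
  proof -
    obtain v where v: "v \<in> V_space \<Lambda> \<kappa>" "components e v = a"
      using real_valued_components[OF a] by blast
    show ?thesis using Q_S0[OF v(1)] S0_form[OF v(1)] by (simp add: v(2))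
  qed
  have real: "bilin \<Lambda> a (Q b) = form a b" if a: "a \<in> W" "real_valued a" and b: "b \<in> W" "real_valued b" for a b
  proof -
    let ?s = "\<lambda>c x. 1 * a c x + 1 * b c x"
    have s: "?s \<in> W" by (rule W_lin[OF a(1) b(1)])
    have "real_valued ?s" using a(2) b(2) by (simp add: real_valued_def)
    from diag[OF s this]
    have "bilin \<Lambda> a (Q a) + bilin \<Lambda> a (Q b) + (bilin \<Lambda> b (Q a) + bilin \<Lambda> b (Q b)) =
        form a a + form a b + (form b a + form b b)"
      unfolding Q_lin[OF a(1) b(1)] bilin_lin_left[OF W_lin[OF Q_W[OF a(1)] Q_W[OF b(1)]] a(1) b(1)]
        bilin_lin_right[OF a(1) Q_W[OF a(1)] Q_W[OF b(1)]] bilin_lin_right[OF b(1) Q_W[OF a(1)] Q_W[OF b(1)]]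
        form_lin_left[OF a(1) b(1) s] form_lin_right[OF a(1) b(1) a(1)] form_lin_right[OF a(1) b(1) b(1)]
      by simp
    hence "bilin \<Lambda> a (Q b) + bilin \<Lambda> b (Q a) = form a b + form b a"
      using diag[OF a] diag[OF b] by simp
    moreover have "bilin \<Lambda> b (Q a) = bilin \<Lambda> a (Q b)"
      using Q_sym[OF a(1) b(1)] bilin_commute by metis
    ultimately show ?thesis using form_commute[of b a] by simp
  qed
  obtain v1 v2 where v12: "v1 \<in> W" "v2 \<in> W" "real_valued v1" "real_valued v2" "v = (\<lambda>c x. 1 * v1 c x + \<i> * v2 c x)"
    using real_decompose[OF v] by blast
  obtain u1 u2 where u12: "u1 \<in> W" "u2 \<in> W" "real_valued u1" "real_valued u2" "u = (\<lambda>c x. 1 * u1 c x + \<i> * u2 c x)"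
    using real_decompose[OF u] by blast
  have right: "bilin \<Lambda> a (Q u) = form a u" if a: "a \<in> W" "real_valued a" for a
    unfolding u12(5) Q_lin[OF u12(1,2)] bilin_lin_right[OF a(1) Q_W[OF u12(1)] Q_W[OF u12(2)]]
      form_lin_right[OF u12(1,2) a(1)]
    by (simp add: real a u12)
  show ?thesis
    unfolding v12(5) bilin_lin_left[OF Q_W[OF u] v12(1,2)] form_lin_left[OF v12(1,2) u]
    by (simp add: right v12)
qed

lemma bilin_zero_imp_zero:
  assumes u: "u \<in> W" and 0: "\<And>v. v \<in> W \<Longrightarrow> bilin \<Lambda> v u = 0"
  shows "u = (\<lambda>c x. 0)"
proof -
  have "ip \<Lambda> u u = 0" using 0[OF W_cnj[OF u]] by (simp add: bilin_eq_ip)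
  note z = ip_self_eq_0[OF pos continuous_V_trig[OF u] this]
  have "u (Inl (i, a)) x = 0" for i a x by (rule trig_on_eq_0[OF pos W_trig(1)[OF u]]) (rule z)
  moreover have "u (Inr p) x = 0" for p x by (rule trig_on_eq_0[OF pos W_trig(2)[OF u]]) (rule z)
  ultimately have "u c x = 0" for c x by (cases c) auto
  thus ?thesis by blast
qed

lemma Q_kernel:
  assumes u: "u \<in> W" and 0: "Q u = (\<lambda>c x. 0)"
  shows "u = (\<lambda>c x. 0)"
proof (rule form_nondegenerate[OF u])
  fix v assume "v \<in> W"
  from bilin_Q[OF this u] show "form v u = 0" by (simp add: 0 bilin_def)
qed

lemma Q_inj: "inj_on Q W"
proof (rule inj_onI)
  fix u w assume u: "u \<in> W" and w: "w \<in> W" and eq: "Q u = Q w"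
  have "Q (\<lambda>c x. 1 * u c x + (- 1) * w c x) = (\<lambda>c x. 0)"
    unfolding Q_lin[OF u w] eq by simp
  from Q_kernel[OF W_lin[OF u w] this] show "u = w" by (simp add: fun_eq_iff)
qed

text \<open>What is orthogonal to the range lies, up to conjugation, in the kernel of the symmetric
  \<open>Q\<close> and is zero; an orthonormal basis of the range provides the orthogonal
  decomposition.\<close>

lemma Q_surj: "Q ` W = W"
proof (intro equalityI subsetI)
  fix y assume y: "y \<in> W"
  have "lin_closed (Q ` W)"
    unfolding lin_closed_def
  proof (intro conjI ballI allI)
    have "(\<lambda>c x. 0 * y c x + 0 * y c x) \<in> W" by (rule W_lin[OF y y])
    moreover have "Q (\<lambda>c x. 0 * y c x + 0 * y c x) = (\<lambda>c x. 0)" unfolding Q_lin[OF y y] by simp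
    ultimately show "(\<lambda>c x. 0) \<in> Q ` W" by force
    fix u w s t assume "u \<in> Q ` W" "w \<in> Q ` W"
    then obtain u' w' where "u' \<in> W" "w' \<in> W" "u = Q u'" "w = Q w'" by blast
    thus "(\<lambda>c x. s * u c x + t * w c x) \<in> Q ` W"
      using Q_lin[of u' w' s t] W_lin[of u' w' s t] by (intro image_eqI[of _ _ "\<lambda>c x. s * u' c x + t * w' c x"]) auto
  qed
  moreover have sub: "Q ` W \<subseteq> W" using Q_W by blast
  ultimately obtain N b where b: "\<And>n. n < N \<Longrightarrow> b n \<in> Q ` W"
    and on: "orthonormal \<Lambda> N b" and ex: "\<And>w. w \<in> Q ` W \<Longrightarrow> w = comb N b (\<lambda>n. ip \<Lambda> (b n) w)"
    using W_basis[of "Q ` W"] by blast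
  have linQ: "lin_closed (Q ` W)" by fact
  let ?y = "comb N b (\<lambda>n. ip \<Lambda> (b n) y)"
  have yQ: "?y \<in> Q ` W" by (rule lin_closed_comb[OF linQ b])
  hence y': "?y \<in> W" using sub by blast
  define r where "r = (\<lambda>c x. 1 * y c x + (- 1) * ?y c x)"
  have r: "r \<in> W" unfolding r_def by (rule W_lin[OF y y'])
  have cb: "continuous_cfun (b n)" if "n < N" for n using b[OF that] sub continuous_V_trig by blast
  have br: "ip \<Lambda> (b n) r = 0" if n: "n < N" for n
  proof -
    have "ip \<Lambda> (b n) ?y = (\<Sum>m<N. ip \<Lambda> (b m) y * (if n = m then 1 else 0))"
      using on n by (subst ip_comb_right[OF cb[OF n] cb]) (auto simp: orthonormal_def)
    also have "\<dots> = ip \<Lambda> (b n) y" using n by (simp add: if_distrib[of "(*) _"] cong: if_cong)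
    finally show ?thesis
      unfolding r_def by (subst ip_lin_right[OF cb[OF n] W_li[OF y] W_li[OF y']]) simp
  qed
  have Qr: "ip \<Lambda> w r = 0" if w: "w \<in> Q ` W" for w
  proof -
    have "ip \<Lambda> (comb N b (\<lambda>n. ip \<Lambda> (b n) w)) r = 0"
      by (subst ip_comb_left[OF W_li[OF r] cb]) (simp_all add: br)
    thus ?thesis using ex[OF w] by simp
  qed
  \<comment> \<open>The conjugate enters because \<open>Q\<close> is symmetric for
    \<open>bilin\<close>, not selfadjoint for \<open>ip\<close>.\<close>
  let ?r = "\<lambda>c x. cnj (r c x)"
  have "Q ?r = (\<lambda>c x. 0)"
  proof (rule bilin_zero_imp_zero[OF Q_W[OF W_cnj[OF r]]])
    fix v assume v: "v \<in> W"
    have "bilin \<Lambda> v (Q ?r) = bilin \<Lambda> (Q v) ?r" by (rule Q_sym[OF v W_cnj[OF r]])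
    also have "\<dots> = cnj (ip \<Lambda> (Q v) r)"
      by (simp add: bilin_def ip_def tint_cnj[symmetric])
    also have "\<dots> = 0" using Qr[of "Q v"] v by simp
    finally show "bilin \<Lambda> v (Q ?r) = 0" .
  qed
  from Q_kernel[OF W_cnj[OF r] this] have "r c x = 0" for c x by (simp add: fun_eq_iff)
  hence "y = ?y" by (simp add: r_def fun_eq_iff)
  thus "y \<in> Q ` W" using yQ by simp
qed (use Q_W in blast)

lemma Q_comb:
  "(\<And>n. n < N \<Longrightarrow> b n \<in> W) \<Longrightarrow> Q (comb N b \<gamma>) = comb N (\<lambda>n. Q (b n)) \<gamma>"
proof (induction N)
  case 0
  have z: "(\<lambda>c x. 0) \<in> W" using lin_closed_V_trig unfolding lin_closed_def by blast
  have "Q (\<lambda>c x. 0 * 0 + 0 * 0) = (\<lambda>c x. 0 * Q (\<lambda>c x. 0) c x + 0 * Q (\<lambda>c x. 0) c x)"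
    by (rule Q_lin[OF z z])
  thus ?case by (simp add: comb_def)
next
  case (Suc N)
  hence "comb N b \<gamma> \<in> W" "b N \<in> W" by (auto intro: lin_closed_comb[OF lin_closed_V_trig])
  from Q_lin[OF this, of 1 "\<gamma> N"] show ?case
    using Suc by (simp add: comb_def)
qed

text \<open>The projection is defined by testing with real fields; since these span \<open>W\<close>
  over the complex numbers, the test determines it uniquely.\<close>

lemma V_proj_eq:
  assumes g: "g \<in> L2_space \<Lambda>" and b: "\<And>n. n < N \<Longrightarrow> b n \<in> W"
    and ex: "\<And>w. w \<in> W \<Longrightarrow> w = comb N b (\<lambda>n. ip \<Lambda> (b n) w)" and on: "orthonormal \<Lambda> N b"
  shows "V_proj e \<Lambda> \<kappa> g = comb N b (\<lambda>n. ip \<Lambda> (b n) g)"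
  unfolding V_proj_def W_eq
proof (rule the_equality)
  note li = L2_space_locally_integrable[OF g]
  let ?u = "comb N b (\<lambda>n. ip \<Lambda> (b n) g)"
  have u: "?u \<in> W" by (rule lin_closed_comb[OF lin_closed_V_trig b])
  have cb: "continuous_cfun (b n)" if "n < N" for n by (rule continuous_V_trig[OF b[OF that]])
  have rv: "(\<lambda>c x. cnj (components e v c x)) = components e v" for v :: "'g field \<times> 'g field"
    by (auto simp: components_def fun_eq_iff split: sum.splits)
  have bi: "bilin \<Lambda> (components e v) (\<lambda>c x. g c x - w c x) = ip \<Lambda> (components e v) g - ip \<Lambda> (components e v) w"
    if v: "v \<in> V_space \<Lambda> \<kappa>" and w: "w \<in> W" for v w
    unfolding bilin_eq_ip rv
    by (rule ip_diff_right[OF continuous_V_trig[OF components_V_trig(1)[OF v]] li W_li[OF w]])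
  have eq: "ip \<Lambda> w g = ip \<Lambda> w ?u" if w: "w \<in> W" for w
  proof -
    let ?\<gamma> = "\<lambda>n. ip \<Lambda> (b n) w"
    have "ip \<Lambda> w g = ip \<Lambda> (comb N b ?\<gamma>) g" using ex[OF w] by simp
    also have "\<dots> = (\<Sum>n<N. cnj (?\<gamma> n) * ip \<Lambda> (b n) g)" by (rule ip_comb_left[OF li cb])
    also have "\<dots> = (\<Sum>n<N. ip \<Lambda> (b n) g * ip \<Lambda> w (b n))"
      by (intro sum.cong refl) (subst ip_cnj[of _ w], simp)
    also have "\<dots> = ip \<Lambda> w ?u" by (rule ip_comb_right[OF continuous_V_trig[OF w] cb, symmetric])
    finally show ?thesis .
  qed
  show "?u \<in> W \<and> (\<forall>v\<in>V_space \<Lambda> \<kappa>. bilin \<Lambda> (components e v) (\<lambda>c x. g c x - ?u c x) = 0)"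
  proof (intro conjI u ballI)
    fix v :: "'g field \<times> 'g field" assume v: "v \<in> V_space \<Lambda> \<kappa>"
    show "bilin \<Lambda> (components e v) (\<lambda>c x. g c x - ?u c x) = 0"
      unfolding bi[OF v u] using eq[OF components_V_trig(1)[OF v]] by (simp only: diff_self)
  qed
  fix w assume w: "w \<in> W \<and> (\<forall>v\<in>V_space \<Lambda> \<kappa>. bilin \<Lambda> (components e v) (\<lambda>c x. g c x - w c x) = 0)"
  hence wW: "w \<in> W" by simp
  define d where "d = (\<lambda>c x. 1 * ?u c x + (- 1) * w c x)"
  have d: "d \<in> W" unfolding d_def by (rule W_lin[OF u wW])
  have "bilin \<Lambda> (components e v) d = 0" if v: "v \<in> V_space \<Lambda> \<kappa>" for v
  proof -
    note cW = components_V_trig(1)[OF v, of e]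
    have "ip \<Lambda> (components e v) g = ip \<Lambda> (components e v) w" using w bi[OF v wW] v by auto
    moreover have "bilin \<Lambda> (components e v) d = 1 * bilin \<Lambda> (components e v) ?u + (- 1) * bilin \<Lambda> (components e v) w"
      unfolding d_def by (rule bilin_lin_right[OF cW u wW])
    ultimately show ?thesis using eq[OF cW] by (simp add: bilin_eq_ip rv)
  qed
  hence real: "bilin \<Lambda> a d = 0" if "a \<in> W" "real_valued a" for a
    using real_valued_components[OF that] by blast
  have "d = (\<lambda>c x. 0)"
  proof (rule bilin_zero_imp_zero[OF d])
    fix v assume "v \<in> W"
    then obtain v1 v2 where v: "v1 \<in> W" "v2 \<in> W" "real_valued v1" "real_valued v2" "v = (\<lambda>c x. 1 * v1 c x + \<i> * v2 c x)"
      using real_decompose by blast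
    show "bilin \<Lambda> v d = 0" unfolding v(5) bilin_lin_left[OF d v(1,2)] by (simp add: real v)
  qed
  thus "w = ?u" by (simp add: d_def fun_eq_iff)
qed

lemma propagator_exists:
  "\<exists>K. (\<forall>c d. continuous_on UNIV (\<lambda>(x, y). K c d x y)) \<and>
     (\<forall>c d x. periodic \<Lambda> (K c d x) \<and> periodic \<Lambda> (\<lambda>x'. K c d x' x)) \<and>
     (\<forall>g\<in>L2_space \<Lambda>. \<forall>c x.
        inv_into (V_complex e \<Lambda> \<kappa>) (Q_op br e \<Lambda> \<kappa> \<mu> \<Phi>) (V_proj e \<Lambda> \<kappa> g) c x =
        (\<Sum>d\<in>UNIV. tint \<Lambda> (\<lambda>y. K c d x y * g d y)))"
proof -
  obtain N b where b: "\<And>n. n < N \<Longrightarrow> b n \<in> W" and on: "orthonormal \<Lambda> N b"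
    and ex: "\<And>w. w \<in> W \<Longrightarrow> w = comb N b (\<lambda>n. ip \<Lambda> (b n) w)"
    using W_basis[OF subset_refl lin_closed_V_trig] by blast
  define r where "r n = inv_into W Q (b n)" for n
  have r: "r n \<in> W" "Q (r n) = b n" if "n < N" for n
  proof -
    have "b n \<in> Q ` W" using b[OF that] by (simp add: Q_surj)
    from inv_into_into[OF this] f_inv_into_f[OF this] show "r n \<in> W" "Q (r n) = b n"
      by (simp_all add: r_def)
  qed
  \<comment> \<open>Expand the projection of \<open>g\<close> in the basis \<open>b\<close> and
    replace each \<open>b n\<close> by its preimage \<open>r n\<close> under
    \<open>Q\<close>.\<close>
  define K where "K c d x y = (\<Sum>n<N. r n c x * cnj (b n d y))" for c d x y
  have per: "w c (x + (2 * \<Lambda> $ i) *\<^sub>R axis i 1) = w c x" if w: "w \<in> W" for w c x i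
  proof -
    have "trig_on (lattice \<Lambda>) (w c)"
    proof (cases c)
      case (Inl p)
      thus ?thesis using trig_on_mono[OF W_trig(1)[OF w, of "fst p" "snd p"] modes_subset_lattice] by simp
    next
      case (Inr p)
      thus ?thesis using trig_on_mono[OF W_trig(2)[OF w, of p] modes_subset_lattice] by simp
    qed
    from trig_on_periodic[OF pos this] show ?thesis by (simp add: periodic_def)
  qed
  show ?thesis
  proof (intro exI[of _ K] conjI allI ballI)
    fix c d
    have "continuous_on UNIV (\<lambda>p :: (real ^ 4) \<times> (real ^ 4). r n c (fst p) * cnj (b n d (snd p)))" if "n < N" for n
      by (intro continuous_intros continuous_on_compose2[OF W_cont[OF r(1)[OF that]]]
          continuous_on_compose2[OF W_cont[OF b[OF that]]]) auto
    thus "continuous_on UNIV (\<lambda>(x, y). K c d x y)"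
      unfolding K_def case_prod_unfold by (intro continuous_on_sum) auto
  next
    fix c d x
    show "periodic \<Lambda> (K c d x)" "periodic \<Lambda> (\<lambda>x'. K c d x' x)"
      unfolding periodic_def K_def by (simp_all add: per r b)
  next
    fix g :: "'l comp cfun" and c x assume g: "g \<in> L2_space \<Lambda>"
    let ?\<gamma> = "\<lambda>n. ip \<Lambda> (b n) g"
    have rW: "comb N r ?\<gamma> \<in> W" by (rule lin_closed_comb[OF lin_closed_V_trig r(1)])
    have "Q (comb N r ?\<gamma>) = comb N b ?\<gamma>"
      by (subst Q_comb[OF r(1)]) (auto simp: comb_def fun_eq_iff r(2))
    hence inv: "inv_into W Q (comb N b ?\<gamma>) = comb N r ?\<gamma>"
      using inv_into_f_f[OF Q_inj rW] by simp
    have "inv_into (V_complex e \<Lambda> \<kappa>) (Q_op br e \<Lambda> \<kappa> \<mu> \<Phi>) (V_proj e \<Lambda> \<kappa> g) c x = comb N r ?\<gamma> c x"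
    proof -
      have "V_proj e \<Lambda> \<kappa> g = comb N b ?\<gamma>" by (rule V_proj_eq[OF g b ex on])
      thus ?thesis unfolding W_eq Q_def[symmetric] by (simp only: inv)
    qed
    also have "\<dots> = (\<Sum>d\<in>UNIV. tint \<Lambda> (\<lambda>y. K c d x y * g d y))"
    proof -
      have "tint \<Lambda> (\<lambda>y. K c d x y * g d y) = (\<Sum>n<N. r n c x * tint \<Lambda> (\<lambda>y. cnj (b n d y) * g d y))" for d
      proof -
        have eq: "(\<lambda>y. K c d x y * g d y) = (\<lambda>y. \<Sum>n<N. r n c x * (cnj (b n d y) * g d y))"
          by (simp add: K_def sum_distrib_right mult.assoc)
        have "tint \<Lambda> (\<lambda>y. K c d x y * g d y) = (\<Sum>n<N. tint \<Lambda> (\<lambda>y. r n c x * (cnj (b n d y) * g d y)))"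
          unfolding eq by (intro tint_sum_integrable set_integrable_mult_right
              locally_integrable_D[OF L2_space_locally_integrable[OF g] continuous_V_trig[OF b]]) auto
        thus ?thesis by (simp add: tint_mult)
      qed
      hence "(\<Sum>d\<in>UNIV. tint \<Lambda> (\<lambda>y. K c d x y * g d y)) = (\<Sum>n<N. r n c x * ?\<gamma> n)"
        by (simp add: ip_def sum_distrib_left) (rule sum.swap)
      thus ?thesis by (simp add: comb_def mult.commute)
    qed
    finally show "inv_into (V_complex e \<Lambda> \<kappa>) (Q_op br e \<Lambda> \<kappa> \<mu> \<Phi>) (V_proj e \<Lambda> \<kappa> g) c x =
        (\<Sum>d\<in>UNIV. tint \<Lambda> (\<lambda>y. K c d x y * g d y))" .
  qed
qed

text \<open>Continuity belongs to the description by which the kernel is chosen, so it follows once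
  some kernel satisfies that description.\<close>

lemma cont2_propagator: "cont2 (propagator br e \<Lambda> \<kappa> \<mu> \<Phi> c d)"
  using someI_ex[OF propagator_exists] unfolding propagator_def[symmetric] cont2_def by blast

end

theorem theorem1:
  fixes br :: "'g::euclidean_space \<Rightarrow> 'g \<Rightarrow> 'g"
    and e :: "'l::finite \<Rightarrow> 'g"
    and f :: "'l \<Rightarrow> 'l \<Rightarrow> 'l \<Rightarrow> real"
    and \<Lambda> :: "real ^ 4"
    and \<kappa> \<mu> :: real
    and \<Phi> :: "'g ^ 3"
    and \<zeta> Z :: "real \<Rightarrow> real"
    and C :: "'l comp \<Rightarrow> 'l comp \<Rightarrow> real ^ 4 \<Rightarrow> real ^ 4 \<Rightarrow> complex"
  assumes "compact_simple_lie_algebra br"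
    and "orthonormal_basis e"
    and "f = structure_constants br e"
    and "\<And>i. \<Lambda> $ i > 0"
    and "\<kappa> > 0"
    and "\<And>i (m::int). \<kappa> \<noteq> pi * real_of_int m / \<Lambda> $ i"
    and "cutoff_zeta \<zeta>"
    and "cutoff_Z Z"
    and "C = propagator br e \<Lambda> \<kappa> \<mu> \<Phi>"
  shows "Z_bose f \<Lambda> C = even_series (Theta f \<Lambda> C)
    \<and> (\<forall>\<epsilon>>0. Z_fermi f \<Lambda> C \<zeta> Z \<epsilon> = even_series (\<lambda>n. Xi f \<Lambda> C \<zeta> Z n \<epsilon>))
    \<and> (\<forall>n. (Xi f \<Lambda> C \<zeta> Z n \<longlongrightarrow> Theta f \<Lambda> C n) (at_right 0))"
proof -
  interpret cutoffs \<Lambda> \<zeta> Z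
    by unfold_locales (use assms in auto)
  interpret quadratic_model br e \<Lambda> \<kappa> \<mu> \<Phi>
    by unfold_locales (use assms in auto)
  have br: "bilinear br" "\<And>x. br x x = 0"
    using assms(1) by (auto simp: compact_simple_lie_algebra_def)
  have "f b a c = - f a b c" for a b c
  proof -
    \<comment> \<open>Polarization of \<open>br x x = 0\<close> at \<open>e a + e b\<close>.\<close>
    have "br (e a) (e b) + br (e b) (e a) = 0"
    proof -
      have "br (e a + e b) (e a + e b) = br (e a) (e a) + br (e b) (e a) + (br (e a) (e b) + br (e b) (e b))"
        by (simp only: bilinear_ladd[OF br(1)] bilinear_radd[OF br(1)])
      thus ?thesis by (simp add: br(2) add.commute)
    qed
    hence "br (e b) (e a) = - br (e a) (e b)" by (rule minus_unique[symmetric])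
    thus ?thesis by (simp add: assms(3) structure_constants_def)
  qed
  moreover have "cont2 (C c d)" for c d
    unfolding assms(9) by (rule cont2_propagator)
  ultimately show ?thesis
    using Z_bose_even Z_fermi_even tendsto_Xi[of C f] by blast
qed

end
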